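(* Let $(M,\star,F)$ be a forward complete $\Theta$-Finsler manifold and let $p\in(1,\infty)$. Suppose that $\Theta^{qp/(p-q)}$ is a concave function for some $q\in(1,p]$. Then for every $(\mu_t)\in\mathsf{FAC}^p([0,1];\mathscr{P}_p(M))$ there exists $\eta\in\mathscr{P}(C([0,1];M))$ such that (i) $\eta$ is concentrated on $\mathsf{AC}^p([0,1];M)$; (ii) $\mu_t=(e_t)_\sharp\eta$ for every $t\in[0,1]$; (iii) $|\mu'_+|_p^p(t)=\int_{C([0,1];M)}F^p(\gamma'(t))\,d\eta(\gamma)$ for $\mathscr{L}^1$-a.e. $t\in(0,1)$.
   Context: A Finsler manifold $(M,F)$ is a connected smooth manifold $M$ without boundary of dimension $n\ge 2$ with a continuous function $F:TM\to[0,\infty)$ such that (a) $F\in C^\infty(TM\setminus\{0\})$; (b) $F(x,\lambda y)=\lambda F(x,y)$ for all $\lambda\ge 0$; (c) the matrix $g_{ij}(x,y)=[\frac12F^2]_{y^iy^j}(x,y)$ is positive definite for $y\neq 0$. $F(x,-y)=F(x,y)$ is not assumed. The (generally non-symmetric) distance is $d_F(p,q)=\inf\int_0^1F(\gamma'(t))\,dt$ over piecewise smooth curves from $p$ to $q$; $\hat d_F(x,y)=\frac12[d_F(x,y)+d_F(y,x)]$. $(M,F)$ is forward complete if every forward Cauchy sequence (for each $\epsilon>0$ there is $N$ with $d_F(x_m,x_n)<\epsilon$ whenever $n\ge m>N$) converges in $M$. A triple $(M,\star,F)$ is a $\Theta$-Finsler manifold if $(M,F)$ is a Finsler manifold, $\star\in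 M$ is a fixed point, and $\Theta:[0,\infty)\to[1,\infty)$ is a nondecreasing function with $\lambda_{d_F}(\overline{B^+_\star(r)})\le\Theta(r)$ for all $r>0$, where $B^+_\star(r)=\{y:d_F(\star,y)<r\}$ and $\lambda_{d_F}(A)=\inf\{\lambda\ge1: d_F(x,y)\le\lambda d_F(y,x)\ \forall x,y\in A\}$. Convention when $q=p$: $\Theta^\infty:=\sup_{x\in M}\Theta(d_F(\star,x))$, and $\Theta^\infty$ is said to be concave if it is finite. $\mathscr{P}(X)$ denotes Borel probability measures on $X$. $\mathscr{P}_p(M)=\{\mu\in\mathscr{P}(M):\int_M\hat d_F(\star,x)^p\,d\mu(x)<\infty\}$ and $W_p(\mu,\nu)=\inf_\pi(\int_{M\times M}d_F(x,y)^p\,d\pi(x,y))^{1/p}$, the infimum over $\pi\in\mathscr{P}(M\times M)$ with first marginal $\mu$ and second marginal $\nu$. For an asymmetric metric space $(X,d)$, $\mathsf{FAC}^p([0,1];X)$ (resp. $\mathsf{BAC}^p([0,1];X)$) is the class of maps $\gamma:[0,1]\to X$ for which there is a nonnegative $f\in L^p([0,1])$ with $d(\gamma(t_1),\gamma(t_2))\le\int_{t_1}^{t_2}f$ (resp. $d(\gamma(t_2),\gamma(t_1))\le\int_{t_1}^{t_2}f$) for all $t_1\le t_2$; $\mathsf{AC}^p=\mathsf{FAC}^p\cap\mathsf{BAC}^p$. These are used with $(X,d)=(M,d_F)$ and $(X,d)=(\mathscr{P}_p(M),W_p)$. $C([0,1];M)$ is the space of continuous curves with the compact-open (uniform) topology,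 and $e_t(\gamma)=\gamma(t)$. The forward metric derivative is $|\mu'_+|_p(t)=\lim_{s\to t}\frac{W_p(\mu_{\min\{s,t\}},\mu_{\max\{s,t\}})}{|t-s|}$, which exists for $\mathscr{L}^1$-a.e. $t\in(0,1)$ when $(\mu_t)\in\mathsf{FAC}^p([0,1];\mathscr{P}_p(M))$. $\mathscr{L}^1$ is Lebesgue measure. *)

theory Defs
  imports "HOL-Analysis.Analysis" "HOL-Probability.Probability"
begin

section \<open>Smooth maps between open subsets of Euclidean spaces\<close>

text \<open>Only meant for an open set \<open>S\<close>; there \<open>k_smooth_on k S f\<close> says that \<open>f\<close> is of class
  \<open>C\<^sup>k\<close>.\<close>

primrec k_smooth_on ::
  "nat \<Rightarrow> 'b::real_normed_vector set \<Rightarrow> ('b \<Rightarrow> 'c::real_normed_vector) \<Rightarrow> bool" where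
  "k_smooth_on 0 S f \<longleftrightarrow> continuous_on S f"
| "k_smooth_on (Suc k) S f \<longleftrightarrow>
     (\<forall>x\<in>S. f differentiable (at x)) \<and>
     (\<forall>v. k_smooth_on k S (\<lambda>x. frechet_derivative f (at x) v))"

definition smooth_on :: "'b::real_normed_vector set \<Rightarrow> ('b \<Rightarrow> 'c::real_normed_vector) \<Rightarrow> bool" where
  "smooth_on S f \<longleftrightarrow> (\<forall>k. k_smooth_on k S f)"


section \<open>Smooth manifolds and tangent vectors\<close>

text \<open>A manifold is the universe of a Hausdorff second countable type \<open>'a\<close>, together with a smooth
  atlas modelled on \<open>real ^ 'n\<close>. A chart is a pair (domain, coordinate map); the values of
  the coordinate map outside the domain carry no meaning.\<close>

type_synonym ('a, 'n) chart = "'a set \<times> ('a \<Rightarrow> (real, 'n) vec)"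

definition chart_inv :: "('a, 'n::finite) chart \<Rightarrow> real ^ 'n \<Rightarrow> 'a" where
  "chart_inv c = inv_into (fst c) (snd c)"

definition smooth_atlas ::
  "('a::{t2_space, second_countable_topology}, 'n::finite) chart set \<Rightarrow> bool" where
  "smooth_atlas \<A> \<longleftrightarrow>
     (\<Union>c\<in>\<A>. fst c) = UNIV \<and>
     (\<forall>c\<in>\<A>. open (fst c) \<and> open (snd c ` fst c) \<and>
        homeomorphism (fst c) (snd c ` fst c) (snd c) (chart_inv c)) \<and>
     (\<forall>c\<in>\<A>. \<forall>c'\<in>\<A>. smooth_on (snd c ` (fst c \<inter> fst c')) (snd c' \<circ> chart_inv c))"

definition charts_at :: "('a, 'n::finite) chart set \<Rightarrow> 'a \<Rightarrow> ('a, 'n) chart set" where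
  "charts_at \<A> x = {c \<in> \<A>. x \<in> fst c}"

text \<open>A tangent vector with base point \<open>x\<close> is the family of its coordinate vectors in all charts
  around \<open>x\<close>, subject to the usual transformation law.\<close>

type_synonym ('a, 'n) tvec = "('a, 'n) chart \<Rightarrow> (real, 'n) vec"

definition tangent_space :: "('a, 'n::finite) chart set \<Rightarrow> 'a \<Rightarrow> ('a, 'n) tvec set" where
  "tangent_space \<A> x =
     {v \<in> extensional (charts_at \<A> x).
        \<forall>c\<in>charts_at \<A> x. \<forall>c'\<in>charts_at \<A> x.
          v c' = frechet_derivative (snd c' \<circ> chart_inv c) (at (snd c x)) (v c)}"

definition tscale ::
  "('a, 'n::finite) chart set \<Rightarrow> real \<Rightarrow> 'a \<times> ('a, 'n) tvec \<Rightarrow> 'a \<times> ('a, 'n) tvec" where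
  "tscale \<A> l w = (fst w, \<lambda>c\<in>charts_at \<A> (fst w). l *\<^sub>R snd w c)"

definition tangent_bundle :: "('a, 'n::finite) chart set \<Rightarrow> ('a \<times> ('a, 'n) tvec) set" where
  "tangent_bundle \<A> = (SIGMA x:UNIV. tangent_space \<A> x)"

text \<open>\<open>from_coords \<A> c\<close> is the inverse of the chart of the tangent bundle induced by \<open>c\<close>: it sends
  \<open>(u, y)\<close> to the tangent vector at the point with coordinates \<open>u\<close> whose components
  in the chart \<open>c\<close> are \<open>y\<close>.\<close>

definition from_coords ::
  "('a, 'n::finite) chart set \<Rightarrow> ('a, 'n) chart \<Rightarrow> (real ^ 'n) \<times> (real ^ 'n)
     \<Rightarrow> 'a \<times> ('a, 'n) tvec" where
  "from_coords \<A> c uy =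
     (chart_inv c (fst uy),
      \<lambda>c'\<in>charts_at \<A> (chart_inv c (fst uy)).
        frechet_derivative (snd c' \<circ> chart_inv c) (at (fst uy)) (snd uy))"


section \<open>Finsler manifolds\<close>

definition partial_deriv :: "'n::finite \<Rightarrow> (real ^ 'n \<Rightarrow> real) \<Rightarrow> real ^ 'n \<Rightarrow> real" where
  "partial_deriv i f y = frechet_derivative f (at y) (axis i 1)"

definition fundamental_tensor ::
  "('a, 'n::finite) chart set \<Rightarrow> ('a \<times> ('a, 'n) tvec \<Rightarrow> real) \<Rightarrow> ('a, 'n) chart
     \<Rightarrow> real ^ 'n \<Rightarrow> real ^ 'n \<Rightarrow> real ^ 'n ^ 'n" where
  "fundamental_tensor \<A> F c u y =
     (\<chi> i j. partial_deriv j (partial_deriv i (\<lambda>z. (F (from_coords \<A> c (u, z)))\<^sup>2 / 2)) y)"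

definition pos_def_matrix :: "real ^ 'n ^ 'n \<Rightarrow> bool" where
  "pos_def_matrix G \<longleftrightarrow> transpose G = G \<and> (\<forall>w. w \<noteq> 0 \<longrightarrow> w \<bullet> (G *v w) > 0)"

definition finsler_manifold ::
  "('a::{t2_space, second_countable_topology}, 'n::finite) chart set
     \<Rightarrow> ('a \<times> ('a, 'n) tvec \<Rightarrow> real) \<Rightarrow> bool" where
  "finsler_manifold \<A> F \<longleftrightarrow>
     CARD('n) \<ge> 2 \<and> connected (UNIV :: 'a set) \<and> smooth_atlas \<A> \<and>
     F \<in> tangent_bundle \<A> \<rightarrow> {0..} \<and>
     (\<forall>c\<in>\<A>. continuous_on ((snd c ` fst c) \<times> UNIV) (F \<circ> from_coords \<A> c)) \<and>
     (\<forall>c\<in>\<A>. smooth_on ((snd c ` fst c) \<times> (UNIV - {0})) (F \<circ> from_coords \<A> c)) \<and>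
     (\<forall>w\<in>tangent_bundle \<A>. \<forall>l\<ge>0. F (tscale \<A> l w) = l * F w) \<and>
     (\<forall>c\<in>\<A>. \<forall>u\<in>snd c ` fst c. \<forall>y. y \<noteq> 0 \<longrightarrow> pos_def_matrix (fundamental_tensor \<A> F c u y))"

text \<open>A curve is smooth on a compact interval \<open>{a..b}\<close> if, in charts, it extends locally (also
  across the end points) to a smooth map.\<close>

definition smooth_curve_on ::
  "('a, 'n::finite) chart set \<Rightarrow> real \<Rightarrow> real \<Rightarrow> (real \<Rightarrow> 'a) \<Rightarrow> bool" where
  "smooth_curve_on \<A> a b \<gamma> \<longleftrightarrow>
     (\<forall>t\<in>{a..b}. \<forall>c\<in>charts_at \<A> (\<gamma> t). \<exists>\<epsilon>>0. \<exists>g.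
        smooth_on (ball t \<epsilon>) g \<and>
        (\<forall>s\<in>ball t \<epsilon> \<inter> {a..b}. \<gamma> s \<in> fst c \<and> snd c (\<gamma> s) = g s))"

definition piecewise_smooth_curve ::
  "('a, 'n::finite) chart set \<Rightarrow> (real \<Rightarrow> 'a) \<Rightarrow> bool" where
  "piecewise_smooth_curve \<A> \<gamma> \<longleftrightarrow>
     (\<exists>(k::nat) \<tau>. \<tau> 0 = 0 \<and> \<tau> k = 1 \<and>
        (\<forall>i<k. \<tau> i < \<tau> (Suc i) \<and> smooth_curve_on \<A> (\<tau> i) (\<tau> (Suc i)) \<gamma>))"

definition curve_differentiable_at ::
  "('a::topological_space, 'n::finite) chart set \<Rightarrow> (real \<Rightarrow> 'a) \<Rightarrow> real \<Rightarrow> bool" where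
  "curve_differentiable_at \<A> \<gamma> t \<longleftrightarrow>
     isCont \<gamma> t \<and> (\<forall>c\<in>charts_at \<A> (\<gamma> t). (snd c \<circ> \<gamma>) differentiable (at t))"

definition velocity ::
  "('a, 'n::finite) chart set \<Rightarrow> (real \<Rightarrow> 'a) \<Rightarrow> real \<Rightarrow> 'a \<times> ('a, 'n) tvec" where
  "velocity \<A> \<gamma> t =
     (\<gamma> t, \<lambda>c\<in>charts_at \<A> (\<gamma> t). vector_derivative (snd c \<circ> \<gamma>) (at t))"

text \<open>\<open>speed \<A> F \<gamma> t\<close> is \<open>F (\<gamma>' t)\<close>. Piecewise smooth and absolutely continuous curves are
  differentiable almost everywhere; the value 0 is a dummy for the exceptional times.\<close>

definition speed ::
  "('a::topological_space, 'n::finite) chart set \<Rightarrow> ('a \<times> ('a, 'n) tvec \<Rightarrow> real)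
     \<Rightarrow> (real \<Rightarrow> 'a) \<Rightarrow> real \<Rightarrow> real" where
  "speed \<A> F \<gamma> t = (if curve_differentiable_at \<A> \<gamma> t then F (velocity \<A> \<gamma> t) else 0)"

definition finsler_dist ::
  "('a::topological_space, 'n::finite) chart set \<Rightarrow> ('a \<times> ('a, 'n) tvec \<Rightarrow> real)
     \<Rightarrow> 'a \<Rightarrow> 'a \<Rightarrow> real" where
  "finsler_dist \<A> F x y =
     (INF \<gamma> \<in> {\<gamma>. piecewise_smooth_curve \<A> \<gamma> \<and> \<gamma> 0 = x \<and> \<gamma> 1 = y}.
        LINT t|lebesgue_on {0..1}. speed \<A> F \<gamma> t)"


section \<open>Asymmetric distances\<close>

definition sym_dist :: "('x \<Rightarrow> 'x \<Rightarrow> real) \<Rightarrow> 'x \<Rightarrow> 'x \<Rightarrow> real" where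
  "sym_dist d x y = (d x y + d y x) / 2"

definition forward_Cauchy :: "('x \<Rightarrow> 'x \<Rightarrow> real) \<Rightarrow> (nat \<Rightarrow> 'x) \<Rightarrow> bool" where
  "forward_Cauchy d X \<longleftrightarrow>
     (\<forall>\<epsilon>>0. \<exists>N. \<forall>m n. n \<ge> m \<and> m > N \<longrightarrow> d (X m) (X n) < \<epsilon>)"

definition forward_complete :: "('x::topological_space \<Rightarrow> 'x \<Rightarrow> real) \<Rightarrow> bool" where
  "forward_complete d \<longleftrightarrow> (\<forall>X. forward_Cauchy d X \<longrightarrow> (\<exists>x. X \<longlonglongrightarrow> x))"

definition forward_ball :: "('x \<Rightarrow> 'x \<Rightarrow> real) \<Rightarrow> 'x \<Rightarrow> real \<Rightarrow> 'x set" where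
  "forward_ball d x r = {y. d x y < r}"

text \<open>Extended-real valued: the infimum is \<open>\<infinity>\<close> if no constant is admissible.\<close>

definition reversibility :: "('x \<Rightarrow> 'x \<Rightarrow> real) \<Rightarrow> 'x set \<Rightarrow> ereal" where
  "reversibility d S = (INF l \<in> {l. l \<ge> 1 \<and> (\<forall>x\<in>S. \<forall>y\<in>S. d x y \<le> l * d y x)}. ereal l)"

definition theta_finsler_manifold ::
  "('a::{t2_space, second_countable_topology}, 'n::finite) chart set \<Rightarrow> 'a
     \<Rightarrow> ('a \<times> ('a, 'n) tvec \<Rightarrow> real) \<Rightarrow> (real \<Rightarrow> real) \<Rightarrow> bool" where
  "theta_finsler_manifold \<A> star F \<Theta> \<longleftrightarrow>
     finsler_manifold \<A> F \<and> \<Theta> \<in> {0..} \<rightarrow> {1..} \<and> mono_on {0..} \<Theta> \<and>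
     (\<forall>r>0. reversibility (finsler_dist \<A> F) (closure (forward_ball (finsler_dist \<A> F) star r))
              \<le> ereal (\<Theta> r))"

text \<open>``\<open>\<Theta>\<close> to the power \<open>q p / (p - q)\<close> is concave''; for \<open>q = p\<close> this means by convention that
  the supremum of \<open>\<Theta> (d star x)\<close> over all points \<open>x\<close> is finite.\<close>

definition theta_power_concave ::
  "('x \<Rightarrow> 'x \<Rightarrow> real) \<Rightarrow> 'x \<Rightarrow> (real \<Rightarrow> real) \<Rightarrow> real \<Rightarrow> real \<Rightarrow> bool" where
  "theta_power_concave d star \<Theta> p q \<longleftrightarrow>
     (if q = p then bdd_above (range (\<lambda>x. \<Theta> (d star x)))
      else concave_on {0..} (\<lambda>r. \<Theta> r powr (q * p / (p - q))))"


section \<open>Absolutely continuous curves\<close>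

definition Lp_nonneg :: "real \<Rightarrow> (real \<Rightarrow> real) set" where
  "Lp_nonneg p =
     {f. (\<forall>t\<in>{0..1}. 0 \<le> f t) \<and> f \<in> borel_measurable (lebesgue_on {0..1}) \<and>
         integrable (lebesgue_on {0..1}) (\<lambda>t. f t powr p)}"

definition FAC :: "real \<Rightarrow> 'x set \<Rightarrow> ('x \<Rightarrow> 'x \<Rightarrow> real) \<Rightarrow> (real \<Rightarrow> 'x) set" where
  "FAC p X d =
     {\<gamma>. \<gamma> \<in> {0..1} \<rightarrow> X \<and>
        (\<exists>f\<in>Lp_nonneg p. \<forall>t1 t2. 0 \<le> t1 \<and> t1 \<le> t2 \<and> t2 \<le> 1 \<longrightarrow>
           d (\<gamma> t1) (\<gamma> t2) \<le> (LINT t|lebesgue_on {t1..t2}. f t))}"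

definition BAC :: "real \<Rightarrow> 'x set \<Rightarrow> ('x \<Rightarrow> 'x \<Rightarrow> real) \<Rightarrow> (real \<Rightarrow> 'x) set" where
  "BAC p X d =
     {\<gamma>. \<gamma> \<in> {0..1} \<rightarrow> X \<and>
        (\<exists>f\<in>Lp_nonneg p. \<forall>t1 t2. 0 \<le> t1 \<and> t1 \<le> t2 \<and> t2 \<le> 1 \<longrightarrow>
           d (\<gamma> t2) (\<gamma> t1) \<le> (LINT t|lebesgue_on {t1..t2}. f t))}"

definition AC :: "real \<Rightarrow> 'x set \<Rightarrow> ('x \<Rightarrow> 'x \<Rightarrow> real) \<Rightarrow> (real \<Rightarrow> 'x) set" where
  "AC p X d = FAC p X d \<inter> BAC p X d"

text \<open>As usual with \<open>Lim\<close>, the value is arbitrary at the times where the limit does not exist; for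
  curves in \<open>FAC\<close> these form a null set.\<close>

definition forward_metric_deriv :: "('x \<Rightarrow> 'x \<Rightarrow> real) \<Rightarrow> (real \<Rightarrow> 'x) \<Rightarrow> real \<Rightarrow> real" where
  "forward_metric_deriv d \<gamma> t =
     Lim (at t) (\<lambda>s. d (\<gamma> (min s t)) (\<gamma> (max s t)) / \<bar>t - s\<bar>)"


section \<open>Wasserstein spaces\<close>

definition borel_prob :: "'x::topological_space measure set" where
  "borel_prob = {\<mu>. prob_space \<mu> \<and> sets \<mu> = sets borel}"

definition wasserstein_space ::
  "real \<Rightarrow> ('x::topological_space \<Rightarrow> 'x \<Rightarrow> real) \<Rightarrow> 'x \<Rightarrow> 'x measure set" where
  "wasserstein_space p d star =
     {\<mu> \<in> borel_prob. (\<integral>\<^sup>+ x. ennreal (sym_dist d star x powr p) \<partial>\<mu>) < \<infinity>}"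

definition couplings ::
  "'x::topological_space measure \<Rightarrow> 'x measure \<Rightarrow> ('x \<times> 'x) measure set" where
  "couplings \<mu> \<nu> = {\<pi> \<in> borel_prob. distr \<pi> borel fst = \<mu> \<and> distr \<pi> borel snd = \<nu>}"

definition transport_cost ::
  "real \<Rightarrow> ('x \<Rightarrow> 'x \<Rightarrow> real) \<Rightarrow> ('x \<times> 'x) measure \<Rightarrow> ennreal" where
  "transport_cost p d \<pi> = (\<integral>\<^sup>+ z. ennreal (d (fst z) (snd z) powr p) \<partial>\<pi>)"

text \<open>The infimum may be taken over the couplings of finite cost, since the others contribute the
  value \<open>\<infinity>\<close>. The (real) infimum is meaningful whenever such a coupling exists.\<close>

definition wasserstein_dist ::
  "real \<Rightarrow> ('x::topological_space \<Rightarrow> 'x \<Rightarrow> real) \<Rightarrow> 'x measure \<Rightarrow> 'x measure \<Rightarrow> real" where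
  "wasserstein_dist p d \<mu> \<nu> =
     (INF \<pi> \<in> {\<pi> \<in> couplings \<mu> \<nu>. transport_cost p d \<pi> < \<infinity>}.
        enn2real (transport_cost p d \<pi>) powr (1 / p))"


section \<open>The space of continuous curves\<close>

text \<open>Curves on the unit interval are represented by functions that are \<open>undefined\<close> outside it.\<close>

definition curve_space :: "(real \<Rightarrow> 'x::topological_space) set" where
  "curve_space = {\<gamma> \<in> extensional {0..1}. continuous_on {0..1} \<gamma>}"

definition compact_open_topology :: "(real \<Rightarrow> 'x::topological_space) topology" where
  "compact_open_topology =
     topology_generated_by
       {{\<gamma> \<in> curve_space. \<gamma> ` K \<subseteq> U} | K U. compact K \<and> K \<subseteq> {0..1} \<and> open U}"

definition curve_borel :: "(real \<Rightarrow> 'x::topological_space) measure" where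
  "curve_borel = sigma curve_space {S. openin compact_open_topology S}"

definition curve_prob :: "(real \<Rightarrow> 'x::topological_space) measure set" where
  "curve_prob = {\<eta>. prob_space \<eta> \<and> sets \<eta> = sets curve_borel}"

end

theory Submission
 imports Defs "HOL-Analysis.Analysis" "HOL-Probability.Probability"
begin

text \<open>Let \<open>pen p x l = x\<^sup>p / l\<^sup>p\<^sup>-\<^sup>1\<close> be the \<open>p\<close>-energy of a step of size \<open>x\<close> in time \<open>l\<close>; it is jointly
 subadditive. For each \<open>N\<close>, near-optimal couplings of the marginals at the times \<open>i / 2\<^sup>N\<close> are glued to a
 Markov chain; its states record points only through countably many small cells, so no disintegration is
 needed. The one-dimensional marginals being fixed, a subsequence of these discrete processes converges
 in law, and refining the cells gives a process at dyadic times with marginals \<open>\<mu> t\<close> whose expected dyadic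
 energy is at most the limit \<open>S\<close> of the energies of \<open>\<mu>\<close>. Forward completeness and the reversibility bounds
 on forward balls extend almost every path to an absolutely continuous curve; \<open>\<eta>\<close> is its law. Let \<open>G t\<close> be the
 mean of \<open>F\<^sup>p (\<gamma>' t)\<close>. The interval function ``integral of \<open>G\<close> over \<open>I\<close> minus the energy of \<open>\<mu>\<close> over \<open>I\<close>'' is
 nonnegative, superadditive, and its dyadic sums tend to 0, because the integral of \<open>G\<close> is at most \<open>S\<close>. By a
 maximal inequality its density vanishes almost everywhere, which is (iii).\<close>

section \<open>Superadditive interval functions\<close>

text \<open>Most limit passages give only an inequality, by Fatou's lemma, and this suffices. For
  laws, an inequality between the integrals of all test functions \<open>bump C n\<close> already
  forces two probability measures to coincide. For energies, the upper bound \<open>total\<close> is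
  met from below because the joint law of two evaluations is a coupling. No mass escapes in the
  limit of the discrete processes, since each coordinate has an eventually constant law. The
  distance is not symmetric, and a bound on \<open>d x y\<close> gives none on \<open>d y x\<close>
  that is uniform on the manifold. Cells are therefore small in both directions, and backward
  estimates along a path rest on the fact that a path of finite energy stays in one forward ball.
  Comparing interval functions, rather than derivatives, yields the existence of the metric
  derivative together with its value. The exchange of "almost every path" and "almost every time"
  requires joint measurability; speed and differentiability are therefore expressed through
  countably many evaluations.\<close>

lemma sum_superadditive_disjoint_le:
 fixes \<nu> :: "real => real => real"
 assumes nonneg: "!!s t. s <= t ==> 0 <= \<nu> s t"
  and super: "!!s t u. s <= t ==> t <= u ==> \<nu> s t + \<nu> t u <= \<nu> s u"
  and "finite C" "!!s u. (s, u) \<in> C ==> a <= s & s < u & u <= x"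
  and "pairwise (%i j. disjnt {fst i..snd i} {fst j..snd j}) C" "a <= x"
 shows "(\<Sum>i\<in>C. \<nu> (fst i) (snd i)) <= \<nu> a x" using assms(3-6)
proof (induction "card C" arbitrary: C x)
 case 0
 thus ?case using nonneg by simp
next
 case (Suc n)
 have ne: "C ~= {}" "finite C" using Suc.prems(1) Suc.hyps(2) by auto
 \<comment> \<open>Split off the interval \<open>{s..u}\<close> with the largest right end point: by
   disjointness every other interval ends before \<open>s\<close>, so the induction hypothesis
   applies on \<open>{a..s}\<close>.\<close>
 have "Max (snd ` C) \<in> snd ` C" using ne by (intro Max_in) auto
 then obtain i where iC: "i \<in> C" and imax: "Max (snd ` C) = snd i" by (rule imageE) auto
 have i: "i \<in> C" "!!j. j \<in> C ==> snd j <= snd i" unfolding imax[symmetric] using ne iC by (auto intro!: Max_ge)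
 obtain s u where su: "i = (s, u)" by (cases i)
 have bs: "a <= s" "s < u" "u <= x" using Suc.prems(2) i(1) su by auto
 have "(\<Sum>i\<in>C - {i}. \<nu> (fst i) (snd i)) <= \<nu> a s"
 proof (rule Suc.hyps(1))
  show "n = card (C - {i})" using Suc.hyps(2) ne i by simp
  show "finite (C - {i})" using ne by simp
  show "a <= s' & s' < u' & u' <= s" if j: "(s', u') \<in> C - {i}" for s' u'
  proof -
   have 1: "a <= s'" "s' < u'" "u' <= u" using j Suc.prems(2)[of s' u'] i(2)[of "(s', u')"] su by auto
   have "disjnt {s'..u'} {s..u}" using Suc.prems(3) j i(1) su unfolding pairwise_def by force
   hence "u' \<notin> {s..u}" using 1 unfolding disjnt_def by auto
   thus ?thesis using 1 by auto
  qed
  show "pairwise (%i j. disjnt {fst i..snd i} {fst j..snd j}) (C - {i})" using Suc.prems(3) by (rule pairwise_subset) auto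
  show "a <= s" by fact
 qed
 moreover have "(\<Sum>i\<in>C. \<nu> (fst i) (snd i)) = \<nu> s u + (\<Sum>i\<in>C - {i}. \<nu> (fst i) (snd i))"
  using ne i su by (simp add: sum.remove)
 moreover have "\<nu> a s + \<nu> s u <= \<nu> a u" "\<nu> a u + \<nu> u x <= \<nu> a x" "0 <= \<nu> u x" using super nonneg bs by auto
 ultimately show ?case by linarith
qed

text \<open>Serves the countable Vitali subfamily, whose total length is controlled through its
  finite subfamilies only.\<close>

lemma emeasure_UN_countable_le_finite_sums:
 assumes "countable C" "!!i. i \<in> C ==> A i \<in> sets M"
  and fin: "!!D. finite D ==> D \<subseteq> C ==> (\<Sum>i\<in>D. emeasure M (A i)) <= B"
 shows "emeasure M (\<Union>i\<in>C. A i) <= B"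
proof -
 define f where "f = (%n. if n \<in> to_nat_on C ` C then A (from_nat_into C n) else {})"
 have "(\<Union>i\<in>C. A i) \<subseteq> (\<Union>n. f n)"
 proof
  fix x assume "x \<in> (\<Union>i\<in>C. A i)"
  then obtain i where "i \<in> C" "x \<in> A i" by blast
  hence "x \<in> f (to_nat_on C i)" using assms(1) by (simp add: f_def)
  thus "x \<in> (\<Union>n. f n)" by blast
 qed
 moreover have f: "f n \<in> sets M" for n using assms(1,2) by (auto simp: f_def)
 ultimately have "emeasure M (\<Union>i\<in>C. A i) <= emeasure M (\<Union>n. f n)" by (intro emeasure_mono) auto
 also have "... <= (\<Sum>n. emeasure M (f n))" using f by (intro emeasure_subadditive_countably) auto
 also have "... <= B"
 proof (rule suminf_le_const)
  fix N
  let ?D = "from_nat_into C ` ({..<N} \<inter> to_nat_on C ` C)"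
  have "(\<Sum>n<N. emeasure M (f n)) = (\<Sum>n\<in>{..<N} \<inter> to_nat_on C ` C. emeasure M (A (from_nat_into C n)))"
   by (rule sum.mono_neutral_cong_right) (auto simp: f_def)
  also have "... = (\<Sum>i\<in>?D. emeasure M (A i))" using assms(1) by (subst sum.reindex) (auto simp: inj_on_def)
  also have "... <= B" using assms(1) by (intro fin) auto
  finally show "(\<Sum>n<N. emeasure M (f n)) <= B" .
 qed simp
 finally show ?thesis .
qed

text \<open>The weak type (1,1) estimate of the maximal function of a superadditive interval function.\<close>

lemma superadditive_weak_type:
 fixes \<nu> :: "real => real => real"
 assumes nonneg: "!!s t. s <= t ==> 0 <= \<nu> s t"
  and super: "!!s t u. s <= t ==> t <= u ==> \<nu> s t + \<nu> t u <= \<nu> s u"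
  and bound: "!!s t. s <= t ==> \<nu> s t <= B"
  and c: "0 < c"
  and E: "!!t. t \<in> E ==> \<exists>s u. s <= t & t <= u & s < u & c * (u - s) < \<nu> s u"
 shows "\<exists>T\<in>sets borel. E \<subseteq> T & emeasure lborel T <= ennreal (5 * B / c)"
proof -
 define K where "K = {(s, u). s < u & c * (u - s) < \<nu> s u}"
 \<comment> \<open>The Vitali covering lemma speaks of balls; the interval \<open>(s, u)\<close>
   becomes the ball with centre \<open>a\<close> and radius \<open>r\<close>.\<close>
 define a where "a = (%(s, u). (s + u) / (2::real))"
 define r where "r = (%(s, u). (u - s) / (2::real))"
 have cb: "cball (a i) (r i) = {fst i..snd i}" for i by (cases i) (simp add: a_def r_def cball_eq_atLeastAtMost field_simps)
 have "E \<subseteq> (\<Union>i\<in>K. cball (a i) (r i))"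
 proof
  fix t assume "t \<in> E"
  then obtain s u where "s <= t" "t <= u" "s < u" "c * (u - s) < \<nu> s u" using E by blast
  thus "t \<in> (\<Union>i\<in>K. cball (a i) (r i))" unfolding cb K_def by force
 qed
 moreover have "0 < r i & r i <= B / c" if "i \<in> K" for i
 proof -
  obtain s u where i: "i = (s, u)" by (cases i)
  have "s < u" "c * (u - s) < \<nu> s u" "\<nu> s u <= B" using that bound[of s u] by (auto simp: K_def i)
  hence "(u - s) < B / c" using c by (simp add: field_simps)
  moreover have "0 < (u - s) / 2" "(u - s) / 2 <= u - s" using \<open>s < u\<close> by auto
  ultimately show ?thesis unfolding r_def i prod.case by (blast intro: order.trans less_imp_le)
 qed
 ultimately obtain C where C: "countable C" "C \<subseteq> K"
  "pairwise (%i j. disjnt (cball (a i) (r i)) (cball (a j) (r j))) C"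
  "E \<subseteq> (\<Union>i\<in>C. cball (a i) (5 * r i))" by (rule Vitali_covering_lemma_cballs)
 have rpos: "0 < r i" if "i \<in> C" for i using that C(2) by (auto simp: K_def r_def)
 define T where "T = (\<Union>i\<in>C. cball (a i) (5 * r i))"
 have B0: "0 <= B" using nonneg[of 0 0] bound[of 0 0] by simp
 \<comment> \<open>A ball enlarged five times has length \<open>10 * r i\<close>. On
   \<open>K\<close> the value of \<open>\<nu>\<close> exceeds \<open>c * (2 * r i)\<close>, and
   superadditivity bounds the sum of these values by \<open>B\<close>; hence the constant 5.\<close>
 have fin: "(\<Sum>i\<in>D. 10 * r i) <= 5 * B / c" if D: "finite D" "D \<subseteq> C" for D
 proof (cases "D = {}")
  case True
  thus ?thesis using B0 c by simp
 next
  case False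
  define l where "l = Min (fst ` D)"
  define m where "m = Max (snd ` D)"
  have lm: "l <= s & s < u & u <= m" if "(s, u) \<in> D" for s u using that D C(2) unfolding l_def m_def K_def
   by (auto intro!: Min_le Max_ge rev_image_eqI)
  hence "l <= m" using False by fastforce
  have "(\<Sum>i\<in>D. c * (2 * r i)) <= (\<Sum>i\<in>D. \<nu> (fst i) (snd i))"
  proof (rule sum_mono)
   fix i assume "i \<in> D"
   hence "i \<in> K" using D C(2) by auto
   thus "c * (2 * r i) <= \<nu> (fst i) (snd i)" by (auto simp: K_def r_def algebra_simps)
  qed
  also have "... <= \<nu> l m"
  proof (rule sum_superadditive_disjoint_le[OF nonneg super])
   show "pairwise (%i j. disjnt {fst i..snd i} {fst j..snd j}) D" using pairwise_subset[OF C(3) D(2)] unfolding cb .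
  qed (use D lm \<open>l <= m\<close> in auto)
  also have "... <= B" using bound \<open>l <= m\<close> by simp
  also have "(\<Sum>i\<in>D. c * (2 * r i)) = (2 * c) * (\<Sum>i\<in>D. r i)" unfolding sum_distrib_left by (rule sum.cong) auto
  finally have "(2 * c) * (\<Sum>i\<in>D. r i) <= B" .
  hence "(\<Sum>i\<in>D. r i) <= B / (2 * c)" using c by (simp add: field_simps)
  hence "10 * (\<Sum>i\<in>D. r i) <= 10 * (B / (2 * c))" by (rule mult_left_mono) simp
  thus ?thesis by (simp add: sum_distrib_left)
 qed
 have "emeasure lborel T <= ennreal (5 * B / c)" unfolding T_def
 proof (rule emeasure_UN_countable_le_finite_sums[OF C(1)])
  fix D assume D: "finite D" "D \<subseteq> C"
  have "emeasure lborel (cball (a i) (5 * r i)) = ennreal (10 * r i)" if "i \<in> D" for i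
   using rpos[of i] that D(2) unfolding cball_eq_atLeastAtMost by auto
  hence "(\<Sum>i\<in>D. emeasure lborel (cball (a i) (5 * r i))) = (\<Sum>i\<in>D. ennreal (10 * r i))" by (rule sum.cong[OF refl])
  also have "... = ennreal (\<Sum>i\<in>D. 10 * r i)" using rpos D(2) by (intro sum_ennreal) (auto intro: less_imp_le)
  also have "... <= ennreal (5 * B / c)" using fin[OF D] by (rule ennreal_leI)
  finally show "(\<Sum>i\<in>D. emeasure lborel (cball (a i) (5 * r i))) <= ennreal (5 * B / c)" .
 qed simp
 moreover have "T \<in> sets borel" unfolding T_def using C(1) by auto
 ultimately show ?thesis using C(4) unfolding T_def by blast
qed

lemma null_set_superset:
 assumes "!!e. 0 < e ==> \<exists>T\<in>sets M. E \<subseteq> T & emeasure M T <= ennreal e"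
 shows "\<exists>N\<in>null_sets M. E \<subseteq> N"
proof -
 have "\<exists>T. T \<in> sets M & E \<subseteq> T & emeasure M T <= ennreal (1 / real (Suc n))" for n
  using assms[of "1 / real (Suc n)"] by auto
 then obtain T where T: "!!n. T n \<in> sets M" "!!n. E \<subseteq> T n"
   "!!n. emeasure M (T n) <= ennreal (1 / real (Suc n))" by metis
 have "emeasure M (\<Inter>n. T n) <= ennreal e" if "0 < e" for e
 proof -
  obtain n where "1 / real (Suc n) < e" using \<open>0 < e\<close> by (metis nat_approx_posE)
  have "emeasure M (\<Inter>n. T n) <= emeasure M (T n)" using T(1) by (intro emeasure_mono) auto
  also have "... <= ennreal e" using T(3)[of n] \<open>1 / real (Suc n) < e\<close> by (meson ennreal_leI less_imp_le order_trans)
  finally show ?thesis .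
 qed
 hence "emeasure M (\<Inter>n. T n) <= 0" using ennreal_le_epsilon[of 0 "emeasure M (\<Inter>n. T n)"] by auto
 hence "(\<Inter>n. T n) \<in> null_sets M" using T(1) by (auto intro!: null_setsI)
 thus ?thesis using T(2) by blast
qed

lemma AE_not_in_null_cover:
 assumes "!!e. 0 < e ==> \<exists>T\<in>sets M. E \<subseteq> T & emeasure M T <= ennreal e"
 shows "AE x in M. x \<notin> E"
proof -
 obtain N where N: "N \<in> null_sets M" "E \<subseteq> N" using null_set_superset[OF assms] by blast
 show ?thesis using AE_not_in[OF N(1)] by (rule eventually_mono) (use N(2) in auto)
qed

text \<open>The weak type estimate is applied on every dyadic interval of one fine level. It covers
  the times of upper density above \<open>c\<close> up to measure \<open>5 / c\<close> times a
  dyadic sum, which is as small as desired.\<close>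

lemma AE_density_zero_superadditive:
 fixes \<delta> :: "real => real => real"
 assumes nonneg: "!!s t. 0 <= s ==> s <= t ==> t <= 1 ==> 0 <= \<delta> s t"
  and super: "!!s t u. 0 <= s ==> s <= t ==> t <= u ==> u <= 1 ==> \<delta> s t + \<delta> t u <= \<delta> s u"
  and dyadic: "!!e. 0 < e ==> \<exists>N. (\<Sum>i<2 ^ N. \<delta> (real i / 2 ^ N) (real (Suc i) / 2 ^ N)) < e"
 shows "AE t in lborel. 0 < t & t < 1 -->
  (\<forall>c>0. \<exists>r>0. \<forall>s u. 0 <= s & s <= t & t <= u & u <= 1 & s < u & u - s < r --> \<delta> s u <= c * (u - s))"
proof -
 define bad where "bad c = {t. 0 < t & t < 1 &
  (\<forall>r>0. \<exists>s u. 0 <= s & s <= t & t <= u & u <= 1 & s < u & u - s < r & c * (u - s) < \<delta> s u)}" for c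
 \<comment> \<open>An interval around a dyadic point may cross from one cell into the next; these
   countably many times are discarded.\<close>
 define D where "D = (%(i, N). real i / 2 ^ N) ` (UNIV :: (nat \<times> nat) set)"
 have "countable D" unfolding D_def by (intro countable_image) simp
 hence D0: "emeasure lborel D = 0" "D \<in> sets borel" using emeasure_lborel_countable sets.countable[of D borel] by auto
 have AE_bad: "AE t in lborel. t \<notin> bad c" if c: "0 < c" for c
 proof (rule AE_not_in_null_cover)
  fix e :: real assume e: "0 < e"
  obtain N where N: "(\<Sum>i<2 ^ N. \<delta> (real i / 2 ^ N) (real (Suc i) / 2 ^ N)) < e * c / 5" using dyadic[of "e * c / 5"] e c by auto
  define a where "a i = real i / 2 ^ N" for i
  have a01: "0 <= a i" "a i < a (Suc i)" for i by (auto simp: a_def divide_strict_right_mono)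
  have a1: "a (Suc i) <= 1" if "i < 2 ^ N" for i
  proof -
   have "real (Suc i) <= 2 ^ N" using that by (metis Suc_leI of_nat_le_iff of_nat_numeral of_nat_power)
   thus ?thesis by (simp add: a_def)
  qed
  have "\<exists>T\<in>sets borel. bad c \<inter> {a i<..<a (Suc i)} \<subseteq> T & emeasure lborel T <= ennreal (5 * \<delta> (a i) (a (Suc i)) / c)"
   if i: "i < 2 ^ N" for i
  proof -
   \<comment> \<open>Clamping to one cell extends the interval function to the real line, as the
     weak type estimate requires, and bounds it by its value on the cell.\<close>
   define cl where "cl x = max (a i) (min (a (Suc i)) x)" for x
   have cl: "0 <= cl x" "cl x <= 1" "a i <= cl x" "cl x <= a (Suc i)" for x using a01[of i] a1[OF i] by (auto simp: cl_def)
   have clm: "cl x <= cl y" if "x <= y" for x y using that by (auto simp: cl_def)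
   show ?thesis
   proof (rule superadditive_weak_type[where \<nu> = "%s t. \<delta> (cl s) (cl t)"])
    show "0 <= \<delta> (cl s) (cl t)" if "s <= t" for s t by (intro nonneg cl clm that)
    show "\<delta> (cl s) (cl t) + \<delta> (cl t) (cl u) <= \<delta> (cl s) (cl u)" if "s <= t" "t <= u" for s t u
     by (intro super cl clm that)
    show "\<delta> (cl s) (cl t) <= \<delta> (a i) (a (Suc i))" if "s <= t" for s t
    proof -
     have "\<delta> (a i) (cl s) + \<delta> (cl s) (cl t) <= \<delta> (a i) (cl t)"
      "\<delta> (a i) (cl t) + \<delta> (cl t) (a (Suc i)) <= \<delta> (a i) (a (Suc i))"
      "0 <= \<delta> (a i) (cl s)" "0 <= \<delta> (cl t) (a (Suc i))" using cl[of s] cl[of t] clm[OF that] a01[of i] a1[OF i]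
      by (auto intro!: super nonneg)
     thus ?thesis by linarith
    qed
    show "\<exists>s u. s <= t & t <= u & s < u & c * (u - s) < \<delta> (cl s) (cl u)"
     if t: "t \<in> bad c \<inter> {a i<..<a (Suc i)}" for t
    proof -
     \<comment> \<open>Intervals around \<open>t\<close> shorter than this stay inside the cell and
       are unchanged by clamping.\<close>
     have "0 < min (t - a i) (a (Suc i) - t)" using t by auto
     then obtain s u where su: "0 <= s" "s <= t" "t <= u" "u <= 1" "s < u"
      "u - s < min (t - a i) (a (Suc i) - t)" "c * (u - s) < \<delta> s u" using t unfolding bad_def by blast
     have "cl s = s" "cl u = u" using su by (auto simp: cl_def)
     thus ?thesis using su by (intro exI[of _ s] exI[of _ u]) auto
    qed
   qed (use c in auto)
  qed
  then obtain T where T: "!!i. i < 2 ^ N ==> T i \<in> sets borel"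
   "!!i. i < 2 ^ N ==> bad c \<inter> {a i<..<a (Suc i)} \<subseteq> T i"
   "!!i. i < 2 ^ N ==> emeasure lborel (T i) <= ennreal (5 * \<delta> (a i) (a (Suc i)) / c)" by metis
  let ?T = "(\<Union>i<2 ^ N. T i) \<union> D"
  have "bad c \<subseteq> ?T"
  proof
   fix t assume t: "t \<in> bad c"
   hence t01: "0 < t" "t < 1" by (auto simp: bad_def)
   define i where "i = nat \<lfloor>t * 2 ^ N\<rfloor>"
   have fl: "real i <= t * 2 ^ N" "t * 2 ^ N < real (Suc i)"
    using t01 real_of_int_floor_add_one_gt[of "t * 2 ^ N"] by (auto simp: i_def algebra_simps)
   have "real i < 2 ^ N" using fl(1) t01 by (smt (verit) mult_less_cancel_right2 zero_less_power)
   hence i: "i < 2 ^ N" by (metis of_nat_less_iff of_nat_numeral of_nat_power)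
   have "a i <= t" "t < a (Suc i)" using fl by (auto simp: a_def field_simps)
   moreover have "t \<in> D" if "t = a i" using that by (auto simp: D_def a_def)
   ultimately show "t \<in> ?T" using T(2)[OF i] t i by fastforce
  qed
  moreover have "?T \<in> sets lborel" using T(1) D0 by auto
  moreover have "emeasure lborel ?T <= ennreal e"
  proof -
   have \<delta>0: "0 <= \<delta> (a i) (a (Suc i))" if "i < 2 ^ N" for i by (intro nonneg a01(1) less_imp_le[OF a01(2)] a1 that)
   have "emeasure lborel ?T <= emeasure lborel (\<Union>i<2 ^ N. T i) + emeasure lborel D" using T(1) D0 by (intro emeasure_subadditive) auto
   also have "... = emeasure lborel (\<Union>i<2 ^ N. T i)" using D0 by simp
   also have "... <= (\<Sum>i<2 ^ N. emeasure lborel (T i))" using T(1) by (intro emeasure_subadditive_finite) auto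
   also have "... <= (\<Sum>i<2 ^ N. ennreal (5 * \<delta> (a i) (a (Suc i)) / c))" using T(3) by (intro sum_mono) auto
   also have "... = ennreal (\<Sum>i<2 ^ N. 5 * \<delta> (a i) (a (Suc i)) / c)" using \<delta>0 c by (intro sum_ennreal) auto
   also have "(\<Sum>i<2 ^ N. 5 * \<delta> (a i) (a (Suc i)) / c) = 5 / c * (\<Sum>i<2 ^ N. \<delta> (a i) (a (Suc i)))"
    by (simp add: sum_distrib_left)
   also have "ennreal ... <= ennreal e" using N c unfolding a_def by (intro ennreal_leI) (simp add: field_simps)
   finally show ?thesis .
  qed
  ultimately show "\<exists>T\<in>sets lborel. bad c \<subseteq> T & emeasure lborel T <= ennreal e" by blast
 qed
 have "AE t in lborel. \<forall>n. t \<notin> bad (1 / real (Suc n))" using AE_bad by (intro AE_all_countable[THEN iffD2]) auto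
 thus ?thesis
 proof (rule eventually_mono, intro impI allI)
  fix t c :: real
  assume t: "\<forall>n. t \<notin> bad (1 / real (Suc n))" "0 < t & t < 1" and "0 < c"
  obtain n where n: "1 / real (Suc n) < c" using \<open>0 < c\<close> by (metis nat_approx_posE)
  obtain r where r: "0 < r" "!!s u. 0 <= s ==> s <= t ==> t <= u ==> u <= 1 ==> s < u ==> u - s < r
    ==> \<delta> s u <= 1 / real (Suc n) * (u - s)"
  proof -
   have "t \<notin> bad (1 / real (Suc n))" using t(1) by blast
   hence "\<exists>r>0. \<forall>s u. \<not> (0 <= s & s <= t & t <= u & u <= 1 & s < u & u - s < r & 1 / real (Suc n) * (u - s) < \<delta> s u)"
    using t(2) unfolding bad_def by blast
   thus ?thesis using that unfolding not_less[symmetric] by blast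
  qed
  have "\<delta> s u <= c * (u - s)" if "0 <= s" "s <= t" "t <= u" "u <= 1" "s < u" "u - s < r" for s u
   using r(2)[OF that] mult_right_mono[of "1 / real (Suc n)" c "u - s"] n that by linarith
  thus "\<exists>r>0. \<forall>s u. 0 <= s & s <= t & t <= u & u <= 1 & s < u & u - s < r --> \<delta> s u <= c * (u - s)"
   using r(1) by blast
 qed
qed

lemma set_integrable_Ioc: "integrable lborel f ==> set_integrable lborel {s<..t} (f :: real => real)"
 unfolding set_integrable_def by (intro integrable_mult_indicator) auto

lemma set_integral_density_Ioc:
 fixes k :: "real => real"
 assumes "integrable lborel k" "!!x. 0 <= k x"
 shows "(LINT x:{s<..u}|lborel. k x) = measure (density lborel k) {s<..u}"
proof -
 have "ennreal (measure (density lborel k) {s<..u}) = emeasure (density lborel k) {s<..u}"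
 proof (rule emeasure_eq_ennreal_measure[symmetric])
  have "emeasure (density lborel k) {s<..u} <= emeasure (density lborel k) UNIV" by (intro emeasure_mono) auto
  also have "... = (\<integral>\<^sup>+x. k x \<partial>lborel)" using assms by (subst emeasure_density) auto
  also have "... < \<infinity>" using assms by (simp add: nn_integral_eq_integral)
  finally show "emeasure (density lborel k) {s<..u} ~= \<top>" by simp
 qed
 also have "... = (\<integral>\<^sup>+x. ennreal (indicator {s<..u} x * k x) \<partial>lborel)"
  using assms by (subst emeasure_density) (auto intro!: nn_integral_cong split: split_indicator)
 also have "... = ennreal (LINT x|lborel. indicator {s<..u} x * k x)"
  using assms integrable_mult_indicator[of "{s<..u}" lborel k] by (intro nn_integral_eq_integral) auto
 finally show ?thesis using assms unfolding set_lebesgue_integral_def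
  by (subst (asm) ennreal_inj) (auto intro!: Bochner_Integration.integral_nonneg split: split_indicator)
qed

text \<open>The differentiation theorem used here concerns intervals \<open>{x..x + k}\<close> to
  the right of \<open>x\<close>. Left difference quotients are obtained by applying it to the
  reflected function \<open>h (- x)\<close>.\<close>

lemma AE_has_real_derivative_integral:
 fixes h w :: "real => real"
 assumes h: "integrable lborel h"
  and w: "!!s t. a <= s ==> s <= t ==> t <= b ==> w t - w s = (LINT x:{s<..t}|lborel. h x)"
 shows "AE t in lborel. a < t & t < b --> (w has_real_derivative h t) (at t)"
proof -
 have LI: "(LINT x:{s<..t}|lborel. h x) = integral {s..t} h" for s t
 proof -
  have "(LINT x:{s<..t}|lborel. h x) = (LINT x:{s..t}|lborel. h x)" by (rule set_integral_discrete_difference[where X = "{s}"]) auto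
  also have "... = integral {s..t} h"
   using integrable_mult_indicator[of "{s..t}" lborel h] h by (intro set_borel_integral_eq_integral) (simp add: set_integrable_def)
  finally show ?thesis .
 qed
 have diff: "\<exists>N. negligible N & (\<forall>x e. x \<notin> N --> 0 < e --> (\<exists>d>0. \<forall>k. 0 < k & k < d --> \<bar>integral {x..x + k} f / k - f x\<bar> < e))"
  if "f integrable_on UNIV" for f :: "real => real"
 proof -
  have "f integrable_on cbox u v" for u v by (rule integrable_on_subcbox[OF that]) simp
  from integrable_ccontinuous_explicit[OF this] obtain N where "negligible N"
   "!!x e. x \<notin> N ==> 0 < e ==> \<exists>d>0. \<forall>k. 0 < k & k < d --> norm (integral (cbox x (x + k *\<^sub>R One)) f /\<^sub>R k ^ DIM(real) - f x) < e" by blast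
  thus ?thesis by (intro exI[of _ N]) (simp add: divide_inverse mult.commute)
 qed
 have hU: "h integrable_on UNIV" by (rule integrable_on_lborel[OF h])
 obtain N where N: "negligible N" "!!x e. x \<notin> N ==> 0 < e ==> \<exists>d>0. \<forall>k. 0 < k & k < d --> \<bar>integral {x..x + k} h / k - h x\<bar> < e"
  using diff[OF hU] by blast
 have "(%x. h (- x)) integrable_on UNIV" using integrable_on_lborel[OF lborel_integrable_real_affine[OF h, of "- 1" 0]] by simp
 from diff[OF this] obtain N' where N': "negligible N'"
  "!!x e. x \<notin> N' ==> 0 < e ==> \<exists>d>0. \<forall>k. 0 < k & k < d --> \<bar>integral {x..x + k} (%x. h (- x)) / k - h (- x)\<bar> < e"
  by blast
 have "negligible (N \<union> uminus ` N')"
  using N(1) N'(1) by (intro negligible_Un negligible_differentiable_image_negligible) (auto simp: differentiable_on_def)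
 hence "AE t in lebesgue. t \<notin> N \<union> uminus ` N'" by (intro AE_not_in) (simp only: negligible_iff_null_sets)
 hence "AE t in lborel. t \<notin> N \<union> uminus ` N'" by (simp only: AE_completion_iff)
 thus ?thesis
 proof (eventually_elim, intro impI)
  fix t assume t: "t \<notin> N \<union> uminus ` N'" and ab: "a < t & t < b"
  have t': "t \<notin> N" "- t \<notin> N'" using t by (auto simp: image_iff)
  show "(w has_real_derivative h t) (at t)" unfolding has_field_derivative_iff
  proof (rule tendstoI)
   fix e :: real assume e: "0 < e"
   obtain d1 where d1: "0 < d1" "!!k. 0 < k ==> k < d1 ==> \<bar>integral {t..t + k} h / k - h t\<bar> < e" using N(2)[OF t'(1) e] by blast
   obtain d2 where d2: "0 < d2" "!!k. 0 < k ==> k < d2 ==> \<bar>integral {- t..- t + k} (%x. h (- x)) / k - h t\<bar> < e"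
    using N'(2)[OF t'(2) e] by auto
   show "\<forall>\<^sub>F y in at t. dist ((w y - w t) / (y - t)) (h t) < e" unfolding eventually_at
   proof (intro exI[of _ "min (min d1 d2) (min (t - a) (b - t))"] conjI ballI impI)
    fix y assume y: "y ~= t & dist y t < min (min d1 d2) (min (t - a) (b - t))"
    show "dist ((w y - w t) / (y - t)) (h t) < e"
    proof (cases "t < y")
     case True
     have "w y - w t = integral {t..t + (y - t)} h" using w[of t y] True y ab by (simp add: LI dist_real_def)
     thus ?thesis using d1(2)[of "y - t"] True y by (simp add: dist_real_def)
    next
     case False
     have "w t - w y = integral {y..t} h" using w[of y t] False y ab by (simp add: LI dist_real_def)
     also have "... = integral {- t..- t + (t - y)} (%x. h (- x))" using integral_reflect_real[of t y h] by simp
     finally have "w t - w y = integral {- t..- t + (t - y)} (%x. h (- x))" .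
     moreover have "(w y - w t) / (y - t) = (w t - w y) / (t - y)" using y by (simp add: divide_simps) (simp add: algebra_simps)
     ultimately have "(w y - w t) / (y - t) = integral {- t..- t + (t - y)} (%x. h (- x)) / (t - y)" by (simp only:)
     moreover have "0 < t - y" "t - y < d2" using False y by (simp_all add: dist_real_def)
     ultimately show ?thesis using d2(2)[of "t - y"] by (simp only: dist_real_def)
    qed
   qed (use d1 d2 ab in auto)
  qed
 qed
qed

section \<open>Interval functions of finite energy\<close>

text \<open>For \<open>0 <= x\<close> and \<open>0 < l\<close> this is the perspective
  \<open>l * (x / l) powr p\<close> of a convex function, hence its joint subadditivity. For
  \<open>l = 0\<close> division makes it 0, so that degenerate intervals carry no energy.\<close>

definition pen :: "real => real => real => real" where
 "pen p x l = x powr p / l powr (p - 1)"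

lemma pen_nonneg: "0 <= pen p x l" by (simp add: pen_def)

lemma pen_mono: "0 <= x ==> x <= y ==> 0 <= p ==> pen p x l <= pen p y l"
 unfolding pen_def by (intro divide_right_mono powr_mono2) auto

lemma pen_alt: "0 <= x ==> 0 < l ==> pen p x l = l * (x / l) powr p"
 by (simp add: pen_def powr_divide powr_diff field_simps)

text \<open>Convexity of \<open>powr p\<close> with the weights \<open>l / (l + m)\<close> and
  \<open>m / (l + m)\<close>. If one size vanishes, the claim is monotonicity in the
  duration.\<close>

lemma pen_add_le:
 assumes p: "1 <= p" and x: "0 <= x" "0 <= y" and l: "0 < l" "0 < m"
 shows "pen p (x + y) (l + m) <= pen p x l + pen p y m"
proof -
 have zero: "pen p b (c + d) <= pen p b d" if "0 < c" "0 < d" for b c d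
  unfolding pen_def using that p by (intro divide_left_mono powr_mono2 mult_pos_pos) auto
 consider "x = 0" | "y = 0" | "0 < x" "0 < y" using x by linarith
 thus ?thesis
 proof cases
  case 1 thus ?thesis using zero[of l m y] l pen_nonneg[of p x l] by simp
 next
  case 2 thus ?thesis using zero[of m l x] l pen_nonneg[of p y m] by (simp add: add.commute)
 next
  case 3
  have "((1 - m / (l + m)) *\<^sub>R (x / l) + (m / (l + m)) *\<^sub>R (y / m)) powr p
    <= (1 - m / (l + m)) * (x / l) powr p + m / (l + m) * (y / m) powr p"
   using convex_onD[OF powr_convex[OF p], of "m / (l + m)" "x / l" "y / m"] 3 l by (simp add: field_simps)
  also have "1 - m / (l + m) = l / (l + m)" using l by (simp add: field_simps)
  finally have "((x + y) / (l + m)) powr p <= (l * (x / l) powr p + m * (y / m) powr p) / (l + m)" using l by (simp add: add_divide_distrib)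
  hence "(l + m) * ((x + y) / (l + m)) powr p <= l * (x / l) powr p + m * (y / m) powr p" using l by (simp add: field_simps)
  thus ?thesis using pen_alt x l by (simp add: pen_alt)
 qed
qed

lemma pen_sum_le:
 assumes p: "1 <= p" and "finite I" "I ~= {}" and "!!i. i \<in> I ==> 0 <= x i" "!!i. i \<in> I ==> 0 < l i"
 shows "pen p (\<Sum>i\<in>I. x i) (\<Sum>i\<in>I. l i) <= (\<Sum>i\<in>I. pen p (x i) (l i))" using assms(2-)
proof (induction rule: finite_ne_induct)
 case (insert i F)
 have "pen p (x i + sum x F) (l i + sum l F) <= pen p (x i) (l i) + pen p (sum x F) (sum l F)"
  using insert by (intro pen_add_le[OF p] sum_nonneg sum_pos) auto
 thus ?case using insert by fastforce
qed simp

text \<open>Either \<open>x <= K * l\<close>, or \<open>x / l\<close> is the product of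
  \<open>(x / l) powr (1 - p)\<close> and \<open>(x / l) powr p\<close>, with the first factor at
  most \<open>K powr (1 - p)\<close>. As this coefficient tends to 0 for large \<open>K\<close>,
  bounded energy yields uniform integrability.\<close>

lemma le_pen_add_linear:
 assumes p: "1 < p" and "0 <= x" "0 < l" "0 < K"
 shows "x <= K powr (1 - p) * pen p x l + K * l"
proof (cases "x <= K * l")
 case True
 thus ?thesis using pen_nonneg[of p x l] by (smt (verit) mult_nonneg_nonneg powr_ge_zero)
next
 case False
 hence xl: "K <= x / l" "0 < x / l" using assms by (auto simp: field_simps) (smt (verit) mult_pos_pos)
 have "x = l * (x / l)" using assms by simp
 also have "... = l * ((x / l) powr (1 - p) * (x / l) powr p)"
  using xl(2) by (subst powr_add[symmetric]) (simp only: diff_add_cancel powr_one if_True)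
 also have "... <= l * (K powr (1 - p) * (x / l) powr p)" using xl assms by (intro mult_left_mono mult_right_mono powr_mono2') auto
 also have "... = K powr (1 - p) * pen p x l" using assms by (simp add: pen_alt)
 finally show ?thesis using assms mult_pos_pos[of K l] by linarith
qed

lemma emeasure_interval_measure_le:
 assumes F: "!!x y. x <= y ==> F x <= F y" "!!a. continuous (at_right a) F" and e: "!!x. 0 <= F x" "!!x. F x <= e"
 shows "emeasure (interval_measure F) A <= ennreal e"
proof -
 have "emeasure (interval_measure F) A <= emeasure (interval_measure F) (space (interval_measure F))" by (rule emeasure_space)
 also have "space (interval_measure F) = (\<Union>i. {- (real i)<..real i})" by (simp add: UN_Ioc_eq_UNIV)
 also have "emeasure (interval_measure F) (\<Union>i. {- (real i)<..real i}) = (SUP i. emeasure (interval_measure F) {- (real i)<..real i})"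
  by (intro SUP_emeasure_incseq[symmetric]) (auto simp: incseq_def)
 also have "... <= ennreal e"
 proof (rule SUP_least)
  fix i
  have "F (real i) - F (- real i) <= e" using e(1)[of "- real i"] e(2)[of "real i"] by linarith
  thus "emeasure (interval_measure F) {- (real i)<..real i} <= ennreal e" by (simp add: emeasure_interval_measure_Ioc_eq[OF F] ennreal_leI)
 qed
 finally show ?thesis .
qed

text \<open>By the last hypothesis \<open>w\<close> is Lipschitz up to a monotone part of
  oscillation \<open>e\<close>. This makes its Lebesgue-Stieltjes measure absolutely continuous, and
  \<open>h\<close> is the Radon-Nikodym derivative.\<close>

lemma mono_absolutely_continuous_density:
 fixes w :: "real => real"
 assumes w: "mono w" and bd: "!!x. 0 <= w x" "!!x. w x <= B"
  and crit: "!!e. 0 < e ==> \<exists>P n. mono P & (\<forall>x. 0 <= P x & P x <= e) &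
   (\<forall>s t. s <= t --> w t - w s <= P t - P s + real n * (t - s))"
 shows "\<exists>h. integrable lborel h & (\<forall>x. 0 <= h x) & (\<forall>s t. s <= t --> w t - w s = (LINT x:{s<..t}|lborel. h x))"
proof -
 have wm: "!!x y. x <= y ==> w x <= w y" by (rule monoD[OF w])
 have wc: "continuous (at_right a) w" for a unfolding continuous_within
 proof (rule tendstoI)
  fix d :: real assume "0 < d"
  then obtain P n where P: "!!x. 0 <= P x" "!!x. P x <= d / 2"
   "!!s t. s <= t ==> w t - w s <= P t - P s + real n * (t - s)"
  proof -
   have "0 < d / 2" using \<open>0 < d\<close> by simp
   from crit[OF this] obtain P n where "\<forall>x. 0 <= P x & P x <= d / 2"
    "\<forall>s t. s <= t --> w t - w s <= P t - P s + real n * (t - s)" by (elim exE conjE)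
   thus ?thesis by (intro that[of P n]) auto
  qed
  define y where "y = a + d / (2 * (real n + 1))"
  have y: "a < y" using \<open>0 < d\<close> by (simp add: y_def)
  show "\<forall>\<^sub>F x in at_right a. dist (w x) (w a) < d" unfolding eventually_at_right[OF y]
  proof (intro exI conjI allI impI)
   fix x assume x: "a < x" "x < y"
   have "real n * (x - a) <= (real n + 1) * (x - a)" using x by (intro mult_right_mono) auto
   also have "... < (real n + 1) * (y - a)" using x by (intro mult_strict_left_mono) auto
   also have "... = d / 2" by (simp add: y_def divide_simps)
   finally have "w x - w a < d" using P(3)[of a x] P(1)[of a] P(2)[of x] x by linarith
   thus "dist (w x) (w a) < d" using wm[of a x] x by (auto simp: dist_real_def)
  qed (rule y)
 qed
 let ?\<nu> = "interval_measure w"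
 have fin: "finite_measure ?\<nu>"
 proof (rule finite_measureI)
  have "emeasure ?\<nu> UNIV <= ennreal B" by (rule emeasure_interval_measure_le[OF wm wc bd])
  thus "emeasure ?\<nu> (space ?\<nu>) ~= \<infinity>" using neq_top_trans[of "ennreal B"] by simp
 qed
 have "absolutely_continuous lborel ?\<nu>" unfolding absolutely_continuous_def
 proof
  fix N :: "real set" assume N: "N \<in> null_sets lborel"
  hence Nb: "N \<in> sets borel" by auto
  have "emeasure ?\<nu> N <= ennreal e" if e': "0 < e" for e
  proof -
   have e: "0 < e / 2" using e' by simp
   from crit[OF e] obtain P n where P: "mono P" "!!x. 0 <= P x" "!!x. P x <= e / 2"
    "!!s t. s <= t ==> w t - w s <= P t - P s + real n * (t - s)" by blast
   \<comment> \<open>On an open set \<open>U\<close> of measure below \<open>\<delta>\<close> around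
     the null set, the Lipschitz part contributes at most \<open>n * \<delta> <= e / 2\<close>, and
     the increments of \<open>P\<close> telescope to at most \<open>e / 2\<close>.\<close>
   define \<delta> where "\<delta> = e / 2 / (real n + 1)"
   have \<delta>: "0 < \<delta>" "real n * \<delta> <= e / 2" using e by (simp_all add: \<delta>_def field_simps)
   obtain U where U: "open U" "N \<subseteq> U" "emeasure lborel (U - N) < ennreal \<delta>" using outer_regular_lborel[OF Nb \<delta>(1)] by blast
   have "emeasure lborel U = emeasure lborel (U - N)" using U(1,2) N by (intro emeasure_Diff_null_set[symmetric]) auto
   hence lU: "emeasure lborel U <= ennreal \<delta>" using U(3) by simp
   \<comment> \<open>A grid of mesh \<open>1 / 2 ^ M\<close> on the interval from
     \<open>- 2 ^ M\<close> to \<open>2 ^ M\<close>, so that mesh and range improve together; it has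
     \<open>2 * 4 ^ M\<close> cells.\<close>
   define x where "x M j = (real j - 4 ^ M) / 2 ^ M" for M j :: nat
   define J where "J M = {j \<in> {..<2 * 4 ^ M}. {x M j<..x M (Suc j)} \<subseteq> U}" for M
   define A where "A M = (\<Union>j\<in>J M. {x M j<..x M (Suc j)})" for M
   have x_mono: "x M i <= x M j" if "i <= j" for i j M unfolding x_def using that by (intro divide_right_mono) auto
   have x_Suc: "x M (Suc j) - x M j = 1 / 2 ^ M" for M j by (simp add: x_def diff_divide_distrib[symmetric])
   have fJ: "finite (J M)" for M by (simp add: J_def)
   have disj: "disjoint_family_on (%j. {x M j<..x M (Suc j)}) (J M)" for M
   proof -
    have "{x M i<..x M (Suc i)} \<inter> {x M j<..x M (Suc j)} = {}" if "i < j" for i j using x_mono[of "Suc i" j M] that by auto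
    thus ?thesis unfolding disjoint_family_on_def by (metis Int_commute linorder_neqE_nat)
   qed
   have \<nu>A: "emeasure ?\<nu> (A M) <= ennreal e" for M
   proof -
    have "ennreal (real (card (J M)) / 2 ^ M) = (\<Sum>j\<in>J M. emeasure lborel {x M j<..x M (Suc j)})"
     using x_mono[of _ "Suc _" M] by (simp add: x_Suc ennreal_of_nat_eq_real_of_nat ennreal_mult[symmetric])
    also have "... = emeasure lborel (A M)" unfolding A_def by (rule sum_emeasure[OF _ disj fJ]) auto
    also have "... <= emeasure lborel U" using U(1) by (intro emeasure_mono) (auto simp: A_def J_def)
    also have "... <= ennreal \<delta>" by (rule lU)
    finally have card: "real (card (J M)) / 2 ^ M <= \<delta>" using \<delta>(1) by (simp add: ennreal_le_iff)
    have "emeasure ?\<nu> (A M) = (\<Sum>j\<in>J M. emeasure ?\<nu> {x M j<..x M (Suc j)})"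
     unfolding A_def by (rule sum_emeasure[OF _ disj fJ, symmetric]) auto
    also have "... = ennreal (\<Sum>j\<in>J M. w (x M (Suc j)) - w (x M j))"
     using wm x_mono[of _ "Suc _" M] by (simp add: emeasure_interval_measure_Ioc[OF _ wm wc])
    finally have em: "emeasure ?\<nu> (A M) = ennreal (\<Sum>j\<in>J M. w (x M (Suc j)) - w (x M j))" .
    have "(\<Sum>j\<in>J M. w (x M (Suc j)) - w (x M j)) <= (\<Sum>j\<in>J M. P (x M (Suc j)) - P (x M j) + real n * (1 / 2 ^ M))"
     using P(4)[OF x_mono] x_Suc by (intro sum_mono) (metis le_SucI order_refl)
    also have "... = (\<Sum>j\<in>J M. P (x M (Suc j)) - P (x M j)) + real n * (real (card (J M)) / 2 ^ M)" by (simp add: sum.distrib)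
    also have "(\<Sum>j\<in>J M. P (x M (Suc j)) - P (x M j)) <= (\<Sum>j<2 * 4 ^ M. P (x M (Suc j)) - P (x M j))"
     using monoD[OF P(1) x_mono] by (intro sum_mono2) (auto simp: J_def)
    also have "... = P (x M (2 * 4 ^ M)) - P (x M 0)" by (rule sum_lessThan_telescope)
    also have "... <= e / 2" using P(2)[of "x M 0"] P(3)[of "x M (2 * 4 ^ M)"] by simp
    also have "real n * (real (card (J M)) / 2 ^ M) <= real n * \<delta>" using card by (rule mult_left_mono) simp
    finally have "(\<Sum>j\<in>J M. w (x M (Suc j)) - w (x M j)) <= e" using \<delta>(2) by simp
    thus ?thesis unfolding em by (rule ennreal_leI)
   qed
   have ev: "\<forall>\<^sub>F M in sequentially. y \<in> A M" if "y \<in> U" for y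
   proof -
    obtain r where r: "0 < r" "ball y r \<subseteq> U" using U(1) \<open>y \<in> U\<close> openE by blast
    have "(%M. (1 / 2 :: real) ^ M) \<longlonglongrightarrow> 0" by (rule LIMSEQ_realpow_zero) auto
    hence "\<forall>\<^sub>F M in sequentially. (1 / 2) ^ M < r" using r(1) by (rule order_tendstoD)
    moreover have "\<forall>\<^sub>F M in sequentially. \<bar>y\<bar> < 2 ^ M"
     using filterlim_realpow_sequentially_gt1[of "2 :: real"] by (auto simp: filterlim_at_infinity_conv_norm_at_top filterlim_at_top_dense)
    ultimately show ?thesis
    proof eventually_elim
     case (elim M)
     define z where "z = y * 2 ^ M + 4 ^ M"
     have 4: "(4::real) ^ M = 2 ^ M * 2 ^ M" by (simp add: power_mult_distrib[symmetric])
     have "\<bar>y * 2 ^ M\<bar> < 2 ^ M * 2 ^ M" using elim(2) by (simp add: abs_mult)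
     hence z: "0 < z" "z < 2 * 4 ^ M" unfolding z_def 4 by (simp_all add: abs_less_iff)
     define j where "j = nat (\<lceil>z\<rceil> - 1)"
     have rj: "real j < z" "z <= real (Suc j)" using z(1) ceiling_correct[of z] by (simp_all add: j_def of_nat_nat)
     hence "real j < real (2 * 4 ^ M)" using z(2) by simp
     hence j: "j < 2 * 4 ^ M" by (simp only: of_nat_less_iff)
     have y: "x M j < y" "y <= x M (Suc j)" using rj unfolding x_def z_def by (simp_all add: field_simps)
     have "{x M j<..x M (Suc j)} \<subseteq> ball y r" using y x_Suc[of M j] elim(1) by (auto simp: dist_real_def power_one_over abs_less_iff)
     thus ?case using j y r(2) unfolding A_def J_def by auto
    qed
   qed
   \<comment> \<open>Each point of \<open>U\<close> lies in \<open>A M\<close> for all large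
     \<open>M\<close>, so Fatou's lemma carries the bound from \<open>A M\<close> to
     \<open>U\<close>.\<close>
   have "emeasure ?\<nu> N <= (\<integral>\<^sup>+y. indicator U y \<partial>?\<nu>)" using U(1,2) by (simp add: emeasure_mono)
   also have "... <= (\<integral>\<^sup>+y. liminf (%M. indicator (A M) y) \<partial>?\<nu>)"
   proof (rule nn_integral_mono)
    show "indicator U y <= liminf (%M. indicator (A M) y :: ennreal)" for y
     using Liminf_bounded[of "1 :: ennreal" "%M. indicator (A M) y" sequentially] ev[of y]
     by (auto split: split_indicator elim: eventually_mono)
   qed
   also have "... <= liminf (%M. \<integral>\<^sup>+y. indicator (A M) y \<partial>?\<nu>)"
    by (rule nn_integral_liminf) (simp add: A_def fJ)
   also have "... <= liminf (%M. ennreal e)"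
    by (intro Liminf_mono always_eventually allI) (use \<nu>A in \<open>simp add: A_def fJ\<close>)
   finally show ?thesis by (simp add: Liminf_const)
  qed
  hence "emeasure ?\<nu> N <= 0" using ennreal_le_epsilon[of 0 "emeasure ?\<nu> N"] by auto
  thus "N \<in> null_sets ?\<nu>" using Nb by (auto intro!: null_setsI)
 qed
 then obtain D where D: "D \<in> borel_measurable lborel" "AE x in lborel. RN_deriv lborel ?\<nu> x = ennreal (D x)" "!!x. 0 <= D x"
  using sigma_finite_measure.real_RN_deriv[OF sigma_finite_lborel fin] by (metis sets_interval_measure sets_lborel)
 have \<nu>: "density lborel (%x. ennreal (D x)) = ?\<nu>"
 proof -
  have "density lborel (%x. ennreal (D x)) = density lborel (RN_deriv lborel ?\<nu>)" using D by (intro density_cong) auto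
  thus ?thesis using sigma_finite_measure.density_RN_deriv[OF sigma_finite_lborel \<open>absolutely_continuous lborel ?\<nu>\<close>] by simp
 qed
 have "integrable lborel D"
 proof (rule integrableI_nonneg)
  have "(\<integral>\<^sup>+x. ennreal (D x) \<partial>lborel) = emeasure (density lborel (%x. ennreal (D x))) UNIV"
   using D(1) by (subst emeasure_density) auto
  also have "... < \<infinity>" unfolding \<nu> using finite_measure.emeasure_finite[OF fin, of UNIV] by (simp add: less_top)
  finally show "(\<integral>\<^sup>+x. ennreal (D x) \<partial>lborel) < \<infinity>" .
 qed (use D in auto)
 moreover have "w t - w s = (LINT x:{s<..t}|lborel. D x)" if "s <= t" for s t
  by (simp add: set_integral_density_Ioc[OF \<open>integrable lborel D\<close> D(3)] \<nu> measure_interval_measure_Ioc[OF that wm wc])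
 ultimately show ?thesis using D(3) by blast
qed

lemma set_integral_Ioc_split:
 fixes h :: "real => real"
 assumes "integrable lborel h" "r <= s" "s <= t"
 shows "(LINT x:{r<..t}|lborel. h x) = (LINT x:{r<..s}|lborel. h x) + (LINT x:{s<..t}|lborel. h x)"
proof -
 have "{r<..t} = {r<..s} \<union> {s<..t}" "{r<..s} \<inter> {s<..t} = {}" using assms by auto
 moreover have "set_integrable lborel A h" if "A \<in> sets borel" for A
  using assms that unfolding set_integrable_def by (intro integrable_mult_indicator) auto
 ultimately show ?thesis by (simp add: set_integral_Un)
qed

lemma set_integral_Ioc_nonneg:
 fixes h :: "real => real"
 assumes "!!x. 0 <= h x"
 shows "0 <= (LINT x:{s<..t}|lborel. h x)" unfolding set_lebesgue_integral_def using assms by (intro Bochner_Integration.integral_nonneg) auto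

lemma set_integral_Ioc_le:
 fixes h :: "real => real"
 assumes "integrable lborel h" "!!x. 0 <= h x"
 shows "(LINT x:{s<..t}|lborel. h x) <= (LINT x|lborel. h x)"
 unfolding set_lebesgue_integral_def using assms integrable_mult_indicator[of "{s<..t}" lborel h]
 by (intro integral_mono) (auto split: split_indicator)

lemma set_integral_Ioc_mono:
 fixes h :: "real => real"
 assumes "integrable lborel h" "!!x. 0 <= h x" "{s<..t} \<subseteq> {s'<..t'}"
 shows "(LINT x:{s<..t}|lborel. h x) <= (LINT x:{s'<..t'}|lborel. h x)" unfolding set_lebesgue_integral_def
 using assms integrable_mult_indicator[of "{s<..t}" lborel h] integrable_mult_indicator[of "{s'<..t'}" lborel h]
 by (intro integral_mono) (auto split: split_indicator)

text \<open>Used as uniform integrability: \<open>g\<close> is at most a constant \<open>n\<close>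
  plus a remainder of small integral.\<close>

lemma integral_excess_tendsto_zero:
 fixes g :: "real => real"
 assumes g: "integrable lborel g" "!!x. 0 <= g x"
 shows "(%n. LINT x|lborel. max 0 (g x - real n)) \<longlonglongrightarrow> 0"
proof -
 have [measurable]: "g \<in> borel_measurable borel" using g by auto
 have "(%n. LINT x|lborel. max 0 (g x - real n)) \<longlonglongrightarrow> (LINT x|(lborel :: real measure). 0 :: real)"
 proof (rule integral_dominated_convergence[where w = g])
  show "AE x in lborel. (%n. max 0 (g x - real n)) \<longlonglongrightarrow> 0"
  proof (intro AE_I2 tendsto_eventually)
   fix x
   obtain N where "g x <= real N" using real_arch_simple by blast
   thus "\<forall>\<^sub>F n in sequentially. max 0 (g x - real n) = 0" by (intro eventually_sequentiallyI[of N]) auto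
  qed
  show "AE x in lborel. norm (max 0 (g x - real n)) <= g x" for n using g(2) by (intro AE_I2) auto
 qed (use g in auto)
 thus ?thesis by simp
qed

text \<open>Adding the indefinite integral of \<open>g\<close> makes \<open>u\<close> monotone. The
  density of the sum, diminished by \<open>g\<close>, is the density of \<open>u\<close>.\<close>

lemma absolutely_continuous_density:
 fixes u g :: "real => real"
 assumes g: "integrable lborel g" "!!x. 0 <= g x" and ab: "a <= b"
  and u: "!!s t. a <= s ==> s <= t ==> t <= b ==> \<bar>u t - u s\<bar> <= (LINT x:{s<..t}|lborel. g x)"
 shows "\<exists>h. integrable lborel h &
  (\<forall>s t. a <= s & s <= t & t <= b --> u t - u s = (LINT x:{s<..t}|lborel. h x))"
proof -
 have [measurable]: "g \<in> borel_measurable borel" using g by auto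
 \<comment> \<open>Everything is continued constantly beyond \<open>{a..b}\<close>, because the
   monotone criterion is stated on the whole line.\<close>
 define cl where "cl x = max a (min b x)" for x
 have cl: "a <= cl x" "cl x <= b" "x <= y ==> cl x <= cl y" "x <= y ==> cl y - cl x <= y - x" for x y
  using ab by (auto simp: cl_def)
 have clid: "cl x = x" if "a <= x" "x <= b" for x using that by (auto simp: cl_def)
 define I where "I k x = (LINT y:{a<..cl x}|lborel. k y)" for k :: "real => real" and x
 have I: "I k t - I k s = (LINT x:{cl s<..cl t}|lborel. k x)" if "integrable lborel k" "s <= t" for k s t
  using set_integral_Ioc_split[OF that(1), of a "cl s" "cl t"] cl that(2) by (simp add: I_def)
 define w where "w x = (u (cl x) - u a) + I g x" for x
 have wd: "\<bar>u (cl t) - u (cl s)\<bar> <= I g t - I g s" if "s <= t" for s t using u[of "cl s" "cl t"] cl that I[OF g(1) that] by simp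
 have mw: "mono w"
 proof (rule monoI)
  fix s t :: real assume "s <= t"
  thus "w s <= w t" using wd[of s t] by (simp add: w_def abs_le_iff)
 qed
 have "\<exists>h. integrable lborel h & (\<forall>x. 0 <= h x) & (\<forall>s t. s <= t --> w t - w s = (LINT x:{s<..t}|lborel. h x))"
 proof (rule mono_absolutely_continuous_density[OF mw])
  fix x
  have "w a = 0" using ab by (simp add: w_def I_def cl_def set_lebesgue_integral_def)
  have wcl: "w x = w (cl x)" for x using clid[OF cl(1) cl(2), of x] by (simp add: w_def I_def)
  show "0 <= w x" using monoD[OF mw, of a "cl x"] cl(1)[of x] \<open>w a = 0\<close> wcl[of x] by simp
  show "w x <= w b" using monoD[OF mw, of "cl x" b] cl(2)[of x] wcl[of x] by simp
 next
  fix e :: real assume "0 < e"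
  hence "0 < e / 2" by simp
  from LIMSEQ_D[OF integral_excess_tendsto_zero[OF g] this]
  obtain n where n: "(LINT x|lborel. max 0 (g x - real n)) < e / 2" by (auto simp: abs_less_iff)
  define k where "k x = max 0 (g x - real n)" for x
  have k: "integrable lborel k" "!!x. 0 <= k x" unfolding k_def using g(2)
   by (auto intro!: Bochner_Integration.integrable_bound[OF g(1)] AE_I2)
  show "\<exists>P n. mono P & (\<forall>x. 0 <= P x & P x <= e) & (\<forall>s t. s <= t --> w t - w s <= P t - P s + real n * (t - s))"
  proof (intro exI conjI allI impI)
   \<comment> \<open>An increment of \<open>w\<close> is at most twice the integral of
     \<open>g\<close>, hence the factor 2 before the excess \<open>k\<close> and before
     \<open>n\<close>.\<close>
   show "mono (%x. 2 * I k x)"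
   proof (rule monoI)
    fix x y :: real assume "x <= y"
    thus "2 * I k x <= 2 * I k y"
     using I[OF k(1) \<open>x <= y\<close>] set_integral_Ioc_nonneg[of k "cl x" "cl y", OF k(2)] by linarith
   qed
   show "0 <= 2 * I k x" for x using set_integral_Ioc_nonneg[of k, OF k(2)] by (simp add: I_def)
   show "2 * I k x <= e" for x using set_integral_Ioc_le[OF k, of a "cl x"] n by (simp add: I_def k_def)
   show "w t - w s <= 2 * I k t - 2 * I k s + real (2 * n) * (t - s)" if "s <= t" for s t
   proof -
    have c: "cl s <= cl t" "cl t - cl s <= t - s" using cl that by auto
    have sc: "set_integrable lborel {cl s<..cl t} (%x. q :: real)" for q
     using c unfolding set_integrable_def by (intro integrable_scaleR_left integrable_real_indicator) auto
    have LC: "(LINT x:{cl s<..cl t}|lborel. q) = q * (cl t - cl s)" for q :: real using c unfolding set_lebesgue_integral_def by simp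
    have "(LINT x:{cl s<..cl t}|lborel. g x) <= (LINT x:{cl s<..cl t}|lborel. real n + k x)"
     by (intro set_integral_mono set_integral_add set_integrable_Ioc sc k g) (auto simp: k_def)
    also have "... = real n * (cl t - cl s) + (LINT x:{cl s<..cl t}|lborel. k x)"
     by (subst set_integral_add(2)) (auto intro!: set_integrable_Ioc sc k simp: LC)
    also have "... <= real n * (t - s) + (I k t - I k s)" unfolding I[OF k(1) that] using c by (intro add_mono mult_left_mono) auto
    finally have "I g t - I g s <= real n * (t - s) + (I k t - I k s)" using I[OF g(1) that] by simp
    moreover have "w t - w s <= 2 * (I g t - I g s)" using wd[OF that] by (simp add: w_def abs_le_iff)
    ultimately show ?thesis by (simp add: algebra_simps)
   qed
  qed
 qed
 then obtain h where h: "integrable lborel h" "!!s t. s <= t ==> w t - w s = (LINT x:{s<..t}|lborel. h x)"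
  by (elim exE conjE) blast
 have "u t - u s = (LINT x:{s<..t}|lborel. h x - g x)" if "a <= s" "s <= t" "t <= b" for s t
 proof -
  have "w t - w s = (u t - u s) + (LINT x:{s<..t}|lborel. g x)" using I[OF g(1) that(2)] that by (simp add: w_def clid)
  thus ?thesis by (simp add: set_integral_diff set_integrable_Ioc g h(1) h(2)[OF that(2), symmetric])
 qed
 thus ?thesis using h(1) g(1) by (intro exI[of _ "%x. h x - g x"]) auto
qed

lemma sum_dyadic_split: "(\<Sum>i<k. f (2 * i) + f (Suc (2 * i))) = (\<Sum>j<2 * k. f j :: 'a :: comm_monoid_add)"
 by (induction k) (auto simp: ac_simps)

text \<open>\<open>c\<close> plays the role of an asymmetric distance along a curve that is only defined at dyadic
 times; its total variation \<open>V\<close> is absolutely continuous because of \<open>le_pen_add_linear\<close>.\<close>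

lemma finite_energy_density:
 fixes c :: "real => real => real"
 assumes p: "1 < p"
  and c: "!!s t. 0 <= c s t" "!!s. c s s = 0" "!!r s t. c r t <= c r s + c s t"
  and E: "!!M. (\<Sum>i<2 ^ M. pen p (c (real i / 2 ^ M) (real (Suc i) / 2 ^ M)) (1 / 2 ^ M)) <= E"
 shows "\<exists>g. integrable lborel g & (\<forall>x. 0 <= g x) &
  (\<forall>M i j. i <= j & j <= 2 ^ M --> c (real i / 2 ^ M) (real j / 2 ^ M) <= (LINT x:{real i / 2 ^ M<..real j / 2 ^ M}|lborel. g x))"
proof -
 \<comment> \<open>The number of complete dyadic cells of level \<open>M\<close> up to the clamped
   time \<open>t\<close>; the sums \<open>S f M t\<close> below run over these cells.\<close>
 define k where "k M t = nat \<lfloor>max 0 (min 1 t) * 2 ^ M\<rfloor>" for M :: nat and t :: real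
 define cM where "cM M i = c (real i / 2 ^ M) (real (Suc i) / 2 ^ M)" for M i
 define eM where "eM M i = pen p (cM M i) (1 / 2 ^ M)" for M i
 have k_real: "real (k M t) <= max 0 (min 1 t) * 2 ^ M" "max 0 (min 1 t) * 2 ^ M < real (k M t) + 1" for M t
  using floor_correct[of "max 0 (min 1 t) * 2 ^ M"] by (auto simp: k_def)
 have k_dyadic: "k M (real i / 2 ^ N) = i * 2 ^ (M - N)" if "N <= M" "i <= 2 ^ N" for M N i
 proof -
  have "real i <= 2 ^ N" using that(2) by (metis of_nat_le_iff of_nat_numeral of_nat_power)
  hence "real i / 2 ^ N <= 1" "0 <= real i / 2 ^ N" by auto
  hence "max 0 (min 1 (real i / 2 ^ N)) * 2 ^ M = real i / 2 ^ N * 2 ^ M" by (simp only: min_absorb2 max_absorb2)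
  also have "... = real (i * 2 ^ (M - N))" using that(1) by (simp add: power_diff[of "2 :: real"])
  finally show ?thesis unfolding k_def by (simp only: floor_of_nat nat_int)
 qed
 have k_mono: "k M s <= k M t" if "s <= t" for M s t unfolding k_def using that by (intro nat_mono floor_mono mult_right_mono) auto
 have k1: "k M 1 = 2 ^ M" for M using k_dyadic[of 0 M 1] by simp
 have k_le: "k M t <= 2 ^ M" for M t
 proof -
  have "k M t = k M (min 1 t)" by (simp add: k_def)
  also have "... <= k M 1" by (rule k_mono) simp
  finally show ?thesis unfolding k1 .
 qed
 have k_Suc: "2 * k M t <= k (Suc M) t" for M t
 proof -
  have "real_of_int (2 * \<lfloor>max 0 (min 1 t) * 2 ^ M\<rfloor>) <= max 0 (min 1 t) * 2 ^ Suc M"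
   using floor_correct[of "max 0 (min 1 t) * 2 ^ M"] by simp
  hence "2 * \<lfloor>max 0 (min 1 t) * 2 ^ M\<rfloor> <= \<lfloor>max 0 (min 1 t) * 2 ^ Suc M\<rfloor>" by (simp only: le_floor_iff)
  thus ?thesis unfolding k_def by linarith
 qed
 define S where "S f M t = (\<Sum>i<k M t. f M i)" for f :: "nat => nat => real" and M t
 have S_Suc: "S f M t <= S f (Suc M) t"
  if "!!M i. 0 <= f M i" "!!M i. f M i <= f (Suc M) (2 * i) + f (Suc M) (Suc (2 * i))" for f M t
 proof -
  have "S f M t <= (\<Sum>i<k M t. f (Suc M) (2 * i) + f (Suc M) (Suc (2 * i)))" unfolding S_def by (intro sum_mono that)
  also have "... = (\<Sum>j<2 * k M t. f (Suc M) j)" by (rule sum_dyadic_split)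
  also have "... <= S f (Suc M) t" unfolding S_def using k_Suc that(1) by (intro sum_mono2) auto
  finally show ?thesis .
 qed
 have cM: "0 <= cM M i" "cM M i <= cM (Suc M) (2 * i) + cM (Suc M) (Suc (2 * i))" for M i
 proof -
  have "real (2 * i) / 2 ^ Suc M = real i / 2 ^ M" "real (Suc (Suc (2 * i))) / 2 ^ Suc M = real (Suc i) / 2 ^ M" by (auto simp: field_simps)
  thus "cM M i <= cM (Suc M) (2 * i) + cM (Suc M) (Suc (2 * i))"
   unfolding cM_def using c(3)[of "real i / 2 ^ M" "real (Suc i) / 2 ^ M" "real (Suc (2 * i)) / 2 ^ Suc M"] by simp
 qed (simp add: cM_def c)
 have eM: "0 <= eM M i" "eM M i <= eM (Suc M) (2 * i) + eM (Suc M) (Suc (2 * i))" for M i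
 proof -
  have "eM M i <= pen p (cM (Suc M) (2 * i) + cM (Suc M) (Suc (2 * i))) (1 / 2 ^ M)" unfolding eM_def using p by (intro pen_mono cM) auto
  also have "(1 / 2 ^ M :: real) = 1 / 2 ^ Suc M + 1 / 2 ^ Suc M" by simp
  also have "pen p (cM (Suc M) (2 * i) + cM (Suc M) (Suc (2 * i))) ... <= eM (Suc M) (2 * i) + eM (Suc M) (Suc (2 * i))"
   unfolding eM_def using p by (intro pen_add_le cM) auto
  finally show "eM M i <= eM (Suc M) (2 * i) + eM (Suc M) (Suc (2 * i))" .
 qed (simp add: eM_def pen_nonneg)
 have S_diff: "S f M t - S f M s = (\<Sum>i\<in>{k M s..<k M t}. f M i)" if "s <= t" for f M s t
  unfolding S_def lessThan_atLeast0 using sum_diff_nat_ivl[of 0 "k M s" "k M t" "f M"] k_mono[OF that] by simp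
 have E0: "0 <= E" using E[of 0] pen_nonneg by (metis (no_types, lifting) order_trans sum_nonneg)
 have S_e: "S eM M t <= E" for M t
 proof -
  have "S eM M t <= (\<Sum>i<2 ^ M. eM M i)" unfolding S_def using k_le eM(1) by (intro sum_mono2) auto
  also have "... <= E" using E[of M] unfolding eM_def cM_def .
  finally show ?thesis .
 qed
 \<comment> \<open>\<open>le_pen_add_linear\<close> in each cell. The term \<open>1 / 2 ^ M\<close>
   comes from rounding \<open>s\<close> and \<open>t\<close> to the grid and vanishes in the
   limit.\<close>
 have S_cd: "S cM M t - S cM M s <= K powr (1 - p) * (S eM M t - S eM M s) + K * (t - s + 1 / 2 ^ M)"
  if "s <= t" "0 < K" for M s t K
 proof -
  have "S cM M t - S cM M s <= (\<Sum>i\<in>{k M s..<k M t}. K powr (1 - p) * eM M i + K * (1 / 2 ^ M))"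
   unfolding S_diff[OF that(1)] eM_def using p that by (intro sum_mono le_pen_add_linear cM) auto
  also have "... = K powr (1 - p) * (S eM M t - S eM M s) + K * (real (k M t - k M s) / 2 ^ M)"
   unfolding S_diff[OF that(1)] by (simp add: sum.distrib sum_distrib_left)
  also have "real (k M t - k M s) / 2 ^ M <= t - s + 1 / 2 ^ M"
  proof -
   have "real (k M t - k M s) = real (k M t) - real (k M s)" using k_mono[OF that(1)] by simp
   also have "... <= (max 0 (min 1 t) - max 0 (min 1 s)) * 2 ^ M + 1"
    using k_real(1)[of M t] k_real(2)[where M=M and t=s] by (simp add: left_diff_distrib)
   also have "... <= (t - s) * 2 ^ M + 1" using that by (intro add_mono mult_right_mono) auto
   finally show ?thesis by (simp add: field_simps)
  qed
  finally show ?thesis using that by (auto simp: mult_left_mono)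
 qed
 have S0: "S f M 0 = 0" and S_cl: "S f M (min 1 t) = S f M t" "t <= 0 ==> S f M t = 0" for f M t by (auto simp: S_def k_def)
 have S_c: "S cM M t <= E + 2" for M t
 proof (cases "0 <= t")
  case True
  have "S cM M (min 1 t) - S cM M 0 <= (S eM M (min 1 t) - S eM M 0) + (min 1 t - 0 + 1 / 2 ^ M)" using S_cd[of 0 "min 1 t" 1 M] True by simp
  also have "... <= E + (1 + 1)" using S_e[of M t] by (intro add_mono) (auto simp: S0 S_cl)
  finally show ?thesis by (simp add: S0 S_cl)
 qed (use E0 S_cl in simp)
 have conv: "\<exists>V. \<forall>t. (%M. S f M t) \<longlonglongrightarrow> V t & (\<forall>M. S f M t <= V t)"
  if f: "!!M i. 0 <= f M i" "!!M i. f M i <= f (Suc M) (2 * i) + f (Suc M) (Suc (2 * i))" "!!M t. S f M t <= B" for f B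
 proof -
  have "incseq (%M. S f M t)" for t by (intro incseq_SucI S_Suc f)
  hence "\<exists>L. (%M. S f M t) \<longlonglongrightarrow> L & (\<forall>M. S f M t <= L)" for t
   using incseq_convergent[of "%M. S f M t" B] f(3) by metis
  thus ?thesis by metis
 qed
 \<comment> \<open>\<open>V t\<close> is the forward variation of \<open>c\<close> along dyadic
   points up to \<open>t\<close>, and \<open>P t\<close> below is the energy up to
   \<open>t\<close>.\<close>
 obtain V where V: "!!t. (%M. S cM M t) \<longlonglongrightarrow> V t" "!!M t. S cM M t <= V t" using conv[of cM, OF cM S_c] by blast
 obtain P where P: "!!t. (%M. S eM M t) \<longlonglongrightarrow> P t" "!!M t. S eM M t <= P t" using conv[of eM, OF eM S_e] by blast
 have S_mono: "S f M s <= S f M t" if "s <= t" "!!M i. 0 <= f M i" for f M s t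
  using S_diff[OF that(1), of f M] that(2) by (smt (verit) sum_nonneg)
 have Vm: "mono V" and Pm: "mono P" using S_mono cM(1) eM(1) by (auto intro!: monoI LIMSEQ_le[OF V(1) V(1)] LIMSEQ_le[OF P(1) P(1)])
 have S_nonneg: "0 <= S f M t" if "!!M i. 0 <= f M i" for f M t unfolding S_def using that by (intro sum_nonneg)
 have Vb: "0 <= V t" "V t <= E + 2" for t
 proof -
  show "0 <= V t" by (rule order_trans[OF S_nonneg[of cM 0 t, OF cM(1)] V(2)])
  show "V t <= E + 2" by (rule LIMSEQ_le_const2[OF V(1)]) (use S_c in auto)
 qed
 have Pb: "0 <= P t" "P t <= E" for t
 proof -
  show "0 <= P t" by (rule order_trans[OF S_nonneg[of eM 0 t, OF eM(1)] P(2)])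
  show "P t <= E" by (rule LIMSEQ_le_const2[OF P(1)]) (use S_e in auto)
 qed
 have VP: "V t - V s <= K powr (1 - p) * (P t - P s) + K * (t - s)" if "s <= t" "0 < K" for s t K
 proof (rule LIMSEQ_le)
  show "(%M. S cM M t - S cM M s) \<longlonglongrightarrow> V t - V s" by (intro tendsto_diff V)
  have "(%M. K powr (1 - p) * (S eM M t - S eM M s) + K * (t - s + (1 / 2) ^ M))
   \<longlonglongrightarrow> K powr (1 - p) * (P t - P s) + K * (t - s + 0)" by (intro tendsto_intros P LIMSEQ_realpow_zero) auto
  thus "(%M. K powr (1 - p) * (S eM M t - S eM M s) + K * (t - s + 1 / 2 ^ M))
   \<longlonglongrightarrow> K powr (1 - p) * (P t - P s) + K * (t - s)" by (simp add: power_one_over)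
 qed (use S_cd that in auto)
 have "\<exists>h. integrable lborel h & (\<forall>x. 0 <= h x) & (\<forall>s t. s <= t --> V t - V s = (LINT x:{s<..t}|lborel. h x))"
 proof (rule mono_absolutely_continuous_density[OF Vm Vb])
  fix e :: real assume e: "0 < e"
  \<comment> \<open>With \<open>K = n\<close> the energy part \<open>n powr (1 - p) * P\<close> is
    below \<open>e\<close> for large \<open>n\<close>: the criterion of absolute continuity for
    \<open>V\<close>.\<close>
  have "(%n. real n powr (1 - p) * E) \<longlonglongrightarrow> 0 * E"
   using p by (intro tendsto_intros tendsto_neg_powr filterlim_real_sequentially) auto
  hence "\<forall>\<^sub>F n in sequentially. real n powr (1 - p) * E < e" using e by (auto dest: order_tendstoD(2))
  hence "\<forall>\<^sub>F n in sequentially. real n powr (1 - p) * E < e & 0 < n" using eventually_gt_at_top by (rule eventually_conj)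
  then obtain n :: nat where n: "real n powr (1 - p) * E < e" "0 < n" using eventually_happens'[OF sequentially_bot] by blast
  show "\<exists>P n. mono P & (\<forall>x. 0 <= P x & P x <= e) & (\<forall>s t. s <= t --> V t - V s <= P t - P s + real n * (t - s))"
  proof (intro exI conjI allI impI)
   show "mono (%x. real n powr (1 - p) * P x)" by (rule monoI) (intro mult_left_mono monoD[OF Pm]; simp)
   show "0 <= real n powr (1 - p) * P x" for x using Pb by simp
   have "real n powr (1 - p) * P x <= real n powr (1 - p) * E" for x using Pb by (intro mult_left_mono) auto
   thus "real n powr (1 - p) * P x <= e" for x using n(1) by (meson less_imp_le order_trans)
   show "V t - V s <= real n powr (1 - p) * P t - real n powr (1 - p) * P s + real n * (t - s)" if "s <= t" for s t
    using VP[OF that, of "real n"] n(2) by (simp add: right_diff_distrib)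
  qed
 qed
 then obtain h where h: "integrable lborel h" "\<forall>x. 0 <= h x" "!!s t. s <= t ==> V t - V s = (LINT x:{s<..t}|lborel. h x)"
  by (elim exE conjE) blast
 have "c (real i / 2 ^ N) (real j / 2 ^ N) <= (LINT x:{real i / 2 ^ N<..real j / 2 ^ N}|lborel. h x)"
  if ij: "i <= j" "j <= 2 ^ N" for N i j
 proof -
  have chain: "c (real a / 2 ^ M) (real b / 2 ^ M) <= (\<Sum>i\<in>{a..<b}. cM M i)" if "a <= b" for a b M using that
  proof (induction b rule: dec_induct)
   case base
   thus ?case using c(2) by simp
  next
   case (step n)
   thus ?case using c(3)[of "real a / 2 ^ M" "real (Suc n) / 2 ^ M" "real n / 2 ^ M"] by (simp add: cM_def)
  qed
  let ?s = "real i / 2 ^ N" and ?t = "real j / 2 ^ N"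
  have st: "?s <= ?t" using ij by (simp add: divide_right_mono)
  have "c ?s ?t <= S cM M ?t - S cM M ?s" if M: "N <= M" for M
  proof -
   have "real (k M ?s) / 2 ^ M = ?s" "real (k M ?t) / 2 ^ M = ?t" using k_dyadic[OF M] ij M by (auto simp: power_diff[of "2 :: real"])
   thus ?thesis unfolding S_diff[OF st] using chain[of "k M ?s" "k M ?t" M] k_mono[OF st] by simp
  qed
  hence "c ?s ?t <= V ?t - V ?s" by (intro LIMSEQ_le_const[OF tendsto_diff[OF V(1) V(1)]]) auto
  thus ?thesis using h(3)[OF st] by simp
 qed
 thus ?thesis using h(1,2) by blast
qed

section \<open>Limits of discrete processes\<close>

text \<open>Half-open, because cylinders are realised by intervals \<open>{L a..<L a + l a}\<close>
  that must partition the space.\<close>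

definition unit_measure :: "real measure" where
 "unit_measure = uniform_measure lborel {0..<1}"

lemma prob_space_unit_measure: "prob_space unit_measure" unfolding unit_measure_def by (intro prob_space_uniform_measure) auto

lemma sets_unit_measure [measurable_cong, simp]: "sets unit_measure = sets borel" by (simp add: unit_measure_def)

lemma space_unit_measure [simp]: "space unit_measure = UNIV" by (simp add: unit_measure_def)

lemma emeasure_unit_measure: "A \<in> sets borel ==> emeasure unit_measure A = emeasure lborel ({0..<1} \<inter> A)"
 by (simp add: unit_measure_def divide_ennreal_def)

lemma map_upt_eq_iff: "map f [0..<n] = a \<longleftrightarrow> length a = n & (\<forall>k<n. f k = a ! k)" by (auto simp: list_eq_iff_nth_eq)

text \<open>A consistent family of cylinder weights is realised by nested intervals of \<open>[0, 1)\<close>: the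
 cylinder over \<open>a\<close> corresponds to an interval of length \<open>l a\<close>.\<close>

lemma consistent_weights_realisation:
 fixes l :: "nat list => real"
 assumes l0: "l [] = 1" and nonneg: "!!a. 0 <= l a" and sums: "!!a. (%j. l (a @ [j])) sums l a"
 shows "\<exists>X. (\<forall>k. X k \<in> borel \<rightarrow>\<^sub>M count_space UNIV) &
  (\<forall>a. emeasure unit_measure {u. map (%k. X k u) [0..<length a] = a} = ennreal (l a))"
proof -
 \<comment> \<open>The left end of the interval of \<open>a\<close>: the total weight of the
   cylinders that branch off to the left of \<open>a\<close>, ordered by the first index at which
   they differ.\<close>
 define L where "L a = (\<Sum>k<length a. \<Sum>i<a ! k. l (take k a @ [i]))" for a
 have L_snoc: "L (a @ [j]) = L a + (\<Sum>i<j. l (a @ [i]))" for a j by (auto simp: L_def nth_append intro!: sum.cong)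
 \<comment> \<open>The index of the child interval of \<open>a\<close> that contains
   \<open>u\<close>; iterating it, \<open>A u n\<close> is the address of \<open>u\<close> at depth
   \<open>n\<close>.\<close>
 define nxt where "nxt u a = (LEAST j. u < L a + (\<Sum>i\<le>j. l (a @ [i])))" for u a
 define A where "A u n = rec_nat [] (%_ a. a @ [nxt u a]) n" for u n
 have A_simps: "A u 0 = []" "A u (Suc n) = A u n @ [nxt u (A u n)]" for u n by (auto simp: A_def)
 have A_len: "length (A u n) = n" for u n by (induction n) (auto simp: A_simps)
 have A_nth: "A u n ! k = A u (Suc k) ! k" if "k < n" for u n k using that by (induction n) (auto simp: A_simps nth_append A_len less_Suc_eq)
 have partial: "(\<Sum>i<j. l (a @ [i])) <= l a" for a j
  using sum_le_suminf[of "%j. l (a @ [j])" "{..<j}"] sums[of a] nonneg by (auto simp: sums_iff)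
 have in_cell: "L (A u n) <= u & u < L (A u n) + l (A u n)" if u: "0 <= u" "u < 1" for u n
 proof (induction n)
  case 0
  thus ?case using u by (simp add: A_simps L_def l0)
 next
  case (Suc n)
  let ?a = "A u n"
  let ?P = "%j. u < L ?a + (\<Sum>i\<le>j. l (?a @ [i]))"
  have "(%j. L ?a + (\<Sum>i\<le>j. l (?a @ [i]))) \<longlonglongrightarrow> L ?a + l ?a"
   using sums[of ?a] unfolding sums_def_le by (intro tendsto_intros)
  hence "\<forall>\<^sub>F j in sequentially. ?P j" using Suc by (intro order_tendstoD) auto
  then obtain j where "?P j" using eventually_happens'[OF sequentially_bot] by blast
  hence P: "?P (nxt u ?a)" unfolding nxt_def by (rule LeastI)
  moreover have "L ?a + (\<Sum>i<nxt u ?a. l (?a @ [i])) <= u"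
  proof (cases "nxt u ?a")
   case 0 thus ?thesis using Suc by simp
  next
   case (Suc j)
   hence "\<not> ?P j" using not_less_Least[of j ?P] by (simp add: nxt_def)
   thus ?thesis using Suc by (simp add: lessThan_Suc_atMost)
  qed
  ultimately show ?case by (simp add: A_simps L_snoc lessThan_Suc_atMost[symmetric])
 qed
 have unique: "A u (length a) = a" if "L a <= u" "u < L a + l a" for u a using that
 proof (induction a rule: rev_induct)
  case Nil thus ?case by (simp add: A_simps)
 next
  case (snoc j a)
  have b1: "0 <= (\<Sum>i<j. l (a @ [i]))" using nonneg by (intro sum_nonneg)
  have b2: "(\<Sum>i<j. l (a @ [i])) + l (a @ [j]) <= l a" using partial[of a "Suc j"] by simp
  have A: "A u (length a) = a" using snoc b1 b2 by (intro snoc.IH) (auto simp: L_snoc)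
  have "nxt u a = j" unfolding nxt_def
  proof (rule Least_equality)
   show "u < L a + (\<Sum>i\<le>j. l (a @ [i]))" using snoc by (simp add: L_snoc lessThan_Suc_atMost[symmetric])
   fix j' assume j': "u < L a + (\<Sum>i\<le>j'. l (a @ [i]))"
   show "j <= j'"
   proof (rule ccontr)
    assume "\<not> j <= j'"
    hence "(\<Sum>i\<le>j'. l (a @ [i])) <= (\<Sum>i<j. l (a @ [i]))" using nonneg by (intro sum_mono2) auto
    thus False using j' snoc.prems by (simp add: L_snoc)
   qed
  qed
  thus ?case by (simp add: A_simps A)
 qed
 have L_bounds: "0 <= L a" "L a + l a <= 1" for a
 proof -
  show "0 <= L a" unfolding L_def using nonneg by (intro sum_nonneg)
  show "L a + l a <= 1"
  proof (induction a rule: rev_induct)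
   case Nil thus ?case by (simp add: L_def l0)
  next
   case (snoc j a)
   thus ?case using partial[of a "Suc j"] by (simp add: L_snoc)
  qed
 qed
 have cell: "{u \<in> {0..<1}. A u (length a) = a} = {L a..<L a + l a}" for a
 proof (intro set_eqI iffI)
  fix u assume "u \<in> {u \<in> {0..<1}. A u (length a) = a}"
  thus "u \<in> {L a..<L a + l a}" using in_cell[of u "length a"] by auto
 next
  fix u assume "u \<in> {L a..<L a + l a}"
  hence u: "L a <= u" "u < L a + l a" by auto
  have "0 <= u" using u(1) L_bounds(1)[of a] by linarith
  moreover have "u < 1" using u(2) L_bounds(2)[of a] by linarith
  moreover have "A u (length a) = a" by (rule unique[OF u])
  ultimately show "u \<in> {u \<in> {0..<1}. A u (length a) = a}" by simp
 qed
 \<comment> \<open>Outside \<open>[0, 1)\<close>, a null set of \<open>unit_measure\<close>, the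
   value 0 is a dummy.\<close>
 define X where "X k u = (if 0 <= u & u < 1 then A u (Suc k) ! k else 0)" for k u
 have X_map: "map (%k. X k u) [0..<n] = A u n" if "0 <= u" "u < 1" for u n
 proof (rule nth_equalityI)
  fix i assume "i < length (map (%k. X k u) [0..<n])"
  hence "i < n" by simp
  thus "map (%k. X k u) [0..<n] ! i = A u n ! i" using A_nth[of i n u] that by (simp add: X_def)
 qed (simp add: A_len)
 have "X k \<in> borel \<rightarrow>\<^sub>M count_space UNIV" for k
 proof -
  have "{u. X k u = j} \<in> sets borel" for j
  proof -
   have eq: "{u. X k u = j} = (\<Union>a\<in>{a. length a = Suc k & a ! k = j}. {u \<in> {0..<1}. A u (length a) = a})
     \<union> (if j = 0 then - {0..<1} else {})" using A_len by (auto simp: X_def split: if_splits)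
   have "(\<Union>a\<in>{a. length a = Suc k & a ! k = j}. {u \<in> {0..<1}. A u (length a) = a}) \<in> sets borel"
    unfolding cell by (rule sets.countable_UN'') auto
   thus ?thesis unfolding eq by (intro sets.Un) auto
  qed
  thus ?thesis by (subst measurable_count_space_eq2_countable) (auto simp: vimage_def)
 qed
 moreover have "emeasure unit_measure {u. map (%k. X k u) [0..<length a] = a} = ennreal (l a)" for a
 proof -
  have "{0..<1} \<inter> {u. map (%k. X k u) [0..<length a] = a} = {L a..<L a + l a}" unfolding cell[symmetric] by (auto simp: X_map)
  moreover have "{u. map (%k. X k u) [0..<length a] = a} \<in> sets borel"
  proof -
   have "{u. map (%k. X k u) [0..<length a] = a} = (\<Inter>k<length a. {u. X k u = a ! k})" by (auto simp: map_upt_eq_iff)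
   also have "... \<in> sets borel"
   proof (cases "length a = 0")
    case False
    have "{u. X k u = j} \<in> sets borel" for k j
     using measurable_sets[OF \<open>X k \<in> borel \<rightarrow>\<^sub>M count_space UNIV\<close>, of "{j}"] by (simp add: vimage_def)
    thus ?thesis using False by (intro sets.finite_INT) auto
   qed simp
   finally show ?thesis .
  qed
  ultimately show ?thesis using nonneg[of a] by (simp add: emeasure_unit_measure)
 qed
 ultimately show ?thesis by blast
qed

lemma nn_integral_countable_valued:
 fixes X :: "'a => 'b" and \<psi> :: "'b => ennreal"
 assumes "countable (UNIV :: 'b set)" "!!b. {x \<in> space M. X x = b} \<in> sets M"
 shows "(\<integral>\<^sup>+x. \<psi> (X x) \<partial>M) = (\<integral>\<^sup>+b. \<psi> b * emeasure M {x \<in> space M. X x = b} \<partial>count_space UNIV)"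
proof -
 have "(\<integral>\<^sup>+x. \<psi> (X x) \<partial>M) = (\<integral>\<^sup>+x. (\<integral>\<^sup>+b. \<psi> b * indicator {x \<in> space M. X x = b} x \<partial>count_space UNIV) \<partial>M)"
 proof (rule nn_integral_cong)
  fix x assume x: "x \<in> space M"
  have "(\<integral>\<^sup>+b. \<psi> b * indicator {x \<in> space M. X x = b} x \<partial>count_space UNIV) = (\<integral>\<^sup>+b. \<psi> b * indicator {X x} b \<partial>count_space UNIV)"
   using x by (intro nn_integral_cong) (auto split: split_indicator)
  thus "\<psi> (X x) = (\<integral>\<^sup>+b. \<psi> b * indicator {x \<in> space M. X x = b} x \<partial>count_space UNIV)" by simp
 qed
 also have "... = (\<integral>\<^sup>+b. \<integral>\<^sup>+x. \<psi> b * indicator {x \<in> space M. X x = b} x \<partial>M \<partial>count_space UNIV)"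
  using assms by (intro nn_integral_count_space_nn_integral) auto
 also have "... = (\<integral>\<^sup>+b. \<psi> b * emeasure M {x \<in> space M. X x = b} \<partial>count_space UNIV)"
  using assms(2) by (intro nn_integral_cong nn_integral_cmult_indicator)
 finally show ?thesis .
qed

text \<open>A diagonal sequence makes all cylinder probabilities converge. Their limits are
  consistent because the eventually constant law of each coordinate forbids escape of mass. Fatou's
  lemma for the counting measure on lists then treats arbitrary nonnegative functions of finitely
  many coordinates.\<close>

theorem discrete_processes_subsequence_limit:
 fixes q :: "nat => (nat => nat) pmf"
 assumes const: "!!k. \<exists>\<rho>. \<forall>\<^sub>F N in sequentially. map_pmf (%\<omega>. \<omega> k) (q N) = \<rho>"
 shows "\<exists>r X. strict_mono (r :: nat => nat) & (\<forall>k. X k \<in> borel \<rightarrow>\<^sub>M count_space UNIV) &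
  (\<forall>n (\<psi> :: nat list => ennreal). (\<integral>\<^sup>+u. \<psi> (map (%k. X k u) [0..<n]) \<partial>unit_measure)
    <= liminf (%N. \<integral>\<^sup>+\<omega>. \<psi> (map \<omega> [0..<n]) \<partial>measure_pmf (q (r N))))"
proof -
 define pr where "pr N a = measure_pmf.prob (q N) {\<omega>. map \<omega> [0..<length a] = a}" for N a
 obtain r where r: "strict_mono r" "!!a. \<exists>l. (%N. pr (r N) a) \<longlonglongrightarrow> l"
 proof -
  define P where "P n s \<longleftrightarrow> convergent (%N. pr (s N) (from_nat n))" for n and s :: "nat => nat"
  interpret subseqs P
  proof
   fix n and s :: "nat => nat"
   have "\<forall>N. pr (s N) (from_nat n) \<in> {0..1}" by (auto simp: pr_def)
   then obtain L r' where "strict_mono r'" "((%N. pr (s N) (from_nat n)) \<circ> r') \<longlonglongrightarrow> L"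
    using compact_Icc[of 0 "1 :: real"] unfolding compact_def by meson
   thus "\<exists>r'. strict_mono r' & P n (s \<circ> r')" by (intro exI[of _ r']) (auto simp: P_def convergent_def o_def)
  qed
  have "P k (diagseq \<circ> (+) (Suc k))" for k
  proof (rule diagseq_holds)
   show "P n (s \<circ> r)" if "strict_mono r" "P n s" for r s n
    using that convergent_subseq_convergent[of "%N. pr (s N) (from_nat n)" r] by (simp add: P_def o_def)
  qed
  note holds = this
  have *: "convergent (%N. pr (diagseq (N + Suc (to_nat a))) a)" for a
  proof -
   have "convergent (%N. pr (diagseq (Suc (to_nat a) + N)) (from_nat (to_nat a)))" using holds[of "to_nat a"] unfolding P_def o_def .
   thus ?thesis by (simp only: from_nat_to_nat add.commute)
  qed
  have "convergent (%N. pr (diagseq N) a)" for a using * convergent_ignore_initial_segment[of "%N. pr (diagseq N) a"] by blast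
  thus ?thesis using that[of diagseq] subseq_diagseq unfolding convergent_def by blast
 qed
 then obtain l where l: "!!a. (%N. pr (r N) a) \<longlonglongrightarrow> l a" by metis
 have l0: "l [] = 1" using l[of "[]"] by (simp add: pr_def LIMSEQ_const_iff)
 have nonneg: "0 <= l a" for a by (rule LIMSEQ_le_const[OF l]) (auto simp: pr_def)
 have cyl: "{\<omega>. map \<omega> [0..<length (a @ [j])] = a @ [j]} = {\<omega>. map \<omega> [0..<length a] = a} \<inter> {\<omega>. \<omega> (length a) = j}" for a j
  by auto
 have "(%j. l (a @ [j])) sums l a" for a
 proof -
  let ?C = "{\<omega>. map \<omega> [0..<length a] = a}"
  obtain \<rho> where \<rho>: "\<forall>\<^sub>F N in sequentially. map_pmf (%\<omega>. \<omega> (length a)) (q N) = \<rho>" using const by blast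
  have part: "(\<Sum>j<J. pr N (a @ [j])) = measure_pmf.prob (q N) (?C \<inter> {\<omega>. \<omega> (length a) < J})" for N J
  proof -
   have "(\<Sum>j<J. pr N (a @ [j])) = measure_pmf.prob (q N) (\<Union>j<J. ?C \<inter> {\<omega>. \<omega> (length a) = j})"
    unfolding pr_def cyl by (intro measure_pmf.finite_measure_finite_Union[symmetric]) (auto simp: disjoint_family_on_def)
   also have "(\<Union>j<J. ?C \<inter> {\<omega>. \<omega> (length a) = j}) = ?C \<inter> {\<omega>. \<omega> (length a) < J}" by auto
   finally show ?thesis .
  qed
  have up: "(\<Sum>j<J. l (a @ [j])) <= l a" for J
  proof (rule LIMSEQ_le[OF tendsto_sum[OF l] l])
   show "\<exists>N. \<forall>n\<ge>N. (\<Sum>j<J. pr (r n) (a @ [j])) <= pr (r n) a"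
    unfolding part by (auto simp: pr_def intro!: measure_pmf.finite_measure_mono)
  qed
  \<comment> \<open>Truncating the next coordinate at \<open>J\<close> loses at most its probability
    of lying in \<open>{J..}\<close>, which under the fixed law \<open>\<rho>\<close> does not
    depend on \<open>N\<close>.\<close>
  have low: "l a - measure_pmf.prob \<rho> {J..} <= (\<Sum>j<J. l (a @ [j]))" for J
  proof (rule LIMSEQ_le[OF tendsto_diff[OF l tendsto_const] tendsto_sum[OF l]])
   have "\<forall>\<^sub>F N in sequentially. map_pmf (%\<omega>. \<omega> (length a)) (q (r N)) = \<rho>"
    by (rule eventually_subseq[OF r(1) \<rho>])
   hence "\<forall>\<^sub>F N in sequentially. pr (r N) a - measure_pmf.prob \<rho> {J..} <= (\<Sum>j<J. pr (r N) (a @ [j]))"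
   proof eventually_elim
    case (elim N)
    have "pr (r N) a <= measure_pmf.prob (q (r N)) ((?C \<inter> {\<omega>. \<omega> (length a) < J}) \<union> {\<omega>. J <= \<omega> (length a)})"
     unfolding pr_def by (intro measure_pmf.finite_measure_mono) auto
    also have "... <= measure_pmf.prob (q (r N)) (?C \<inter> {\<omega>. \<omega> (length a) < J}) + measure_pmf.prob (q (r N)) {\<omega>. J <= \<omega> (length a)}"
     by (intro measure_Un_le) auto
    also have "measure_pmf.prob (q (r N)) {\<omega>. J <= \<omega> (length a)} = measure_pmf.prob \<rho> {J..}"
     unfolding elim[symmetric] measure_map_pmf by (simp add: vimage_def)
    finally show ?case unfolding part by simp
   qed
   thus "\<exists>N. \<forall>n\<ge>N. pr (r n) a - measure_pmf.prob \<rho> {J..} <= (\<Sum>j<J. pr (r n) (a @ [j]))"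
    unfolding eventually_sequentially .
  qed
  have "(%J. measure_pmf.prob \<rho> {J..}) \<longlonglongrightarrow> measure_pmf.prob \<rho> (\<Inter>J. {J..})"
   by (rule measure_pmf.finite_Lim_measure_decseq) (auto simp: decseq_def)
  moreover have "(\<Inter>J. {J..}) = ({} :: nat set)" using Suc_n_not_le_n by blast
  ultimately have "(%J. l a - measure_pmf.prob \<rho> {J..}) \<longlonglongrightarrow> l a - 0" by (intro tendsto_diff) auto
  hence lim: "(%J. l a - measure_pmf.prob \<rho> {J..}) \<longlonglongrightarrow> l a" by simp
  show ?thesis unfolding sums_def
  proof (rule tendsto_sandwich[OF _ _ lim tendsto_const])
   show "\<forall>\<^sub>F J in sequentially. l a - measure_pmf.prob \<rho> {J..} <= (\<Sum>j<J. l (a @ [j]))"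
    using low by (rule always_eventually[OF allI])
   show "\<forall>\<^sub>F J in sequentially. (\<Sum>j<J. l (a @ [j])) <= l a" using up by (rule always_eventually[OF allI])
  qed
 qed
 from consistent_weights_realisation[of l, OF l0 nonneg this]
 obtain X where X: "!!k. X k \<in> borel \<rightarrow>\<^sub>M count_space UNIV"
  "!!a. emeasure unit_measure {u. map (%k. X k u) [0..<length a] = a} = ennreal (l a)" by blast
 have "(\<integral>\<^sup>+u. \<psi> (map (%k. X k u) [0..<n]) \<partial>unit_measure)
    <= liminf (%N. \<integral>\<^sup>+\<omega>. \<psi> (map \<omega> [0..<n]) \<partial>measure_pmf (q (r N)))" for n and \<psi> :: "nat list => ennreal"
 proof -
  define lb where "lb a = (if length a = n then l a else 0)" for a
  define pb where "pb N a = (if length a = n then pr N a else 0)" for N a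
  have mX: "{u. X k u = j} \<in> sets borel" for k j using measurable_sets[OF X(1), of "{j}"] by (simp add: vimage_def)
  have "{u \<in> space unit_measure. map (%k. X k u) [0..<n] = a} \<in> sets unit_measure" for a
  proof -
   have "{u \<in> space unit_measure. map (%k. X k u) [0..<n] = a} = (if length a = n then (\<Inter>k\<in>{..<n}. {u. X k u = a ! k}) else {})"
    by (auto simp: map_upt_eq_iff)
   also have "... \<in> sets borel" using mX by (cases "n = 0") (auto intro!: sets.finite_INT)
   finally show ?thesis by simp
  qed
  from nn_integral_countable_valued[OF countableI_type this]
  have "(\<integral>\<^sup>+u. \<psi> (map (%k. X k u) [0..<n]) \<partial>unit_measure)
    = (\<integral>\<^sup>+a. \<psi> a * emeasure unit_measure {u. map (%k. X k u) [0..<n] = a} \<partial>count_space UNIV)" by simp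
  also have "... = (\<integral>\<^sup>+a. \<psi> a * ennreal (lb a) \<partial>count_space UNIV)"
  proof (intro nn_integral_cong)
   fix a
   show "\<psi> a * emeasure unit_measure {u. map (%k. X k u) [0..<n] = a} = \<psi> a * ennreal (lb a)"
   proof (cases "length a = n")
    case True
    thus ?thesis using X(2)[of a] by (simp add: lb_def)
   next
    case False
    hence "{u. map (%k. X k u) [0..<n] = a} = {}" by auto
    thus ?thesis using False by (simp add: lb_def)
   qed
  qed
  also have "... <= (\<integral>\<^sup>+a. liminf (%N. \<psi> a * ennreal (pb (r N) a)) \<partial>count_space UNIV)"
  proof (intro nn_integral_mono)
   fix a
   have "(%N. pb (r N) a) \<longlonglongrightarrow> lb a" using l[of a] by (simp add: pb_def lb_def)
   hence "(%N. ennreal (pb (r N) a)) \<longlonglongrightarrow> ennreal (lb a)" by (intro tendsto_ennrealI)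
   \<comment> \<open>An infinite value of \<open>\<psi>\<close> makes the product discontinuous at
     weight 0. There the left side is 0; otherwise the weights are eventually positive and the
     products converge.\<close>
   thus "\<psi> a * ennreal (lb a) <= liminf (%N. \<psi> a * ennreal (pb (r N) a))" (is "_ <= liminf ?f")
   proof (cases "ennreal (lb a) = 0")
    case False
    have "?f \<longlonglongrightarrow> \<psi> a * ennreal (lb a)"
    proof (cases "\<psi> a = \<top>")
     case True
     have "\<forall>\<^sub>F N in sequentially. 0 < ennreal (pb (r N) a)"
      using False \<open>(%N. ennreal (pb (r N) a)) \<longlonglongrightarrow> ennreal (lb a)\<close>
      by (intro order_tendstoD) (auto simp: zero_less_iff_neq_zero)
     hence "\<forall>\<^sub>F N in sequentially. ?f N = \<psi> a * ennreal (lb a)"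
      by (rule eventually_mono) (use False in \<open>auto simp: True ennreal_top_mult zero_less_iff_neq_zero\<close>)
     thus ?thesis by (rule tendsto_eventually)
    next
     case False
     thus ?thesis using \<open>(%N. ennreal (pb (r N) a)) \<longlonglongrightarrow> ennreal (lb a)\<close>
      by (intro ennreal_tendsto_cmult) (auto simp: less_top)
    qed
    hence "liminf ?f = \<psi> a * ennreal (lb a)" by (intro lim_imp_Liminf) auto
    thus ?thesis by simp
   qed simp
  qed
  also have "... <= liminf (%N. \<integral>\<^sup>+a. \<psi> a * ennreal (pb (r N) a) \<partial>count_space UNIV)"
   by (intro nn_integral_liminf) auto
  also have "(%N. \<integral>\<^sup>+a. \<psi> a * ennreal (pb (r N) a) \<partial>count_space UNIV) = (%N. \<integral>\<^sup>+\<omega>. \<psi> (map \<omega> [0..<n]) \<partial>measure_pmf (q (r N)))"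
  proof
   fix N
   have "(\<integral>\<^sup>+\<omega>. \<psi> (map \<omega> [0..<n]) \<partial>measure_pmf (q (r N)))
    = (\<integral>\<^sup>+a. \<psi> a * emeasure (measure_pmf (q (r N))) {\<omega>. map \<omega> [0..<n] = a} \<partial>count_space UNIV)"
    using nn_integral_countable_valued[OF countableI_type, of "measure_pmf (q (r N))" "%\<omega>. map \<omega> [0..<n]" \<psi>] by simp
   also have "... = (\<integral>\<^sup>+a. \<psi> a * ennreal (pb (r N) a) \<partial>count_space UNIV)"
   proof (intro nn_integral_cong)
    fix a
    show "\<psi> a * emeasure (measure_pmf (q (r N))) {\<omega>. map \<omega> [0..<n] = a} = \<psi> a * ennreal (pb (r N) a)"
    proof (cases "length a = n")
     case True
     thus ?thesis by (simp add: pb_def pr_def measure_pmf.emeasure_eq_measure)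
    next
     case False
     hence "{\<omega>. map \<omega> [0..<n] = a} = {}" by auto
     thus ?thesis using False by (simp add: pb_def)
    qed
   qed
   finally show "(\<integral>\<^sup>+a. \<psi> a * ennreal (pb (r N) a) \<partial>count_space UNIV) = (\<integral>\<^sup>+\<omega>. \<psi> (map \<omega> [0..<n]) \<partial>measure_pmf (q (r N)))" ..
  qed
  finally show ?thesis .
 qed
 thus ?thesis using r(1) X(1) by blast
qed

section \<open>Finsler metrics in charts\<close>

lemma k_smooth_on_cong:
 assumes "open S" "!!x. x \<in> S ==> f x = g x" "k_smooth_on k S f"
 shows "k_smooth_on k S g" using assms
proof (induction k arbitrary: f g)
 case 0
 thus ?case by (simp cong: continuous_on_cong)
next
 case (Suc k)
 have ev: "\<forall>\<^sub>F y in nhds x. f y = g y" if "x \<in> S" for x using Suc.prems(1,2) that unfolding eventually_nhds by blast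
 have der: "(g has_derivative D) (at x)" if "x \<in> S" "(f has_derivative D) (at x)" for x D
  using has_derivative_transform_eventually[OF that(2)] ev[OF that(1)] Suc.prems(2)[OF that(1)]
  by (simp add: eventually_nhds_conv_at eventually_conj_iff)
 have fd: "frechet_derivative f (at x) = frechet_derivative g (at x)" "g differentiable (at x)" if "x \<in> S" for x
 proof -
  have "f differentiable (at x)" using Suc.prems(3) that by simp
  hence "(f has_derivative frechet_derivative f (at x)) (at x)" by (simp add: frechet_derivative_works)
  hence "(g has_derivative frechet_derivative f (at x)) (at x)" by (rule der[OF that])
  from frechet_derivative_at[OF this] differentiableI[OF this]
  show "frechet_derivative f (at x) = frechet_derivative g (at x)" "g differentiable (at x)" .
 qed
 show ?case unfolding k_smooth_on.simps
 proof (intro conjI ballI allI)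
  fix v
  show "k_smooth_on k S (%x. frechet_derivative g (at x) v)"
  proof (rule Suc.IH[OF Suc.prems(1)])
   show "k_smooth_on k S (%x. frechet_derivative f (at x) v)" using Suc.prems(3) by simp
  qed (simp add: fd(1))
 qed (rule fd(2))
qed

text \<open>Serves straight segments in charts and affine reparametrisations of curves.\<close>

lemma k_smooth_on_affine:
 fixes f :: "'b::real_normed_vector => 'c::real_normed_vector" and u w :: 'b
 assumes "open S" "k_smooth_on k S f"
 shows "k_smooth_on k {t :: real. u + t *\<^sub>R w \<in> S} (%t. f (u + t *\<^sub>R w))" using assms
proof (induction k arbitrary: f)
 case 0
 thus ?case by (auto intro!: continuous_on_compose2[of S f] continuous_intros)
next
 case (Suc k)
 let ?T = "{t :: real. u + t *\<^sub>R w \<in> S}"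
 have "open ?T" using open_vimage[OF Suc.prems(1), of "%t. u + t *\<^sub>R w"] by (simp add: vimage_def continuous_intros)
 have der: "((%t. f (u + t *\<^sub>R w)) has_derivative (%h. frechet_derivative f (at (u + t *\<^sub>R w)) (h *\<^sub>R w))) (at t)"
  if "t \<in> ?T" for t
 proof -
  have "f differentiable (at (u + t *\<^sub>R w))" using Suc.prems(2) that by simp
  hence "(f has_derivative frechet_derivative f (at (u + t *\<^sub>R w))) (at (u + t *\<^sub>R w))" by (simp add: frechet_derivative_works)
  moreover have "((%t. u + t *\<^sub>R w) has_derivative (%h. h *\<^sub>R w)) (at t)" by (auto intro!: derivative_eq_intros)
  ultimately show ?thesis by (rule has_derivative_compose[rotated])
 qed
 show ?case unfolding k_smooth_on.simps
 proof (intro conjI ballI allI)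
  fix v :: real
  have "k_smooth_on k ?T (%t. frechet_derivative f (at (u + t *\<^sub>R w)) (v *\<^sub>R w))" using Suc.prems by (intro Suc.IH) auto
  thus "k_smooth_on k ?T (%t. frechet_derivative (%t. f (u + t *\<^sub>R w)) (at t) v)"
   by (rule k_smooth_on_cong[OF \<open>open ?T\<close>, rotated]) (auto simp: frechet_derivative_at[OF der, symmetric])
 qed (rule differentiableI[OF der])
qed

lemma k_smooth_on_subset:
 assumes "k_smooth_on k S f" "T \<subseteq> S"
 shows "k_smooth_on k T f" using assms by (induction k arbitrary: f) (auto intro: continuous_on_subset)

lemma smooth_on_C1:
 assumes "smooth_on S f"
 shows smooth_on_differentiable: "x \<in> S ==> f differentiable (at x)"
  and smooth_on_continuous_derivative: "continuous_on S (%x. frechet_derivative f (at x) v)"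
  and smooth_on_continuous: "continuous_on S f"
  and smooth_on_differentiable_derivative:
   "x \<in> S ==> (%x. frechet_derivative f (at x) v) differentiable (at x)"
proof -
 have "k_smooth_on (Suc 0) S f" "k_smooth_on 0 S f" "k_smooth_on (Suc (Suc 0)) S f" using assms unfolding smooth_on_def by blast+
 thus "x \<in> S ==> f differentiable (at x)" "continuous_on S (%x. frechet_derivative f (at x) v)"
  "continuous_on S f" "x \<in> S ==> (%x. frechet_derivative f (at x) v) differentiable (at x)" by auto
qed

lemma frechet_vector_derivative:
 assumes "f differentiable (at t)"
 shows "frechet_derivative f (at t) (1 :: real) = vector_derivative f (at t)"
proof -
 have "(f has_derivative (%h. h *\<^sub>R vector_derivative f (at t))) (at t)"
  using assms vector_derivative_works unfolding has_vector_derivative_def by blast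
 from frechet_derivative_at[OF this] show ?thesis by (metis scaleR_one)
qed

section \<open>Charts, tangent vectors and the speed in coordinates\<close>

locale finsler =
 fixes \<A> :: "('a::{t2_space, second_countable_topology}, 'n::finite) chart set"
  and F :: "'a \<times> ('a, 'n) tvec => real"
 assumes finsler: "finsler_manifold \<A> F"
begin

abbreviation "d \<equiv> finsler_dist \<A> F"

definition Om :: "('a, 'n) chart => (real ^ 'n) set" where
 "Om c = snd c ` fst c"

definition Fc :: "('a, 'n) chart => real ^ 'n => real ^ 'n => real" where
 "Fc c u y = F (from_coords \<A> c (u, y))"

lemma charts_at_iff: "c \<in> charts_at \<A> x \<longleftrightarrow> c \<in> \<A> & x \<in> fst c" by (simp add: charts_at_def)

lemma atlas: "smooth_atlas \<A>" using finsler unfolding finsler_manifold_def by (elim conjE)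

lemma ex_chart: "\<exists>c. c \<in> \<A> & x \<in> fst c"
proof -
 have "(\<Union>c\<in>\<A>. fst c) = UNIV" using atlas unfolding smooth_atlas_def by (elim conjE)
 thus ?thesis by blast
qed

context
 fixes c :: "('a, 'n) chart"
 assumes c: "c \<in> \<A>"
begin

lemma open_chart: "open (fst c)" and open_Om: "open (Om c)"
 and chart_homeo: "homeomorphism (fst c) (Om c) (snd c) (chart_inv c)"
proof -
 have "\<forall>c\<in>\<A>. open (fst c) & open (snd c ` fst c) &
    homeomorphism (fst c) (snd c ` fst c) (snd c) (chart_inv c)" using atlas unfolding smooth_atlas_def by (elim conjE)
 from bspec[OF this c]
 show "open (fst c)" "open (Om c)" "homeomorphism (fst c) (Om c) (snd c) (chart_inv c)" unfolding Om_def by simp_all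
qed

lemma chart_inv_chart: "x \<in> fst c ==> chart_inv c (snd c x) = x"
 and chart_chart_inv: "u \<in> Om c ==> snd c (chart_inv c u) = u"
 and chart_inv_in: "u \<in> Om c ==> chart_inv c u \<in> fst c"
 and chart_in: "x \<in> fst c ==> snd c x \<in> Om c"
 and continuous_chart: "continuous_on (fst c) (snd c)"
 and continuous_chart_inv: "continuous_on (Om c) (chart_inv c)"
proof -
 show "x \<in> fst c ==> chart_inv c (snd c x) = x" by (rule homeomorphism_apply1[OF chart_homeo])
 show "u \<in> Om c ==> snd c (chart_inv c u) = u" by (rule homeomorphism_apply2[OF chart_homeo])
 show "u \<in> Om c ==> chart_inv c u \<in> fst c" using homeomorphism_image2[OF chart_homeo] by blast
 show "x \<in> fst c ==> snd c x \<in> Om c" by (simp add: Om_def)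
 show "continuous_on (fst c) (snd c)" "continuous_on (Om c) (chart_inv c)"
  using homeomorphism_cont1[OF chart_homeo] homeomorphism_cont2[OF chart_homeo] .
qed

lemma isCont_chart: "x \<in> fst c ==> isCont (snd c) x" using continuous_chart open_chart by (simp add: continuous_on_eq_continuous_at)

lemma isCont_chart_inv: "u \<in> Om c ==> isCont (chart_inv c) u"
 using continuous_chart_inv open_Om by (simp add: continuous_on_eq_continuous_at)

lemma transition_smooth: "c' \<in> \<A> ==> smooth_on (snd c ` (fst c \<inter> fst c')) (snd c' \<circ> chart_inv c)"
proof -
 assume c': "c' \<in> \<A>"
 have "\<forall>c\<in>\<A>. \<forall>c'\<in>\<A>. smooth_on (snd c ` (fst c \<inter> fst c')) (snd c' \<circ> chart_inv c)"
  using atlas unfolding smooth_atlas_def by (elim conjE)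
 from bspec[OF bspec[OF this c] c'] show ?thesis .
qed

lemma transition_derivative:
 assumes "c' \<in> \<A>" "x \<in> fst c" "x \<in> fst c'"
 shows "((snd c' \<circ> chart_inv c) has_derivative frechet_derivative (snd c' \<circ> chart_inv c) (at (snd c x))) (at (snd c x))"
 using smooth_on_differentiable[OF transition_smooth[OF assms(1)], of "snd c x"] assms(2,3) by (simp add: frechet_derivative_works)

lemma Fc_continuous: "continuous_on (Om c \<times> UNIV) (%(u, y). Fc c u y)"
proof -
 have "\<forall>c\<in>\<A>. continuous_on ((snd c ` fst c) \<times> UNIV) (F \<circ> from_coords \<A> c)"
  using finsler unfolding finsler_manifold_def by (elim conjE)
 from bspec[OF this c] show ?thesis by (simp add: Om_def Fc_def o_def case_prod_beta')
qed

lemma Fc_smooth: "smooth_on (Om c \<times> (UNIV - {0})) (%(u, y). Fc c u y)"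
proof -
 have "\<forall>c\<in>\<A>. smooth_on ((snd c ` fst c) \<times> (UNIV - {0})) (F \<circ> from_coords \<A> c)"
  using finsler unfolding finsler_manifold_def by (elim conjE)
 from bspec[OF this c] show ?thesis by (simp add: Om_def Fc_def o_def case_prod_beta')
qed

lemma fundamental_tensor_pos:
 assumes "u \<in> Om c" "y ~= 0"
 shows "pos_def_matrix (\<chi> i j. partial_deriv j (partial_deriv i (%z. (Fc c u z)\<^sup>2 / 2)) y)"
proof -
 have "\<forall>c\<in>\<A>. \<forall>u\<in>snd c ` fst c. \<forall>y. y ~= 0 --> pos_def_matrix (fundamental_tensor \<A> F c u y)"
  using finsler unfolding finsler_manifold_def by (elim conjE)
 from bspec[OF bspec[OF this c], of u] assms show ?thesis by (simp add: Om_def Fc_def fundamental_tensor_def)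
qed

end

lemma open_overlap:
 assumes c: "c \<in> \<A>" and c': "c' \<in> \<A>"
 shows "open (snd c ` (fst c \<inter> fst c'))"
proof -
 have "openin (top_of_set (fst c)) (fst c \<inter> fst c')" using open_chart[OF c'] by (rule openin_open_Int)
 hence "openin (top_of_set (Om c)) (snd c ` (fst c \<inter> fst c'))" by (rule homeomorphism_imp_open_map[OF chart_homeo[OF c]])
 thus ?thesis using open_Om[OF c] by (rule openin_open_trans)
qed

text \<open>Near \<open>t\<close> the map \<open>h\<close> stays in the chart \<open>c\<close>,
  where its coordinates in \<open>c'\<close> are the transition map applied to those in
  \<open>c\<close>. It is used for curves and also for inverse charts in the role of
  \<open>h\<close>.\<close>

lemma has_derivative_chart_change:
 assumes cs: "c \<in> \<A>" "c' \<in> \<A>" and x: "h t \<in> fst c" "h t \<in> fst c'" and h: "isCont h t"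
  and D: "((snd c \<circ> h) has_derivative D) (at t)"
 shows "((snd c' \<circ> h) has_derivative (%s. frechet_derivative (snd c' \<circ> chart_inv c) (at (snd c (h t))) (D s))) (at t)"
proof -
 have "((snd c' \<circ> chart_inv c) has_derivative
   frechet_derivative (snd c' \<circ> chart_inv c) (at (snd c (h t)))) (at ((snd c \<circ> h) t))" using transition_derivative[OF cs x] by simp
 from diff_chain_at[OF D this]
 have "((snd c' \<circ> chart_inv c) \<circ> (snd c \<circ> h) has_derivative
   frechet_derivative (snd c' \<circ> chart_inv c) (at (snd c (h t))) \<circ> D) (at t)" .
 moreover have "\<forall>\<^sub>F s in at t. h s \<in> fst c" by (rule topological_tendstoD[OF h[unfolded isCont_def] open_chart[OF cs(1)] x(1)])
 hence "\<forall>\<^sub>F s in at t. ((snd c' \<circ> chart_inv c) \<circ> (snd c \<circ> h)) s = (snd c' \<circ> h) s"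
  by eventually_elim (simp add: chart_inv_chart[OF cs(1)])
 ultimately show ?thesis
  using has_derivative_transform_eventually[of "(snd c' \<circ> chart_inv c) \<circ> (snd c \<circ> h)" _ t UNIV "snd c' \<circ> h"] x(1)
  by (simp add: o_def chart_inv_chart[OF cs(1)])
qed

text \<open>The transformation law is the chain rule for three charts: \<open>c\<close>, in which
  the components are given, and the two charts being compared.\<close>

lemma from_coords_in_bundle:
 assumes c: "c \<in> \<A>" "u \<in> Om c"
 shows "from_coords \<A> c (u, y) \<in> tangent_bundle \<A>"
proof -
 let ?x = "chart_inv c u"
 have x: "?x \<in> fst c" "snd c ?x = u" by (rule chart_inv_in[OF c], rule chart_chart_inv[OF c])
 have key: "frechet_derivative (snd c2 \<circ> chart_inv c) (at u) y =
   frechet_derivative (snd c2 \<circ> chart_inv c1) (at (snd c1 ?x)) (frechet_derivative (snd c1 \<circ> chart_inv c) (at u) y)"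
  if "c1 \<in> charts_at \<A> ?x" "c2 \<in> charts_at \<A> ?x" for c1 c2
 proof -
  have 1: "c1 \<in> \<A>" "?x \<in> fst c1" "c2 \<in> \<A>" "?x \<in> fst c2" using that by (auto simp: charts_at_iff)
  have "((snd c2 \<circ> chart_inv c) has_derivative (%s. frechet_derivative (snd c2 \<circ> chart_inv c1) (at (snd c1 ?x))
    (frechet_derivative (snd c1 \<circ> chart_inv c) (at u) s))) (at u)" using 1 transition_derivative[OF c(1) 1(1) x(1) 1(2)] unfolding x(2)
   by (intro has_derivative_chart_change[OF 1(1,3)] isCont_chart_inv c)
  from frechet_derivative_at[OF this] show ?thesis by metis
 qed
 show ?thesis unfolding from_coords_def tangent_bundle_def tangent_space_def
 proof (intro SigmaI CollectI conjI ballI, goal_cases)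
  case (3 c1 c2)
  hence 3: "c1 \<in> charts_at \<A> ?x" "c2 \<in> charts_at \<A> ?x" by simp_all
  show ?case using key[OF 3] 3 by (simp only: restrict_apply' fst_conv snd_conv)
 qed (rule UNIV_I restrict_extensional)+
qed

lemma from_coords_scale:
 assumes c: "c \<in> \<A>" "u \<in> Om c"
 shows "tscale \<A> l (from_coords \<A> c (u, y)) = from_coords \<A> c (u, l *\<^sub>R y)"
proof -
 let ?x = "chart_inv c u"
 have x: "?x \<in> fst c" "snd c ?x = u" by (rule chart_inv_in[OF c], rule chart_chart_inv[OF c])
 have "frechet_derivative (snd c' \<circ> chart_inv c) (at u) (l *\<^sub>R y) = l *\<^sub>R frechet_derivative (snd c' \<circ> chart_inv c) (at u) y"
  if "c' \<in> charts_at \<A> ?x" for c' using has_derivative_linear[OF transition_derivative[OF c(1) _ x(1), of c']] that x(2)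
  by (simp add: charts_at_iff linear_cmul)
 thus ?thesis by (auto simp: from_coords_def tscale_def restrict_def)
qed

lemma F_nonneg:
 assumes "w \<in> tangent_bundle \<A>"
 shows "0 <= F w"
proof -
 have "F \<in> tangent_bundle \<A> \<rightarrow> {0..}" using finsler unfolding finsler_manifold_def by (elim conjE)
 from funcset_mem[OF this assms] show ?thesis by simp
qed

lemma Fc_nonneg: "c \<in> \<A> ==> u \<in> Om c ==> 0 <= Fc c u y"
 unfolding Fc_def by (intro F_nonneg from_coords_in_bundle)

lemma Fc_scale:
 assumes "c \<in> \<A>" "u \<in> Om c" "0 <= l"
 shows "Fc c u (l *\<^sub>R y) = l * Fc c u y"
proof -
 have "\<forall>w\<in>tangent_bundle \<A>. \<forall>l\<ge>0. F (tscale \<A> l w) = l * F w"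
  using finsler unfolding finsler_manifold_def by (elim conjE)
 from bspec[OF this from_coords_in_bundle[OF assms(1,2), of y]]
 show ?thesis using assms(3) unfolding Fc_def from_coords_scale[OF assms(1,2)] by blast
qed

lemma Fc_zero: "c \<in> \<A> ==> u \<in> Om c ==> Fc c u 0 = 0" using Fc_scale[of c u 0 0] by simp

text \<open>Transition maps are differentiable, so one chart decides for all charts around the
  point.\<close>

lemma curve_differentiable_at_iff:
 assumes c: "c \<in> \<A>" "\<gamma> t \<in> fst c"
 shows "curve_differentiable_at \<A> \<gamma> t \<longleftrightarrow> isCont \<gamma> t & (snd c \<circ> \<gamma>) differentiable (at t)"
proof
 assume "curve_differentiable_at \<A> \<gamma> t"
 hence d: "isCont \<gamma> t" "\<forall>c\<in>charts_at \<A> (\<gamma> t). (snd c \<circ> \<gamma>) differentiable (at t)"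
  unfolding curve_differentiable_at_def by simp_all
 have "c \<in> charts_at \<A> (\<gamma> t)" using c by (simp add: charts_at_iff)
 thus "isCont \<gamma> t & (snd c \<circ> \<gamma>) differentiable (at t)" using d(1) bspec[OF d(2)] by simp
next
 assume d: "isCont \<gamma> t & (snd c \<circ> \<gamma>) differentiable (at t)"
 hence "(snd c \<circ> \<gamma>) differentiable (at t)" by (rule conjunct2)
 then obtain D where "((snd c \<circ> \<gamma>) has_derivative D) (at t)" unfolding differentiable_def by (rule exE)
 thus "curve_differentiable_at \<A> \<gamma> t" unfolding curve_differentiable_at_def charts_at_iff
 proof (intro conjI ballI)
  fix c' assume "c' \<in> charts_at \<A> (\<gamma> t)"
  hence c': "c' \<in> \<A>" "\<gamma> t \<in> fst c'" by (auto simp: charts_at_iff)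
  show "(snd c' \<circ> \<gamma>) differentiable (at t)"
   using d by (intro differentiableI[OF has_derivative_chart_change[OF c(1) c'(1) c(2) c'(2) _ \<open>((snd c \<circ> \<gamma>) has_derivative D) (at t)\<close>]]) simp
 qed (use d in simp)
qed

text \<open>By the chain rule the components of the velocity in every chart are generated by those
  in the single chart \<open>c\<close>, so the velocity is a value of
  \<open>from_coords\<close>.\<close>

lemma speed_chart:
 assumes c: "c \<in> \<A>" "\<gamma> t \<in> fst c" and d: "curve_differentiable_at \<A> \<gamma> t"
 shows "speed \<A> F \<gamma> t = Fc c (snd c (\<gamma> t)) (vector_derivative (snd c \<circ> \<gamma>) (at t))"
proof -
 have cont: "isCont \<gamma> t" and df: "(snd c \<circ> \<gamma>) differentiable (at t)"
  using d curve_differentiable_at_iff[of c \<gamma> t] c by auto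
 let ?v = "vector_derivative (snd c \<circ> \<gamma>) (at t)"
 have D: "((snd c \<circ> \<gamma>) has_derivative (%h. h *\<^sub>R ?v)) (at t)"
  using df vector_derivative_works unfolding has_vector_derivative_def by blast
 have "vector_derivative (snd c' \<circ> \<gamma>) (at t) = frechet_derivative (snd c' \<circ> chart_inv c) (at (snd c (\<gamma> t))) ?v"
  if "c' \<in> charts_at \<A> (\<gamma> t)" for c'
 proof (rule vector_derivative_at)
  have c': "c' \<in> \<A>" "\<gamma> t \<in> fst c'" using that by (auto simp: charts_at_iff)
  have "linear (frechet_derivative (snd c' \<circ> chart_inv c) (at (snd c (\<gamma> t))))"
   using has_derivative_linear[OF transition_derivative[OF c(1) c'(1) c(2) c'(2)]] .
  thus "((snd c' \<circ> \<gamma>) has_vector_derivative frechet_derivative (snd c' \<circ> chart_inv c) (at (snd c (\<gamma> t))) ?v) (at t)"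
   using has_derivative_chart_change[OF c(1) c'(1) c(2) c'(2) cont D] by (simp add: has_vector_derivative_def linear_cmul)
 qed
 hence "velocity \<A> \<gamma> t = from_coords \<A> c (snd c (\<gamma> t), ?v)"
  unfolding velocity_def from_coords_def using chart_inv_chart[OF c] by (auto simp: restrict_def)
 thus ?thesis using d by (simp add: speed_def Fc_def)
qed

lemma speed_nonneg: "0 <= speed \<A> F \<gamma> t"
proof (cases "curve_differentiable_at \<A> \<gamma> t")
 case True
 obtain c where c: "c \<in> \<A>" "\<gamma> t \<in> fst c" using ex_chart by blast
 show ?thesis using speed_chart[of c \<gamma> t] c True Fc_nonneg[OF c(1) chart_in[OF c]] by simp
qed (simp add: speed_def)

end

section \<open>Minkowski norms and supporting functionals\<close>

lemma frechet_eq_sum_partial: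
 fixes f :: "real ^ 'n => real"
 assumes "f differentiable (at x)"
 shows "frechet_derivative f (at x) z = (\<Sum>i\<in>UNIV. z $ i * partial_deriv i f x)"
proof -
 have lin: "linear (frechet_derivative f (at x))" using assms by (simp add: frechet_derivative_works has_derivative_linear)
 have "frechet_derivative f (at x) (\<Sum>i\<in>UNIV. z $ i *s axis i 1) = (\<Sum>i\<in>UNIV. z $ i * partial_deriv i f x)"
  by (simp add: linear_sum[OF lin] scalar_mult_eq_scaleR linear_cmul[OF lin] partial_deriv_def)
 thus ?thesis by (simp add: basis_expansion)
qed

lemma has_real_derivative_along_line:
 fixes f :: "real ^ 'n => real"
 assumes "f differentiable (at (y + s *\<^sub>R z))"
 shows "((%s. f (y + s *\<^sub>R z)) has_real_derivative (\<Sum>i\<in>UNIV. z $ i * partial_deriv i f (y + s *\<^sub>R z))) (at s)"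
proof -
 let ?D = "frechet_derivative f (at (y + s *\<^sub>R z))"
 have D: "(f has_derivative ?D) (at (y + s *\<^sub>R z))" using assms by (simp add: frechet_derivative_works)
 have "((%s. y + s *\<^sub>R z) has_derivative (%h. h *\<^sub>R z)) (at s)" by (auto intro!: derivative_eq_intros)
 from has_derivative_compose[OF this D]
 have "((%s. f (y + s *\<^sub>R z)) has_derivative (%h. ?D (h *\<^sub>R z))) (at s)" .
 thus ?thesis using linear_cmul[OF has_derivative_linear[OF D]] frechet_eq_sum_partial[OF assms, of z]
  by (simp add: has_field_derivative_def mult_commute_abs)
qed

text \<open>One tangent space in isolation: a positively homogeneous function whose half square has
  a positive definite Hessian off the origin. Neither subadditivity nor symmetry is postulated;
  convexity is derived from the Hessian.\<close>

locale minkowski_norm =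
 fixes N :: "real ^ 'n::finite => real" and L
 defines "L \<equiv> %z. (N z)\<^sup>2 / 2"
 assumes N_nonneg: "0 <= N y"
  and N_scale: "0 <= l ==> N (l *\<^sub>R y) = l * N y"
  and L_diff: "y ~= 0 ==> L differentiable (at y)"
  and L_diff2: "y ~= 0 ==> partial_deriv i L differentiable (at y)"
  and L_pos: "y ~= 0 ==> pos_def_matrix (\<chi> i j. partial_deriv j (partial_deriv i L) y)"
begin

definition dL :: "real ^ 'n => real ^ 'n => real" where
 "dL y z = (\<Sum>i\<in>UNIV. z $ i * partial_deriv i L y)"

lemma L_line: "y + s *\<^sub>R z ~= 0 ==> ((%s. L (y + s *\<^sub>R z)) has_real_derivative dL (y + s *\<^sub>R z) z) (at s)"
 unfolding dL_def by (intro has_real_derivative_along_line L_diff)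

lemma dL_line:
 assumes "y + s *\<^sub>R z ~= 0" "z ~= 0"
 shows "\<exists>D>0. ((%s. dL (y + s *\<^sub>R z) z) has_real_derivative D) (at s)"
proof -
 let ?x = "y + s *\<^sub>R z"
 let ?G = "\<chi> i j. partial_deriv j (partial_deriv i L) ?x"
 have "((%s. dL (y + s *\<^sub>R z) z) has_real_derivative
   (\<Sum>i\<in>UNIV. z $ i * (\<Sum>j\<in>UNIV. z $ j * partial_deriv j (partial_deriv i L) ?x))) (at s)" unfolding dL_def using assms
  by (intro DERIV_sum DERIV_cmult has_real_derivative_along_line L_diff2)
 also have "(\<Sum>i\<in>UNIV. z $ i * (\<Sum>j\<in>UNIV. z $ j * partial_deriv j (partial_deriv i L) ?x)) = z \<bullet> (?G *v z)"
  by (simp add: inner_vec_def matrix_vector_mult_def mult.commute)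
 finally show ?thesis using L_pos[OF assms(1)] assms(2) unfolding pos_def_matrix_def by blast
qed

lemma L_scale: "0 <= l ==> L (l *\<^sub>R y) = l\<^sup>2 * L y" by (simp add: L_def N_scale power_mult_distrib)

lemma dL_self:
 assumes "y ~= 0" "-1 < s"
 shows "dL (y + s *\<^sub>R y) y = 2 * (1 + s) * L y"
proof (rule DERIV_unique)
 have eq: "y + r *\<^sub>R y = (1 + r) *\<^sub>R y" for r by (simp add: scaleR_left_distrib)
 show "((%s. L (y + s *\<^sub>R y)) has_real_derivative dL (y + s *\<^sub>R y) y) (at s)"
  using assms unfolding eq[of s] by (intro L_line[of y s y, unfolded eq[of s]]) auto
 have d: "((%s. (1 + s)\<^sup>2 * L y) has_real_derivative 2 * (1 + s) * L y) (at s)" by (auto intro!: derivative_eq_intros)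
 have ev: "\<forall>\<^sub>F r in nhds s. (1 + r)\<^sup>2 * L y = L (y + r *\<^sub>R y)"
 proof -
  have "\<forall>\<^sub>F r in nhds s. r \<in> {-1<..}" using assms by (intro eventually_nhds_in_open) auto
  thus ?thesis by eventually_elim (simp add: eq L_scale)
 qed
 show "((%s. L (y + s *\<^sub>R y)) has_real_derivative 2 * (1 + s) * L y) (at s)" using d unfolding DERIV_cong_ev[OF refl ev refl] .
qed

text \<open>By homogeneity the second derivative of \<open>L\<close> at \<open>y\<close> in the
  direction \<open>y\<close> is \<open>2 * L y\<close>, and positive definiteness makes it
  positive.\<close>

lemma N_pos:
 assumes "y ~= 0"
 shows "0 < N y"
proof -
 obtain D where D: "0 < D" "((%s. dL (y + s *\<^sub>R y) y) has_real_derivative D) (at 0)" using dL_line[of y 0 y] assms by auto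
 have d: "((%s. 2 * (1 + s) * L y) has_real_derivative 2 * L y) (at 0)" by (auto intro!: derivative_eq_intros)
 have ev: "\<forall>\<^sub>F r in nhds 0. 2 * (1 + r) * L y = dL (y + r *\<^sub>R y) y"
 proof -
  have "\<forall>\<^sub>F r in nhds 0. r \<in> {-1 :: real<..}" by (intro eventually_nhds_in_open) auto
  thus ?thesis by eventually_elim (simp add: dL_self assms)
 qed
 have "((%s. dL (y + s *\<^sub>R y) y) has_real_derivative 2 * L y) (at 0)" using d unfolding DERIV_cong_ev[OF refl ev refl] .
 hence "2 * L y = D" using D(2) by (rule DERIV_unique)
 hence "N y ~= 0" using D(1) by (auto simp: L_def)
 thus ?thesis using N_nonneg[of y] by simp
qed

lemma N_zero: "N 0 = 0" using N_scale[of 0 0] by simp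

lemma dL_linear: "linear (dL y)" unfolding dL_def by (rule linearI) (simp_all add: sum.distrib sum_distrib_left algebra_simps)

text \<open>Mean value theorem and monotonicity of the derivative along the segment. The segment has
  to avoid the origin, where no second derivative is available.\<close>

lemma L_tangent_le:
 assumes "!!s. 0 <= s ==> s <= 1 ==> w + s *\<^sub>R z ~= 0"
 shows "L w + dL w z <= L (w + z)"
proof (cases "z = 0")
 case True
 thus ?thesis by (simp add: dL_def)
next
 case False
 obtain s where s: "0 < s" "s < 1" "L (w + 1 *\<^sub>R z) - L (w + 0 *\<^sub>R z) = (1 - 0) * dL (w + s *\<^sub>R z) z"
  using MVT2[of 0 1 "%s. L (w + s *\<^sub>R z)" "%s. dL (w + s *\<^sub>R z) z"] L_line assms by auto
 have "dL (w + 0 *\<^sub>R z) z <= dL (w + s *\<^sub>R z) z"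
 proof (rule DERIV_nonneg_imp_nondecreasing[where f = "%s. dL (w + s *\<^sub>R z) z"])
  fix x assume "0 <= x" "x <= s"
  hence "w + x *\<^sub>R z ~= 0" using assms s by simp
  from dL_line[OF this False]
  show "\<exists>D. ((%s. dL (w + s *\<^sub>R z) z) has_real_derivative D) (at x) & 0 <= D" using less_imp_le by blast
 qed (use s in simp)
 thus ?thesis using s(3) by simp
qed

text \<open>The Finsler form of the Cauchy-Schwarz inequality. With \<open>v\<close> rescaled to the
  norm of \<open>w\<close>, it is the tangent inequality for \<open>L\<close> at \<open>w\<close>.
  The segment meets the origin only if \<open>v\<close> is a negative multiple of \<open>w\<close>,
  and then the left side is at most 0.\<close>

lemma dL_le:
 assumes w: "w ~= 0"
 shows "dL w v <= N w * N v"
proof -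
 have Nw: "0 < N w" by (rule N_pos[OF w])
 have dLw: "dL w w = (N w)\<^sup>2" using dL_self[OF w, of 0] by (simp add: L_def)
 consider "v = 0" | k where "0 < k" "v = (- k) *\<^sub>R w" | "v ~= 0" "!!k. 0 < k ==> v ~= (- k) *\<^sub>R w" by blast
 thus ?thesis
 proof cases
  case 1
  thus ?thesis by (simp add: dL_def N_zero)
 next
  case (2 k)
  have "dL w v = - k * (N w)\<^sup>2" using linear_cmul[OF dL_linear, of w "-k" w] 2 dLw by simp
  also have "... <= 0" using 2 by simp
  also have "0 <= N w * N v" using N_nonneg by simp
  finally show ?thesis .
 next
  case 3
  have Nv: "0 < N v" by (rule N_pos[OF 3(1)])
  define l where "l = N w / N v"
  have l: "0 < l" "l * N v = N w" using Nw Nv by (auto simp: l_def)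
  have "L w + dL w (l *\<^sub>R v - w) <= L (w + (l *\<^sub>R v - w))"
  proof (rule L_tangent_le)
   fix s :: real assume s: "0 <= s" "s <= 1"
   show "w + s *\<^sub>R (l *\<^sub>R v - w) ~= 0"
   proof
    assume "w + s *\<^sub>R (l *\<^sub>R v - w) = 0"
    hence e: "(s * l) *\<^sub>R v = (- (1 - s)) *\<^sub>R w" by (simp add: algebra_simps add_eq_0_iff)
    have "s ~= 0" using e w by auto
    hence "v = (- ((1 - s) / (s * l))) *\<^sub>R w"
    proof -
     have "v = (1 / (s * l)) *\<^sub>R ((s * l) *\<^sub>R v)" using \<open>s ~= 0\<close> l by simp
     also have "... = (1 / (s * l) * (- (1 - s))) *\<^sub>R w" unfolding e by (rule scaleR_scaleR)
     also have "1 / (s * l) * (- (1 - s)) = - ((1 - s) / (s * l))" by (simp add: minus_divide_left)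
     finally show ?thesis .
    qed
    moreover have "s ~= 1" using calculation 3(1) by auto
    moreover have "0 < (1 - s) / (s * l)" using s \<open>s ~= 0\<close> \<open>s ~= 1\<close> l by simp
    ultimately show False using 3(2) by blast
   qed
  qed
  hence "L w + (l * dL w v - (N w)\<^sup>2) <= L (l *\<^sub>R v)"
   using linear_diff[OF dL_linear, of w "l *\<^sub>R v" w] linear_cmul[OF dL_linear, of w l v] dLw by simp
  also have "L (l *\<^sub>R v) = (N w)\<^sup>2 / 2" using l N_scale[of l v] by (simp add: L_def)
  finally have "l * dL w v <= (N w)\<^sup>2" by (simp add: L_def field_simps)
  hence "dL w v <= (N w)\<^sup>2 / l" using l by (simp add: field_simps)
  also have "(N w)\<^sup>2 / l = N w * N v" using Nw by (simp add: l_def power2_eq_square)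
  finally show ?thesis .
 qed
qed

text \<open>The functional is \<open>dL w\<close> divided by \<open>N w\<close>. It turns lower
  bounds on lengths into the integration of one linear functional, and it gives the triangle
  inequality for \<open>N\<close>.\<close>

lemma support_functional:
 "\<exists>f. linear f & f w = N w & (\<forall>v. f v <= N v)"
proof (cases "w = 0")
 case True
 thus ?thesis using N_nonneg N_zero by (intro exI[of _ "%_. 0"]) (auto simp: linear_zero)
next
 case False
 have Nw: "0 < N w" by (rule N_pos[OF False])
 have "linear (%v. dL w v / N w)" using dL_linear[of w] by (intro linearI) (simp_all add: linear_add linear_cmul add_divide_distrib)
 moreover have "dL w w / N w = N w" using dL_self[OF False, of 0] Nw by (simp add: L_def power2_eq_square)
 moreover have "dL w v / N w <= N v" for v using dL_le[OF False, of v] Nw by (simp add: field_simps)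
 ultimately show ?thesis by blast
qed

end

context finsler
begin

text \<open>Smoothness is known jointly in position and direction; it is restricted to the fibre
  over \<open>u\<close> by the chain rule for the embedding of \<open>z\<close> as
  \<open>(u, z)\<close>.\<close>

lemma minkowski_norm_Fc:
 assumes c: "c \<in> \<A>" "u \<in> Om c"
 shows "minkowski_norm (Fc c u)"
proof
 let ?G = "%(u, y). Fc c u y"
 let ?S = "Om c \<times> (UNIV - {0})"
 let ?L = "%z. (Fc c u z)\<^sup>2 / 2"
 have sm: "smooth_on ?S ?G" by (rule Fc_smooth[OF c(1)])
 have inS: "(u, z) \<in> ?S" if "z ~= 0" for z using that c by simp
 have emb: "((%z. (u, z)) has_derivative (%h. (0, h))) (at z)" for z :: "real ^ 'n" by (auto intro!: derivative_eq_intros)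
 have FD: "((%z. Fc c u z) has_derivative (%h. frechet_derivative ?G (at (u, z)) (0, h))) (at z)" if "z ~= 0" for z
 proof -
  have "(?G has_derivative frechet_derivative ?G (at (u, z))) (at (u, z))"
   using smooth_on_differentiable[OF sm inS[OF that]] by (simp add: frechet_derivative_works)
  from has_derivative_compose[OF emb this] show ?thesis by simp
 qed
 have LD: "(?L has_derivative (%h. Fc c u z * frechet_derivative ?G (at (u, z)) (0, h))) (at z)" if "z ~= 0" for z
  using FD[OF that] by (auto intro!: derivative_eq_intros)
 have PD: "partial_deriv i ?L z = Fc c u z * frechet_derivative ?G (at (u, z)) (0, axis i 1)" if "z ~= 0" for z i
  unfolding partial_deriv_def frechet_derivative_at[OF LD[OF that], symmetric] ..
 show "0 <= Fc c u y" for y by (rule Fc_nonneg[OF c])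
 show "Fc c u (l *\<^sub>R y) = l * Fc c u y" if "0 <= l" for l y by (rule Fc_scale[OF c that])
 show "?L differentiable (at y)" if "y ~= 0" for y by (rule differentiableI[OF LD[OF that]])
 show "pos_def_matrix (\<chi> i j. partial_deriv j (partial_deriv i ?L) y)" if "y ~= 0" for y by (rule fundamental_tensor_pos[OF c that])
 show "partial_deriv i ?L differentiable (at y)" if "y ~= 0" for i y
 proof -
  let ?H = "%x. frechet_derivative ?G (at x) (0, axis i 1)"
  have "(?H has_derivative frechet_derivative ?H (at (u, y))) (at (u, y))"
   using smooth_on_differentiable_derivative[OF sm inS[OF that]] by (simp add: frechet_derivative_works)
  from has_derivative_mult[OF FD[OF that] has_derivative_compose[OF emb this]]
  have "(%z. Fc c u z * ?H (u, z)) differentiable (at y)" by (rule differentiableI)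
  then obtain D where D: "((%z. Fc c u z * ?H (u, z)) has_derivative D) (at y)" unfolding differentiable_def by (rule exE)
  have "(partial_deriv i ?L has_derivative D) (at y)"
  proof (rule has_derivative_transform_within_open[OF D])
   show "open (UNIV - {0 :: real ^ 'n})" by (intro open_Diff) auto
  qed (use that PD in auto)
  thus ?thesis by (rule differentiableI)
 qed
qed

end

section \<open>Lengths of piecewise smooth curves\<close>

lemma bounded_on_open_interval_from_local:
 fixes f :: "real => real"
 assumes "!!t. t \<in> {a..b} ==> \<exists>e>0. \<exists>M. \<forall>s\<in>ball t e \<inter> {a<..<b}. f s <= M"
 shows "\<exists>M. \<forall>s\<in>{a<..<b}. f s <= M"
proof -
 define C where "C = {B. open B & (\<exists>M. \<forall>s\<in>B \<inter> {a<..<b}. f s <= M)}"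
 have "{a..b} \<subseteq> \<Union>C"
 proof
  fix t assume "t \<in> {a..b}"
  then obtain e M where "0 < e" "\<forall>s\<in>ball t e \<inter> {a<..<b}. f s <= M" using assms by blast
  thus "t \<in> \<Union>C" by (intro UnionI[of "ball t e"]) (auto simp: C_def)
 qed
 then obtain D where D: "D \<subseteq> C" "finite D" "{a..b} \<subseteq> \<Union>D" by (rule compactE[OF compact_Icc]) (auto simp: C_def)
 have "\<forall>B\<in>D. \<exists>M. \<forall>s\<in>B \<inter> {a<..<b}. f s <= M" using D(1) by (auto simp: C_def)
 from bchoice[OF this] obtain m where m: "\<forall>B\<in>D. \<forall>s\<in>B \<inter> {a<..<b}. f s <= m B" by (rule exE)
 have "f s <= Max (m ` D)" if s: "s \<in> {a<..<b}" for s
 proof -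
  have "s \<in> \<Union>D" by (rule subsetD[OF D(3)]) (use s in auto)
  then obtain B where B: "B \<in> D" "s \<in> B" by (rule UnionE)
  have "f s <= m B" using bspec[OF bspec[OF m B(1)], of s] B(2) s by simp
  also have "... <= Max (m ` D)" using B(1) D(2) by simp
  finally show ?thesis .
 qed
 thus ?thesis by blast
qed

lemma absolutely_integrable_on_negligible:
 fixes f :: "real => real"
 assumes "negligible S"
 shows "f absolutely_integrable_on S" using assms unfolding absolutely_integrable_on_def by (auto intro: integrable_negligible)

context finsler
begin

text \<open>The local extension \<open>g\<close> across the end points supplies the continuous
  function \<open>h\<close>. At \<open>a\<close> and \<open>b\<close> themselves the speed of
  \<open>\<gamma>\<close> may differ from \<open>h\<close>, since it depends on
  \<open>\<gamma>\<close> outside the interval; hence the open interval.\<close>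

lemma smooth_curve_local:
 assumes sc: "smooth_curve_on \<A> a b \<gamma>" and t: "t \<in> {a..b}"
 shows "\<exists>e>0. continuous_on (ball t e \<inter> {a..b}) \<gamma> &
  (\<exists>h. continuous_on (ball t e \<inter> {a..b}) h &
   (\<forall>s\<in>ball t e \<inter> {a<..<b}. curve_differentiable_at \<A> \<gamma> s & speed \<A> F \<gamma> s = h s))"
proof -
 obtain c where c: "c \<in> \<A>" "\<gamma> t \<in> fst c" using ex_chart by blast
 hence "c \<in> charts_at \<A> (\<gamma> t)" by (simp add: charts_at_iff)
 then obtain e g where e: "0 < e" and g: "smooth_on (ball t e) g"
  and eq: "!!s. s \<in> ball t e \<inter> {a..b} ==> \<gamma> s \<in> fst c & snd c (\<gamma> s) = g s"
  using sc t unfolding smooth_curve_on_def by meson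
 let ?I = "ball t e \<inter> {a..b}"
 have gOm: "g s \<in> Om c" if "s \<in> ?I" for s using eq[OF that] chart_in[OF c(1)] by metis
 have \<gamma>g: "\<gamma> s = chart_inv c (g s)" if "s \<in> ?I" for s using eq[OF that] chart_inv_chart[OF c(1)] by metis
 have gc: "continuous_on ?I g" using smooth_on_continuous[OF g] by (rule continuous_on_subset) auto
 have "continuous_on ?I (%s. chart_inv c (g s))" using gOm by (intro continuous_on_compose2[OF continuous_chart_inv[OF c(1)] gc]) auto
 hence C\<gamma>: "continuous_on ?I \<gamma>" by (subst continuous_on_cong[OF refl \<gamma>g])
 let ?h = "%s. Fc c (g s) (frechet_derivative g (at s) 1)"
 have "continuous_on ?I (%s. (g s, frechet_derivative g (at s) 1))" using gc continuous_on_subset[OF smooth_on_continuous_derivative[OF g]]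
  by (intro continuous_on_Pair) auto
 hence "continuous_on ?I (%s. (%(u, y). Fc c u y) (g s, frechet_derivative g (at s) 1))"
  using gOm by (intro continuous_on_compose2[OF Fc_continuous[OF c(1)]]) auto
 hence Ch: "continuous_on ?I ?h" by simp
 have "curve_differentiable_at \<A> \<gamma> s & speed \<A> F \<gamma> s = ?h s" if s: "s \<in> ball t e \<inter> {a<..<b}" for s
 proof -
  have sI: "s \<in> ?I" using s by auto
  have "open (ball t e \<inter> {a<..<b})" by (intro open_Int) auto
  hence "\<forall>\<^sub>F r in nhds s. r \<in> ball t e \<inter> {a<..<b}" using s by (rule eventually_nhds_in_open)
  hence ev: "\<forall>\<^sub>F r in nhds s. r \<in> ?I" by (rule eventually_mono) auto
  have gd: "g differentiable (at s)" using smooth_on_differentiable[OF g] s by blast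
  have gv: "(g has_vector_derivative vector_derivative g (at s)) (at s)" using gd by (simp add: vector_derivative_works)
  have vd: "((snd c \<circ> \<gamma>) has_vector_derivative vector_derivative g (at s)) (at s)"
  proof (rule has_vector_derivative_transform_within_open[OF gv _ s])
   show "open (ball t e \<inter> {a<..<b})" by fact
  qed (use eq in auto)
  have "isCont g s" using gd differentiable_imp_continuous_within by blast
  hence "isCont (%r. chart_inv c (g r)) s" using isCont_chart_inv[OF c(1) gOm[OF sI]] by (rule isCont_o2)
  moreover have ev\<gamma>: "\<forall>\<^sub>F r in nhds s. chart_inv c (g r) = \<gamma> r"
   using ev by (rule eventually_mono) (use \<gamma>g in auto)
  ultimately have "isCont \<gamma> s" using isCont_cong[OF ev\<gamma>] by simp
  have \<gamma>s: "\<gamma> s \<in> fst c" "snd c (\<gamma> s) = g s" using eq[OF sI] by auto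
  have cd: "curve_differentiable_at \<A> \<gamma> s"
   using curve_differentiable_at_iff[of c \<gamma> s] c(1) \<gamma>s(1) \<open>isCont \<gamma> s\<close> vd by (auto intro: differentiableI_vector)
  have "speed \<A> F \<gamma> s = Fc c (g s) (vector_derivative g (at s))"
   using speed_chart[of c \<gamma> s] c(1) \<gamma>s cd vector_derivative_at[OF vd] by simp
  thus ?thesis using cd frechet_vector_derivative[OF gd] by simp
 qed
 thus ?thesis using e C\<gamma> Ch by blast
qed

text \<open>Compactness gives a bound on the speed in the open interval, where it is continuous; the
  two end points are negligible.\<close>

lemma smooth_curve_interval:
 assumes sc: "smooth_curve_on \<A> a b \<gamma>" and ab: "a < b"
 shows "continuous_on {a..b} \<gamma>" and "!!t. t \<in> {a<..<b} ==> curve_differentiable_at \<A> \<gamma> t"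
  and "set_integrable lebesgue {a..b} (speed \<A> F \<gamma>)"
proof -
 note local = smooth_curve_local[OF sc]
 show "continuous_on {a..b} \<gamma>" unfolding continuous_on_eq_continuous_within
 proof
  fix t assume t: "t \<in> {a..b}"
  obtain e where e: "0 < e" "continuous_on (ball t e \<inter> {a..b}) \<gamma>" using local[OF t] by blast
  hence "continuous (at t within ball t e \<inter> {a..b}) \<gamma>" using t by (simp add: continuous_on_eq_continuous_within)
  moreover have "at t within (ball t e \<inter> {a..b}) = at t within {a..b}" by (rule at_within_nhd[of t "ball t e"]) (use e(1) in auto)
  ultimately show "continuous (at t within {a..b}) \<gamma>" by simp
 qed
 show cd: "curve_differentiable_at \<A> \<gamma> t" if t: "t \<in> {a<..<b}" for t
 proof -
  have "t \<in> {a..b}" using t by auto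
  from local[OF this] obtain e h where "0 < e" "\<forall>s\<in>ball t e \<inter> {a<..<b}. curve_differentiable_at \<A> \<gamma> s & speed \<A> F \<gamma> s = h s"
   by blast
  thus ?thesis using t by (metis IntI centre_in_ball)
 qed
 have "continuous_on {a<..<b} (speed \<A> F \<gamma>)" unfolding continuous_on_eq_continuous_at[OF open_greaterThanLessThan]
 proof
  fix t assume t: "t \<in> {a<..<b}"
  hence "t \<in> {a..b}" by auto
  from local[OF this] obtain e h where e: "0 < e" "continuous_on (ball t e \<inter> {a..b}) h"
   "!!s. s \<in> ball t e \<inter> {a<..<b} ==> speed \<A> F \<gamma> s = h s" by blast
  have op: "open (ball t e \<inter> {a<..<b})" by (intro open_Int) auto
  have tin: "t \<in> ball t e \<inter> {a<..<b}" using t e(1) by auto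
  have "continuous_on (ball t e \<inter> {a<..<b}) h" using e(2) by (rule continuous_on_subset) auto
  hence "continuous_on (ball t e \<inter> {a<..<b}) (speed \<A> F \<gamma>)" by (subst continuous_on_cong[OF refl e(3)])
  thus "isCont (speed \<A> F \<gamma>) t" using continuous_on_eq_continuous_at[OF op] tin by blast
 qed
 hence meas: "speed \<A> F \<gamma> \<in> borel_measurable (lebesgue_on {a<..<b})" by (intro continuous_imp_measurable_on_sets_lebesgue) auto
 have "\<exists>M. \<forall>s\<in>{a<..<b}. speed \<A> F \<gamma> s <= M"
 proof (rule bounded_on_open_interval_from_local)
  fix t assume t: "t \<in> {a..b}"
  from local[OF this] obtain e h where e: "0 < e" "continuous_on (ball t e \<inter> {a..b}) h"
   "!!s. s \<in> ball t e \<inter> {a<..<b} ==> speed \<A> F \<gamma> s = h s" by blast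
  let ?K = "cball t (e / 2) \<inter> {a..b}"
  have "continuous_on ?K h" using e(2) by (rule continuous_on_subset) (use e(1) in auto)
  moreover have "compact ?K" by (intro compact_Int_closed) auto
  moreover have "t \<in> ?K" using t e(1) by auto
  ultimately obtain M where M: "!!s. s \<in> ?K ==> h s <= M" using continuous_attains_sup[of ?K h] by blast
  have "speed \<A> F \<gamma> s <= M" if "s \<in> ball t (e / 2) \<inter> {a<..<b}" for s using that e(1) e(3)[of s] M[of s] by auto
  thus "\<exists>e>0. \<exists>M. \<forall>s\<in>ball t e \<inter> {a<..<b}. speed \<A> F \<gamma> s <= M" using e(1) half_gt_zero by blast
 qed
 then obtain M where M: "!!s. s \<in> {a<..<b} ==> speed \<A> F \<gamma> s <= M" by blast
 have "integrable (lebesgue_on {a<..<b}) (speed \<A> F \<gamma>)"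
 proof (rule Bochner_Integration.integrable_bound)
  show "integrable (lebesgue_on {a<..<b}) (%_. M)"
   by (intro finite_measure.integrable_const finite_measureI) (use ab in \<open>simp add: emeasure_restrict_space\<close>)
  show "AE x in lebesgue_on {a<..<b}. norm (speed \<A> F \<gamma> x) <= norm M"
   using M speed_nonneg by (intro AE_I2) (auto intro: order_trans[OF _ abs_ge_self])
 qed (rule meas)
 hence "set_integrable lebesgue {a<..<b} (speed \<A> F \<gamma>)" by (simp add: set_integrable_def integrable_restrict_space)
 hence "(speed \<A> F \<gamma>) absolutely_integrable_on ({a<..<b} \<union> {a, b})"
  by (rule set_integrable_Un[OF _ absolutely_integrable_on_negligible]) (auto intro: negligible_finite)
 moreover have "{a<..<b} \<union> {a, b} = {a..b}" using ab by auto
 ultimately show "set_integrable lebesgue {a..b} (speed \<A> F \<gamma>)" by simp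
qed

text \<open>The properties of a piecewise smooth curve that enter the length estimates;
  \<open>S\<close> absorbs the corners.\<close>

definition admissible :: "(real => 'a) => bool" where
 "admissible \<gamma> \<longleftrightarrow> continuous_on {0..1} \<gamma> &
  (\<exists>S. finite S & (\<forall>t\<in>{0<..<1} - S. curve_differentiable_at \<A> \<gamma> t)) &
  set_integrable lebesgue {0..1} (speed \<A> F \<gamma>)"

lemma piecewise_smooth_admissible:
 assumes "piecewise_smooth_curve \<A> \<gamma>"
 shows "admissible \<gamma>"
proof -
 obtain k \<tau> where \<tau>: "\<tau> 0 = 0" "\<tau> k = 1"
  "!!i. i < k ==> \<tau> i < \<tau> (Suc i)" "!!i. i < k ==> smooth_curve_on \<A> (\<tau> i) (\<tau> (Suc i)) \<gamma>"
  using assms unfolding piecewise_smooth_curve_def by blast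
 have "0 <= \<tau> i & continuous_on {0..\<tau> i} \<gamma> & (\<exists>S. finite S & (\<forall>t\<in>{0<..<\<tau> i} - S. curve_differentiable_at \<A> \<gamma> t)) &
   set_integrable lebesgue {0..\<tau> i} (speed \<A> F \<gamma>)" if "i <= k" for i using that
 proof (induction i)
  case 0
  have "set_integrable lebesgue {0} (speed \<A> F \<gamma>)" by (rule absolutely_integrable_on_negligible) simp
  thus ?case using \<tau>(1) by auto
 next
  case (Suc i)
  hence i: "i < k" by simp
  note piece = smooth_curve_interval[OF \<tau>(4)[OF i] \<tau>(3)[OF i]]
  have un: "{0..\<tau> (Suc i)} = {0..\<tau> i} \<union> {\<tau> i..\<tau> (Suc i)}" using Suc \<tau>(3)[OF i] by auto
  obtain S where S: "finite S" "!!t. t \<in> {0<..<\<tau> i} - S ==> curve_differentiable_at \<A> \<gamma> t" using Suc by auto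
  have "0 <= \<tau> (Suc i)" using Suc \<tau>(3)[OF i] by auto
  moreover have "continuous_on {0..\<tau> (Suc i)} \<gamma>" unfolding un using Suc piece(1) by (intro continuous_on_closed_Un) auto
  moreover have "\<exists>S. finite S & (\<forall>t\<in>{0<..<\<tau> (Suc i)} - S. curve_differentiable_at \<A> \<gamma> t)"
  proof (intro exI conjI ballI)
   show "finite (insert (\<tau> i) S)" using S(1) by simp
   fix t assume "t \<in> {0<..<\<tau> (Suc i)} - insert (\<tau> i) S"
   thus "curve_differentiable_at \<A> \<gamma> t" using S(2)[of t] piece(2)[of t] by (cases "t < \<tau> i") auto
  qed
  moreover have "set_integrable lebesgue {0..\<tau> (Suc i)} (speed \<A> F \<gamma>)"
   unfolding un using Suc piece(3) by (intro set_integrable_Un) auto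
  ultimately show ?case by blast
 qed
 from this[of k] \<tau>(2) show ?thesis unfolding admissible_def by simp
qed

definition len :: "(real => 'a) => real" where
 "len \<gamma> = (LINT t|lebesgue_on {0..1}. speed \<A> F \<gamma> t)"

lemma len_nonneg: "0 <= len \<gamma>" unfolding len_def by (intro Bochner_Integration.integral_nonneg speed_nonneg)

lemma has_integral_len:
 assumes "admissible \<gamma>"
 shows "(speed \<A> F \<gamma> has_integral len \<gamma>) {0..1}"
proof -
 have i: "set_integrable lebesgue {0..1} (speed \<A> F \<gamma>)" using assms unfolding admissible_def by blast
 hence "integrable (lebesgue_on {0..1}) (speed \<A> F \<gamma>)" by (simp add: set_integrable_def integrable_restrict_space)
 thus ?thesis unfolding len_def by (intro has_integral_integral_lebesgue_on) auto
qed

lemma finsler_dist_eq: "d x y = (INF \<gamma> \<in> {\<gamma>. piecewise_smooth_curve \<A> \<gamma> & \<gamma> 0 = x & \<gamma> 1 = y}. len \<gamma>)"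
 unfolding finsler_dist_def len_def ..

lemma dist_le_len: "piecewise_smooth_curve \<A> \<gamma> ==> d (\<gamma> 0) (\<gamma> 1) <= len \<gamma>"
 unfolding finsler_dist_eq by (intro cINF_lower bdd_belowI2[of _ 0] len_nonneg) auto

lemma segment_smooth:
 assumes c: "c \<in> \<A>" and seg: "!!t. 0 <= t ==> t <= 1 ==> u + t *\<^sub>R w \<in> Om c"
 shows "piecewise_smooth_curve \<A> (%t. chart_inv c (u + t *\<^sub>R w))"
proof -
 have "smooth_curve_on \<A> 0 1 (%t. chart_inv c (u + t *\<^sub>R w))" unfolding smooth_curve_on_def
 proof (intro ballI)
  fix t :: real and c' assume t: "t \<in> {0..1}" and "c' \<in> charts_at \<A> (chart_inv c (u + t *\<^sub>R w))"
  hence c': "c' \<in> \<A>" "chart_inv c (u + t *\<^sub>R w) \<in> fst c'" by (auto simp: charts_at_iff)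
  let ?S = "snd c ` (fst c \<inter> fst c')"
  let ?T = "{t :: real. u + t *\<^sub>R w \<in> ?S}"
  have inS: "v \<in> ?S \<longleftrightarrow> v \<in> Om c & chart_inv c v \<in> fst c'" for v
   using chart_inv_chart[OF c] chart_chart_inv[OF c, of v] chart_inv_in[OF c, of v] chart_in[OF c] by (auto intro!: rev_image_eqI)
  have "open ?T" using open_vimage[OF open_overlap[OF c c'(1)], of "%t. u + t *\<^sub>R w"] by (simp add: vimage_def continuous_intros)
  moreover have "t \<in> ?T" using c'(2) seg[of t] t by (simp add: inS)
  ultimately obtain e where e: "0 < e" "ball t e \<subseteq> ?T" by (meson openE)
  have "k_smooth_on k (ball t e) (%t. (snd c' \<circ> chart_inv c) (u + t *\<^sub>R w))" for k
   using k_smooth_on_subset[OF k_smooth_on_affine[OF open_overlap[OF c c'(1)]] e(2)]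
    transition_smooth[OF c c'(1)] unfolding smooth_on_def by blast
  hence "smooth_on (ball t e) (%t. (snd c' \<circ> chart_inv c) (u + t *\<^sub>R w))" unfolding smooth_on_def by blast
  moreover have "\<forall>s\<in>ball t e \<inter> {0..1}. chart_inv c (u + s *\<^sub>R w) \<in> fst c' &
    snd c' (chart_inv c (u + s *\<^sub>R w)) = (snd c' \<circ> chart_inv c) (u + s *\<^sub>R w)" using e(2) inS by auto
  ultimately show "\<exists>e>0. \<exists>g. smooth_on (ball t e) g & (\<forall>s\<in>ball t e \<inter> {0..1}.
    chart_inv c (u + s *\<^sub>R w) \<in> fst c' & snd c' (chart_inv c (u + s *\<^sub>R w)) = g s)" using e(1) by blast
 qed
 thus ?thesis unfolding piecewise_smooth_curve_def by (intro exI[of _ "Suc 0"] exI[of _ real]) auto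
qed

lemma speed_segment:
 assumes c: "c \<in> \<A>" and t: "u + t *\<^sub>R w \<in> Om c"
 shows "speed \<A> F (%t. chart_inv c (u + t *\<^sub>R w)) t = Fc c (u + t *\<^sub>R w) w"
proof -
 let ?\<gamma> = "%t. chart_inv c (u + t *\<^sub>R w)"
 have in_c: "?\<gamma> t \<in> fst c" using chart_inv_in[OF c t] .
 have "isCont (%t. u + t *\<^sub>R w) t" by (intro continuous_intros)
 hence cont: "isCont ?\<gamma> t" using isCont_chart_inv[OF c t] by (rule isCont_o2)
 have op: "open {r. u + r *\<^sub>R w \<in> Om c}"
  using open_vimage[OF open_Om[OF c], of "%t. u + t *\<^sub>R w"] by (simp add: vimage_def continuous_intros)
 have lin: "((%r. u + r *\<^sub>R w) has_vector_derivative w) (at t)" by (auto intro!: derivative_eq_intros)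
 have vd: "((snd c \<circ> ?\<gamma>) has_vector_derivative w) (at t)"
  by (rule has_vector_derivative_transform_within_open[OF lin op]) (use t chart_chart_inv[OF c] in auto)
 have "curve_differentiable_at \<A> ?\<gamma> t"
  using curve_differentiable_at_iff[of c ?\<gamma> t] c in_c cont vd by (auto intro: differentiableI_vector)
 thus ?thesis using speed_chart[of c ?\<gamma> t] c in_c vector_derivative_at[OF vd] chart_chart_inv[OF c t] by simp
qed

end

section \<open>Concatenation of curves and the triangle inequality\<close>

context finsler
begin

lemma smooth_curve_affine:
 assumes sc: "smooth_curve_on \<A> a b \<gamma>" and m: "0 < m" "m * a' + q = a" "m * b' + q = b"
  and eq: "!!s. s \<in> {a'..b'} ==> \<gamma>' s = \<gamma> (m * s + q)"
 shows "smooth_curve_on \<A> a' b' \<gamma>'" unfolding smooth_curve_on_def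
proof (intro ballI)
 fix t c assume t: "t \<in> {a'..b'}" and c: "c \<in> charts_at \<A> (\<gamma>' t)"
 have img: "m * s + q \<in> {a..b}" if "s \<in> {a'..b'}" for s using that m by (auto simp: mult_left_mono)
 have "\<gamma>' t = \<gamma> (m * t + q)" by (rule eq[OF t])
 then obtain e g where e: "0 < e" and g: "smooth_on (ball (m * t + q) e) g"
  and gs: "\<forall>s\<in>ball (m * t + q) e \<inter> {a..b}. \<gamma> s \<in> fst c & snd c (\<gamma> s) = g s"
  using bspec[OF bspec[OF sc[unfolded smooth_curve_on_def] img[OF t]], of c] c by auto
 have ball: "m * s + q \<in> ball (m * t + q) e" if "s \<in> ball t (e / m)" for s
 proof -
  have "\<bar>m * t + q - (m * s + q)\<bar> = m * \<bar>t - s\<bar>" using m(1) by (simp add: abs_mult right_diff_distrib[symmetric])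
  also have "... < e" using that m(1) by (simp add: dist_real_def field_simps)
  finally show ?thesis by (simp add: dist_real_def)
 qed
 have "k_smooth_on k (ball t (e / m)) (%s. g (q + s *\<^sub>R m))" for k
 proof (rule k_smooth_on_subset[OF k_smooth_on_affine[OF open_ball]])
  show "k_smooth_on k (ball (m * t + q) e) g" using g unfolding smooth_on_def by blast
  show "ball t (e / m) \<subseteq> {s. q + s *\<^sub>R m \<in> ball (m * t + q) e}" using ball by (auto simp: mult.commute add.commute)
 qed
 hence "smooth_on (ball t (e / m)) (%s. g (q + s *\<^sub>R m))" unfolding smooth_on_def by blast
 moreover have "\<gamma>' s \<in> fst c & snd c (\<gamma>' s) = g (q + s *\<^sub>R m)" if s: "s \<in> ball t (e / m) \<inter> {a'..b'}" for s
  using bspec[OF gs, of "m * s + q"] ball[of s] img[of s] eq[of s] s by (simp add: mult.commute add.commute)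
 moreover have "0 < e / m" using e m(1) by simp
 ultimately show "\<exists>\<epsilon>>0. \<exists>g. smooth_on (ball t \<epsilon>) g & (\<forall>s\<in>ball t \<epsilon> \<inter> {a'..b'}. \<gamma>' s \<in> fst c & snd c (\<gamma>' s) = g s)"
  by blast
qed

definition concat_curve :: "(real => 'a) => (real => 'a) => real => 'a" where
 "concat_curve \<gamma>1 \<gamma>2 t = (if t <= 1/2 then \<gamma>1 (2 * t) else \<gamma>2 (2 * t - 1))"

lemma concat_piecewise_smooth:
 assumes "piecewise_smooth_curve \<A> \<gamma>1" "piecewise_smooth_curve \<A> \<gamma>2" and j: "\<gamma>1 1 = \<gamma>2 0"
 shows "piecewise_smooth_curve \<A> (concat_curve \<gamma>1 \<gamma>2)"
proof -
 obtain k1 \<tau>1 where t1: "\<tau>1 0 = 0" "\<tau>1 k1 = 1" "!!i. i < k1 ==> \<tau>1 i < \<tau>1 (Suc i)"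
  "!!i. i < k1 ==> smooth_curve_on \<A> (\<tau>1 i) (\<tau>1 (Suc i)) \<gamma>1"
  using assms(1) unfolding piecewise_smooth_curve_def by blast
 obtain k2 \<tau>2 where t2: "\<tau>2 0 = 0" "\<tau>2 k2 = 1" "!!i. i < k2 ==> \<tau>2 i < \<tau>2 (Suc i)"
  "!!i. i < k2 ==> smooth_curve_on \<A> (\<tau>2 i) (\<tau>2 (Suc i)) \<gamma>2"
  using assms(2) unfolding piecewise_smooth_curve_def by blast
 have m1: "\<tau>1 i <= 1" if "i <= k1" for i using that
 proof (induction rule: inc_induct)
  case base thus ?case using t1 by simp
 next
  case (step n) thus ?case using t1(3)[of n] by linarith
 qed
 have m2: "0 <= \<tau>2 i" if "i <= k2" for i using that
 proof (induction i)
  case 0 thus ?case using t2 by simp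
 next
  case (Suc n) thus ?case using t2(3)[of n] by auto
 qed
 define \<tau> where "\<tau> i = (if i <= k1 then \<tau>1 i / 2 else 1/2 + \<tau>2 (i - k1) / 2)" for i
 have "\<tau> i < \<tau> (Suc i) & smooth_curve_on \<A> (\<tau> i) (\<tau> (Suc i)) (concat_curve \<gamma>1 \<gamma>2)" if i: "i < k1 + k2" for i
 proof (cases "i < k1")
  case True
  hence eq: "\<tau> i = \<tau>1 i / 2" "\<tau> (Suc i) = \<tau>1 (Suc i) / 2" by (auto simp: \<tau>_def)
  have "smooth_curve_on \<A> (\<tau>1 i / 2) (\<tau>1 (Suc i) / 2) (concat_curve \<gamma>1 \<gamma>2)"
   by (rule smooth_curve_affine[OF t1(4)[OF True], where m = 2 and q = 0])
    (use m1[of "Suc i"] True in \<open>auto simp: concat_curve_def\<close>)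
  thus ?thesis using t1(3)[OF True] by (simp add: eq)
 next
  case False
  define n where "n = i - k1"
  have n: "i = k1 + n" "n < k2" using False i by (auto simp: n_def)
  have eq: "\<tau> i = 1/2 + \<tau>2 n / 2" "\<tau> (Suc i) = 1/2 + \<tau>2 (Suc n) / 2" using t1(2) t2(1) by (auto simp: \<tau>_def n)
  have "smooth_curve_on \<A> (1/2 + \<tau>2 n / 2) (1/2 + \<tau>2 (Suc n) / 2) (concat_curve \<gamma>1 \<gamma>2)"
  proof (rule smooth_curve_affine[OF t2(4)[OF n(2)], where m = 2 and q = "-1"])
   fix s assume "s \<in> {1/2 + \<tau>2 n / 2..1/2 + \<tau>2 (Suc n) / 2}"
   hence "1/2 <= s" using m2[of n] n by auto
   thus "concat_curve \<gamma>1 \<gamma>2 s = \<gamma>2 (2 * s + -1)"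
   proof (cases "s = 1/2")
    case True
    show ?thesis unfolding True concat_curve_def using j by simp
   qed (auto simp: concat_curve_def)
  qed auto
  thus ?thesis using t2(3)[OF n(2)] by (simp add: eq)
 qed
 moreover have "0 < k2" using t2(1,2) by (cases k2) auto
 hence "\<tau> 0 = 0" "\<tau> (k1 + k2) = 1" using t1(1) t2(2) by (auto simp: \<tau>_def)
 ultimately show ?thesis unfolding piecewise_smooth_curve_def by (intro exI[of _ "k1 + k2"] exI[of _ \<tau>]) blast
qed

text \<open>The factor \<open>m\<close> has to be positive because the metric is only positively
  homogeneous.\<close>

lemma speed_affine:
 assumes m: "0 < m" and ev: "\<forall>\<^sub>F s in nhds t. \<gamma>' s = \<gamma> (m * s + q)"
  and cd: "curve_differentiable_at \<A> \<gamma> (m * t + q)"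
 shows "speed \<A> F \<gamma>' t = m * speed \<A> F \<gamma> (m * t + q)"
proof -
 obtain c where c: "c \<in> \<A>" "\<gamma> (m * t + q) \<in> fst c" using ex_chart by blast
 have e: "\<gamma>' t = \<gamma> (m * t + q)" using eventually_nhds_x_imp_x[OF ev] .
 have cont: "isCont \<gamma> (m * t + q)" and df: "(snd c \<circ> \<gamma>) differentiable (at (m * t + q))"
  using cd curve_differentiable_at_iff[of c \<gamma> "m * t + q"] c by auto
 let ?v = "vector_derivative (snd c \<circ> \<gamma>) (at (m * t + q))"
 have lin: "((%s. m * s + q) has_real_derivative m) (at t)" by (auto intro!: derivative_eq_intros)
 have V: "((snd c \<circ> \<gamma>) has_vector_derivative ?v) (at (m * t + q))" using df by (simp add: vector_derivative_works)
 have V0: "((snd c \<circ> \<gamma>) \<circ> (%s. m * s + q) has_vector_derivative m *\<^sub>R ?v) (at t)"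
  using vector_diff_chain_at[OF lin[unfolded has_real_derivative_iff_has_vector_derivative], of "snd c \<circ> \<gamma>" ?v] V by simp
 obtain U where U: "open U" "t \<in> U" "!!s. s \<in> U ==> \<gamma>' s = \<gamma> (m * s + q)"
  using ev unfolding eventually_nhds by blast
 have V': "((snd c \<circ> \<gamma>') has_vector_derivative m *\<^sub>R ?v) (at t)"
  by (rule has_vector_derivative_transform_within_open[OF V0 U(1,2)]) (simp add: U(3))
 have "isCont (%s. m * s + q) t" by (intro continuous_intros)
 hence "isCont (%s. \<gamma> (m * s + q)) t" using cont by (rule isCont_o2)
 hence cont': "isCont \<gamma>' t" using isCont_cong[OF ev] by simp
 have cd': "curve_differentiable_at \<A> \<gamma>' t"
  using curve_differentiable_at_iff[of c \<gamma>' t] c e cont' V' by (auto intro: differentiableI_vector)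
 have "speed \<A> F \<gamma>' t = Fc c (snd c (\<gamma> (m * t + q))) (m *\<^sub>R ?v)"
  using speed_chart[of c \<gamma>' t] c e cd' vector_derivative_at[OF V'] by simp
 also have "... = m * Fc c (snd c (\<gamma> (m * t + q))) ?v" using Fc_scale[OF c(1) chart_in[OF c], of m] m by simp
 also have "... = m * speed \<A> F \<gamma> (m * t + q)" using speed_chart[of c \<gamma> "m * t + q"] c cd by simp
 finally show ?thesis .
qed

text \<open>On each half the speed is twice that of the reparametrised piece, except at the finitely
  many corners, the junction and the end points; finite sets do not change the integral.\<close>

lemma len_concat:
 assumes ps: "piecewise_smooth_curve \<A> \<gamma>1" "piecewise_smooth_curve \<A> \<gamma>2" and j: "\<gamma>1 1 = \<gamma>2 0"
 shows "len (concat_curve \<gamma>1 \<gamma>2) = len \<gamma>1 + len \<gamma>2"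
proof -
 let ?\<gamma> = "concat_curve \<gamma>1 \<gamma>2"
 note adm = ps[THEN piecewise_smooth_admissible]
 obtain S1 where S1: "finite S1" "!!t. t \<in> {0<..<1} - S1 ==> curve_differentiable_at \<A> \<gamma>1 t"
  using adm(1) unfolding admissible_def by blast
 obtain S2 where S2: "finite S2" "!!t. t \<in> {0<..<1} - S2 ==> curve_differentiable_at \<A> \<gamma>2 t"
  using adm(2) unfolding admissible_def by blast
 have I1: "((%t. 2 * speed \<A> F \<gamma>1 (2 * t + 0)) has_integral len \<gamma>1) {0..1/2}"
 proof -
  have "((%t. speed \<A> F \<gamma>1 (2 * t + 0)) has_integral len \<gamma>1 / 2) {0..1/2}"
   using has_integral_affinity[OF has_integral_len[OF adm(1), unfolded box_real(2)[symmetric]], of 2 0] by (simp add: image_affinity_cbox)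
  from has_integral_mult_right[OF this, of 2] show ?thesis by simp
 qed
 have I2: "((%t. 2 * speed \<A> F \<gamma>2 (2 * t + -1)) has_integral len \<gamma>2) {1/2..1}"
 proof -
  have "((%t. speed \<A> F \<gamma>2 (2 * t + -1)) has_integral len \<gamma>2 / 2) {1/2..1}"
   using has_integral_affinity[OF has_integral_len[OF adm(2), unfolded box_real(2)[symmetric]], of 2 "-1"]
   by (simp add: image_affinity_cbox image_affinity_atLeastAtMost_div)
  from has_integral_mult_right[OF this, of 2] show ?thesis by simp
 qed
 have J1: "(speed \<A> F ?\<gamma> has_integral len \<gamma>1) {0..1/2}"
 proof (rule has_integral_spike_finite[OF _ _ I1])
  show "finite ((%t. t / 2) ` S1 \<union> {0, 1/2})" using S1(1) by simp
  fix t assume t: "t \<in> {0..1/2} - ((%t. t / 2) ` S1 \<union> {0, 1/2})"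
  hence t': "0 < t" "t < 1/2" by auto
  have "2 * t \<notin> S1"
  proof
   assume "2 * t \<in> S1"
   hence "2 * t / 2 \<in> (%t. t / 2) ` S1" by (rule imageI)
   thus False using t by simp
  qed
  hence cd: "curve_differentiable_at \<A> \<gamma>1 (2 * t + 0)" using S1(2)[of "2 * t"] t' by simp
  have "\<forall>\<^sub>F s in nhds t. s \<in> {..<1/2}" using t' by (intro eventually_nhds_in_open) auto
  hence "\<forall>\<^sub>F s in nhds t. ?\<gamma> s = \<gamma>1 (2 * s + 0)" by (rule eventually_mono) (simp add: concat_curve_def)
  thus "speed \<A> F ?\<gamma> t = 2 * speed \<A> F \<gamma>1 (2 * t + 0)" using cd by (intro speed_affine) auto
 qed
 have J2: "(speed \<A> F ?\<gamma> has_integral len \<gamma>2) {1/2..1}"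
 proof (rule has_integral_spike_finite[OF _ _ I2])
  show "finite ((%t. (t + 1) / 2) ` S2 \<union> {1/2, 1})" using S2(1) by simp
  fix t assume t: "t \<in> {1/2..1} - ((%t. (t + 1) / 2) ` S2 \<union> {1/2, 1})"
  hence t': "1/2 < t" "t < 1" by auto
  have "2 * t + -1 \<notin> S2"
  proof
   assume "2 * t + -1 \<in> S2"
   hence "(2 * t + -1 + 1) / 2 \<in> (%t. (t + 1) / 2) ` S2" by (rule imageI)
   thus False using t by simp
  qed
  hence cd: "curve_differentiable_at \<A> \<gamma>2 (2 * t + -1)" using S2(2)[of "2 * t + -1"] t' by simp
  have "\<forall>\<^sub>F s in nhds t. s \<in> {1/2<..}" using t' by (intro eventually_nhds_in_open) auto
  hence "\<forall>\<^sub>F s in nhds t. ?\<gamma> s = \<gamma>2 (2 * s + -1)" by (rule eventually_mono) (simp add: concat_curve_def)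
  thus "speed \<A> F ?\<gamma> t = 2 * speed \<A> F \<gamma>2 (2 * t + -1)" using cd by (intro speed_affine) auto
 qed
 have "(speed \<A> F ?\<gamma> has_integral (len \<gamma>1 + len \<gamma>2)) {0..1}" by (rule has_integral_combine[OF _ _ J1 J2]) auto
 thus ?thesis using has_integral_len[OF piecewise_smooth_admissible[OF concat_piecewise_smooth[OF ps j]]] has_integral_unique by blast
qed

text \<open>Any two points of a coordinate ball are joined by a segment, and joining is transitive.
  The set of points reachable from \<open>x\<close> is thus open and closed, hence everything by
  connectedness. The infimum that defines the distance is therefore over a nonempty set.\<close>

lemma ex_curve: "\<exists>\<gamma>. piecewise_smooth_curve \<A> \<gamma> & \<gamma> 0 = x & \<gamma> 1 = y"
proof -
 define R where "R x y \<longleftrightarrow> (\<exists>\<gamma>. piecewise_smooth_curve \<A> \<gamma> & \<gamma> 0 = x & \<gamma> 1 = y)" for x y :: 'a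
 have trans: "R x z" if xy: "R x y" and yz: "R y z" for x y z
 proof -
  obtain \<gamma>1 where g1: "piecewise_smooth_curve \<A> \<gamma>1" "\<gamma>1 0 = x" "\<gamma>1 1 = y" using xy unfolding R_def by blast
  obtain \<gamma>2 where g2: "piecewise_smooth_curve \<A> \<gamma>2" "\<gamma>2 0 = y" "\<gamma>2 1 = z" using yz unfolding R_def by blast
  show ?thesis unfolding R_def
   using concat_piecewise_smooth[OF g1(1) g2(1)] g1 g2 by (intro exI[of _ "concat_curve \<gamma>1 \<gamma>2"]) (simp add: concat_curve_def)
 qed
 have local: "\<exists>U. open U & x \<in> U & (\<forall>y\<in>U. \<forall>z\<in>U. R y z)" for x
 proof -
  obtain c where c: "c \<in> \<A>" "x \<in> fst c" using ex_chart by blast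
  obtain r where r: "0 < r" "ball (snd c x) r \<subseteq> Om c" using open_Om[OF c(1)] chart_in[OF c] by (meson openE)
  let ?U = "fst c \<inter> snd c -` ball (snd c x) r"
  have "open ?U" using continuous_open_preimage[OF continuous_chart[OF c(1)] open_chart[OF c(1)] open_ball] .
  moreover have "x \<in> ?U" using c r by simp
  moreover have "R y z" if "y \<in> ?U" "z \<in> ?U" for y z
  proof -
   have in_ball: "snd c y + t *\<^sub>R (snd c z - snd c y) \<in> ball (snd c x) r" if "0 <= t" "t <= 1" for t
   proof -
    have "(1 - t) *\<^sub>R snd c y + t *\<^sub>R snd c z \<in> ball (snd c x) r"
     using \<open>y \<in> ?U\<close> \<open>z \<in> ?U\<close> that by (intro convexD[OF convex_ball]) auto
    thus ?thesis by (simp add: algebra_simps)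
   qed
   hence "piecewise_smooth_curve \<A> (%t. chart_inv c (snd c y + t *\<^sub>R (snd c z - snd c y)))"
    using r(2) by (intro segment_smooth c) blast
   thus ?thesis unfolding R_def using that
    by (intro exI[of _ "%t. chart_inv c (snd c y + t *\<^sub>R (snd c z - snd c y))"]) (simp add: chart_inv_chart[OF c(1)])
  qed
  ultimately show ?thesis by blast
 qed
 have refl: "R x x" using local[of x] by blast
 have "open {y. R x y}"
 proof (subst open_subopen, rule ballI)
  fix y assume y: "y \<in> {y. R x y}"
  obtain U where U: "open U" "y \<in> U" "!!u v. u \<in> U ==> v \<in> U ==> R u v" using local[of y] by blast
  have "U \<subseteq> {y. R x y}" using U(2,3) y trans by blast
  thus "\<exists>T. open T & y \<in> T & T \<subseteq> {y. R x y}" using U by blast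
 qed
 moreover have "open (- {y. R x y})"
 proof (subst open_subopen, rule ballI)
  fix y assume y: "y \<in> - {y. R x y}"
  obtain U where U: "open U" "y \<in> U" "!!u v. u \<in> U ==> v \<in> U ==> R u v" using local[of y] by blast
  have "U \<subseteq> - {y. R x y}" using U(2,3) y trans by blast
  thus "\<exists>T. open T & y \<in> T & T \<subseteq> - {y. R x y}" using U by blast
 qed
 moreover have "connected (UNIV :: 'a set)" using finsler unfolding finsler_manifold_def by (elim conjE)
 hence "open S ==> open (- S) ==> S = {} \<or> S = UNIV" for S :: "'a set"
  unfolding connected_clopen by (simp add: closed_def)
 ultimately have "{y. R x y} = {} \<or> {y. R x y} = UNIV" by blast
 hence "R x y" using refl by blast
 thus ?thesis unfolding R_def .
qed

lemma dist_nonneg: "0 <= d x y" unfolding finsler_dist_eq using ex_curve by (intro cINF_greatest len_nonneg) auto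

lemma ex_almost_minimising:
 assumes "d x y < e"
 shows "\<exists>\<gamma>. piecewise_smooth_curve \<A> \<gamma> & \<gamma> 0 = x & \<gamma> 1 = y & len \<gamma> < e"
proof -
 let ?S = "{\<gamma>. piecewise_smooth_curve \<A> \<gamma> & \<gamma> 0 = x & \<gamma> 1 = y}"
 have "?S ~= {}" using ex_curve by blast
 moreover have "bdd_below (len ` ?S)" by (intro bdd_belowI2[of _ 0] len_nonneg)
 ultimately have "\<exists>\<gamma>\<in>?S. len \<gamma> < e" using assms unfolding finsler_dist_eq by (subst (asm) cINF_less_iff)
 thus ?thesis by blast
qed

lemma dist_triangle_ineq: "d x z <= d x y + d y z"
proof (rule field_le_epsilon)
 fix e :: real assume e: "0 < e"
 obtain \<gamma>1 where g1: "piecewise_smooth_curve \<A> \<gamma>1" "\<gamma>1 0 = x" "\<gamma>1 1 = y" "len \<gamma>1 < d x y + e / 2"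
  using ex_almost_minimising[of x y "d x y + e / 2"] e by auto
 obtain \<gamma>2 where g2: "piecewise_smooth_curve \<A> \<gamma>2" "\<gamma>2 0 = y" "\<gamma>2 1 = z" "len \<gamma>2 < d y z + e / 2"
  using ex_almost_minimising[of y z "d y z + e / 2"] e by auto
 have "d (concat_curve \<gamma>1 \<gamma>2 0) (concat_curve \<gamma>1 \<gamma>2 1) <= len (concat_curve \<gamma>1 \<gamma>2)"
  using g1 g2 by (intro dist_le_len concat_piecewise_smooth) auto
 thus "d x z <= d x y + d y z + e" using g1 g2 len_concat[OF g1(1) g2(1)] by (simp add: concat_curve_def)
qed

end

section \<open>Local comparison of the distance with a fixed norm\<close>

context finsler
begin

text \<open>Extreme values on the compact Euclidean unit sphere, spread to all vectors by positive
  homogeneity.\<close>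

lemma Fc_norm_bounds:
 assumes c: "c \<in> \<A>" "u \<in> Om c"
 shows "\<exists>\<alpha> \<beta>. 0 < \<alpha> & 0 < \<beta> & (\<forall>y. \<alpha> * norm y <= Fc c u y & Fc c u y <= \<beta> * norm y)"
proof -
 interpret N: minkowski_norm "Fc c u" "%z. (Fc c u z)\<^sup>2 / 2" by (rule minkowski_norm_Fc[OF c])
 have "continuous_on (sphere 0 1) (%y. (u, y))" by (intro continuous_intros)
 hence "continuous_on (sphere 0 1) (%y. (%(u, y). Fc c u y) (u, y))"
  by (rule continuous_on_compose2[OF Fc_continuous[OF c(1)]]) (use c in auto)
 hence cont: "continuous_on (sphere 0 1) (Fc c u)" by simp
 have ne: "sphere (0 :: real ^ 'n) 1 ~= {}" by simp
 obtain y0 where y0: "y0 \<in> sphere 0 1" "!!y. y \<in> sphere 0 1 ==> Fc c u y0 <= Fc c u y"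
  using continuous_attains_inf[OF compact_sphere ne cont] by blast
 obtain y1 where y1: "y1 \<in> sphere 0 1" "!!y. y \<in> sphere 0 1 ==> Fc c u y <= Fc c u y1"
  using continuous_attains_sup[OF compact_sphere ne cont] by blast
 have "y0 ~= 0" using y0(1) by auto
 hence pos: "0 < Fc c u y0" by (rule N.N_pos)
 have "Fc c u y0 * norm y <= Fc c u y & Fc c u y <= Fc c u y1 * norm y" for y
 proof (cases "y = 0")
  case True
  thus ?thesis by (simp add: N.N_zero)
 next
  case False
  let ?z = "(1 / norm y) *\<^sub>R y"
  have "?z \<in> sphere 0 1" "y = norm y *\<^sub>R ?z" using False by auto
  hence "Fc c u y = norm y * Fc c u ?z" using N.N_scale[of "norm y" ?z] by simp
  thus ?thesis using y0(2)[OF \<open>?z \<in> sphere 0 1\<close>] y1(2)[OF \<open>?z \<in> sphere 0 1\<close>]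
   by (simp add: mult.commute mult_left_mono)
 qed
 moreover have "0 < Fc c u y1" using pos y0(2)[OF y1(1)] by simp
 ultimately show ?thesis using pos by blast
qed

text \<open>The error is relative to the norm at the centre, so that the comparison survives
  rescaling of \<open>y\<close> and integrates to lengths.\<close>

definition adapted :: "('a, 'n) chart => real ^ 'n => real => real => bool" where
 "adapted c u0 e r \<longleftrightarrow> c \<in> \<A> & u0 \<in> Om c & 0 < r & 0 < e & e < 1 & cball u0 r \<subseteq> Om c &
  (\<forall>u\<in>cball u0 r. \<forall>y. \<bar>Fc c u y - Fc c u0 y\<bar> <= e * Fc c u0 y)"

text \<open>Uniform continuity on a compact ball times the unit sphere bounds the absolute error on
  unit vectors by \<open>e * \<alpha>\<close>; the lower bound \<open>\<alpha>\<close> of the norm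
  makes this a relative error \<open>e\<close>.\<close>

lemma ex_adapted:
 assumes c: "c \<in> \<A>" "u0 \<in> Om c" and e: "0 < e" "e < 1"
 shows "\<exists>r. adapted c u0 e r"
proof -
 obtain \<alpha> \<beta> where ab: "0 < \<alpha>" "!!y. \<alpha> * norm y <= Fc c u0 y" using Fc_norm_bounds[OF c] by blast
 obtain r0 where r0: "0 < r0" "cball u0 r0 \<subseteq> Om c" using open_Om[OF c(1)] c(2) open_contains_cball by blast
 let ?K = "cball u0 r0 \<times> sphere (0 :: real ^ 'n) 1"
 have "continuous_on ?K (%(u, y). Fc c u y)" using r0(2) by (intro continuous_on_subset[OF Fc_continuous[OF c(1)]]) auto
 hence "uniformly_continuous_on ?K (%(u, y). Fc c u y)"
  by (rule compact_uniformly_continuous) (intro compact_Times compact_cball compact_sphere)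
 then obtain \<delta> where \<delta>: "0 < \<delta>" "!!z z'. z \<in> ?K ==> z' \<in> ?K ==> dist z' z < \<delta> ==>
   dist ((%(u, y). Fc c u y) z') ((%(u, y). Fc c u y) z) < e * \<alpha>"
  unfolding uniformly_continuous_on_def using e ab(1) by (metis mult_pos_pos)
 define r where "r = min r0 (\<delta> / 2)"
 have r: "0 < r" "r <= r0" "r < \<delta>" using r0 \<delta>(1) by (auto simp: r_def)
 have unit: "\<bar>Fc c u y - Fc c u0 y\<bar> <= e * Fc c u0 y" if "u \<in> cball u0 r" "norm y = 1" for u y
 proof -
  have "dist (u, y) (u0, y) < \<delta>" using that r by (simp add: dist_Pair_Pair dist_commute)
  moreover have "(u0, y) \<in> ?K" "(u, y) \<in> ?K" using that r r0 by auto
  ultimately have "dist (Fc c u y) (Fc c u0 y) < e * \<alpha>" using \<delta>(2)[of "(u0, y)" "(u, y)"] by simp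
  also have "... <= e * Fc c u0 y" using ab(2)[of y] that e by simp
  finally show ?thesis by (simp add: dist_real_def)
 qed
 have sub: "cball u0 r \<subseteq> Om c" using r r0 by force
 have "\<bar>Fc c u y - Fc c u0 y\<bar> <= e * Fc c u0 y" if u: "u \<in> cball u0 r" for u y
 proof (cases "y = 0")
  case True
  have "u \<in> Om c" using u sub by blast
  thus ?thesis using True Fc_zero[OF c(1)] c(2) by simp
 next
  case False
  let ?z = "(1 / norm y) *\<^sub>R y"
  have z: "norm ?z = 1" "y = norm y *\<^sub>R ?z" using False by auto
  have uO: "u \<in> Om c" using u sub by blast
  have E: "Fc c u y = norm y * Fc c u ?z" "Fc c u0 y = norm y * Fc c u0 ?z"
   using Fc_scale[OF c(1) uO, of "norm y" ?z] Fc_scale[OF c, of "norm y" ?z] z(2) by simp_all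
  have "\<bar>norm y * Fc c u ?z - norm y * Fc c u0 ?z\<bar> = norm y * \<bar>Fc c u ?z - Fc c u0 ?z\<bar>"
   by (simp add: abs_mult right_diff_distrib[symmetric])
  also have "... <= norm y * (e * Fc c u0 ?z)" using unit[OF u z(1)] by (intro mult_left_mono) auto
  finally show ?thesis unfolding E by (simp add: mult.left_commute)
 qed
 thus ?thesis unfolding adapted_def using c e r sub by blast
qed

context
 fixes c :: "('a, 'n) chart" and u0 :: "real ^ 'n" and e r :: real
 assumes ad: "adapted c u0 e r"
begin

lemma adapted_facts: "c \<in> \<A>" "u0 \<in> Om c" "0 < r" "0 < e" "e < 1" "cball u0 r \<subseteq> Om c" using ad by (simp_all add: adapted_def)

lemma adapted_Fc:
 assumes "u \<in> cball u0 r"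
 shows "(1 - e) * Fc c u0 y <= Fc c u y" "Fc c u y <= (1 + e) * Fc c u0 y"
proof -
 have "\<forall>u\<in>cball u0 r. \<forall>y. \<bar>Fc c u y - Fc c u0 y\<bar> <= e * Fc c u0 y" using ad unfolding adapted_def by (elim conjE)
 from bspec[OF this assms] have "\<bar>Fc c u y - Fc c u0 y\<bar> <= e * Fc c u0 y" by (rule spec)
 thus "(1 - e) * Fc c u0 y <= Fc c u y" "Fc c u y <= (1 + e) * Fc c u0 y" by (auto simp: left_diff_distrib distrib_right abs_le_iff)
qed

text \<open>The straight coordinate segment stays in the convex ball and is a competitor in the
  infimum.\<close>

lemma dist_upper:
 assumes "u \<in> cball u0 r" "v \<in> cball u0 r"
 shows "d (chart_inv c u) (chart_inv c v) <= (1 + e) * Fc c u0 (v - u)"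
proof -
 let ?\<gamma> = "%t. chart_inv c (u + t *\<^sub>R (v - u))"
 have in_ball: "u + t *\<^sub>R (v - u) \<in> cball u0 r" if "0 <= t" "t <= 1" for t
 proof -
  have "(1 - t) *\<^sub>R u + t *\<^sub>R v \<in> cball u0 r" using assms that by (intro convexD[OF convex_cball]) auto
  thus ?thesis by (simp add: algebra_simps)
 qed
 have inO: "u + t *\<^sub>R (v - u) \<in> Om c" if "0 <= t" "t <= 1" for t using in_ball[OF that] adapted_facts(6) by (rule subsetD[rotated])
 have ps: "piecewise_smooth_curve \<A> ?\<gamma>" by (rule segment_smooth[OF adapted_facts(1) inO])
 have "d (?\<gamma> 0) (?\<gamma> 1) <= len ?\<gamma>" by (rule dist_le_len[OF ps])
 also have "len ?\<gamma> <= (1 + e) * Fc c u0 (v - u)"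
 proof (rule has_integral_le[OF has_integral_len[OF piecewise_smooth_admissible[OF ps]]])
  show "((%_. (1 + e) * Fc c u0 (v - u)) has_integral (1 + e) * Fc c u0 (v - u)) {0..1 :: real}"
   using has_integral_const_real[of "(1 + e) * Fc c u0 (v - u)" 0 1] by simp
  fix t :: real assume t: "t \<in> {0..1}"
  hence "speed \<A> F ?\<gamma> t = Fc c (u + t *\<^sub>R (v - u)) (v - u)" using speed_segment[OF adapted_facts(1) inO[of t]] by auto
  also have "... <= (1 + e) * Fc c u0 (v - u)" using in_ball[of t] t by (intro adapted_Fc) auto
  finally show "speed \<A> F ?\<gamma> t <= (1 + e) * Fc c u0 (v - u)" .
 qed
 finally show ?thesis by simp
qed

text \<open>A linear functional below the norm at \<open>u0\<close>, equal to it on the total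
  displacement, is integrated along the curve: the fundamental theorem of calculus gives its value
  on the displacement, the pointwise bound gives the length.\<close>

lemma len_lower_inside:
 assumes adm: "admissible \<gamma>" and T: "0 <= T" "T <= 1"
  and inside: "!!t. t \<in> {0..T} ==> \<gamma> t \<in> fst c & snd c (\<gamma> t) \<in> cball u0 r"
 shows "(1 - e) * Fc c u0 (snd c (\<gamma> T) - snd c (\<gamma> 0)) <= len \<gamma>"
proof -
 interpret N: minkowski_norm "Fc c u0" "%z. (Fc c u0 z)\<^sup>2 / 2" by (rule minkowski_norm_Fc[OF adapted_facts(1,2)])
 let ?w = "snd c (\<gamma> T) - snd c (\<gamma> 0)"
 obtain l where l: "linear l" "l ?w = Fc c u0 ?w" "!!v. l v <= Fc c u0 v" using N.support_functional[of ?w] by blast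
 obtain S where S: "finite S" "!!t. t \<in> {0<..<1} - S ==> curve_differentiable_at \<A> \<gamma> t"
  using adm unfolding admissible_def by blast
 define x where "x = snd c \<circ> \<gamma>"
 \<comment> \<open>At corners and at the end points the value 0 keeps the comparison with the
   nonnegative speed valid everywhere.\<close>
 define x' where "x' t = (if t \<in> S \<or> t \<notin> {0<..<T} then 0 else vector_derivative x (at t))" for t
 have cd: "curve_differentiable_at \<A> \<gamma> t" if "t \<in> {0<..<T} - S" for t using that T S(2)[of t] by auto
 have "continuous_on {0..T} \<gamma>" using adm T unfolding admissible_def by (auto intro: continuous_on_subset)
 hence cx: "continuous_on {0..T} x" unfolding x_def o_def using inside
  by (intro continuous_on_compose2[OF continuous_chart[OF adapted_facts(1)]]) auto
 have "(x' has_integral x T - x 0) {0..T}"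
 proof (rule fundamental_theorem_of_calculus_interior_strong[OF S(1) T(1) _ cx])
  fix t assume t: "t \<in> {0<..<T} - S"
  hence "x differentiable (at t)"
   using curve_differentiable_at_iff[of c \<gamma> t] cd[OF t] adapted_facts(1) inside[of t] unfolding x_def by auto
  thus "(x has_vector_derivative x' t) (at t)" using t by (simp add: x'_def vector_derivative_works)
 qed
 hence "((l \<circ> x') has_integral l (x T - x 0)) {0..T}" using l(1) by (intro has_integral_linear) (simp_all add: linear_conv_bounded_linear)
 hence H1: "((%t. (1 - e) * l (x' t)) has_integral (1 - e) * l ?w) {0..T}" unfolding o_def x_def by (intro has_integral_mult_right) simp
 have "set_integrable lebesgue {0..1} (speed \<A> F \<gamma>)" using adm unfolding admissible_def by (elim conjE)
 hence "set_integrable lebesgue {0..T} (speed \<A> F \<gamma>)" by (rule set_integrable_subset) (use T in auto)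
 hence i: "speed \<A> F \<gamma> integrable_on {0..T}" by (rule set_lebesgue_integral_eq_integral(1))
 have "(1 - e) * l ?w <= integral {0..T} (speed \<A> F \<gamma>)"
 proof (rule has_integral_le[OF H1 integrable_integral[OF i]])
  fix t assume t: "t \<in> {0..T}"
  show "(1 - e) * l (x' t) <= speed \<A> F \<gamma> t"
  proof (cases "t \<in> {0<..<T} - S")
   case False
   hence "x' t = 0" by (auto simp: x'_def)
   thus ?thesis using speed_nonneg linear_0[OF l(1)] by simp
  next
   case True
   have "(1 - e) * l (x' t) <= (1 - e) * Fc c u0 (x' t)" using adapted_facts(5) l(3) by (intro mult_left_mono) auto
   also have "... <= Fc c (snd c (\<gamma> t)) (x' t)" using inside[OF t] by (intro adapted_Fc) simp
   also have "... = speed \<A> F \<gamma> t"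
    using speed_chart[of c \<gamma> t] adapted_facts(1) inside[OF t] cd[OF True] True by (simp add: x'_def x_def)
   finally show ?thesis .
  qed
 qed
 also have "... <= len \<gamma>" by (rule has_integral_subset_le[OF _ integrable_integral[OF i] has_integral_len[OF adm]])
   (use T speed_nonneg in auto)
 finally show ?thesis unfolding l(2) .
qed

text \<open>The curve is followed up to the first time \<open>T\<close> outside the open coordinate
  ball, where it has reached the sphere of radius \<open>r\<close>; if there is no such time, it
  stays inside to the end.\<close>

lemma len_lower:
 assumes ps: "piecewise_smooth_curve \<A> \<gamma>" and g0: "\<gamma> 0 \<in> fst c" "snd c (\<gamma> 0) \<in> ball u0 r"
 shows "(\<gamma> 1 \<in> fst c & snd c (\<gamma> 1) \<in> cball u0 r & (1 - e) * Fc c u0 (snd c (\<gamma> 1) - snd c (\<gamma> 0)) <= len \<gamma>) \<or>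
  (\<exists>v. norm (v - u0) = r & (1 - e) * Fc c u0 (v - snd c (\<gamma> 0)) <= len \<gamma>)"
proof -
 note c = adapted_facts(1)
 have adm: "admissible \<gamma>" by (rule piecewise_smooth_admissible[OF ps])
 have cont: "continuous_on {0..1} \<gamma>" using adm unfolding admissible_def by (elim conjE)
 define B where "B = fst c \<inter> snd c -` ball u0 r"
 \<comment> \<open>Compact, hence closed in the Hausdorff manifold: the curve cannot leave the chart
   domain before its coordinates reach the sphere.\<close>
 define K where "K = chart_inv c ` cball u0 r"
 have "open B" unfolding B_def using continuous_open_preimage[OF continuous_chart[OF c] open_chart[OF c] open_ball] .
 have K_iff: "x \<in> K \<longleftrightarrow> x \<in> fst c & snd c x \<in> cball u0 r" for x
 proof
  assume "x \<in> K"
  then obtain u where u: "u \<in> cball u0 r" "x = chart_inv c u" unfolding K_def by (rule imageE) blast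
  have "u \<in> Om c" using u(1) adapted_facts(6) by (rule subsetD[rotated])
  thus "x \<in> fst c & snd c x \<in> cball u0 r" using u chart_inv_in[OF c] chart_chart_inv[OF c] by simp
 next
  assume x: "x \<in> fst c & snd c x \<in> cball u0 r"
  hence "x = chart_inv c (snd c x)" using chart_inv_chart[OF c] by simp
  thus "x \<in> K" unfolding K_def using x by (intro rev_image_eqI[of "snd c x"]) auto
 qed
 have "compact K" unfolding K_def by (intro compact_continuous_image continuous_on_subset[OF continuous_chart_inv[OF c]] adapted_facts compact_cball)
 hence "closed K" by (rule compact_imp_closed)
 have BK: "x \<in> B ==> x \<in> K" for x unfolding K_iff B_def by auto
 define Z where "Z = {t \<in> {0..1}. \<gamma> t \<notin> B}"
 show ?thesis
 proof (cases "Z = {}")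
  case True
  hence "\<gamma> t \<in> K" if "t \<in> {0..1}" for t using that BK by (auto simp: Z_def)
  hence "\<gamma> t \<in> fst c & snd c (\<gamma> t) \<in> cball u0 r" if "t \<in> {0..1}" for t using that unfolding K_iff by blast
  thus ?thesis using len_lower_inside[OF adm, of 1] by simp
 next
  case False
  have "Z = {0..1} \<inter> \<gamma> -` (- B)" by (auto simp: Z_def)
  moreover have "closed ({0..1} \<inter> \<gamma> -` (- B))" using \<open>open B\<close> by (intro continuous_closed_preimage[OF cont]) auto
  ultimately have "closed Z" by simp
  define T where "T = Inf Z"
  have bb: "bdd_below Z" by (rule bdd_belowI[of _ 0]) (auto simp: Z_def)
  have TZ: "T \<in> Z" unfolding T_def using closed_contains_Inf[OF False bb \<open>closed Z\<close>] .
  hence T: "0 <= T" "T <= 1" "\<gamma> T \<notin> B" by (auto simp: Z_def)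
  have before: "\<gamma> t \<in> B" if "0 <= t" "t < T" for t
  proof (rule ccontr)
   assume "\<gamma> t \<notin> B"
   hence "t \<in> Z" using that T by (auto simp: Z_def)
   hence "T <= t" unfolding T_def by (rule cInf_lower[OF _ bb])
   thus False using that by simp
  qed
  have "T ~= 0" using T(3) g0 by (auto simp: B_def)
  hence "0 < T" using T by simp
  have "\<gamma> T \<in> K"
  proof -
   have "closed ({0..1} \<inter> \<gamma> -` K)" by (intro continuous_closed_preimage[OF cont] \<open>closed K\<close>) simp
   moreover have "{0..<T} \<subseteq> {0..1} \<inter> \<gamma> -` K" using before BK T by auto
   ultimately have "closure {0..<T} \<subseteq> {0..1} \<inter> \<gamma> -` K" by (rule closure_minimal[rotated])
   moreover have "T \<in> closure {0..<T}" using \<open>0 < T\<close> by simp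
   ultimately show ?thesis by blast
  qed
  hence gT: "\<gamma> T \<in> fst c" "snd c (\<gamma> T) \<in> cball u0 r" unfolding K_iff by auto
  have "\<gamma> t \<in> fst c & snd c (\<gamma> t) \<in> cball u0 r" if t: "t \<in> {0..T}" for t
  proof (cases "t = T")
   case False
   hence "\<gamma> t \<in> K" using before BK t by auto
   thus ?thesis unfolding K_iff .
  qed (use gT in simp)
  from len_lower_inside[OF adm T(1,2) this]
  have "(1 - e) * Fc c u0 (snd c (\<gamma> T) - snd c (\<gamma> 0)) <= len \<gamma>" .
  moreover have "norm (snd c (\<gamma> T) - u0) = r" using gT T(3) by (auto simp: B_def dist_norm norm_minus_commute)
  ultimately show ?thesis by blast
 qed
qed

text \<open>A nearly shortest curve either stays in the ball or pays for reaching the sphere, whose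
  Euclidean distance from the starting point is at least
  \<open>r - norm (snd c x - u0)\<close>.\<close>

lemma dist_lower:
 assumes x: "x \<in> fst c" "snd c x \<in> ball u0 r" and \<alpha>: "0 < \<alpha>" "!!y. \<alpha> * norm y <= Fc c u0 y"
 shows "(y \<in> fst c & snd c y \<in> cball u0 r & (1 - e) * Fc c u0 (snd c y - snd c x) <= d x y) \<or>
  (1 - e) * (\<alpha> * (r - norm (snd c x - u0))) <= d x y"
proof (rule ccontr)
 assume neg: "\<not> ?thesis"
 define b where "b = (1 - e) * (\<alpha> * (r - norm (snd c x - u0)))"
 define P where "P \<longleftrightarrow> y \<in> fst c & snd c y \<in> cball u0 r"
 \<comment> \<open>The smaller of the two claimed lower bounds; the first one is available only if
   \<open>y\<close> lies in the ball, which is \<open>P\<close>.\<close>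
 define a where "a = (if P then min b ((1 - e) * Fc c u0 (snd c y - snd c x)) else b)"
 have "d x y < a" using neg unfolding a_def b_def P_def by auto
 then obtain \<gamma> where g: "piecewise_smooth_curve \<A> \<gamma>" "\<gamma> 0 = x" "\<gamma> 1 = y" "len \<gamma> < a"
  using ex_almost_minimising by blast
 have "a <= b" by (simp add: a_def)
 have no_exit: "\<not> (norm (v - u0) = r & (1 - e) * Fc c u0 (v - snd c x) <= len \<gamma>)" for v
 proof
  assume v: "norm (v - u0) = r & (1 - e) * Fc c u0 (v - snd c x) <= len \<gamma>"
  have "r - norm (snd c x - u0) <= norm (v - snd c x)" using v norm_triangle_ineq2[of "v - u0" "snd c x - u0"] by simp
  hence "\<alpha> * (r - norm (snd c x - u0)) <= \<alpha> * norm (v - snd c x)" using \<alpha>(1) by simp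
  also have "... <= Fc c u0 (v - snd c x)" by (rule \<alpha>(2))
  finally have "b <= (1 - e) * Fc c u0 (v - snd c x)" unfolding b_def using adapted_facts(5) by (intro mult_left_mono) auto
  thus False using v g(4) \<open>a <= b\<close> by linarith
 qed
 have "y \<in> fst c & snd c y \<in> cball u0 r & (1 - e) * Fc c u0 (snd c y - snd c x) <= len \<gamma>"
  using len_lower[OF g(1)] x g(2,3) no_exit by auto
 thus False using g(4) by (auto simp: a_def P_def)
qed

end

end

section \<open>The distance and the manifold topology\<close>

context finsler
begin

lemma adapted_smaller: "adapted c u0 e r ==> 0 < r' ==> r' <= r ==> adapted c u0 e r'"
 unfolding adapted_def using subset_cball[of r' r u0] by (meson subset_eq)

lemma dist_self [simp]: "d x x = 0"
proof -
 obtain c where c: "c \<in> \<A>" "x \<in> fst c" using ex_chart by blast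
 obtain r where ad: "adapted c (snd c x) (1/2) r" using ex_adapted[OF c(1) chart_in[OF c], of "1/2"] by auto
 have "snd c x \<in> cball (snd c x) r" using adapted_facts(3)[OF ad] by simp
 from dist_upper[OF ad this this] have "d x x <= 0" using Fc_zero[OF c(1) chart_in[OF c]] chart_inv_chart[OF c] by simp
 thus ?thesis using dist_nonneg[of x x] by simp
qed

lemma eventually_in_adapted:
 assumes ad: "adapted c (snd c x) e r" and x: "x \<in> fst c"
 shows "\<forall>\<^sub>F y in nhds x. y \<in> fst c & snd c y \<in> ball (snd c x) r"
proof -
 note c = adapted_facts(1)[OF ad]
 have "open (fst c \<inter> snd c -` ball (snd c x) r)" using continuous_open_preimage[OF continuous_chart[OF c] open_chart[OF c] open_ball] .
 moreover have "x \<in> fst c \<inter> snd c -` ball (snd c x) r" using x adapted_facts(3)[OF ad] by simp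
 ultimately have "\<forall>\<^sub>F y in nhds x. y \<in> fst c \<inter> snd c -` ball (snd c x) r" by (rule eventually_nhds_in_open)
 thus ?thesis by (rule eventually_mono) auto
qed

text \<open>The segment estimate bounds both directions by the Euclidean distance of the
  coordinates, so asymmetry is harmless near a fixed point.\<close>

lemma dist_tendsto_zero: "((%y. d x y + d y x) \<longlongrightarrow> 0) (nhds x)"
proof -
 obtain c where c: "c \<in> \<A>" "x \<in> fst c" using ex_chart by blast
 let ?u = "snd c x"
 obtain r where ad: "adapted c ?u (1/2) r" using ex_adapted[OF c(1) chart_in[OF c], of "1/2"] by auto
 obtain \<alpha> \<beta> where ab: "0 < \<beta>" "!!y. Fc c ?u y <= \<beta> * norm y" using Fc_norm_bounds[OF c(1) chart_in[OF c]] by blast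
 have "\<forall>\<^sub>F y in nhds x. y \<in> fst c & snd c y \<in> ball ?u r" by (rule eventually_in_adapted[OF ad c(2)])
 hence up: "\<forall>\<^sub>F y in nhds x. d x y + d y x <= 3 * \<beta> * norm (snd c y - ?u)"
 proof (rule eventually_mono)
  fix y assume y: "y \<in> fst c & snd c y \<in> ball ?u r"
  have u: "?u \<in> cball ?u r" "snd c y \<in> cball ?u r" using y adapted_facts(3)[OF ad] by auto
  have "d x y <= (1 + 1/2) * Fc c ?u (snd c y - ?u)" "d y x <= (1 + 1/2) * Fc c ?u (?u - snd c y)"
   using dist_upper[OF ad u] dist_upper[OF ad u(2,1)] chart_inv_chart[OF c(1)] c(2) y by auto
  moreover have "Fc c ?u (snd c y - ?u) <= \<beta> * norm (snd c y - ?u)" "Fc c ?u (?u - snd c y) <= \<beta> * norm (snd c y - ?u)"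
   using ab(2)[of "snd c y - ?u"] ab(2)[of "?u - snd c y"] by (simp_all add: norm_minus_commute)
  ultimately show "d x y + d y x <= 3 * \<beta> * norm (snd c y - ?u)" by (simp; linarith)
 qed
 have "(snd c \<longlongrightarrow> ?u) (nhds x)" using isCont_chart[OF c] by (simp add: isCont_def tendsto_nhds_iff)
 hence "((%y. 3 * \<beta> * norm (snd c y - ?u)) \<longlongrightarrow> 3 * \<beta> * norm (?u - ?u)) (nhds x)" by (intro tendsto_intros)
 hence lim: "((%y. 3 * \<beta> * norm (snd c y - ?u)) \<longlongrightarrow> 0) (nhds x)" by simp
 have "\<forall>\<^sub>F y in nhds x. 0 <= d x y + d y x" using dist_nonneg by (simp add: add_nonneg_nonneg)
 thus ?thesis using up by (rule tendsto_sandwich[OF _ _ tendsto_const lim])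
qed

text \<open>Leaving a coordinate ball contained in \<open>U\<close> costs at least the fixed length
  \<open>(1 - 1/2) * (\<alpha> * r)\<close>.\<close>

lemma forward_ball_subset:
 assumes "open U" "x \<in> U"
 shows "\<exists>\<delta>>0. \<forall>y. d x y < \<delta> --> y \<in> U"
proof -
 obtain c where c: "c \<in> \<A>" "x \<in> fst c" using ex_chart by blast
 let ?u = "snd c x"
 have uO: "?u \<in> Om c" by (rule chart_in[OF c])
 obtain r0 where ad0: "adapted c ?u (1/2) r0" using ex_adapted[OF c(1) uO, of "1/2"] by auto
 obtain \<alpha> \<beta> where ab: "0 < \<alpha>" "!!y. \<alpha> * norm y <= Fc c ?u y" using Fc_norm_bounds[OF c(1) uO] by blast
 have "open (Om c \<inter> chart_inv c -` U)" using continuous_open_preimage[OF continuous_chart_inv[OF c(1)] open_Om[OF c(1)] assms(1)] .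
 moreover have "?u \<in> Om c \<inter> chart_inv c -` U" using uO assms(2) chart_inv_chart[OF c] by simp
 ultimately obtain \<rho> where \<rho>: "0 < \<rho>" "cball ?u \<rho> \<subseteq> Om c \<inter> chart_inv c -` U" using open_contains_cball by blast
 define r where "r = min r0 \<rho>"
 have r: "0 < r" "r <= r0" "r <= \<rho>" using \<rho>(1) adapted_facts(3)[OF ad0] by (auto simp: r_def)
 have ad: "adapted c ?u (1/2) r" by (rule adapted_smaller[OF ad0 r(1,2)])
 have "y \<in> U" if y: "d x y < (1 - 1/2) * (\<alpha> * r)" for y
 proof -
  have "?u \<in> ball ?u r" using r by simp
  from dist_lower[OF ad c(2) this ab, of y] y have "y \<in> fst c" "snd c y \<in> cball ?u r" by auto
  hence "snd c y \<in> cball ?u \<rho>" using r(3) by simp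
  hence "chart_inv c (snd c y) \<in> U" using \<rho>(2) by blast
  thus ?thesis using chart_inv_chart[OF c(1) \<open>y \<in> fst c\<close>] by simp
 qed
 moreover have "0 < (1 - 1/2) * (\<alpha> * r)" using ab(1) r(1) by simp
 ultimately show ?thesis by blast
qed

text \<open>The forward distance from the limit alone decides convergence, since small forward balls
  fit into neighbourhoods; the backward distance then follows from the topology.\<close>

lemma tendsto_iff_dist: "(f \<longlongrightarrow> x) G \<longleftrightarrow> ((%s. d x (f s)) \<longlongrightarrow> 0) G"
proof
 assume f: "(f \<longlongrightarrow> x) G"
 have "((%s. d x (f s) + d (f s) x) \<longlongrightarrow> 0) G" using filterlim_compose[OF dist_tendsto_zero f] .
 thus "((%s. d x (f s)) \<longlongrightarrow> 0) G" by (rule Lim_null_comparison[rotated]) (simp add: dist_nonneg)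
next
 assume f: "((%s. d x (f s)) \<longlongrightarrow> 0) G"
 show "(f \<longlongrightarrow> x) G"
 proof (rule topological_tendstoI)
  fix U assume "open U" "x \<in> U"
  then obtain \<delta> where \<delta>: "0 < \<delta>" "!!y. d x y < \<delta> ==> y \<in> U" using forward_ball_subset by blast
  have "\<forall>\<^sub>F s in G. d x (f s) < \<delta>" using f \<delta>(1) by (rule order_tendstoD(2))
  thus "\<forall>\<^sub>F s in G. f s \<in> U" by (rule eventually_mono) (rule \<delta>(2))
 qed
qed

lemma tendsto_dist_Finsler:
 assumes "(f \<longlongrightarrow> x) G" "(g \<longlongrightarrow> y) G"
 shows "((%s. d (f s) (g s)) \<longlongrightarrow> d x y) G"
proof -
 have f: "((%s. d x (f s) + d (f s) x) \<longlongrightarrow> 0) G" using filterlim_compose[OF dist_tendsto_zero assms(1)] .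
 have g: "((%s. d y (g s) + d (g s) y) \<longlongrightarrow> 0) G" using filterlim_compose[OF dist_tendsto_zero assms(2)] .
 have "((%s. d (f s) (g s) - d x y) \<longlongrightarrow> 0) G"
 proof (rule Lim_null_comparison)
  show "\<forall>\<^sub>F s in G. norm (d (f s) (g s) - d x y) <= (d x (f s) + d (f s) x) + (d y (g s) + d (g s) y)"
  proof (rule always_eventually, rule allI)
   fix s
   have "d (f s) (g s) <= d (f s) x + d x y + d y (g s)" "d x y <= d x (f s) + d (f s) (g s) + d (g s) y"
    using dist_triangle_ineq[of "f s" "g s" x] dist_triangle_ineq[of x "g s" y]
     dist_triangle_ineq[of x y "f s"] dist_triangle_ineq[of "f s" y "g s"] by linarith+
   thus "norm (d (f s) (g s) - d x y) <= (d x (f s) + d (f s) x) + (d y (g s) + d (g s) y)"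
    using dist_nonneg[of x "f s"] dist_nonneg[of "f s" x] dist_nonneg[of y "g s"] dist_nonneg[of "g s" y] by (simp add: abs_le_iff)
  qed
  show "((%s. (d x (f s) + d (f s) x) + (d y (g s) + d (g s) y)) \<longlongrightarrow> 0) G" using tendsto_add[OF f g] by simp
 qed
 thus ?thesis by (simp add: LIM_zero_iff)
qed

lemma continuous_on_dist_pair: "continuous_on UNIV (%z. d (fst z) (snd z))" unfolding continuous_on_def
 by (intro ballI tendsto_dist_Finsler tendsto_fst tendsto_snd tendsto_ident_at)

lemma borel_measurable_dist [measurable (raw)]:
 assumes [measurable]: "f \<in> M \<rightarrow>\<^sub>M borel" "g \<in> M \<rightarrow>\<^sub>M borel"
 shows "(%x. d (f x) (g x)) \<in> borel_measurable M"
 using borel_measurable_continuous_Pair[OF assms, of d] continuous_on_dist_pair by (simp add: case_prod_beta')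

text \<open>Transfers absolute continuity from the distance to coordinates. With \<open>V\<close> of
  radius \<open>r / 4\<close>, leaving the ball of radius \<open>r\<close> is at least as expensive
  as the Euclidean distance of any two points of \<open>V\<close> demands.\<close>

lemma coordinates_Lipschitz:
 "\<exists>c V C. c \<in> \<A> & open V & x0 \<in> V & V \<subseteq> fst c & 0 < C & (\<forall>x\<in>V. \<forall>y\<in>V. norm (snd c y - snd c x) <= C * d x y)"
proof -
 obtain c where c: "c \<in> \<A>" "x0 \<in> fst c" using ex_chart by blast
 let ?u = "snd c x0"
 have uO: "?u \<in> Om c" by (rule chart_in[OF c])
 obtain r where ad: "adapted c ?u (1/2) r" using ex_adapted[OF c(1) uO, of "1/2"] by auto
 obtain \<alpha> \<beta> where ab: "0 < \<alpha>" "!!y. \<alpha> * norm y <= Fc c ?u y" using Fc_norm_bounds[OF c(1) uO] by blast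
 have r: "0 < r" by (rule adapted_facts(3)[OF ad])
 let ?V = "fst c \<inter> snd c -` ball ?u (r / 4)"
 have "open ?V" using continuous_open_preimage[OF continuous_chart[OF c(1)] open_chart[OF c(1)] open_ball] .
 moreover have "x0 \<in> ?V" using c(2) r by simp
 moreover have "norm (snd c y - snd c x) <= 2 / \<alpha> * d x y" if "x \<in> ?V" "y \<in> ?V" for x y
 proof -
  have x: "x \<in> fst c" "norm (snd c x - ?u) < r / 4" and y: "norm (snd c y - ?u) < r / 4" using that by (auto simp: dist_norm norm_minus_commute)
  have xb: "snd c x \<in> ball ?u r" using x(2) r by (simp add: dist_norm norm_minus_commute)
  have n: "norm (snd c y - snd c x) <= r / 2" using norm_triangle_ineq4[of "snd c y - ?u" "snd c x - ?u"] x(2) y by simp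
  have "\<alpha> * norm (snd c y - snd c x) <= 2 * d x y" using dist_lower[OF ad x(1) xb ab, of y]
  proof
   assume "y \<in> fst c & snd c y \<in> cball ?u r & (1 - 1/2) * Fc c ?u (snd c y - snd c x) <= d x y"
   thus ?thesis using ab(2)[of "snd c y - snd c x"] by simp
  next
   assume "(1 - 1/2) * (\<alpha> * (r - norm (snd c x - ?u))) <= d x y"
   moreover have "\<alpha> * norm (snd c y - snd c x) <= \<alpha> * (r - norm (snd c x - ?u))"
   proof (rule mult_left_mono)
    show "norm (snd c y - snd c x) <= r - norm (snd c x - ?u)" using n x(2) r by linarith
   qed (use ab(1) in simp)
   ultimately show ?thesis by simp
  qed
  thus ?thesis using ab(1) by (simp add: field_simps)
 qed
 moreover have "0 < 2 / \<alpha>" using ab(1) by simp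
 ultimately show ?thesis using c(1) by (intro exI[of _ c] exI[of _ ?V] exI[of _ "2 / \<alpha>"]) auto
qed

text \<open>The distance is compared with the norm at \<open>\<gamma> t\<close>, and the increment
  of the curve with \<open>b - a\<close> times the velocity. The interval may extend to both sides
  of \<open>t\<close>, as the dyadic intervals containing \<open>t\<close> do.\<close>

lemma metric_derivative_eq_speed:
 assumes cd: "curve_differentiable_at \<A> \<gamma> t" and e: "0 < e"
 shows "\<exists>\<rho>>0. \<forall>a b. a <= t & t <= b & b - a < \<rho> -->
  \<bar>d (\<gamma> a) (\<gamma> b) - speed \<A> F \<gamma> t * (b - a)\<bar> <= e * (b - a)"
proof -
 obtain c where c: "c \<in> \<A>" "\<gamma> t \<in> fst c" using ex_chart by blast
 let ?u = "snd c (\<gamma> t)"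
 have uO: "?u \<in> Om c" by (rule chart_in[OF c])
 interpret N: minkowski_norm "Fc c ?u" "%z. (Fc c ?u z)\<^sup>2 / 2" by (rule minkowski_norm_Fc[OF c(1) uO])
 define x where "x = snd c \<circ> \<gamma>"
 define v where "v = vector_derivative x (at t)"
 define N0 where "N0 = Fc c ?u"
 have sp: "speed \<A> F \<gamma> t = N0 v" using speed_chart[of c \<gamma> t] c cd by (simp add: N0_def v_def x_def)
 have cont: "isCont \<gamma> t" and df: "x differentiable (at t)" using curve_differentiable_at_iff[of c \<gamma> t] c cd by (auto simp: x_def)
 obtain \<alpha> \<beta> where ab: "0 < \<alpha>" "0 < \<beta>" "!!y. \<alpha> * norm y <= N0 y" "!!y. N0 y <= \<beta> * norm y"
  using Fc_norm_bounds[OF c(1) uO] unfolding N0_def by blast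
 have Nv: "0 <= N0 v" unfolding N0_def by (rule N.N_nonneg)
 \<comment> \<open>Triangle inequality for the norm at \<open>\<gamma> t\<close>, through its
   supporting functional at \<open>y\<close>.\<close>
 have sub: "N0 y <= N0 z + N0 (y - z)" for y z
 proof -
  obtain l where l: "linear l" "l y = N0 y" "!!v. l v <= N0 v" using N.support_functional[of y] unfolding N0_def by blast
  have "l y = l z + l (y - z)" using linear_diff[OF l(1)] by simp
  thus ?thesis using l(2) l(3)[of z] l(3)[of "y - z"] by simp
 qed
 \<comment> \<open>Error budget: \<open>\<eta>\<close> is the relative error of the metric, with
   \<open>\<eta> * N0 v <= e / 4\<close>; \<open>\<kappa>\<close> below is the error of the linear
   approximation, with \<open>\<beta> * \<kappa> = e / 4\<close>.\<close>
 define \<eta> where "\<eta> = min (1/2) (e / (4 * (N0 v + 1)))"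
 have \<eta>: "0 < \<eta>" "\<eta> <= 1/2" "\<eta> * N0 v <= e / 4"
 proof -
  show "0 < \<eta>" using e Nv by (simp add: \<eta>_def)
  show "\<eta> <= 1/2" unfolding \<eta>_def by (rule min.cobounded1)
  have "\<eta> * N0 v <= e / (4 * (N0 v + 1)) * (N0 v + 1)" using Nv e by (intro mult_mono) (auto simp: \<eta>_def)
  also have "... = e / 4" using Nv by (simp add: divide_simps add_nonneg_eq_0_iff)
  finally show "\<eta> * N0 v <= e / 4" .
 qed
 obtain r where ad: "adapted c ?u \<eta> r" using ex_adapted[OF c(1) uO \<eta>(1)] \<eta>(2) by auto
 have r: "0 < r" by (rule adapted_facts(3)[OF ad])
 define \<kappa> where "\<kappa> = e / (4 * \<beta>)"
 have \<kappa>: "0 < \<kappa>" "\<beta> * \<kappa> = e / 4" using e ab(2) by (auto simp: \<kappa>_def)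
 have "(x has_derivative (%h. h *\<^sub>R v)) (at t)" using df unfolding v_def vector_derivative_works has_vector_derivative_def .
 then obtain r1 where r1: "0 < r1" "!!s. norm (s - t) < r1 ==> norm (x s - x t - (s - t) *\<^sub>R v) <= \<kappa> * norm (s - t)"
  using \<kappa>(1) unfolding has_derivative_at_alt by meson
 have "\<forall>\<^sub>F y in nhds (\<gamma> t). y \<in> fst c & snd c y \<in> ball ?u (r / 2)"
  by (rule eventually_in_adapted[OF adapted_smaller[OF ad] c(2)]) (use r in auto)
 hence "\<forall>\<^sub>F s in nhds t. \<gamma> s \<in> fst c & snd c (\<gamma> s) \<in> ball ?u (r / 2)"
  by (rule eventually_compose_filterlim[OF _ cont[unfolded isCont_def tendsto_at_iff_tendsto_nhds]])
 then obtain r2 where r2: "0 < r2" "!!s. dist s t < r2 ==> \<gamma> s \<in> fst c & snd c (\<gamma> s) \<in> ball ?u (r / 2)"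
  unfolding eventually_nhds_metric by blast
 \<comment> \<open>The last bound makes an excursion out of the ball cost at least
   \<open>(1 - \<eta>) * ((N0 v + 1) * (b - a))\<close>, which settles the second alternative of
   \<open>dist_lower\<close>.\<close>
 define \<rho> where "\<rho> = min (min r1 r2) (\<alpha> * r / (2 * (N0 v + 1)))"
 have \<rho>: "0 < \<rho>" "\<rho> <= r1" "\<rho> <= r2" using r1(1) r2(1) ab(1) r Nv by (auto simp: \<rho>_def)
 have "\<bar>d (\<gamma> a) (\<gamma> b) - N0 v * (b - a)\<bar> <= e * (b - a)" if st: "a <= t" "t <= b" "b - a < \<rho>" for a b
 proof -
  let ?w = "x b - x a"
  have close: "\<gamma> s \<in> fst c & snd c (\<gamma> s) \<in> ball ?u (r / 2)" if "s \<in> {a, b}" for s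
   using that st \<rho> by (intro r2) (auto simp: dist_real_def)
  have "norm (x s - x t - (s - t) *\<^sub>R v) <= \<kappa> * \<bar>s - t\<bar>" if "s \<in> {a, b}" for s
   using r1(2)[of s] that st \<rho> by auto
  from this[of a] this[of b]
  have dab: "norm (x a - x t - (a - t) *\<^sub>R v) <= \<kappa> * (t - a)" "norm (x b - x t - (b - t) *\<^sub>R v) <= \<kappa> * (b - t)"
   using st by auto
  have weq: "?w - (b - a) *\<^sub>R v = (x b - x t - (b - t) *\<^sub>R v) - (x a - x t - (a - t) *\<^sub>R v)" by (simp add: algebra_simps)
  have nw: "norm (?w - (b - a) *\<^sub>R v) <= \<kappa> * (b - a)"
   unfolding weq using dab norm_triangle_ineq4[of "x b - x t - (b - t) *\<^sub>R v" "x a - x t - (a - t) *\<^sub>R v"] by (simp add: algebra_simps)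
  have Nvs: "N0 ((b - a) *\<^sub>R v) = (b - a) * N0 v" unfolding N0_def using st by (intro N.N_scale) simp
  have Nk: "N0 y <= e / 4 * (b - a)" if "norm y <= \<kappa> * (b - a)" for y
  proof -
   have "N0 y <= \<beta> * (\<kappa> * (b - a))" by (rule order_trans[OF ab(4) mult_left_mono[OF that less_imp_le[OF ab(2)]]])
   also have "... = e / 4 * (b - a)" using \<kappa>(2) by (simp add: mult.assoc[symmetric])
   finally show ?thesis .
  qed
  have wu: "N0 ?w <= (b - a) * N0 v + e / 4 * (b - a)" using sub[of ?w "(b - a) *\<^sub>R v"] Nk[OF nw] Nvs by simp
  have wl: "(b - a) * N0 v <= N0 ?w + e / 4 * (b - a)"
   using sub[of "(b - a) *\<^sub>R v" ?w] Nk[of "(b - a) *\<^sub>R v - ?w"] nw Nvs by (simp add: norm_minus_commute)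
  have ba: "0 <= b - a" using st by simp
  have ring: "(1 + \<eta>) * (A + B) = A + B + \<eta> * A + \<eta> * B" "(1 - \<eta>) * (A - B) = A - B - \<eta> * A + \<eta> * B" for A B
   by (simp_all add: algebra_simps)
  have \<eta>b: "\<eta> * ((b - a) * N0 v) <= e / 4 * (b - a)" using mult_left_mono[OF \<eta>(3) ba] by (simp add: mult_ac)
  have cb: "snd c (\<gamma> a) \<in> cball ?u r" "snd c (\<gamma> b) \<in> cball ?u r" using close[of a] close[of b] r by auto
  have "d (\<gamma> a) (\<gamma> b) <= (1 + \<eta>) * N0 ?w"
   using dist_upper[OF ad cb] chart_inv_chart[OF c(1)] close[of a] close[of b] by (simp add: x_def N0_def)
  also have "... <= (1 + \<eta>) * ((b - a) * N0 v + e / 4 * (b - a))" using wu \<eta>(1) by (intro mult_left_mono) auto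
  also have "... = (b - a) * N0 v + e / 4 * (b - a) + \<eta> * ((b - a) * N0 v) + \<eta> * (e / 4 * (b - a))" by (rule ring)
  also have "\<eta> * (e / 4 * (b - a)) <= 1 * (e / 4 * (b - a))" using \<eta> e ba by (intro mult_right_mono) auto
  finally have upper: "d (\<gamma> a) (\<gamma> b) <= N0 v * (b - a) + e * (b - a)"
   using \<eta>b mult_nonneg_nonneg[OF less_imp_le[OF e] ba] by (simp add: mult.commute)
  have ab': "snd c (\<gamma> a) \<in> ball ?u r" "\<gamma> a \<in> fst c" using close[of a] r by auto
  have lower: "N0 v * (b - a) <= d (\<gamma> a) (\<gamma> b) + e * (b - a)"
   using dist_lower[OF ad ab'(2,1) ab(1) ab(3)[unfolded N0_def], of "\<gamma> b"]
  proof
   assume "\<gamma> b \<in> fst c & snd c (\<gamma> b) \<in> cball ?u r & (1 - \<eta>) * Fc c ?u (snd c (\<gamma> b) - snd c (\<gamma> a)) <= d (\<gamma> a) (\<gamma> b)"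
   hence "(1 - \<eta>) * N0 ?w <= d (\<gamma> a) (\<gamma> b)" by (simp add: x_def N0_def)
   moreover have "(1 - \<eta>) * ((b - a) * N0 v - e / 4 * (b - a)) <= (1 - \<eta>) * N0 ?w" using wl \<eta>(2) by (intro mult_left_mono) auto
   moreover have "(1 - \<eta>) * ((b - a) * N0 v - e / 4 * (b - a)) =
     (b - a) * N0 v - e / 4 * (b - a) - \<eta> * ((b - a) * N0 v) + \<eta> * (e / 4 * (b - a))" by (rule ring)
   moreover have "0 <= \<eta> * (e / 4 * (b - a))" "0 <= e / 4 * (b - a)" using \<eta>(1) e ba by auto
   ultimately show ?thesis using \<eta>b by (simp add: mult.commute; linarith)
  next
   assume far: "(1 - \<eta>) * (\<alpha> * (r - norm (snd c (\<gamma> a) - ?u))) <= d (\<gamma> a) (\<gamma> b)"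
   have "r / 2 <= r - norm (snd c (\<gamma> a) - ?u)" using close[of a] by (simp add: dist_norm norm_minus_commute)
   hence "\<alpha> * (r / 2) <= \<alpha> * (r - norm (snd c (\<gamma> a) - ?u))" using ab(1) by (intro mult_left_mono) auto
   moreover have "(N0 v + 1) * (b - a) <= (N0 v + 1) * (\<alpha> * r / (2 * (N0 v + 1)))"
    using st Nv by (intro mult_left_mono) (auto simp: \<rho>_def)
   moreover have "(N0 v + 1) * (\<alpha> * r / (2 * (N0 v + 1))) = \<alpha> * (r / 2)" using Nv by (simp add: field_simps)
   ultimately have bnd: "(N0 v + 1) * (b - a) <= \<alpha> * (r - norm (snd c (\<gamma> a) - ?u))" by linarith
   have "(1 - \<eta>) * ((N0 v + 1) * (b - a)) <= d (\<gamma> a) (\<gamma> b)"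
    using far mult_left_mono[OF bnd, of "1 - \<eta>"] \<eta>(2) by linarith
   moreover have "(1 - \<eta>) * ((N0 v + 1) * (b - a)) = (b - a) * N0 v - \<eta> * ((b - a) * N0 v) + (1 - \<eta>) * (b - a)"
    by (simp add: algebra_simps)
   moreover have "0 <= (1 - \<eta>) * (b - a)" "0 <= e / 4 * (b - a)" using \<eta>(2) e ba by auto
   ultimately show ?thesis using \<eta>b by (simp add: mult.commute; linarith)
  qed
  show ?thesis using upper lower by (simp add: abs_le_iff)
 qed
 thus ?thesis using \<rho>(1) unfolding sp by blast
qed

end

section \<open>Curves of finite energy\<close>

lemma integral_small_intervals:
 fixes g :: "real => real"
 assumes g: "integrable lborel g" "!!x. 0 <= g x" and e: "0 < e"
 shows "\<exists>\<delta>>0. \<forall>s t. s <= t & t - s < \<delta> --> (LINT x:{s<..t}|lborel. g x) < e"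
proof -
 have [measurable]: "g \<in> borel_measurable borel" using g by auto
 have "0 < e / 2" using e by simp
 from LIMSEQ_D[OF integral_excess_tendsto_zero[OF g] this]
 obtain n where n: "(LINT x|lborel. max 0 (g x - real n)) < e / 2" by (auto simp: abs_less_iff)
 define k where "k x = max 0 (g x - real n)" for x
 have k: "integrable lborel k" "!!x. 0 <= k x"
  unfolding k_def using g(2) by (auto intro!: Bochner_Integration.integrable_bound[OF g(1)] AE_I2)
 have "(LINT x:{s<..t}|lborel. g x) < e" if st: "s <= t" "t - s < e / (2 * (real n + 1))" for s t
 proof -
  have sc: "set_integrable lborel {s<..t} (%x. q :: real)" for q
   using st unfolding set_integrable_def by (intro integrable_scaleR_left integrable_real_indicator) auto
  have LC: "(LINT x:{s<..t}|lborel. q) = q * (t - s)" for q :: real using st unfolding set_lebesgue_integral_def by simp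
  have "(LINT x:{s<..t}|lborel. g x) <= (LINT x:{s<..t}|lborel. real n + k x)"
   by (intro set_integral_mono set_integral_add set_integrable_Ioc sc k g) (auto simp: k_def)
  also have "... = real n * (t - s) + (LINT x:{s<..t}|lborel. k x)"
   by (subst set_integral_add(2)) (auto intro!: set_integrable_Ioc sc k simp: LC)
  also have "(LINT x:{s<..t}|lborel. k x) < e / 2" using set_integral_Ioc_le[OF k, of s t] n by (simp add: k_def)
  also have "real n * (t - s) <= (real n + 1) * (t - s)" using st by (intro mult_right_mono) auto
  also have "(real n + 1) * (t - s) <= (real n + 1) * (e / (2 * (real n + 1)))" using st by (intro mult_left_mono) auto
  also have "... = e / 2" by (simp add: divide_simps)
  finally show ?thesis by simp
 qed
 thus ?thesis using e by (intro exI[of _ "e / (2 * (real n + 1))"]) auto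
qed

lemma powr_ge_tangent:
 fixes x a :: real
 assumes "1 < p" "0 <= x" "0 < a"
 shows "a powr p + p * a powr (p - 1) * (x - a) <= x powr p"
proof (cases "x = 0")
 case True
 have "a powr p = a powr (p - 1) * a" using assms by (simp add: powr_mult_base mult.commute)
 hence "a powr p + p * a powr (p - 1) * (x - a) = a powr p * (1 - p)" using True by (simp add: algebra_simps)
 also have "... <= 0" using assms by (intro mult_nonneg_nonpos) auto
 finally show ?thesis using True by simp
next
 case False
 have "p * a powr (p - 1) * (x - a) <= x powr p - a powr p"
 proof (rule convex_on_imp_above_tangent[where A = "{0<..}"])
  show "convex_on {0<..} (%x. x powr p)" using assms by (intro powr_convex) auto
  show "((%x. x powr p) has_real_derivative p * a powr (p - 1)) (at a within {0<..})" using assms by (auto intro!: derivative_eq_intros)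
  show "a \<in> interior {0<..}" using assms by (simp add: interior_open)
 qed (use assms False in auto)
 thus ?thesis by simp
qed

text \<open>Jensen's inequality for \<open>powr p\<close>, by integrating the tangent at the mean
  value \<open>a\<close>.\<close>

lemma pen_integral_le:
 fixes f :: "real => real"
 assumes p: "1 < p" and st: "s < t" and f: "!!x. 0 <= f x" "set_integrable lborel {s<..t} f"
  "set_integrable lborel {s<..t} (%x. f x powr p)"
 shows "pen p (LINT x:{s<..t}|lborel. f x) (t - s) <= (LINT x:{s<..t}|lborel. f x powr p)"
proof -
 let ?I = "LINT x:{s<..t}|lborel. f x"
 have I0: "0 <= ?I" by (rule set_integral_Ioc_nonneg[OF f(1)])
 have J0: "0 <= (LINT x:{s<..t}|lborel. f x powr p)" by (rule set_integral_Ioc_nonneg) simp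
 show ?thesis
 proof (cases "?I = 0")
  case True
  thus ?thesis using J0 by (simp add: pen_def)
 next
  case False
  define a where "a = ?I / (t - s)"
  have a: "0 < a" using False I0 st by (simp add: a_def)
  have sc: "set_integrable lborel {s<..t} (%x. q :: real)" for q
   using st unfolding set_integrable_def by (intro integrable_scaleR_left integrable_real_indicator) auto
  have LC: "(LINT x:{s<..t}|lborel. q) = q * (t - s)" for q :: real using st unfolding set_lebesgue_integral_def by simp
  let ?k = "p * a powr (p - 1)"
  have "(LINT x:{s<..t}|lborel. (a powr p - ?k * a) + ?k * f x) = (a powr p - ?k * a) * (t - s) + ?k * ?I"
   using f(2) by (subst set_integral_add(2)) (auto intro!: sc simp: LC)
  also have "?I = a * (t - s)" using st by (simp add: a_def)
  also have "(a powr p - ?k * a) * (t - s) + ?k * (a * (t - s)) = (t - s) * a powr p" by (simp add: algebra_simps)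
  also have "... = pen p ?I (t - s)" using I0 st by (simp add: pen_alt a_def)
  finally have "pen p ?I (t - s) = (LINT x:{s<..t}|lborel. (a powr p - ?k * a) + ?k * f x)" ..
  also have "... <= (LINT x:{s<..t}|lborel. f x powr p)"
  proof (rule set_integral_mono[OF _ f(3)])
   show "set_integrable lborel {s<..t} (%x. (a powr p - ?k * a) + ?k * f x)" using f(2) by (intro set_integral_add(1) sc) auto
   show "(a powr p - ?k * a) + ?k * f x <= f x powr p" for x using powr_ge_tangent[OF p f(1) a, of x] by (simp add: right_diff_distrib)
  qed
  finally show ?thesis .
 qed
qed

definition dyadic_floor :: "nat => real => real" where
 "dyadic_floor m t = real (nat \<lfloor>t * 2 ^ m\<rfloor>) / 2 ^ m"

lemma dyadic_floor_bounds:
 assumes "0 <= t"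
 shows "dyadic_floor m t <= t" "t < dyadic_floor m t + 1 / 2 ^ m"
proof -
 have n: "real (nat \<lfloor>t * 2 ^ m\<rfloor>) = real_of_int \<lfloor>t * 2 ^ m\<rfloor>" using assms by simp
 have "real_of_int \<lfloor>t * 2 ^ m\<rfloor> <= t * 2 ^ m" "t * 2 ^ m < real_of_int \<lfloor>t * 2 ^ m\<rfloor> + 1"
  using real_of_int_floor_add_one_gt by auto
 thus "dyadic_floor m t <= t" "t < dyadic_floor m t + 1 / 2 ^ m" unfolding dyadic_floor_def n by (auto simp: field_simps)
qed

lemma dyadic_floor_mono: "s <= t ==> dyadic_floor m s <= dyadic_floor m t"
 unfolding dyadic_floor_def by (intro divide_right_mono of_nat_mono nat_mono floor_mono mult_right_mono) auto

lemma dyadic_floor_refine: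
 assumes "m <= n" "0 <= t"
 shows "dyadic_floor m t <= dyadic_floor n t" "\<exists>i. dyadic_floor m t = real i / 2 ^ n"
proof -
 let ?i = "nat \<lfloor>t * 2 ^ m\<rfloor> * 2 ^ (n - m)"
 have e: "dyadic_floor m t = real ?i / 2 ^ n" using assms(1) by (simp add: dyadic_floor_def power_diff[of "2 :: real"])
 thus "\<exists>i. dyadic_floor m t = real i / 2 ^ n" ..
 have "real ?i <= t * 2 ^ n" using dyadic_floor_bounds(1)[OF assms(2), of m] unfolding e by (simp add: field_simps)
 hence "int ?i <= \<lfloor>t * 2 ^ n\<rfloor>" by (simp only: le_floor_iff of_int_of_nat_eq)
 from nat_mono[OF this] have "?i <= nat \<lfloor>t * 2 ^ n\<rfloor>" by (simp only: nat_int)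
 hence "real ?i <= real (nat \<lfloor>t * 2 ^ n\<rfloor>)" by (rule of_nat_mono)
 thus "dyadic_floor m t <= dyadic_floor n t" unfolding e unfolding dyadic_floor_def by (intro divide_right_mono) auto
qed

lemma dyadic_floor_dyadic: "n <= m ==> dyadic_floor m (real i / 2 ^ n) = real i / 2 ^ n"
proof -
 assume "n <= m"
 hence "real i / 2 ^ n * 2 ^ m = real (i * 2 ^ (m - n))" by (simp add: power_diff[of "2 :: real"])
 hence "nat \<lfloor>real i / 2 ^ n * 2 ^ m\<rfloor> = i * 2 ^ (m - n)" by (simp only: floor_of_nat nat_int)
 thus ?thesis using \<open>n <= m\<close> by (simp add: dyadic_floor_def power_diff[of "2 :: real"])
qed

lemma dyadic_floor_tendsto:
 assumes "0 <= t"
 shows "(%m. dyadic_floor m t) \<longlonglongrightarrow> t"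
proof (rule tendsto_sandwich)
 have "(%m. t - (1 / 2) ^ m) \<longlonglongrightarrow> t - 0" by (intro tendsto_intros LIMSEQ_realpow_zero) auto
 thus "(%m. t - 1 / 2 ^ m) \<longlonglongrightarrow> t" by (simp add: power_one_over)
 show "\<forall>\<^sub>F m in sequentially. t - 1 / 2 ^ m <= dyadic_floor m t"
  using dyadic_floor_bounds(2)[OF assms] by (intro always_eventually allI) (simp add: less_imp_le diff_le_eq)
 show "\<forall>\<^sub>F m in sequentially. dyadic_floor m t <= t" using dyadic_floor_bounds(1)[OF assms] by (intro always_eventually allI) simp
qed simp

locale theta_finsler = finsler \<A> F
 for \<A> :: "('a::{t2_space, second_countable_topology}, 'n::finite) chart set" and F +
 fixes star :: 'a and \<Theta> :: "real => real" and p :: real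
 assumes theta: "theta_finsler_manifold \<A> star F \<Theta>"
  and complete: "forward_complete d" and p: "1 < p"
begin

lemma reversible_on_balls: "\<exists>C\<ge>1. \<forall>x y. d star x < R --> d star y < R --> d x y <= C * d y x"
proof -
 define R' where "R' = max R 1"
 let ?S = "closure (forward_ball d star R')"
 have "\<forall>r>0. reversibility d (closure (forward_ball d star r)) <= ereal (\<Theta> r)"
  using theta unfolding theta_finsler_manifold_def by (elim conjE)
 hence "reversibility d ?S <= ereal (\<Theta> R')" by (simp add: R'_def)
 also have "... < ereal (\<Theta> R' + 1)" by simp
 finally obtain l where l: "1 <= l" "\<forall>x\<in>?S. \<forall>y\<in>?S. d x y <= l * d y x"
  unfolding reversibility_def INF_less_iff by blast
 have "x \<in> ?S" if "d star x < R" for x by (rule subsetD[OF closure_subset]) (use that in \<open>simp add: forward_ball_def R'_def\<close>)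
 thus ?thesis using l by blast
qed

text \<open>Forward absolute continuity with a density on the whole line, the working form of such
  curves; backward estimates are drawn from reversibility.\<close>

definition controlled :: "(real => real) => (real => 'a) => bool" where
 "controlled g \<gamma> \<longleftrightarrow> integrable lborel g & (\<forall>x. 0 <= g x) &
  (\<forall>s t. 0 <= s & s <= t & t <= 1 --> d (\<gamma> s) (\<gamma> t) <= (LINT x:{s<..t}|lborel. g x))"

lemma controlledD:
 assumes "controlled g \<gamma>"
 shows "integrable lborel g" "0 <= g x" "0 <= s ==> s <= t ==> t <= 1 ==> d (\<gamma> s) (\<gamma> t) <= (LINT x:{s<..t}|lborel. g x)"
 using assms unfolding controlled_def by (elim conjE; simp)+

text \<open>The curve stays in one forward ball around \<open>star\<close>: its distance from
  \<open>star\<close> is at most \<open>d star (\<gamma> 0)\<close> plus the total integral of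
  \<open>g\<close>.\<close>

lemma controlled_reversible:
 assumes con: "controlled g \<gamma>"
 shows "\<exists>C\<ge>1. \<forall>s\<in>{0..1}. \<forall>t\<in>{0..1}. d (\<gamma> s) (\<gamma> t) <= C * d (\<gamma> t) (\<gamma> s)"
proof -
 define R where "R = d star (\<gamma> 0) + (LINT x|lborel. g x) + 1"
 obtain C where C: "1 <= C" "!!x y. d star x < R ==> d star y < R ==> d x y <= C * d y x"
  using reversible_on_balls[of R] by blast
 have "d star (\<gamma> t) < R" if "t \<in> {0..1}" for t
 proof -
  have "d star (\<gamma> t) <= d star (\<gamma> 0) + d (\<gamma> 0) (\<gamma> t)" by (rule dist_triangle_ineq)
  also have "d (\<gamma> 0) (\<gamma> t) <= (LINT x:{0<..t}|lborel. g x)" using controlledD(3)[OF con, of 0 t] that by simp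
  also have "... <= (LINT x|lborel. g x)" by (rule set_integral_Ioc_le[OF controlledD(1,2)[OF con]])
  finally show ?thesis by (simp add: R_def)
 qed
 thus ?thesis using C by blast
qed

text \<open>Convergence is tested by \<open>d (\<gamma> t) (\<gamma> s)\<close>. For
  \<open>s\<close> after \<open>t\<close> this is controlled directly, for \<open>s\<close> before
  \<open>t\<close> after reversal at the price of the constant \<open>C\<close>.\<close>

lemma controlled_continuous:
 assumes con: "controlled g \<gamma>"
 shows "continuous_on {0..1} \<gamma>" unfolding continuous_on_def
proof
 fix t :: real assume t: "t \<in> {0..1}"
 obtain C where C: "1 <= C" "\<forall>s\<in>{0..1}. \<forall>t\<in>{0..1}. d (\<gamma> s) (\<gamma> t) <= C * d (\<gamma> t) (\<gamma> s)"
  using controlled_reversible[OF con] by blast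
 show "(\<gamma> \<longlongrightarrow> \<gamma> t) (at t within {0..1})" unfolding tendsto_iff_dist
 proof (rule tendstoI)
  fix e :: real assume "0 < e"
  hence "0 < e / C" using C(1) by simp
  from integral_small_intervals[OF controlledD(1,2)[OF con] this]
  obtain \<delta> where \<delta>: "0 < \<delta>" "!!s t. s <= t ==> t - s < \<delta> ==> (LINT x:{s<..t}|lborel. g x) < e / C" by blast
  have "d (\<gamma> t) (\<gamma> s) < e" if s: "s \<in> {0..1}" "dist s t < \<delta>" for s
  proof (cases "t <= s")
   case True
   have "d (\<gamma> t) (\<gamma> s) <= (LINT x:{t<..s}|lborel. g x)" using controlledD(3)[OF con] True s t by simp
   also have "... < e / C" using s True by (intro \<delta>(2)) (auto simp: dist_real_def)
   also have "... <= e" using C(1) \<open>0 < e\<close> by (simp add: divide_le_eq_1 divide_le_eq)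
   finally show ?thesis .
  next
   case False
   have "d (\<gamma> t) (\<gamma> s) <= C * d (\<gamma> s) (\<gamma> t)" using C(2) s t by blast
   also have "d (\<gamma> s) (\<gamma> t) <= (LINT x:{s<..t}|lborel. g x)" using controlledD(3)[OF con] False s t by simp
   also have "... < e / C" using s False by (intro \<delta>(2)) (auto simp: dist_real_def)
   finally show ?thesis using C(1) by simp
  qed
  thus "\<forall>\<^sub>F s in at t within {0..1}. dist (d (\<gamma> t) (\<gamma> s)) 0 < e"
   unfolding eventually_at using \<delta>(1) dist_nonneg by (intro exI[of _ \<delta>]) auto
 qed
qed

text \<open>Dyadic floors approach \<open>t\<close> from below and increase with \<open>m\<close>,
  so the density obtained from the energy bound makes the values at them a forward Cauchy sequence.
  Passing to the limit in both end points keeps the same density.\<close>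

lemma dyadic_extension:
 assumes E: "!!M. (\<Sum>i<2 ^ M. pen p (d (Y (real i / 2 ^ M)) (Y (real (Suc i) / 2 ^ M))) (1 / 2 ^ M)) <= E"
 shows "\<exists>g \<gamma>. controlled g \<gamma> & (\<forall>t\<in>{0..1}. (%m. Y (dyadic_floor m t)) \<longlonglongrightarrow> \<gamma> t)
  & (\<forall>M i. i <= 2 ^ M --> \<gamma> (real i / 2 ^ M) = Y (real i / 2 ^ M))"
proof -
 have "\<exists>g. integrable lborel g & (\<forall>x. 0 <= g x) &
  (\<forall>M i j. i <= j & j <= 2 ^ M --> d (Y (real i / 2 ^ M)) (Y (real j / 2 ^ M)) <= (LINT x:{real i / 2 ^ M<..real j / 2 ^ M}|lborel. g x))"
  by (rule finite_energy_density[OF p _ _ _ E]) (simp_all add: dist_nonneg dist_triangle_ineq)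
 then obtain g where g: "integrable lborel g" "\<forall>x. 0 <= g x"
  "\<forall>M i j. i <= j & j <= 2 ^ M --> d (Y (real i / 2 ^ M)) (Y (real j / 2 ^ M)) <= (LINT x:{real i / 2 ^ M<..real j / 2 ^ M}|lborel. g x)"
  by (elim exE conjE)
 have dy: "d (Y (dyadic_floor m s)) (Y (dyadic_floor n t)) <= (LINT x:{dyadic_floor m s<..dyadic_floor n t}|lborel. g x)"
  if st: "0 <= s" "0 <= t" "t <= 1" "dyadic_floor m s <= dyadic_floor n t" "m <= n" for m n s t
 proof -
  obtain i where i: "dyadic_floor m s = real i / 2 ^ n" using dyadic_floor_refine(2)[OF st(5,1)] by blast
  obtain j where j: "dyadic_floor n t = real j / 2 ^ n" by (simp add: dyadic_floor_def)
  have "i <= j" using st(4) unfolding i j by (simp add: divide_le_cancel)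
  moreover have "j <= 2 ^ n"
  proof -
   have "real j / 2 ^ n <= 1" using order_trans[OF dyadic_floor_bounds(1)[OF st(2)] st(3), of n] unfolding j .
   hence "real j <= 1 * 2 ^ n" by (simp only: pos_divide_le_eq zero_less_power zero_less_numeral)
   thus ?thesis by (metis mult_1 of_nat_le_iff of_nat_numeral of_nat_power)
  qed
  ultimately show ?thesis unfolding i j using g(3) by blast
 qed
 have small: "\<exists>\<delta>>0. \<forall>s t. s <= t & t - s < \<delta> --> (LINT x:{s<..t}|lborel. g x) < e" if "0 < e" for e
  using integral_small_intervals[OF g(1) _ that] g(2) by blast
 have "\<exists>x. (%m. Y (dyadic_floor m t)) \<longlonglongrightarrow> x" if t: "t \<in> {0..1}" for t
 proof -
  have "forward_Cauchy d (%m. Y (dyadic_floor m t))" unfolding forward_Cauchy_def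
  proof (intro allI impI)
   fix e :: real assume "0 < e"
   from small[OF this] obtain \<delta> where \<delta>: "0 < \<delta>" "!!s t. s <= t ==> t - s < \<delta> ==> (LINT x:{s<..t}|lborel. g x) < e" by blast
   obtain N where N: "(1 / 2) ^ N < \<delta>" using \<delta>(1) real_arch_pow_inv[of \<delta> "1/2"] by auto
   have "d (Y (dyadic_floor m t)) (Y (dyadic_floor n t)) < e" if mn: "m <= n" "N < m" for m n
   proof -
    have le: "dyadic_floor m t <= dyadic_floor n t" using dyadic_floor_refine(1)[OF mn(1)] t by simp
    have "dyadic_floor n t - dyadic_floor m t <= 1 / 2 ^ m" using dyadic_floor_bounds[of t] t by (smt (verit) atLeastAtMost_iff)
    also have "... = (1 / 2) ^ m" by (simp add: power_one_over)
    also have "... <= (1 / 2) ^ N" using mn(2) by (intro power_decreasing) auto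
    finally have "dyadic_floor n t - dyadic_floor m t < \<delta>" using N by simp
    hence "(LINT x:{dyadic_floor m t<..dyadic_floor n t}|lborel. g x) < e" by (rule \<delta>(2)[OF le])
    moreover have "d (Y (dyadic_floor m t)) (Y (dyadic_floor n t)) <= (LINT x:{dyadic_floor m t<..dyadic_floor n t}|lborel. g x)"
     using dy[of t t m n] le mn t by simp
    ultimately show ?thesis by simp
   qed
   thus "\<exists>N. \<forall>m n. m <= n & N < m --> d (Y (dyadic_floor m t)) (Y (dyadic_floor n t)) < e" by blast
  qed
  thus ?thesis using complete unfolding forward_complete_def by blast
 qed
 then obtain \<gamma> where \<gamma>: "!!t. t \<in> {0..1} ==> (%m. Y (dyadic_floor m t)) \<longlonglongrightarrow> \<gamma> t" by metis
 have "d (\<gamma> s) (\<gamma> t) <= (LINT x:{s<..t}|lborel. g x)" if st: "0 <= s" "s <= t" "t <= 1" for s t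
 proof (rule field_le_epsilon)
  fix e :: real assume "0 < e"
  from small[OF this] obtain \<delta> where \<delta>: "0 < \<delta>" "!!s t. s <= t ==> t - s < \<delta> ==> (LINT x:{s<..t}|lborel. g x) < e" by blast
  show "d (\<gamma> s) (\<gamma> t) <= (LINT x:{s<..t}|lborel. g x) + e"
  proof (rule tendsto_upperbound)
   show "(%m. d (Y (dyadic_floor m s)) (Y (dyadic_floor m t))) \<longlonglongrightarrow> d (\<gamma> s) (\<gamma> t)"
    using st by (intro tendsto_dist_Finsler \<gamma>) auto
   have "(%m. (1 / 2 :: real) ^ m) \<longlonglongrightarrow> 0" by (rule LIMSEQ_realpow_zero) auto
   hence "\<forall>\<^sub>F m in sequentially. (1 / 2 :: real) ^ m < \<delta>" using \<delta>(1) by (rule order_tendstoD(2))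
   thus "\<forall>\<^sub>F m in sequentially. d (Y (dyadic_floor m s)) (Y (dyadic_floor m t)) <= (LINT x:{s<..t}|lborel. g x) + e"
   proof (rule eventually_mono)
    fix m assume m: "(1 / 2 :: real) ^ m < \<delta>"
    let ?s = "dyadic_floor m s" and ?t = "dyadic_floor m t"
    have b: "?s <= s" "s - ?s < \<delta>" "?s <= ?t" "?t <= t"
     using dyadic_floor_bounds[OF st(1), of m] dyadic_floor_mono[OF st(2), of m] dyadic_floor_bounds(1)[of t m] m st
     by (auto simp: power_one_over)
    have "d (Y ?s) (Y ?t) <= (LINT x:{?s<..?t}|lborel. g x)" using dy[of s t m m] b st by simp
    also have "... <= (LINT x:{?s<..t}|lborel. g x)" using g(2) b by (intro set_integral_Ioc_mono[OF g(1)]) auto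
    also have "... = (LINT x:{?s<..s}|lborel. g x) + (LINT x:{s<..t}|lborel. g x)" by (rule set_integral_Ioc_split[OF g(1) b(1) st(2)])
    also have "(LINT x:{?s<..s}|lborel. g x) < e" by (rule \<delta>(2)[OF b(1,2)])
    finally show "d (Y ?s) (Y ?t) <= (LINT x:{s<..t}|lborel. g x) + e" by simp
   qed
  qed simp
 qed
 hence "controlled g \<gamma>" using g(1,2) unfolding controlled_def by blast
 moreover have "\<gamma> (real i / 2 ^ M) = Y (real i / 2 ^ M)" if "i <= 2 ^ M" for M i
 proof (rule LIMSEQ_unique)
  have "real i <= 2 ^ M" using that by (metis of_nat_le_iff of_nat_numeral of_nat_power)
  thus "(%m. Y (dyadic_floor m (real i / 2 ^ M))) \<longlonglongrightarrow> \<gamma> (real i / 2 ^ M)" by (intro \<gamma>) simp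
  show "(%m. Y (dyadic_floor m (real i / 2 ^ M))) \<longlonglongrightarrow> Y (real i / 2 ^ M)"
   by (intro tendsto_eventually eventually_sequentiallyI[of M]) (simp add: dyadic_floor_dyadic)
 qed
 ultimately show ?thesis using \<gamma> by blast
qed

end

lemma LINT_lebesgue_on_Icc:
 fixes f :: "real => real"
 assumes [measurable]: "f \<in> borel_measurable borel"
 shows "(LINT t|lebesgue_on {a..b}. f t) = (LINT x:{a<..b}|lborel. f x)"
proof -
 have "(LINT t|lebesgue_on {a..b}. f t) = (LINT x|lebesgue. indicator {a..b} x *\<^sub>R f x)" by (rule integral_restrict_space) simp
 also have "... = (LINT x|lborel. indicator {a..b} x *\<^sub>R f x)" by (rule integral_completion) simp
 also have "... = (LINT x|lborel. indicator {a<..b} x *\<^sub>R f x)"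
 proof (rule integral_cong_AE)
  show "AE x in lborel. indicator {a..b} x *\<^sub>R f x = indicator {a<..b} x *\<^sub>R f x"
   using AE_lborel_singleton[of a] by eventually_elim (auto split: split_indicator)
 qed simp_all
 finally show ?thesis by (simp add: set_lebesgue_integral_def)
qed

section \<open>Differentiability and speed of controlled curves\<close>

context theta_finsler
begin

text \<open>In Lipschitz coordinates every component is absolutely continuous. Countably many
  coordinate sets cover the manifold by the Lindelof property, and only intervals with rational end
  points are considered, so countably many null sets remain.\<close>

lemma controlled_AE_differentiable:
 assumes con: "controlled g \<gamma>"
 shows "AE t in lborel. 0 < t & t < 1 --> curve_differentiable_at \<A> \<gamma> t"
proof -
 note g = controlledD(1,2)[OF con]
 have cont: "continuous_on {0..1} \<gamma>" by (rule controlled_continuous[OF con])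
 define nice where "nice c V C \<longleftrightarrow> c \<in> \<A> & open V & V \<subseteq> fst c & (0::real) < C &
   (\<forall>x\<in>V. \<forall>y\<in>V. norm (snd c y - snd c x) <= C * d x y)" for c V C
 define VV where "VV = {V. \<exists>c C. nice c V C}"
 have "open V" if "V \<in> VV" for V using that by (auto simp: VV_def nice_def)
 from Lindelof[OF this] obtain WW where WW: "WW \<subseteq> VV" "countable WW" "\<Union>WW = \<Union>VV" by blast
 have cover: "\<exists>V\<in>WW. x \<in> V" for x
 proof -
  obtain c V C where "c \<in> \<A>" "open V" "x \<in> V" "V \<subseteq> fst c" "0 < C"
   "\<forall>x\<in>V. \<forall>y\<in>V. norm (snd c y - snd c x) <= C * d x y" using coordinates_Lipschitz[of x] by (elim exE conjE)
  hence "nice c V C" "x \<in> V" by (simp_all add: nice_def)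
  hence "x \<in> \<Union>VV" unfolding VV_def by blast
  thus ?thesis using WW(3) by blast
 qed
 have "\<forall>V\<in>WW. \<exists>c. \<exists>C. nice c V C" using WW(1) by (auto simp: VV_def)
 from bchoice[OF this] obtain cc where cc: "\<forall>V\<in>WW. \<exists>C. nice (cc V) V C" by (rule exE)
 define I where "I V a b \<longleftrightarrow> 0 <= a & a <= b & b <= 1 & \<gamma> ` {a..b} \<subseteq> V" for V and a b :: real
 have one: "AE t in lborel. I V a b --> a < t & t < b --> (%s. (snd (cc V) \<circ> \<gamma>) s \<bullet> i) differentiable (at t)"
  if V: "V \<in> WW" and i: "i \<in> Basis" for V a b i
 proof (cases "I V a b")
  case True
  obtain C where C: "nice (cc V) V C" using cc V by blast
  let ?u = "%s. (snd (cc V) \<circ> \<gamma>) s \<bullet> i"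
  have "\<exists>h. integrable lborel h & (\<forall>s t. a <= s & s <= t & t <= b --> ?u t - ?u s = (LINT x:{s<..t}|lborel. h x))"
  proof (rule absolutely_continuous_density[where g = "%x. C * g x"])
   show "integrable lborel (%x. C * g x)" using g(1) by simp
   show "0 <= C * g x" for x using g(2) C by (simp add: nice_def)
   show "a <= b" using True by (simp add: I_def)
   fix s t assume st: "a <= s" "s <= t" "t <= b"
   have "\<gamma> s \<in> V" "\<gamma> t \<in> V" using True st by (auto simp: I_def)
   have "\<bar>?u t - ?u s\<bar> = \<bar>(snd (cc V) (\<gamma> t) - snd (cc V) (\<gamma> s)) \<bullet> i\<bar>" by (simp add: inner_diff_left)
   also have "... <= norm (snd (cc V) (\<gamma> t) - snd (cc V) (\<gamma> s))" by (rule Basis_le_norm[OF i])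
   also have "... <= C * d (\<gamma> s) (\<gamma> t)" using C \<open>\<gamma> s \<in> V\<close> \<open>\<gamma> t \<in> V\<close> by (simp add: nice_def)
   also have "... <= C * (LINT x:{s<..t}|lborel. g x)"
    using controlledD(3)[OF con, of s t] st True C by (intro mult_left_mono) (auto simp: I_def nice_def)
   finally show "\<bar>?u t - ?u s\<bar> <= (LINT x:{s<..t}|lborel. C * g x)" by simp
  qed
  then obtain h where h: "integrable lborel h"
   "!!s t. a <= s ==> s <= t ==> t <= b ==> ?u t - ?u s = (LINT x:{s<..t}|lborel. h x)" by blast
  have "AE t in lborel. a < t & t < b --> (?u has_real_derivative h t) (at t)" by (rule AE_has_real_derivative_integral[OF h])
  thus ?thesis by (rule eventually_mono) (auto simp: has_field_derivative_def intro: differentiableI)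
 qed simp
 have "AE t in lborel. \<forall>V\<in>WW. \<forall>a\<in>\<rat>. \<forall>b\<in>\<rat>. \<forall>i\<in>Basis. I V a b --> a < t & t < b -->
   (%s. (snd (cc V) \<circ> \<gamma>) s \<bullet> i) differentiable (at t)"
  by (intro AE_ball_countable'[OF _ WW(2)] AE_ball_countable'[OF _ countable_rat]
    AE_ball_countable'[OF _ countable_finite[OF finite_Basis]] one)
 thus ?thesis
 proof (rule eventually_mono, intro impI)
  fix t :: real
  assume D: "\<forall>V\<in>WW. \<forall>a\<in>\<rat>. \<forall>b\<in>\<rat>. \<forall>i\<in>Basis. I V a b --> a < t & t < b -->
   (%s. (snd (cc V) \<circ> \<gamma>) s \<bullet> i) differentiable (at t)" and t: "0 < t & t < 1"
  obtain V where V: "V \<in> WW" "\<gamma> t \<in> V" using cover by blast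
  obtain C where C: "nice (cc V) V C" using cc V(1) by blast
  have "continuous_on {0<..<1} \<gamma>" using cont by (rule continuous_on_subset) auto
  hence ct: "isCont \<gamma> t" using t by (simp add: continuous_on_eq_continuous_at)
  have "open V" using C by (simp add: nice_def)
  have "\<forall>\<^sub>F s in nhds t. \<gamma> s \<in> V"
   by (rule topological_tendstoD[OF ct[unfolded isCont_def tendsto_at_iff_tendsto_nhds] \<open>open V\<close> V(2)])
  then obtain e where e: "0 < e" "!!s. dist s t < e ==> \<gamma> s \<in> V" unfolding eventually_nhds_metric by blast
  obtain a where a: "a \<in> \<rat>" "max 0 (t - e) < a" "a < t" using Rats_dense_in_real[of "max 0 (t - e)" t] t e by auto
  obtain b where b: "b \<in> \<rat>" "t < b" "b < min 1 (t + e)" using Rats_dense_in_real[of t "min 1 (t + e)"] t e by auto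
  have "I V a b" unfolding I_def using a b e(2) by (auto simp: dist_real_def)
  hence "(%s. (snd (cc V) \<circ> \<gamma>) s \<bullet> i) differentiable (at t)" if "i \<in> Basis" for i
   using bspec[OF bspec[OF bspec[OF bspec[OF D V(1)] a(1)] b(1)] that] a(3) b(2) by simp
  hence "(snd (cc V) \<circ> \<gamma>) differentiable (at t)" by (subst differentiable_componentwise_within) blast
  thus "curve_differentiable_at \<A> \<gamma> t" using curve_differentiable_at_iff[of "cc V" \<gamma> t] C V(2) ct by (auto simp: nice_def)
 qed
qed

text \<open>Allows curves that are \<open>undefined\<close> outside the unit interval to be
  evaluated at all real times.\<close>

definition clamp01 :: "real => real" where
 "clamp01 t = max 0 (min 1 t)"

lemma clamp01_measurable [measurable]: "clamp01 \<in> borel_measurable borel" unfolding clamp01_def by measurable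

text \<open>A jointly measurable substitute for the speed; it agrees with the speed at all points of
 differentiability.\<close>

definition mspeed :: "(real => 'a) => real => real" where
 "mspeed \<gamma> t = indicator {0<..<1} t *
  enn2real (limsup (%k. ennreal (real (Suc k) * d (\<gamma> (clamp01 t)) (\<gamma> (clamp01 (t + 1 / real (Suc k)))))))"

lemma mspeed_nonneg: "0 <= mspeed \<gamma> t" by (simp add: mspeed_def)

text \<open>Curve and time may both depend on \<open>x\<close>: this covers a single curve as well
  as the joint dependence on path and time.\<close>

lemma mspeed_measurable:
 assumes G: "!!k. (%x. G x (clamp01 (T x + 1 / real (Suc k)))) \<in> M \<rightarrow>\<^sub>M borel" "(%x. G x (clamp01 (T x))) \<in> M \<rightarrow>\<^sub>M borel"
  and [measurable]: "T \<in> borel_measurable M"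
 shows "(%x. mspeed (G x) (T x)) \<in> borel_measurable M"
proof -
 have S: "(%x. ennreal (real (Suc k) * d (G x (clamp01 (T x))) (G x (clamp01 (T x + 1 / real (Suc k)))))) \<in> borel_measurable M" for k
  by (intro measurable_compose[OF _ measurable_ennreal] borel_measurable_times borel_measurable_dist G) simp
 have "(%x. limsup (%k. ennreal (real (Suc k) * d (G x (clamp01 (T x))) (G x (clamp01 (T x + 1 / real (Suc k))))))) \<in> borel_measurable M"
  by (rule borel_measurable_limsup[OF S])
 hence "(%x. enn2real (limsup (%k. ennreal (real (Suc k) * d (G x (clamp01 (T x))) (G x (clamp01 (T x + 1 / real (Suc k)))))))) \<in> borel_measurable M"
  by (rule borel_measurable_enn2real)
 moreover have "(%x. indicator {0<..<1} (T x) :: real) \<in> borel_measurable M" by measurable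
 ultimately show ?thesis unfolding mspeed_def by (rule borel_measurable_times[rotated])
qed

lemma mspeed_eq_speed:
 assumes cd: "curve_differentiable_at \<A> \<gamma> t" and t: "0 < t" "t < 1"
 shows "mspeed \<gamma> t = speed \<A> F \<gamma> t"
proof -
 let ?f = "%k. real (Suc k) * d (\<gamma> (clamp01 t)) (\<gamma> (clamp01 (t + 1 / real (Suc k))))"
 have "?f \<longlonglongrightarrow> speed \<A> F \<gamma> t"
 proof (rule tendstoI)
  fix e :: real assume "0 < e"
  hence "0 < e / 2" by simp
  from metric_derivative_eq_speed[OF cd this]
  obtain \<rho> where \<rho>: "0 < \<rho>" "!!b. t <= b ==> b - t < \<rho> ==> \<bar>d (\<gamma> t) (\<gamma> b) - speed \<A> F \<gamma> t * (b - t)\<bar> <= e / 2 * (b - t)"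
   by blast
  have "(%k. 1 / real (Suc k)) \<longlonglongrightarrow> 0" by (rule LIMSEQ_Suc[OF lim_1_over_n])
  hence "\<forall>\<^sub>F k in sequentially. 1 / real (Suc k) < min \<rho> (1 - t)" using \<rho>(1) t by (intro order_tendstoD(2)) auto
  thus "\<forall>\<^sub>F k in sequentially. dist (?f k) (speed \<A> F \<gamma> t) < e"
  proof (rule eventually_mono)
   fix k assume k: "1 / real (Suc k) < min \<rho> (1 - t)"
   let ?h = "1 / real (Suc k)"
   have h: "0 < ?h" "?h < \<rho>" "t + ?h < 1" using k by auto
   have c: "clamp01 t = t" "clamp01 (t + ?h) = t + ?h"
    unfolding clamp01_def using t h by (simp_all only: min_absorb2 max_absorb2 less_imp_le add_pos_pos)
   have "\<bar>d (\<gamma> t) (\<gamma> (t + ?h)) - speed \<A> F \<gamma> t * ?h\<bar> <= e / 2 * ?h" using \<rho>(2)[of "t + ?h"] h by simp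
   hence "real (Suc k) * \<bar>d (\<gamma> t) (\<gamma> (t + ?h)) - speed \<A> F \<gamma> t * ?h\<bar> <= real (Suc k) * (e / 2 * ?h)"
    by (rule mult_left_mono) simp
   moreover have "real (Suc k) * \<bar>d (\<gamma> t) (\<gamma> (t + ?h)) - speed \<A> F \<gamma> t * ?h\<bar> = \<bar>real (Suc k) * (d (\<gamma> t) (\<gamma> (t + ?h)) - speed \<A> F \<gamma> t * ?h)\<bar>"
    by (simp add: abs_mult)
   moreover have "real (Suc k) * (d (\<gamma> t) (\<gamma> (t + ?h)) - speed \<A> F \<gamma> t * ?h) = ?f k - speed \<A> F \<gamma> t"
    unfolding c by (simp add: field_simps)
   moreover have "real (Suc k) * (e / 2 * ?h) = e / 2" by (simp del: of_nat_Suc)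
   ultimately have "\<bar>?f k - speed \<A> F \<gamma> t\<bar> <= e / 2" by (simp only:)
   thus "dist (?f k) (speed \<A> F \<gamma> t) < e" using \<open>0 < e\<close> by (simp add: dist_real_def)
  qed
 qed
 hence "(%k. ennreal (?f k)) \<longlonglongrightarrow> ennreal (speed \<A> F \<gamma> t)" by (rule tendsto_ennrealI)
 hence "limsup (%k. ennreal (?f k)) = ennreal (speed \<A> F \<gamma> t)" by (intro lim_imp_Limsup) auto
 thus ?thesis using t speed_nonneg by (simp add: mspeed_def)
qed

lemma controlled_mspeed_measurable:
 assumes con: "controlled g \<gamma>"
 shows "mspeed \<gamma> \<in> borel_measurable borel"
proof (rule mspeed_measurable[where T = "%x. x" and G = "%_. \<gamma>"])
 have "continuous_on UNIV (%t. \<gamma> (clamp01 t))" by (intro continuous_on_compose2[OF controlled_continuous[OF con]])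
   (auto simp: clamp01_def intro!: continuous_intros)
 hence *: "(%t. \<gamma> (clamp01 t)) \<in> borel \<rightarrow>\<^sub>M borel" by (rule borel_measurable_continuous_onI)
 thus "(%x. \<gamma> (clamp01 x)) \<in> borel \<rightarrow>\<^sub>M borel" .
 show "(%x. \<gamma> (clamp01 (x + 1 / real (Suc k)))) \<in> borel \<rightarrow>\<^sub>M borel" for k
  by (rule measurable_compose[OF _ *]) simp
qed simp

lemma controlled_AE_mspeed:
 assumes con: "controlled g \<gamma>"
 shows "AE t in lborel. 0 < t & t < 1 --> curve_differentiable_at \<A> \<gamma> t & mspeed \<gamma> t = speed \<A> F \<gamma> t"
 using controlled_AE_differentiable[OF con] by (rule eventually_mono) (simp add: mspeed_eq_speed)

lemma has_real_derivative_tendsto_forward: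
 fixes w :: "real => real"
 assumes "(w has_real_derivative D) (at t)"
 shows "(%k. (w (t + 1 / real (Suc k)) - w t) / (1 / real (Suc k))) \<longlonglongrightarrow> D"
proof -
 have "(%k. t + 1 / real (Suc k)) \<longlonglongrightarrow> t + 0" by (intro tendsto_intros LIMSEQ_Suc[OF lim_1_over_n])
 hence "((%y. (w y - w t) / (y - t)) \<circ> (%k. t + 1 / real (Suc k))) \<longlonglongrightarrow> D"
  using assms unfolding has_field_derivative_iff tendsto_at_iff_sequentially by auto
 thus ?thesis by (simp add: o_def)
qed

lemma derivative_ge_speed:
 assumes cd: "curve_differentiable_at \<A> \<gamma> t" and D: "(w has_real_derivative D) (at t)" and t: "t < 1"
  and w: "!!s. t <= s ==> s <= 1 ==> d (\<gamma> t) (\<gamma> s) <= w s - w t"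
 shows "speed \<A> F \<gamma> t <= D"
proof (rule field_le_epsilon)
 fix e :: real assume e: "0 < e"
 from metric_derivative_eq_speed[OF cd this]
 obtain \<rho> where \<rho>: "0 < \<rho>" "!!b. t <= b ==> b - t < \<rho> ==> \<bar>d (\<gamma> t) (\<gamma> b) - speed \<A> F \<gamma> t * (b - t)\<bar> <= e * (b - t)"
  by blast
 have "speed \<A> F \<gamma> t - e <= D"
 proof (rule tendsto_lowerbound[OF has_real_derivative_tendsto_forward[OF D]])
  have "(%k. 1 / real (Suc k)) \<longlonglongrightarrow> 0" by (rule LIMSEQ_Suc[OF lim_1_over_n])
  hence "\<forall>\<^sub>F k in sequentially. 1 / real (Suc k) < min \<rho> (1 - t)" using \<rho>(1) t by (intro order_tendstoD(2)) auto
  thus "\<forall>\<^sub>F k in sequentially. speed \<A> F \<gamma> t - e <= (w (t + 1 / real (Suc k)) - w t) / (1 / real (Suc k))"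
  proof (rule eventually_mono)
   fix k assume k: "1 / real (Suc k) < min \<rho> (1 - t)"
   let ?h = "1 / real (Suc k)"
   have h: "0 < ?h" "?h < \<rho>" "t + ?h <= 1" using k by auto
   have "\<bar>d (\<gamma> t) (\<gamma> (t + ?h)) - speed \<A> F \<gamma> t * ?h\<bar> <= e * ?h" using \<rho>(2)[of "t + ?h"] h by simp
   hence "(speed \<A> F \<gamma> t - e) * ?h <= d (\<gamma> t) (\<gamma> (t + ?h))" unfolding left_diff_distrib by linarith
   also have "... <= w (t + ?h) - w t" using h by (intro w) auto
   finally show "speed \<A> F \<gamma> t - e <= (w (t + ?h) - w t) / ?h" using h(1) by (subst pos_le_divide_eq)
  qed
 qed simp
 thus "speed \<A> F \<gamma> t <= D + e" by simp
qed

text \<open>The speed is the derivative of the distance from \<open>\<gamma> t\<close>, which is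
  dominated by the increment of the indefinite integral \<open>w\<close> of \<open>g\<close>; the
  derivative of \<open>w\<close> is \<open>g\<close> almost everywhere.\<close>

lemma controlled_speed_le:
 assumes con: "controlled g \<gamma>"
 shows "AE t in lborel. mspeed \<gamma> t <= g t"
proof -
 note g = controlledD(1,2)[OF con]
 define w where "w x = (LINT y:{0<..x}|lborel. g y)" for x
 have w: "w t - w s = (LINT x:{s<..t}|lborel. g x)" if "0 <= s" "s <= t" for s t
  using set_integral_Ioc_split[OF g(1) that] by (simp add: w_def)
 have "AE t in lborel. 0 < t & t < 1 --> (w has_real_derivative g t) (at t)"
  by (rule AE_has_real_derivative_integral[OF g(1)]) (simp add: w)
 with controlled_AE_mspeed[OF con] show ?thesis
 proof eventually_elim
  case (elim t)
  show ?case
  proof (cases "0 < t & t < 1")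
   case True
   hence "speed \<A> F \<gamma> t <= g t" using elim controlledD(3)[OF con] w by (intro derivative_ge_speed[of \<gamma> t w]) auto
   thus ?thesis using elim True by simp
  next
   case False
   thus ?thesis using g(2)[of t] by (simp add: mspeed_def)
  qed
 qed
qed

lemma controlled_mspeed_integrable:
 assumes con: "controlled g \<gamma>"
 shows "integrable lborel (mspeed \<gamma>)"
 using controlled_speed_le[OF con] mspeed_nonneg controlledD(2)[OF con] controlled_mspeed_measurable[OF con]
 by (intro Bochner_Integration.integrable_bound[OF controlledD(1)[OF con]]) (auto elim!: eventually_mono)

text \<open>The distance from \<open>\<gamma> s\<close> is an absolutely continuous function of
  time, and by the triangle inequality its derivative is at most the speed. Reversal is what bounds
  its decrease and so gives absolute continuity.\<close>

lemma dist_le_integral_mspeed: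
 assumes con: "controlled g \<gamma>" and st: "0 <= s" "s <= t" "t <= 1"
 shows "d (\<gamma> s) (\<gamma> t) <= (LINT x:{s<..t}|lborel. mspeed \<gamma> x)"
proof -
 note g = controlledD(1,2)[OF con]
 obtain C where C: "1 <= C" "\<forall>s\<in>{0..1}. \<forall>t\<in>{0..1}. d (\<gamma> s) (\<gamma> t) <= C * d (\<gamma> t) (\<gamma> s)"
  using controlled_reversible[OF con] by blast
 let ?w = "%r. d (\<gamma> s) (\<gamma> r)"
 have "\<exists>h. integrable lborel h & (\<forall>r r'. s <= r & r <= r' & r' <= t --> ?w r' - ?w r = (LINT x:{r<..r'}|lborel. h x))"
 proof (rule absolutely_continuous_density[where g = "%x. C * g x", OF _ _ st(2)])
  show "integrable lborel (%x. C * g x)" using g(1) by simp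
  show "0 <= C * g x" for x using g(2) C(1) by simp
  fix r r' assume r: "s <= r" "r <= r'" "r' <= t"
  have G: "d (\<gamma> r) (\<gamma> r') <= (LINT x:{r<..r'}|lborel. g x)" using controlledD(3)[OF con] r st by simp
  have "d (\<gamma> r') (\<gamma> r) <= C * d (\<gamma> r) (\<gamma> r')" using C(2) r st by auto
  moreover have "d (\<gamma> r) (\<gamma> r') <= C * d (\<gamma> r) (\<gamma> r')" using mult_right_mono[OF C(1) dist_nonneg[of "\<gamma> r" "\<gamma> r'"]] by simp
  moreover have "C * d (\<gamma> r) (\<gamma> r') <= C * (LINT x:{r<..r'}|lborel. g x)" using G C(1) by (intro mult_left_mono) auto
  moreover have "?w r' <= ?w r + d (\<gamma> r) (\<gamma> r')" "?w r <= ?w r' + d (\<gamma> r') (\<gamma> r)" by (rule dist_triangle_ineq)+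
  ultimately show "\<bar>?w r' - ?w r\<bar> <= (LINT x:{r<..r'}|lborel. C * g x)" by (simp add: abs_le_iff)
 qed
 then obtain h where h: "integrable lborel h"
  "!!r r'. s <= r ==> r <= r' ==> r' <= t ==> ?w r' - ?w r = (LINT x:{r<..r'}|lborel. h x)" by blast
 have "AE r in lborel. s < r & r < t --> (?w has_real_derivative h r) (at r)" by (rule AE_has_real_derivative_integral[OF h])
 with controlled_AE_mspeed[OF con]
 have AEh: "AE r in lborel. s < r & r < t --> h r <= mspeed \<gamma> r"
 proof eventually_elim
  case (elim r)
  show ?case
  proof
   assume r: "s < r & r < t"
   hence r01: "0 < r" "r < 1" using st by auto
   have cd: "curve_differentiable_at \<A> \<gamma> r" "mspeed \<gamma> r = speed \<A> F \<gamma> r" using elim(1) r01 by auto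
   have D: "(?w has_real_derivative h r) (at r)" using elim(2) r by simp
   have "h r <= speed \<A> F \<gamma> r"
   proof (rule field_le_epsilon)
    fix e :: real assume "0 < e"
    from metric_derivative_eq_speed[OF cd(1) this]
    obtain \<rho> where \<rho>: "0 < \<rho>" "!!b. r <= b ==> b - r < \<rho> ==> \<bar>d (\<gamma> r) (\<gamma> b) - speed \<A> F \<gamma> r * (b - r)\<bar> <= e * (b - r)"
     by blast
    show "h r <= speed \<A> F \<gamma> r + e"
    proof (rule tendsto_upperbound[OF has_real_derivative_tendsto_forward[OF D]])
     have "(%k. 1 / real (Suc k)) \<longlonglongrightarrow> 0" by (rule LIMSEQ_Suc[OF lim_1_over_n])
     hence "\<forall>\<^sub>F k in sequentially. 1 / real (Suc k) < \<rho>" using \<rho>(1) by (intro order_tendstoD(2)) auto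
     thus "\<forall>\<^sub>F k in sequentially. (?w (r + 1 / real (Suc k)) - ?w r) / (1 / real (Suc k)) <= speed \<A> F \<gamma> r + e"
     proof (rule eventually_mono)
      fix k assume k: "1 / real (Suc k) < \<rho>"
      let ?h = "1 / real (Suc k)"
      have h: "0 < ?h" by simp
      have "\<bar>d (\<gamma> r) (\<gamma> (r + ?h)) - speed \<A> F \<gamma> r * ?h\<bar> <= e * ?h" using \<rho>(2)[of "r + ?h"] h k by simp
      moreover have "?w (r + ?h) - ?w r <= d (\<gamma> r) (\<gamma> (r + ?h))" using dist_triangle_ineq[of "\<gamma> s" "\<gamma> (r + ?h)" "\<gamma> r"] by simp
      ultimately have "?w (r + ?h) - ?w r <= (speed \<A> F \<gamma> r + e) * ?h" unfolding distrib_right by linarith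
      thus "(?w (r + ?h) - ?w r) / ?h <= speed \<A> F \<gamma> r + e" using h by (subst pos_divide_le_eq)
     qed
    qed simp
   qed
   thus "h r <= mspeed \<gamma> r" using cd(2) by simp
  qed
 qed
 have "d (\<gamma> s) (\<gamma> t) = (LINT x:{s<..t}|lborel. h x)" using h(2)[of s t] st by simp
 also have "... <= (LINT x:{s<..t}|lborel. mspeed \<gamma> x)" unfolding set_lebesgue_integral_def
 proof (rule integral_mono_AE)
  show "integrable lborel (%x. indicator {s<..t} x *\<^sub>R h x)" "integrable lborel (%x. indicator {s<..t} x *\<^sub>R mspeed \<gamma> x)"
   by (intro integrable_mult_indicator h(1) controlled_mspeed_integrable[OF con]; simp)+
  show "AE x in lborel. indicator {s<..t} x *\<^sub>R h x <= indicator {s<..t} x *\<^sub>R mspeed \<gamma> x"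
   using AEh AE_lborel_singleton[of t] by eventually_elim (auto split: split_indicator)
 qed
 finally show ?thesis .
qed

text \<open>The speed is a density for the forward class, and \<open>C\<close> times the speed is
  one for the backward class.\<close>

lemma controlled_AC:
 assumes con: "controlled g \<gamma>" and fin: "(\<integral>\<^sup>+t. ennreal (mspeed \<gamma> t powr p) \<partial>lborel) < \<infinity>"
 shows "\<gamma> \<in> AC p UNIV d"
proof -
 have [measurable]: "mspeed \<gamma> \<in> borel_measurable borel" by (rule controlled_mspeed_measurable[OF con])
 have ip: "integrable lborel (%t. mspeed \<gamma> t powr p)" using fin by (intro integrableI_nonneg) auto
 have Lp: "(%t. c * mspeed \<gamma> t) \<in> Lp_nonneg p" if "0 <= c" for c
 proof -
  have "(%t. (c * mspeed \<gamma> t) powr p) = (%t. c powr p * mspeed \<gamma> t powr p)"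
   using that mspeed_nonneg by (simp add: powr_mult)
  hence i: "integrable lborel (%t. (c * mspeed \<gamma> t) powr p)" using ip by simp
  hence "integrable lebesgue (%t. (c * mspeed \<gamma> t) powr p)" by (subst integrable_completion) auto
  hence "integrable lebesgue (%t. indicator {0..1} t *\<^sub>R (c * mspeed \<gamma> t) powr p)"
   by (intro integrable_mult_indicator) auto
  hence "integrable (lebesgue_on {0..1}) (%t. (c * mspeed \<gamma> t) powr p)"
   by (subst integrable_restrict_space) (auto simp: set_integrable_def)
  moreover have "(%t. c * mspeed \<gamma> t) \<in> borel_measurable (lebesgue_on {0..1})"
   by (intro measurable_restrict_space1 measurable_completion) simp
  ultimately show ?thesis unfolding Lp_nonneg_def using that mspeed_nonneg by simp
 qed
 obtain C where C: "1 <= C" "\<forall>s\<in>{0..1}. \<forall>t\<in>{0..1}. d (\<gamma> s) (\<gamma> t) <= C * d (\<gamma> t) (\<gamma> s)"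
  using controlled_reversible[OF con] by blast
 have I: "(LINT t|lebesgue_on {a..b}. c * mspeed \<gamma> t) = c * (LINT x:{a<..b}|lborel. mspeed \<gamma> x)" for a b c
  by (subst LINT_lebesgue_on_Icc) simp_all
 have "\<gamma> \<in> FAC p UNIV d" unfolding FAC_def
  using Lp[of 1] I[where c = 1] dist_le_integral_mspeed[OF con] by (intro CollectI conjI bexI[of _ "%t. 1 * mspeed \<gamma> t"]) simp_all
 moreover have "\<gamma> \<in> BAC p UNIV d" unfolding BAC_def
 proof (intro CollectI conjI bexI allI impI)
  show "(%t. C * mspeed \<gamma> t) \<in> Lp_nonneg p" using C(1) by (intro Lp) simp
  fix a b :: real assume ab: "0 <= a & a <= b & b <= 1"
  have "d (\<gamma> b) (\<gamma> a) <= C * d (\<gamma> a) (\<gamma> b)" using C(2) ab by auto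
  also have "... <= C * (LINT x:{a<..b}|lborel. mspeed \<gamma> x)"
   using dist_le_integral_mspeed[OF con, of a b] ab C(1) by (intro mult_left_mono) auto
  finally show "d (\<gamma> b) (\<gamma> a) <= (LINT t|lebesgue_on {a..b}. C * mspeed \<gamma> t)" unfolding I .
 qed simp
 ultimately show ?thesis unfolding AC_def by (rule IntI)
qed

text \<open>The step functions \<open>f M\<close> have the dyadic energies as integrals, and where
  the curve is differentiable their lower limit is at least the \<open>p\<close>-th power of the
  speed; Fatou's lemma concludes.\<close>

lemma energy_mspeed_le:
 assumes con: "controlled g \<gamma>"
  and E: "!!M. (\<Sum>i<2 ^ M. pen p (d (\<gamma> (real i / 2 ^ M)) (\<gamma> (real (Suc i) / 2 ^ M))) (1 / 2 ^ M)) <= E"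
 shows "(\<integral>\<^sup>+t. ennreal (mspeed \<gamma> t powr p) \<partial>lborel) <= ennreal E"
proof -
 have [measurable]: "mspeed \<gamma> \<in> borel_measurable borel" by (rule controlled_mspeed_measurable[OF con])
 define e where "e M i = pen p (d (\<gamma> (real i / 2 ^ M)) (\<gamma> (real (Suc i) / 2 ^ M))) (1 / 2 ^ M)" for M i
 define f where "f M t = (\<Sum>i<2 ^ M. ennreal (2 ^ M * e M i) * indicator {real i / 2 ^ M..<real (Suc i) / 2 ^ M} t)" for M :: nat and t
 have intf: "(\<integral>\<^sup>+t. f M t \<partial>lborel) <= ennreal E" for M
 proof -
  have "(\<integral>\<^sup>+t. f M t \<partial>lborel) = (\<Sum>i<2 ^ M. ennreal (2 ^ M * e M i) * emeasure lborel {real i / 2 ^ M..<real (Suc i) / 2 ^ M})"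
   unfolding f_def by (subst nn_integral_sum) (auto simp: nn_integral_cmult_indicator)
  also have "... = (\<Sum>i<2 ^ M. ennreal (e M i))"
  proof (rule sum.cong[OF refl])
   fix i
   have "emeasure lborel {real i / 2 ^ M..<real (Suc i) / 2 ^ M} = ennreal (1 / 2 ^ M)"
    by (subst emeasure_lborel_Ico) (auto simp: divide_right_mono diff_divide_distrib[symmetric])
   thus "ennreal (2 ^ M * e M i) * emeasure lborel {real i / 2 ^ M..<real (Suc i) / 2 ^ M} = ennreal (e M i)"
    by (simp add: ennreal_mult'[symmetric] e_def pen_nonneg)
  qed
  also have "... = ennreal (\<Sum>i<2 ^ M. e M i)" by (intro sum_ennreal) (simp add: e_def pen_nonneg)
  also have "... <= ennreal E" using E[of M] unfolding e_def by (rule ennreal_leI)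
  finally show ?thesis .
 qed
 have "AE t in lborel. ennreal (mspeed \<gamma> t powr p) <= liminf (%M. f M t)" using controlled_AE_mspeed[OF con]
 proof eventually_elim
  case (elim t)
  show ?case
  proof (cases "0 < t & t < 1")
   case False
   thus ?thesis using p by (simp add: mspeed_def)
  next
   case True
   let ?v = "speed \<A> F \<gamma> t"
   have cd: "curve_differentiable_at \<A> \<gamma> t" and mv: "mspeed \<gamma> t = ?v" using elim True by auto
   define i where "i M = nat \<lfloor>t * 2 ^ M\<rfloor>" for M :: nat
   have df: "dyadic_floor M t = real (i M) / 2 ^ M" for M by (simp add: dyadic_floor_def i_def)
   have b: "real (i M) / 2 ^ M <= t" "t < real (Suc (i M)) / 2 ^ M" for M
    using dyadic_floor_bounds[of t M] True unfolding df by (auto simp: add_divide_distrib)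
   have iM: "i M < 2 ^ M" for M
   proof -
    have "real (i M) / 2 ^ M < 1" using b(1)[of M] True by linarith
    hence "real (i M) < 1 * 2 ^ M" by (simp only: pos_divide_less_eq zero_less_power zero_less_numeral)
    thus ?thesis by (metis mult_1 of_nat_less_iff of_nat_numeral of_nat_power)
   qed
   let ?D = "%M. d (\<gamma> (real (i M) / 2 ^ M)) (\<gamma> (real (Suc (i M)) / 2 ^ M))"
   have fge: "ennreal ((2 ^ M * ?D M) powr p) <= f M t" for M
   proof -
    have "(2 ^ M * ?D M) powr p = 2 ^ M * e M (i M)" unfolding e_def using dist_nonneg by (simp add: pen_alt mult.commute)
    moreover have "ennreal (2 ^ M * e M (i M)) * indicator {real (i M) / 2 ^ M..<real (Suc (i M)) / 2 ^ M} t <= f M t"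
     unfolding f_def using iM[of M] by (intro member_le_sum) auto
    ultimately show ?thesis using b[of M] by simp
   qed
   have "(%M. 2 ^ M * ?D M) \<longlonglongrightarrow> ?v"
   proof (rule tendstoI)
    fix \<epsilon> :: real assume "0 < \<epsilon>"
    hence "0 < \<epsilon> / 2" by simp
    from metric_derivative_eq_speed[OF cd this]
    obtain \<rho> where \<rho>: "0 < \<rho>" "!!a b. a <= t ==> t <= b ==> b - a < \<rho> ==> \<bar>d (\<gamma> a) (\<gamma> b) - ?v * (b - a)\<bar> <= \<epsilon> / 2 * (b - a)"
     by blast
    have "(%m. (1 / 2 :: real) ^ m) \<longlonglongrightarrow> 0" by (rule LIMSEQ_realpow_zero) auto
    hence "\<forall>\<^sub>F m in sequentially. (1 / 2 :: real) ^ m < \<rho>" using \<rho>(1) by (rule order_tendstoD(2))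
    thus "\<forall>\<^sub>F M in sequentially. dist (2 ^ M * ?D M) ?v < \<epsilon>"
    proof (rule eventually_mono)
     fix M assume M: "(1 / 2 :: real) ^ M < \<rho>"
     have len: "real (Suc (i M)) / 2 ^ M - real (i M) / 2 ^ M = 1 / 2 ^ M" by (simp add: diff_divide_distrib[symmetric])
     have "\<bar>?D M - ?v * (1 / 2 ^ M)\<bar> <= \<epsilon> / 2 * (1 / 2 ^ M)"
      using \<rho>(2)[of "real (i M) / 2 ^ M" "real (Suc (i M)) / 2 ^ M"] b[of M] M unfolding len by (simp add: power_one_over)
     hence "2 ^ M * \<bar>?D M - ?v * (1 / 2 ^ M)\<bar> <= 2 ^ M * (\<epsilon> / 2 * (1 / 2 ^ M))" by (rule mult_left_mono) simp
     moreover have "2 ^ M * \<bar>?D M - ?v * (1 / 2 ^ M)\<bar> = \<bar>2 ^ M * (?D M - ?v * (1 / 2 ^ M))\<bar>" by (simp add: abs_mult)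
     moreover have "2 ^ M * (?D M - ?v * (1 / 2 ^ M)) = 2 ^ M * ?D M - ?v" by (simp add: right_diff_distrib)
     ultimately have "\<bar>2 ^ M * ?D M - ?v\<bar> <= \<epsilon> / 2" by simp
     thus "dist (2 ^ M * ?D M) ?v < \<epsilon>" using \<open>0 < \<epsilon>\<close> by (simp add: dist_real_def)
    qed
   qed
   hence "(%M. (2 ^ M * ?D M) powr p) \<longlonglongrightarrow> ?v powr p"
    using p dist_nonneg by (intro tendsto_powr2) (auto intro: always_eventually)
   hence "(%M. ennreal ((2 ^ M * ?D M) powr p)) \<longlonglongrightarrow> ennreal (?v powr p)" by (rule tendsto_ennrealI)
   hence "ennreal (?v powr p) = liminf (%M. ennreal ((2 ^ M * ?D M) powr p))" by (intro lim_imp_Liminf[symmetric]) auto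
   also have "... <= liminf (%M. f M t)" by (intro Liminf_mono always_eventually allI fge)
   finally show ?thesis unfolding mv .
  qed
 qed
 hence "(\<integral>\<^sup>+t. ennreal (mspeed \<gamma> t powr p) \<partial>lborel) <= (\<integral>\<^sup>+t. liminf (%M. f M t) \<partial>lborel)" by (rule nn_integral_mono_AE)
 also have "... <= liminf (%M. \<integral>\<^sup>+t. f M t \<partial>lborel)" by (rule nn_integral_liminf) (unfold f_def, measurable)
 also have "... <= liminf (%M :: nat. ennreal E)" using intf by (intro Liminf_mono always_eventually) simp
 also have "... = ennreal E" by (simp add: Liminf_const)
 finally show ?thesis .
qed

end

section \<open>Couplings and Wasserstein distances\<close>

context finsler
begin

lemma continuous_dist:
 "continuous_on UNIV (%y. d x y)" "continuous_on UNIV (%y. d y x)"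
 unfolding continuous_on_def by (intro ballI tendsto_dist_Finsler tendsto_const tendsto_ident_at)+

lemma ex_dense_seq: "\<exists>z :: nat => 'a. \<forall>U. open U --> U ~= {} --> (\<exists>k. z k \<in> U)"
proof -
 obtain D :: "'a set" where D: "countable D" "!!X. open X ==> X ~= {} ==> \<exists>x\<in>D. x \<in> X"
  using countable_dense_exists by blast
 have "D ~= {}" using D(2)[of UNIV] by auto
 have "\<exists>k. from_nat_into D k \<in> U" if U: "open U" "U ~= {}" for U
 proof -
  obtain x where "x \<in> D" "x \<in> U" using D(2)[OF U] by blast
  thus ?thesis using from_nat_into_surj[OF D(1)] by metis
 qed
 thus ?thesis by blast
qed

definition dense_seq :: "nat => 'a" where
 "dense_seq = (SOME z. \<forall>U. open U --> U ~= {} --> (\<exists>k. z k \<in> U))"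

lemma dense_seq: "open U ==> U ~= {} ==> \<exists>k. dense_seq k \<in> U"
 using someI_ex[OF ex_dense_seq] unfolding dense_seq_def by blast

text \<open>Closeness to the centre is required in both directions, so that centres may replace
  points in either argument of the distance.\<close>

definition cell :: "nat => 'a => nat" where
 "cell m x = (LEAST k. d (dense_seq k) x + d x (dense_seq k) < 1 / 2 ^ m)"

lemma dist_cell: "d (dense_seq (cell m x)) x + d x (dense_seq (cell m x)) < 1 / 2 ^ m"
proof -
 have "open {y. d y x + d x y < 1 / 2 ^ m}" by (intro open_Collect_less continuous_on_add continuous_dist continuous_on_const)
 moreover have "x \<in> {y. d y x + d x y < 1 / 2 ^ m}" by simp
 ultimately obtain k where "d (dense_seq k) x + d x (dense_seq k) < 1 / 2 ^ m" using dense_seq by blast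
 thus ?thesis unfolding cell_def by (rule LeastI)
qed

lemma cell_measurable [measurable]: "cell m \<in> borel \<rightarrow>\<^sub>M count_space UNIV" unfolding cell_def by measurable

lemma same_cell_dist:
 assumes "cell m x = cell m y"
 shows "d x y <= 2 / 2 ^ m"
proof -
 have "d x y <= d x (dense_seq (cell m x)) + d (dense_seq (cell m x)) y" by (rule dist_triangle_ineq)
 thus ?thesis
  using dist_cell[of m x] dist_cell[of m y] assms dist_nonneg[of "dense_seq (cell m x)" x] dist_nonneg[of y "dense_seq (cell m y)"] by simp
qed

text \<open>The set is the target of the distance: a point at distance 0 belongs to a closed set
  because small forward balls around it fit into open sets.\<close>

definition dist_to :: "'a set => 'a => real" where
 "dist_to C x = (INF y\<in>C. d x y)"

context
 fixes C :: "'a set"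
 assumes ne: "C ~= {}"
begin

lemma dist_to_le: "y \<in> C ==> dist_to C x <= d x y" unfolding dist_to_def by (intro cINF_lower bdd_belowI2[of _ 0] dist_nonneg)

lemma dist_to_nonneg: "0 <= dist_to C x" unfolding dist_to_def by (intro cINF_greatest ne dist_nonneg)

lemma dist_to_triangle: "dist_to C x <= d x x' + dist_to C x'"
proof -
 have "dist_to C x - d x x' <= dist_to C x'" unfolding dist_to_def[of C x']
 proof (rule cINF_greatest[OF ne])
  fix y assume "y \<in> C"
  thus "dist_to C x - d x x' <= d x' y" using dist_to_le[of y x] dist_triangle_ineq[of x y x'] by simp
 qed
 thus ?thesis by simp
qed

lemma dist_to_tendsto: "(f \<longlongrightarrow> x) G ==> ((%s. dist_to C (f s)) \<longlongrightarrow> dist_to C x) G"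
proof -
 assume f: "(f \<longlongrightarrow> x) G"
 have "((%s. dist_to C (f s) - dist_to C x) \<longlongrightarrow> 0) G"
 proof (rule Lim_null_comparison)
  show "\<forall>\<^sub>F s in G. norm (dist_to C (f s) - dist_to C x) <= d x (f s) + d (f s) x"
  proof (rule always_eventually, rule allI)
   fix s
   show "norm (dist_to C (f s) - dist_to C x) <= d x (f s) + d (f s) x"
    using dist_to_triangle[of x "f s"] dist_to_triangle[of "f s" x] dist_nonneg[of x "f s"] dist_nonneg[of "f s" x] by (simp add: abs_le_iff)
  qed
 qed (rule filterlim_compose[OF dist_tendsto_zero f])
 thus ?thesis by (simp add: LIM_zero_iff)
qed

lemma dist_to_continuous: "continuous_on UNIV (dist_to C)" unfolding continuous_on_def by (intro ballI dist_to_tendsto tendsto_ident_at)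

lemma dist_to_measurable [measurable]: "dist_to C \<in> borel_measurable borel" by (rule borel_measurable_continuous_onI[OF dist_to_continuous])

lemma dist_to_eq_0_iff: "closed C ==> dist_to C x = 0 \<longleftrightarrow> x \<in> C"
proof
 assume C: "closed C" and 0: "dist_to C x = 0"
 show "x \<in> C"
 proof (rule ccontr)
  assume "x \<notin> C"
  then obtain e where e: "0 < e" "!!y. d x y < e ==> y \<in> - C"
   using forward_ball_subset[of "- C" x] C by (auto simp: open_Compl)
  have "e <= dist_to C x" unfolding dist_to_def by (rule cINF_greatest[OF ne]) (use e(2) in \<open>force simp: not_less[symmetric]\<close>)
  thus False using 0 e(1) by simp
 qed
next
 assume "x \<in> C"
 thus "dist_to C x = 0" using dist_to_le[of x x] dist_to_nonneg[of x] by simp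
qed

end

text \<open>An open set \<open>U\<close> is recognised by the real function
  \<open>dist_to (- U)\<close>, and its composition with the limit is a limit of real measurable
  functions.\<close>

lemma measurable_limit:
 assumes X: "!!n. X n \<in> M \<rightarrow>\<^sub>M (borel :: 'a measure)" and lim: "!!u. u \<in> space M ==> (%n. X n u) \<longlonglongrightarrow> Y u"
 shows "Y \<in> M \<rightarrow>\<^sub>M borel"
proof (rule borel_measurableI)
 fix U :: "'a set" assume "open U"
 show "Y -` U \<inter> space M \<in> sets M"
 proof (cases "- U = {}")
  case True
  hence "Y -` U \<inter> space M = space M" by auto
  thus ?thesis by simp
 next
  case False
  have "(%u. dist_to (- U) (Y u)) \<in> borel_measurable M"
  proof (rule borel_measurable_LIMSEQ_real)
   show "(%n. dist_to (- U) (X n u)) \<longlonglongrightarrow> dist_to (- U) (Y u)" if "u \<in> space M" for u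
    by (rule dist_to_tendsto[OF False lim[OF that]])
   show "(%u. dist_to (- U) (X n u)) \<in> borel_measurable M" for n by (rule measurable_compose[OF X dist_to_measurable[OF False]])
  qed
  hence "{u \<in> space M. dist_to (- U) (Y u) ~= 0} \<in> sets M" by measurable
  moreover have "{u \<in> space M. dist_to (- U) (Y u) ~= 0} = Y -` U \<inter> space M"
   using dist_to_eq_0_iff[OF False] \<open>open U\<close> by auto
  ultimately show ?thesis by simp
 qed
qed

text \<open>Approximates the indicator of a closed set from above; it is Lipschitz with respect to
  the asymmetric distance.\<close>

definition bump :: "'a set => nat => 'a => real" where
 "bump C n x = max 0 (1 - real n * dist_to C x)"

lemma bump_bounds: "C ~= {} ==> 0 <= bump C n x" "C ~= {} ==> bump C n x <= 1"
 using dist_to_nonneg by (auto simp: bump_def)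

lemma bump_measurable [measurable]: "C ~= {} ==> bump C n \<in> borel_measurable borel"
 unfolding bump_def using dist_to_measurable by measurable

lemma bump_tendsto: "C ~= {} ==> (f \<longlongrightarrow> x) G ==> ((%s. bump C n (f s)) \<longlongrightarrow> bump C n x) G"
 unfolding bump_def by (intro tendsto_max tendsto_const tendsto_diff tendsto_mult dist_to_tendsto)

lemma bump_Lipschitz: "C ~= {} ==> bump C n y <= bump C n x + real n * d x y"
proof -
 assume "C ~= {}"
 from mult_left_mono[OF dist_to_triangle[OF this, of x y], of "real n"]
 show ?thesis using dist_nonneg[of x y] by (auto simp: bump_def max_def distrib_left)
qed

text \<open>The inequality gives \<open>measure P C <= measure Q C\<close> for closed
  \<open>C\<close>. Applied to the complements of open neighbourhoods shrinking to \<open>C\<close>,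
  it gives the converse, since both total masses are 1.\<close>

lemma measure_eq_if_bump_le:
 assumes P: "prob_space P" "sets P = sets borel" and Q: "prob_space Q" "sets Q = sets borel"
  and le: "!!C n. closed C ==> C ~= {} ==> (\<integral>\<^sup>+x. ennreal (bump C n x) \<partial>P) <= (\<integral>\<^sup>+x. ennreal (bump C n x) \<partial>Q)"
 shows "P = Q"
proof -
 interpret P: prob_space P by fact
 interpret Q: prob_space Q by fact
 have sp: "space P = UNIV" "space Q = UNIV" using P Q sets_eq_imp_space_eq[of _ borel] by auto
 define A where "A C n = {x. real n * dist_to C x < 1}" for C :: "'a set" and n :: nat
 have A_open: "open (A C n)" if "C ~= {}" for C n unfolding A_def by (intro open_Collect_less continuous_intros dist_to_continuous[OF that])
 have A_lim: "(%n. measure M (A C n)) \<longlonglongrightarrow> measure M C"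
  if C: "closed C" "C ~= {}" and M: "prob_space M" "sets M = sets borel" for C M
 proof -
  interpret M: prob_space M by fact
  have "(%n. measure M (A C n)) \<longlonglongrightarrow> measure M (\<Inter>n. A C n)"
  proof (rule M.finite_Lim_measure_decseq)
   show "range (A C) \<subseteq> sets M" using A_open[OF C(2)] M(2) by auto
   show "decseq (A C)"
   proof (rule decseq_SucI, rule subsetI)
    fix n x assume "x \<in> A C (Suc n)"
    thus "x \<in> A C n" using dist_to_nonneg[OF C(2), of x] by (simp add: A_def distrib_right)
   qed
  qed
  moreover have "(\<Inter>n. A C n) = C"
  proof (intro set_eqI iffI)
   fix x assume x: "x \<in> (\<Inter>n. A C n)"
   have "dist_to C x = 0"
   proof (rule ccontr)
    assume "dist_to C x ~= 0"
    hence "0 < dist_to C x" using dist_to_nonneg[OF C(2), of x] by simp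
    then obtain n where "1 < real n * dist_to C x" using reals_Archimedean3 by blast
    moreover have "real n * dist_to C x < 1" using x by (auto simp: A_def)
    ultimately show False by simp
   qed
   thus "x \<in> C" using dist_to_eq_0_iff[OF C(2,1)] by simp
  next
   fix x assume "x \<in> C"
   thus "x \<in> (\<Inter>n. A C n)" using dist_to_eq_0_iff[OF C(2,1), of x] by (simp add: A_def)
  qed
  ultimately show ?thesis by simp
 qed
 have closed_le: "measure P C <= measure Q C" if C: "closed C" for C
 proof (cases "C = {}")
  case False
  have "measure P C <= measure Q (A C n)" for n
  proof -
   have "emeasure P C = (\<integral>\<^sup>+x. indicator C x \<partial>P)" using C P by simp
   also have "... <= (\<integral>\<^sup>+x. ennreal (bump C n x) \<partial>P)"
   proof (rule nn_integral_mono)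
    show "indicator C x <= ennreal (bump C n x)" for x using dist_to_eq_0_iff[OF False C, of x] by (cases "x \<in> C") (simp_all add: bump_def)
   qed
   also have "... <= (\<integral>\<^sup>+x. ennreal (bump C n x) \<partial>Q)" by (rule le[OF C False])
   also have "... <= (\<integral>\<^sup>+x. indicator (A C n) x \<partial>Q)"
    using bump_bounds[OF False] by (intro nn_integral_mono) (auto simp: bump_def A_def ennreal_neg split: split_indicator)
   also have "... = emeasure Q (A C n)" using A_open[OF False] Q by simp
   finally show ?thesis by (simp add: P.emeasure_eq_measure Q.emeasure_eq_measure)
  qed
  thus ?thesis using A_lim[OF C False Q] by (intro LIMSEQ_le_const) auto
 qed simp
 have "measure P C = measure Q C" if C: "closed C" for C
 proof (rule antisym[OF closed_le[OF C]])
  show "measure Q C <= measure P C"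
  proof (cases "C = {}")
   case False
   have "measure Q (A C n) <= measure P (A C n)" for n
    using closed_le[of "- A C n"] A_open[OF False, of n] P.prob_compl[of "A C n"] Q.prob_compl[of "A C n"] P Q sp
    by (auto simp: Compl_eq_Diff_UNIV closed_def)
   thus ?thesis using A_lim[OF C False P] A_lim[OF C False Q] by (intro LIMSEQ_le) auto
  qed simp
 qed
 thus ?thesis
 proof (intro measure_eqI_generator_eq[where \<Omega> = UNIV and E = "{S. closed S}" and A = "%_. UNIV"])
  show "Int_stable {S :: 'a set. closed S}" by (auto simp: Int_stable_def)
  show "sets P = sigma_sets UNIV {S. closed S}" "sets Q = sigma_sets UNIV {S. closed S}" using P Q by (auto simp: borel_eq_closed)
 qed (use P.emeasure_finite in \<open>auto simp: P.emeasure_eq_measure Q.emeasure_eq_measure\<close>)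
qed

end

section \<open>Couplings of finite and nearly optimal cost\<close>

context theta_finsler
begin

abbreviation "PM \<equiv> wasserstein_space p d star"
abbreviation "WD \<equiv> wasserstein_dist p d"

lemma wasserstein_space_D:
 assumes "\<mu> \<in> PM"
 shows "prob_space \<mu>" "sets \<mu> = sets borel" "space \<mu> = UNIV" "(\<integral>\<^sup>+x. ennreal (sym_dist d star x powr p) \<partial>\<mu>) < \<infinity>"
proof -
 show 1: "prob_space \<mu>" "sets \<mu> = sets borel" "(\<integral>\<^sup>+x. ennreal (sym_dist d star x powr p) \<partial>\<mu>) < \<infinity>"
  using assms unfolding wasserstein_space_def borel_prob_def by simp_all
 show "space \<mu> = UNIV" using sets_eq_imp_space_eq[OF 1(2)] by simp
qed

lemma couplings_D:
 assumes "\<pi> \<in> couplings \<mu> \<nu>"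
 shows "prob_space \<pi>" "sets \<pi> = sets borel" "space \<pi> = UNIV" "distr \<pi> borel fst = \<mu>" "distr \<pi> borel snd = \<nu>"
proof -
 show 1: "prob_space \<pi>" "sets \<pi> = sets borel" "distr \<pi> borel fst = \<mu>" "distr \<pi> borel snd = \<nu>"
  using assms unfolding couplings_def borel_prob_def by simp_all
 show "space \<pi> = UNIV" using sets_eq_imp_space_eq[OF 1(2)] by simp
qed

lemma fst_snd_borel [measurable]:
 "fst \<in> (borel :: ('a \<times> 'a) measure) \<rightarrow>\<^sub>M borel" "snd \<in> (borel :: ('a \<times> 'a) measure) \<rightarrow>\<^sub>M borel"
 unfolding borel_prod[symmetric] by measurable

lemma cost_integrand_measurable:
 "sets \<pi> = sets (borel :: ('a \<times> 'a) measure) ==> (%z. ennreal (d (fst z) (snd z) powr q)) \<in> borel_measurable \<pi>"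
 by (subst measurable_cong_sets[of \<pi> borel]) measurable

text \<open>The product measure has finite cost: \<open>d x y\<close> is at most 4 times the larger
  of the symmetrised distances of \<open>x\<close> and \<open>y\<close> from \<open>star\<close>.
  This makes the real infimum in \<open>wasserstein_dist\<close> meaningful.\<close>

lemma ex_finite_coupling:
 assumes \<mu>: "\<mu> \<in> PM" and \<nu>: "\<nu> \<in> PM"
 shows "\<exists>\<pi>\<in>couplings \<mu> \<nu>. transport_cost p d \<pi> < \<infinity>"
proof -
 note M = wasserstein_space_D[OF \<mu>] and N = wasserstein_space_D[OF \<nu>]
 interpret M: prob_space \<mu> by (rule M)
 interpret N: prob_space \<nu> by (rule N)
 interpret pair_prob_space \<mu> \<nu> ..
 let ?\<pi> = "\<mu> \<Otimes>\<^sub>M \<nu>"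
 have s: "sets ?\<pi> = sets borel" by (subst sets_pair_measure_cong[OF M(2) N(2)]) (simp only: borel_prod)
 have "distr ?\<pi> borel fst = distr ?\<pi> \<mu> fst" "distr ?\<pi> borel snd = distr ?\<pi> \<nu> snd"
  using M(2) N(2) by (auto intro!: distr_cong)
 moreover have "distr ?\<pi> \<mu> fst = \<mu>" by (rule N.distr_pair_fst)
 moreover have "distr ?\<pi> \<nu> snd = \<nu>"
 proof (rule measure_eqI)
  fix A assume "A \<in> sets (distr ?\<pi> \<nu> snd)"
  hence A: "A \<in> sets \<nu>" by simp
  have "snd -` A \<inter> space ?\<pi> = space \<mu> \<times> A" using M(3) N(3) by (auto simp: space_pair_measure)
  thus "emeasure (distr ?\<pi> \<nu> snd) A = emeasure \<nu> A"
   using A by (simp add: emeasure_distr N.emeasure_pair_measure_Times M.emeasure_space_1)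
 qed simp
 ultimately have "?\<pi> \<in> couplings \<mu> \<nu>" unfolding couplings_def borel_prob_def using s prob_space_axioms by simp
 moreover have "transport_cost p d ?\<pi> < \<infinity>"
 proof -
  let ?h = "%x. sym_dist d star x"
  have h0: "0 <= ?h x" for x unfolding sym_dist_def using dist_nonneg[of star x] dist_nonneg[of x star] by simp
  have [measurable]: "?h \<in> borel_measurable borel" unfolding sym_dist_def by measurable
  have pt: "d x y powr p <= 4 powr p * (?h x powr p + ?h y powr p)" for x y
  proof -
   have "d x y <= d x star + d star y" by (rule dist_triangle_ineq)
   also have "... <= 2 * ?h x + 2 * ?h y"
   proof -
    have "2 * ?h z = d star z + d z star" for z by (simp add: sym_dist_def)
    thus ?thesis using dist_nonneg[of star x] dist_nonneg[of y star] by simp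
   qed
   also have "... <= 4 * max (?h x) (?h y)" by simp
   finally have "d x y powr p <= (4 * max (?h x) (?h y)) powr p" using dist_nonneg p by (intro powr_mono2) auto
   also have "... = 4 powr p * max (?h x) (?h y) powr p" by (rule powr_mult)
   also have "max (?h x) (?h y) powr p <= ?h x powr p + ?h y powr p" by (simp add: max_def)
   finally show ?thesis by simp
  qed
  have fm: "fst \<in> ?\<pi> \<rightarrow>\<^sub>M \<mu>" "snd \<in> ?\<pi> \<rightarrow>\<^sub>M \<nu>" by measurable
  have hm: "(%x. ennreal (?h x powr p)) \<in> borel_measurable \<mu>" "(%x. ennreal (?h x powr p)) \<in> borel_measurable \<nu>"
   unfolding measurable_cong_sets[OF M(2) refl] measurable_cong_sets[OF N(2) refl] by measurable
  have "transport_cost p d ?\<pi> <= (\<integral>\<^sup>+z. ennreal (4 powr p) * (ennreal (?h (fst z) powr p) + ennreal (?h (snd z) powr p)) \<partial>?\<pi>)"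
   unfolding transport_cost_def
   by (intro nn_integral_mono) (simp add: ennreal_plus[symmetric] ennreal_mult'[symmetric] pt ennreal_leI del: ennreal_plus)
  also have "... = ennreal (4 powr p) * ((\<integral>\<^sup>+x. ennreal (?h x powr p) \<partial>distr ?\<pi> \<mu> fst) + (\<integral>\<^sup>+x. ennreal (?h x powr p) \<partial>distr ?\<pi> \<nu> snd))"
   using measurable_compose[OF fm(1) hm(1)] measurable_compose[OF fm(2) hm(2)] fm hm
   by (simp add: nn_integral_cmult nn_integral_add nn_integral_distr)
  also have "... < \<infinity>"
   unfolding \<open>distr ?\<pi> \<mu> fst = \<mu>\<close> \<open>distr ?\<pi> \<nu> snd = \<nu>\<close> using M(4) N(4) by (simp add: ennreal_mult_less_top)
  finally show ?thesis .
 qed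
 ultimately show ?thesis by blast
qed

lemma wasserstein_nonneg: "\<mu> \<in> PM ==> \<nu> \<in> PM ==> 0 <= WD \<mu> \<nu>"
 unfolding wasserstein_dist_def using ex_finite_coupling by (intro cINF_greatest) auto

lemma wasserstein_le:
 assumes "\<mu> \<in> PM" "\<nu> \<in> PM" "\<pi> \<in> couplings \<mu> \<nu>"
 shows "ennreal (WD \<mu> \<nu> powr p) <= transport_cost p d \<pi>"
proof (cases "transport_cost p d \<pi> < \<infinity>")
 case True
 let ?c = "enn2real (transport_cost p d \<pi>)"
 have "WD \<mu> \<nu> <= ?c powr (1 / p)" unfolding wasserstein_dist_def using assms(3) True by (intro cINF_lower bdd_belowI2[of _ 0]) auto
 hence "WD \<mu> \<nu> powr p <= (?c powr (1 / p)) powr p" using p wasserstein_nonneg[OF assms(1,2)] by (intro powr_mono2) auto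
 also have "... = ?c" using p by (simp add: powr_powr)
 finally have "ennreal (WD \<mu> \<nu> powr p) <= ennreal ?c" by (rule ennreal_leI)
 thus ?thesis using True by (simp only: ennreal_enn2real infinity_ennreal_def)
qed (simp add: not_less top_unique)

text \<open>The infimum is approached for the \<open>p\<close>-th root of the cost; continuity of
  \<open>powr p\<close> from the right turns this into an error \<open>\<kappa>\<close> of the cost
  itself. Optimal couplings are thereby avoided.\<close>

lemma ex_near_optimal_coupling:
 assumes "\<mu> \<in> PM" "\<nu> \<in> PM" "0 < \<kappa>"
 shows "\<exists>\<pi>\<in>couplings \<mu> \<nu>. transport_cost p d \<pi> <= ennreal (WD \<mu> \<nu> powr p + \<kappa>)"
proof -
 let ?w = "WD \<mu> \<nu>"
 have w0: "0 <= ?w" by (rule wasserstein_nonneg[OF assms(1,2)])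
 have "((%r. r powr p) \<longlongrightarrow> ?w powr p) (at_right ?w)"
 proof (rule tendsto_powr2[OF tendsto_ident_at tendsto_const])
  show "\<forall>\<^sub>F r in at_right ?w. 0 <= r" using eventually_at_right_less[of ?w] by (rule eventually_mono) (use w0 in simp)
 qed (use p in simp)
 hence "\<forall>\<^sub>F r in at_right ?w. r powr p < ?w powr p + \<kappa>" using assms(3) by (intro order_tendstoD) auto
 hence "\<forall>\<^sub>F r in at_right ?w. r powr p < ?w powr p + \<kappa> & ?w < r"
  using eventually_at_right_less by (rule eventually_conj)
 then obtain r where r: "r powr p < ?w powr p + \<kappa>" "?w < r" using eventually_happens'[OF trivial_limit_at_right_real] by blast
 let ?S = "{\<pi> \<in> couplings \<mu> \<nu>. transport_cost p d \<pi> < \<infinity>}"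
 have "?S ~= {}" using ex_finite_coupling[OF assms(1,2)] by blast
 moreover have "bdd_below ((%\<pi>. enn2real (transport_cost p d \<pi>) powr (1 / p)) ` ?S)" by (intro bdd_belowI2[of _ 0]) auto
 ultimately have "\<exists>\<pi>\<in>?S. enn2real (transport_cost p d \<pi>) powr (1 / p) < r"
  using r(2) unfolding wasserstein_dist_def by (subst (asm) cINF_less_iff)
 then obtain \<pi> where \<pi>: "\<pi> \<in> couplings \<mu> \<nu>" "transport_cost p d \<pi> < \<infinity>" "enn2real (transport_cost p d \<pi>) powr (1 / p) < r" by blast
 have "(enn2real (transport_cost p d \<pi>) powr (1 / p)) powr p <= r powr p" using \<pi>(3) p by (intro powr_mono2) auto
 hence "enn2real (transport_cost p d \<pi>) <= ?w powr p + \<kappa>" using p r(1) by (simp add: powr_powr)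
 hence "ennreal (enn2real (transport_cost p d \<pi>)) <= ennreal (?w powr p + \<kappa>)" by (rule ennreal_leI)
 hence "transport_cost p d \<pi> <= ennreal (?w powr p + \<kappa>)" using \<pi>(2) by (simp only: ennreal_enn2real infinity_ennreal_def)
 thus ?thesis using \<pi>(1) by blast
qed

lemma nn_integral_marginal:
 assumes "distr \<pi> borel f = \<mu>" "f \<in> \<pi> \<rightarrow>\<^sub>M borel" "h \<in> borel_measurable borel"
 shows "(\<integral>\<^sup>+z. h (f z) \<partial>\<pi>) = (\<integral>\<^sup>+x. h x \<partial>\<mu>)"
 unfolding assms(1)[symmetric] by (rule nn_integral_distr[symmetric]) (use assms(2,3) in simp_all)

end

section \<open>Gluing of couplings and subadditivity of the Wasserstein energy\<close>

context theta_finsler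
begin

text \<open>Two couplings with a common marginal are glued up to an error of size \<open>2\<^sup>-\<^sup>k\<close>, by drawing the
 second pair conditionally on the cell of the middle point. This avoids disintegration.\<close>

lemma glue_couplings:
 assumes \<nu>: "prob_space \<nu>" "sets \<nu> = sets borel"
  and \<pi>1: "\<pi>1 \<in> couplings \<mu> \<nu>" and \<pi>2: "\<pi>2 \<in> couplings \<nu> \<rho>"
 shows "\<exists>R. sets R = sets (borel \<Otimes>\<^sub>M borel) & distr R borel fst = \<pi>1 & distr R borel snd = \<pi>2 &
  (AE z in R. cell k (snd (fst z)) = cell k (fst (snd z)))"
proof -
 interpret N: prob_space \<nu> by fact
 note P = couplings_D[OF \<pi>1] and Q = couplings_D[OF \<pi>2]
 interpret P: prob_space \<pi>1 by (rule P)
 interpret Q: prob_space \<pi>2 by (rule Q)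
 interpret PQ: pair_prob_space \<pi>1 \<pi>2 ..
 have mP [measurable_cong]: "sets \<pi>1 = sets borel" and mQ [measurable_cong]: "sets \<pi>2 = sets borel" by (rule P Q)+
 \<comment> \<open>Given the cell of the first middle point, the second pair is drawn from
   \<open>\<pi>2\<close> conditioned on its first point lying in that cell; \<open>w\<close> below
   is the density of this law with respect to the product measure. Cells with \<open>W j = 0\<close>
   are null.\<close>
 define W where "W j = emeasure \<nu> {x. cell k x = j}" for j
 define w where "w z = (if cell k (snd (fst z)) = cell k (fst (snd z)) then 1 / W (cell k (snd (fst z))) else 0)"
  for z :: "('a \<times> 'a) \<times> ('a \<times> 'a)"
 have W_fin: "W j ~= \<infinity>" for j unfolding W_def using N.emeasure_finite by simp
 have cs [measurable]: "(%z :: 'a \<times> 'a. cell k (snd z)) \<in> borel \<rightarrow>\<^sub>M count_space UNIV" "(%z :: 'a \<times> 'a. cell k (fst z)) \<in> borel \<rightarrow>\<^sub>M count_space UNIV"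
  by (fact measurable_compose[OF fst_snd_borel(2) cell_measurable] measurable_compose[OF fst_snd_borel(1) cell_measurable])+
 have c1: "(%z :: ('a \<times> 'a) \<times> ('a \<times> 'a). cell k (snd (fst z))) \<in> borel \<Otimes>\<^sub>M borel \<rightarrow>\<^sub>M count_space UNIV"
  and c2: "(%z :: ('a \<times> 'a) \<times> ('a \<times> 'a). cell k (fst (snd z))) \<in> borel \<Otimes>\<^sub>M borel \<rightarrow>\<^sub>M count_space UNIV"
  by (fact measurable_compose[OF measurable_fst cs(1)] measurable_compose[OF measurable_snd cs(2)])+
 have [measurable]: "w \<in> borel_measurable (borel \<Otimes>\<^sub>M borel)" unfolding w_def
 proof (rule measurable_If)
  show "(%z :: ('a \<times> 'a) \<times> ('a \<times> 'a). 1 / W (cell k (snd (fst z)))) \<in> borel_measurable (borel \<Otimes>\<^sub>M borel)"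
   by (rule measurable_compose[OF c1, of "%j. 1 / W j"]) simp
  show "{z \<in> space (borel \<Otimes>\<^sub>M borel). cell k (snd (fst z)) = cell k (fst (snd z))} \<in> sets (borel \<Otimes>\<^sub>M borel :: (('a \<times> 'a) \<times> ('a \<times> 'a)) measure)"
  proof -
   have "{z \<in> space (borel \<Otimes>\<^sub>M borel). cell k (snd (fst z)) = cell k (fst (snd z))}
     = (\<Union>j. ((%z :: ('a \<times> 'a) \<times> ('a \<times> 'a). cell k (snd (fst z))) -` {j} \<inter> space (borel \<Otimes>\<^sub>M borel))
       \<inter> ((%z. cell k (fst (snd z))) -` {j} \<inter> space (borel \<Otimes>\<^sub>M borel)))" by auto
   also have "... \<in> sets (borel \<Otimes>\<^sub>M borel)"
    by (intro sets.countable_UN sets.Int image_subsetI measurable_sets[OF c1] measurable_sets[OF c2]) simp_all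
   finally show ?thesis .
  qed
 qed simp
 have cell_sets [measurable]: "{x. cell k x = j} \<in> sets borel" for j by measurable
 have AEW: "AE x in \<nu>. W (cell k x) ~= 0"
 proof (rule AE_I)
  let ?N = "\<Union>j\<in>{j. W j = 0}. {x. cell k x = j}"
  show "{x \<in> space \<nu>. \<not> W (cell k x) ~= 0} \<subseteq> ?N" by auto
  have "?N \<in> null_sets \<nu>"
  proof (rule null_sets_UN')
   show "{x. cell k x = j} \<in> null_sets \<nu>" if "j \<in> {j. W j = 0}" for j
    using that by (intro null_setsI) (simp_all add: W_def \<nu>(2) cell_sets)
  qed simp
  thus "emeasure \<nu> ?N = 0" "?N \<in> sets \<nu>" by auto
 qed
 have one: "W j ~= 0 ==> W j / W j = 1" for j using W_fin by (simp add: ennreal_divide_self less_top)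
 have in1: "(\<integral>\<^sup>+z2. w (z1, z2) \<partial>\<pi>2) = 1" if "W (cell k (snd z1)) ~= 0" for z1
 proof -
  have "(\<integral>\<^sup>+z2. w (z1, z2) \<partial>\<pi>2) = (\<integral>\<^sup>+z2. indicator {x. cell k x = cell k (snd z1)} (fst z2) / W (cell k (snd z1)) \<partial>\<pi>2)"
   by (intro nn_integral_cong) (auto simp: w_def split: split_indicator)
  also have "... = (\<integral>\<^sup>+x. indicator {x. cell k x = cell k (snd z1)} x / W (cell k (snd z1)) \<partial>\<nu>)"
   by (rule nn_integral_marginal[OF Q(4)]) measurable
  also have "... = W (cell k (snd z1)) / W (cell k (snd z1))" using \<nu>(2) by (subst nn_integral_divide) (simp_all add: W_def)
  finally show ?thesis using one[OF that] by simp
 qed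
 have in2: "(\<integral>\<^sup>+z1. w (z1, z2) \<partial>\<pi>1) = 1" if "W (cell k (fst z2)) ~= 0" for z2
 proof -
  have "(\<integral>\<^sup>+z1. w (z1, z2) \<partial>\<pi>1) = (\<integral>\<^sup>+z1. indicator {x. cell k x = cell k (fst z2)} (snd z1) / W (cell k (fst z2)) \<partial>\<pi>1)"
   by (intro nn_integral_cong) (auto simp: w_def split: split_indicator)
  also have "... = (\<integral>\<^sup>+x. indicator {x. cell k x = cell k (fst z2)} x / W (cell k (fst z2)) \<partial>\<nu>)"
   by (rule nn_integral_marginal[OF P(5)]) measurable
  also have "... = W (cell k (fst z2)) / W (cell k (fst z2))" using \<nu>(2) by (subst nn_integral_divide) (simp_all add: W_def)
  finally show ?thesis using one[OF that] by simp
 qed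
 have AE1: "AE z1 in \<pi>1. W (cell k (snd z1)) ~= 0"
  by (rule AE_distrD[where f = snd and M' = borel and P = "%x. W (cell k x) ~= 0"]) (simp, simp only: P(5), rule AEW)
 have AE2: "AE z2 in \<pi>2. W (cell k (fst z2)) ~= 0"
  by (rule AE_distrD[where f = fst and M' = borel and P = "%x. W (cell k x) ~= 0"]) (simp, simp only: Q(4), rule AEW)
 have sPQ: "sets (\<pi>1 \<Otimes>\<^sub>M \<pi>2) = sets (borel \<Otimes>\<^sub>M borel)" by (rule sets_pair_measure_cong[OF mP mQ])
 have wm: "w \<in> borel_measurable (\<pi>1 \<Otimes>\<^sub>M \<pi>2)" by measurable
 define R where "R = density (\<pi>1 \<Otimes>\<^sub>M \<pi>2) w"
 have sR: "sets R = sets (borel \<Otimes>\<^sub>M borel)" unfolding R_def using sPQ by simp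
 have R1: "distr R borel fst = \<pi>1"
 proof (rule measure_eqI)
  fix A assume "A \<in> sets (distr R borel fst)"
  hence A [measurable]: "A \<in> sets borel" by simp
  have fR: "fst \<in> R \<rightarrow>\<^sub>M borel" unfolding measurable_cong_sets[OF sR refl] by (rule measurable_fst)
  have "emeasure (distr R borel fst) A = (\<integral>\<^sup>+z. indicator A (fst z) \<partial>R)"
   by (subst nn_integral_distr[symmetric, OF fR]) simp_all
  also have "... = (\<integral>\<^sup>+z. w z * indicator A (fst z) \<partial>(\<pi>1 \<Otimes>\<^sub>M \<pi>2))"
   unfolding R_def by (rule nn_integral_density[OF wm]) measurable
  also have "... = (\<integral>\<^sup>+z1. \<integral>\<^sup>+z2. w (z1, z2) * indicator A z1 \<partial>\<pi>2 \<partial>\<pi>1)"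
   by (subst Q.nn_integral_fst[symmetric]) simp_all
  also have "... = (\<integral>\<^sup>+z1. indicator A z1 \<partial>\<pi>1)"
  proof (rule nn_integral_cong_AE)
   show "AE z1 in \<pi>1. (\<integral>\<^sup>+z2. w (z1, z2) * indicator A z1 \<partial>\<pi>2) = indicator A z1"
    using AE1 by eventually_elim (simp add: nn_integral_multc in1)
  qed
  also have "... = emeasure \<pi>1 A" using A mP by simp
  finally show "emeasure (distr R borel fst) A = emeasure \<pi>1 A" .
 qed (simp add: mP)
 have R2: "distr R borel snd = \<pi>2"
 proof (rule measure_eqI)
  fix A assume "A \<in> sets (distr R borel snd)"
  hence A [measurable]: "A \<in> sets borel" by simp
  have fR: "snd \<in> R \<rightarrow>\<^sub>M borel" unfolding measurable_cong_sets[OF sR refl] by (rule measurable_snd)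
  have "emeasure (distr R borel snd) A = (\<integral>\<^sup>+z. indicator A (snd z) \<partial>R)"
   by (subst nn_integral_distr[symmetric, OF fR]) simp_all
  also have "... = (\<integral>\<^sup>+z. w z * indicator A (snd z) \<partial>(\<pi>1 \<Otimes>\<^sub>M \<pi>2))"
   unfolding R_def by (rule nn_integral_density[OF wm]) measurable
  also have "... = (\<integral>\<^sup>+z2. \<integral>\<^sup>+z1. w (z1, z2) * indicator A z2 \<partial>\<pi>1 \<partial>\<pi>2)"
   by (subst PQ.nn_integral_snd[symmetric]) simp_all
  also have "... = (\<integral>\<^sup>+z2. indicator A z2 \<partial>\<pi>2)"
  proof (rule nn_integral_cong_AE)
   show "AE z2 in \<pi>2. (\<integral>\<^sup>+z1. w (z1, z2) * indicator A z2 \<partial>\<pi>1) = indicator A z2"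
    using AE2 by eventually_elim (simp add: nn_integral_multc in2)
  qed
  also have "... = emeasure \<pi>2 A" using A mQ by simp
  finally show "emeasure (distr R borel snd) A = emeasure \<pi>2 A" .
 qed (simp add: mQ)
 have "AE z in R. cell k (snd (fst z)) = cell k (fst (snd z))" unfolding R_def AE_density[OF wm] by (rule AE_I2) (auto simp: w_def split: if_splits)
 with sR R1 R2 show ?thesis by blast
qed

text \<open>Under the glued law, the jump between the two middle points counts as a third step of
  size \<open>2 / 2 ^ k\<close> and duration \<open>1 / 2 ^ k\<close>, with energy
  \<open>2 powr p / 2 ^ k\<close>. Joint subadditivity of \<open>pen\<close> applies, and
  \<open>k\<close> tends to infinity.\<close>

lemma wasserstein_pen_add_le:
 assumes \<mu>: "\<mu> \<in> PM" and \<nu>: "\<nu> \<in> PM" and \<rho>: "\<rho> \<in> PM" and l: "0 < l" and m: "0 < m"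
 shows "pen p (WD \<mu> \<rho>) (l + m) <= pen p (WD \<mu> \<nu>) l + pen p (WD \<nu> \<rho>) m"
proof -
 let ?e = "%k::nat. 1 / 2 ^ k :: real"
 have bound: "pen p (WD \<mu> \<rho>) (l + m + ?e k) <= pen p (WD \<mu> \<nu>) l + pen p (WD \<nu> \<rho>) m
   + ?e k * (1 / l powr (p - 1) + 1 / m powr (p - 1) + 2 powr p)" for k
 proof -
  have e: "0 < ?e k" by simp
  obtain \<pi>1 where \<pi>1: "\<pi>1 \<in> couplings \<mu> \<nu>" "transport_cost p d \<pi>1 <= ennreal (WD \<mu> \<nu> powr p + ?e k)"
   using ex_near_optimal_coupling[OF \<mu> \<nu> e] by blast
  obtain \<pi>2 where \<pi>2: "\<pi>2 \<in> couplings \<nu> \<rho>" "transport_cost p d \<pi>2 <= ennreal (WD \<nu> \<rho> powr p + ?e k)"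
   using ex_near_optimal_coupling[OF \<nu> \<rho> e] by blast
  obtain R where R: "sets R = sets (borel \<Otimes>\<^sub>M borel)" "distr R borel fst = \<pi>1" "distr R borel snd = \<pi>2"
    "AE z in R. cell k (snd (fst z)) = cell k (fst (snd z))"
   using glue_couplings[OF wasserstein_space_D(1,2)[OF \<nu>] \<pi>1(1) \<pi>2(1)] by blast
  note [measurable_cong] = R(1)
  have f: "fst \<in> R \<rightarrow>\<^sub>M borel" "snd \<in> R \<rightarrow>\<^sub>M borel" by measurable
  have R_prob: "prob_space R"
  proof (rule prob_spaceI)
   interpret P: prob_space \<pi>1 by (rule couplings_D[OF \<pi>1(1)])
   have "emeasure \<pi>1 (space \<pi>1) = emeasure R (space R)" unfolding R(2)[symmetric] using f by (simp add: emeasure_distr)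
   thus "emeasure R (space R) = 1" using P.emeasure_space_1 by simp
  qed
  interpret R: prob_space R by fact
  define g where "g z = (fst (fst z), snd (snd z))" for z :: "('a \<times> 'a) \<times> ('a \<times> 'a)"
  have g1: "(%z. fst (fst z)) \<in> R \<rightarrow>\<^sub>M borel" and g2: "(%z. snd (snd z)) \<in> R \<rightarrow>\<^sub>M borel"
   by (fact measurable_compose[OF f(1) fst_snd_borel(1)] measurable_compose[OF f(2) fst_snd_borel(2)])+
  have g [measurable]: "g \<in> R \<rightarrow>\<^sub>M borel" unfolding g_def borel_prod[symmetric] using g1 g2 by measurable
  have "distr R borel g \<in> couplings \<mu> \<rho>" unfolding couplings_def borel_prob_def
  proof (intro CollectI conjI)
   show "prob_space (distr R borel g)" by (rule R.prob_space_distr[OF g])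
   have "distr (distr R borel g) borel fst = distr R borel (fst \<circ> g)" by (rule distr_distr[OF fst_snd_borel(1) g])
   also have "... = distr (distr R borel fst) borel fst" by (subst distr_distr[OF fst_snd_borel(1) f(1)]) (simp add: g_def comp_def)
   also have "... = \<mu>" unfolding R(2) by (rule couplings_D[OF \<pi>1(1)])
   finally show "distr (distr R borel g) borel fst = \<mu>" .
   have "distr (distr R borel g) borel snd = distr R borel (snd \<circ> g)" by (rule distr_distr[OF fst_snd_borel(2) g])
   also have "... = distr (distr R borel snd) borel snd" by (subst distr_distr[OF fst_snd_borel(2) f(2)]) (simp add: g_def comp_def)
   also have "... = \<rho>" unfolding R(3) by (rule couplings_D[OF \<pi>2(1)])
   finally show "distr (distr R borel g) borel snd = \<rho>" .
  qed simp
  from wasserstein_le[OF \<mu> \<rho> this]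
  have "ennreal (WD \<mu> \<rho> powr p) <= (\<integral>\<^sup>+z. ennreal (d (fst (fst z)) (snd (snd z)) powr p) \<partial>R)"
   unfolding transport_cost_def by (subst (asm) nn_integral_distr[OF g]) (simp_all add: g_def cost_integrand_measurable)
  have cm [measurable]: "(%z :: 'a \<times> 'a. ennreal (d (fst z) (snd z) powr p)) \<in> borel_measurable borel"
   by (rule cost_integrand_measurable) simp
  have I1: "(\<integral>\<^sup>+z. ennreal (d (fst (fst z)) (snd (fst z)) powr p) \<partial>R) = transport_cost p d \<pi>1"
   unfolding transport_cost_def by (rule nn_integral_marginal[OF R(2) f(1) cm])
  have I2: "(\<integral>\<^sup>+z. ennreal (d (fst (snd z)) (snd (snd z)) powr p) \<partial>R) = transport_cost p d \<pi>2"
   unfolding transport_cost_def by (rule nn_integral_marginal[OF R(3) f(2) cm])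
  let ?L = "(l + m + ?e k) powr (p - 1)" and ?l = "l powr (p - 1)" and ?m = "m powr (p - 1)"
  have "0 < l + m + ?e k" using l m by (intro add_pos_pos) auto
  hence L: "0 < ?L" "0 < ?l" "0 < ?m" using l m by auto
  have pt: "AE z in R. d (fst (fst z)) (snd (snd z)) powr p
    <= ?L * (d (fst (fst z)) (snd (fst z)) powr p / ?l + d (fst (snd z)) (snd (snd z)) powr p / ?m + ?e k * 2 powr p)" using R(4)
  proof eventually_elim
   case (elim z)
   obtain x y y' w where z: "z = ((x, y), (y', w))" by (metis surj_pair)
   have yy: "d y y' <= 2 * ?e k" using same_cell_dist[of k y y'] elim z by simp
   have "d x w <= d x y + d y w" "d y w <= d y y' + d y' w" by (rule dist_triangle_ineq)+
   hence "d x w <= (d x y + d y' w) + 2 * ?e k" using yy by simp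
   hence "pen p (d x w) (l + m + ?e k) <= pen p ((d x y + d y' w) + 2 * ?e k) ((l + m) + ?e k)"
    using l m p by (intro pen_mono dist_nonneg) (auto intro: add_pos_pos)
   also have "... <= pen p (d x y + d y' w) (l + m) + pen p (2 * ?e k) (?e k)"
    using l m p by (intro pen_add_le add_nonneg_nonneg dist_nonneg add_pos_pos) auto
   also have "pen p (d x y + d y' w) (l + m) <= pen p (d x y) l + pen p (d y' w) m" using l m p by (intro pen_add_le dist_nonneg) auto
   also have "pen p (2 * ?e k) (?e k) = ?e k * 2 powr p" by (subst pen_alt) simp_all
   finally have "d x w powr p / ?L <= d x y powr p / ?l + d y' w powr p / ?m + ?e k * 2 powr p" unfolding pen_def by simp
   thus ?case using L(1) z by (simp add: pos_divide_le_eq mult.commute)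
  qed
  let ?A = "WD \<mu> \<nu> powr p" and ?B = "WD \<nu> \<rho> powr p"
  have "ennreal (WD \<mu> \<rho> powr p) <= (\<integral>\<^sup>+z. ennreal (d (fst (fst z)) (snd (snd z)) powr p) \<partial>R)" by fact
  also have "... <= (\<integral>\<^sup>+z. ennreal (?L / ?l) * ennreal (d (fst (fst z)) (snd (fst z)) powr p)
    + ennreal (?L / ?m) * ennreal (d (fst (snd z)) (snd (snd z)) powr p) + ennreal (?L * (?e k * 2 powr p)) \<partial>R)"
  proof (rule nn_integral_mono_AE)
   show "AE z in R. ennreal (d (fst (fst z)) (snd (snd z)) powr p) <= ennreal (?L / ?l) * ennreal (d (fst (fst z)) (snd (fst z)) powr p)
    + ennreal (?L / ?m) * ennreal (d (fst (snd z)) (snd (snd z)) powr p) + ennreal (?L * (?e k * 2 powr p))" using pt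
   proof eventually_elim
    case (elim z)
    from ennreal_leI[OF elim] show ?case using L by (simp add: ennreal_mult[symmetric] ennreal_plus[symmetric] distrib_left del: ennreal_plus)
   qed
  qed
  also have "... = ennreal (?L / ?l) * transport_cost p d \<pi>1 + ennreal (?L / ?m) * transport_cost p d \<pi>2 + ennreal (?L * (?e k * 2 powr p))"
   using measurable_compose[OF f(1) cm] measurable_compose[OF f(2) cm] by (simp add: nn_integral_add nn_integral_cmult I1 I2 R.emeasure_space_1)
  also have "... <= ennreal (?L / ?l) * ennreal (?A + ?e k) + ennreal (?L / ?m) * ennreal (?B + ?e k) + ennreal (?L * (?e k * 2 powr p))"
   by (intro add_mono mult_left_mono \<pi>1(2) \<pi>2(2)) auto
  also have "... = ennreal (?L / ?l * (?A + ?e k) + ?L / ?m * (?B + ?e k) + ?L * (?e k * 2 powr p))"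
   using L by (simp add: ennreal_mult[symmetric] ennreal_plus[symmetric] del: ennreal_plus)
  finally have "WD \<mu> \<rho> powr p <= ?L / ?l * (?A + ?e k) + ?L / ?m * (?B + ?e k) + ?L * (?e k * 2 powr p)"
   using L by (subst (asm) ennreal_le_iff) (auto intro!: add_nonneg_nonneg)
  also have "... = (?A / ?l + ?B / ?m + ?e k * (1 / ?l + 1 / ?m + 2 powr p)) * ?L" using L by (simp add: field_simps)
  finally show ?thesis unfolding pen_def using L(1) by (simp only: pos_divide_le_eq)
 qed
 have e0: "?e \<longlonglongrightarrow> 0" using LIMSEQ_power_zero[of "1 / 2 :: real"] by (simp add: power_one_over)
 have "(%k. pen p (WD \<mu> \<rho>) (l + m + ?e k)) \<longlonglongrightarrow> pen p (WD \<mu> \<rho>) (l + m + 0)"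
  unfolding pen_def using l m by (intro tendsto_intros e0) (auto simp: powr_def)
 moreover have "(%k. pen p (WD \<mu> \<nu>) l + pen p (WD \<nu> \<rho>) m
   + ?e k * (1 / l powr (p - 1) + 1 / m powr (p - 1) + 2 powr p)) \<longlonglongrightarrow> pen p (WD \<mu> \<nu>) l + pen p (WD \<nu> \<rho>) m + 0 * (1 / l powr (p - 1) + 1 / m powr (p - 1) + 2 powr p)"
  by (intro tendsto_intros e0)
 ultimately show ?thesis using bound LIMSEQ_le by fastforce
qed

end

section \<open>Approximating Markov chains\<close>

lemma ex_pmf_of_countable_valued:
 fixes X :: "'c => 'b::countable"
 assumes M: "prob_space M" and X: "X \<in> M \<rightarrow>\<^sub>M count_space UNIV"
 shows "\<exists>\<rho> :: 'b pmf. \<forall>h. (\<integral>\<^sup>+y. h y \<partial>measure_pmf \<rho>) = (\<integral>\<^sup>+x. h (X x) \<partial>M)"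
proof -
 interpret prob_space M by fact
 let ?D = "distr M (count_space UNIV) X"
 interpret D: prob_space ?D by (rule prob_space_distr[OF X])
 have "AE y in ?D. measure ?D {y} ~= 0"
 proof (rule AE_I)
  have "(\<Union>y\<in>{y. measure ?D {y} = 0}. {y}) \<in> null_sets ?D"
  proof (rule null_sets_UN')
   show "{y} \<in> null_sets ?D" if "y \<in> {y. measure ?D {y} = 0}" for y using that by (intro null_setsI) (simp_all add: D.emeasure_eq_measure)
  qed simp
  thus "emeasure ?D (\<Union>y\<in>{y. measure ?D {y} = 0}. {y}) = 0" "(\<Union>y\<in>{y. measure ?D {y} = 0}. {y}) \<in> sets ?D" by auto
 qed auto
 hence "measure_pmf (Abs_pmf ?D) = ?D" using D.prob_space_axioms by (intro Abs_pmf_inverse) simp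
 hence "(\<integral>\<^sup>+y. h y \<partial>measure_pmf (Abs_pmf ?D)) = (\<integral>\<^sup>+x. h (X x) \<partial>M)" for h :: "'b => ennreal"
  by (simp add: nn_integral_distr[OF X])
 thus ?thesis by blast
qed

lemma pmf_eqI_nn_integral:
 assumes "!!h. (\<integral>\<^sup>+y. h y \<partial>measure_pmf \<rho>) = (\<integral>\<^sup>+y. h y \<partial>measure_pmf \<sigma>)"
 shows "\<rho> = \<sigma>"
proof (rule pmf_eqI)
 fix y
 have "emeasure (measure_pmf \<rho>) {y} = emeasure (measure_pmf \<sigma>) {y}" using assms[of "indicator {y}"] by simp
 thus "pmf \<rho> y = pmf \<sigma> y" by (simp add: emeasure_pmf_single)
qed

text \<open>The next state is drawn from \<open>q k\<close> conditioned on its first component,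
  which is elementary for discrete laws; matching marginals keep the conditioning events
  possible.\<close>

lemma ex_markov_chain_pmf:
 fixes q :: "nat => ('b \<times> 'b) pmf"
 assumes q: "!!i. Suc i < n ==> map_pmf snd (q i) = map_pmf fst (q (Suc i))"
 shows "\<exists>Q :: (nat => 'b) pmf. \<forall>i<n. map_pmf (%\<omega>. (\<omega> i, \<omega> (Suc i))) Q = q i"
proof -
 have "k <= n ==> \<exists>Q :: (nat => 'b) pmf. (\<forall>i<k. map_pmf (%\<omega>. (\<omega> i, \<omega> (Suc i))) Q = q i) &
   (k < n --> map_pmf (%\<omega>. \<omega> k) Q = map_pmf fst (q k))" for k
 proof (induction k)
  case 0
  show ?case by (rule exI[of _ "map_pmf (%z i. fst z) (q 0)"]) (simp add: pmf.map_comp comp_def)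
 next
  case (Suc k)
  then obtain Q where Q: "\<forall>i<k. map_pmf (%\<omega>. (\<omega> i, \<omega> (Suc i))) Q = q i" "map_pmf (%\<omega>. \<omega> k) Q = map_pmf fst (q k)"
   by auto
  let ?c = "%x. cond_pmf (q k) {z. fst z = x}"
  let ?Q = "bind_pmf Q (%\<omega>. map_pmf (%z. fun_upd \<omega> (Suc k) (snd z)) (?c (\<omega> k)))"
  have sup: "set_pmf (q k) \<inter> {z. fst z = \<omega> k} ~= {}" if "\<omega> \<in> set_pmf Q" for \<omega>
  proof -
   have "\<omega> k \<in> set_pmf (map_pmf (%\<omega>. \<omega> k) Q)" using that by simp
   thus ?thesis unfolding Q(2) by auto
  qed
  have 1: "map_pmf (%\<omega>. (\<omega> i, \<omega> (Suc i))) ?Q = q i" if "i < k" for i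
   using that Q(1) by (simp add: map_bind_pmf pmf.map_comp comp_def map_pmf_const map_pmf_def[symmetric])
  have "map_pmf (%\<omega>. (\<omega> k, \<omega> (Suc k))) ?Q = bind_pmf Q (%\<omega>. map_pmf (%z. (\<omega> k, snd z)) (?c (\<omega> k)))"
   by (simp add: map_bind_pmf pmf.map_comp comp_def)
  also have "... = bind_pmf Q (%\<omega>. map_pmf (%z. z) (?c (\<omega> k)))"
  proof (rule bind_pmf_cong[OF refl], rule map_pmf_cong[OF refl])
   fix \<omega> z assume "\<omega> \<in> set_pmf Q" "z \<in> set_pmf (?c (\<omega> k))"
   thus "(\<omega> k, snd z) = z" using set_cond_pmf[OF sup] by (cases z) auto
  qed
  also have "... = bind_pmf (map_pmf (%\<omega>. \<omega> k) Q) ?c" by (simp add: bind_map_pmf)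
  also have "... = bind_pmf (map_pmf fst (q k)) ?c" unfolding Q(2) ..
  also have "... = q k" by (rule bind_cond_pmf_cancel[where R = "%x z. fst z = x"]) (auto simp: pmf_map measure_pmf_single vimage_def)
  finally have 2: "map_pmf (%\<omega>. (\<omega> k, \<omega> (Suc k))) ?Q = q k" .
  have "map_pmf (%\<omega>. \<omega> (Suc k)) ?Q = map_pmf snd (map_pmf (%\<omega>. (\<omega> k, \<omega> (Suc k))) ?Q)"
   by (simp add: pmf.map_comp comp_def)
  also have "... = map_pmf snd (q k)" unfolding 2 ..
  finally have 3: "map_pmf (%\<omega>. \<omega> (Suc k)) ?Q = map_pmf snd (q k)" .
  show ?case using 1 2 3 q by (intro exI[of _ ?Q]) (auto simp: less_Suc_eq)
 qed
 from this[of n] show ?thesis by auto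
qed

lemma measurable_count_space_combine:
 fixes X :: "'c => 'b::countable"
 assumes X: "X \<in> M \<rightarrow>\<^sub>M count_space UNIV" and Y: "Y \<in> M \<rightarrow>\<^sub>M count_space UNIV"
 shows "(%x. f (X x) (Y x)) \<in> M \<rightarrow>\<^sub>M count_space UNIV"
proof (rule measurable_compose_countable[OF _ X])
 show "(%x. f i (Y x)) \<in> M \<rightarrow>\<^sub>M count_space UNIV" for i by (rule measurable_compose[OF Y, of "f i"]) simp
qed

text \<open>Passes from a Lebesgue measurable density on the unit interval to a Borel one on the
  line. It is integrable since \<open>h x <= 1 + h x powr p\<close> on the unit interval and
  \<open>h\<close> vanishes almost everywhere outside.\<close>

lemma FAC_density:
 assumes \<gamma>: "\<gamma> \<in> FAC p X D" and p: "1 < p"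
 shows "\<exists>h. (\<forall>x. 0 <= h x) & integrable lborel h & integrable lborel (%x. h x powr p) &
  (\<forall>s t. 0 <= s & s <= t & t <= 1 --> D (\<gamma> s) (\<gamma> t) <= (LINT x:{s<..t}|lborel. h x))"
proof -
 obtain f where f: "f \<in> Lp_nonneg p"
  and D: "!!s t. 0 <= s & s <= t & t <= 1 ==> D (\<gamma> s) (\<gamma> t) <= (LINT x|lebesgue_on {s..t}. f x)"
  using \<gamma> unfolding FAC_def by auto
 have f0: "!!t. t \<in> {0..1} ==> 0 <= f t" and fm: "f \<in> borel_measurable (lebesgue_on {0..1})"
  and fp: "integrable (lebesgue_on {0..1}) (%t. f t powr p)" using f unfolding Lp_nonneg_def by simp_all
 let ?f = "%x. indicator {0..1} x *\<^sub>R f x"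
 have fm': "?f \<in> borel_measurable lebesgue" using fm by (simp add: borel_measurable_restrict_space_iff)
 obtain g where g [measurable]: "g \<in> borel_measurable lborel" and fg: "AE x in lborel. ?f x = g x"
  using completion_ex_borel_measurable_real[OF fm'] by auto
 define h where "h x = max 0 (g x)" for x
 have hm [measurable]: "h \<in> borel_measurable borel" using g unfolding h_def by simp
 have f0': "0 <= ?f x" for x using f0 by (simp add: indicator_def)
 have fh': "AE x in lborel. ?f x = h x" using fg
 proof eventually_elim
  case (elim x)
  thus ?case using f0'[of x] by (simp only: h_def max_absorb2)
 qed
 have fh: "AE x in lebesgue. ?f x = h x" by (rule AE_completion[OF fh'])
 have h0: "0 <= h x" for x by (simp add: h_def)
 have "integrable lebesgue (%x. indicator {0..1} x *\<^sub>R f x powr p)" using fp by (subst (asm) integrable_restrict_space) simp_all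
 hence "integrable lebesgue (%x. h x powr p)"
 proof (rule integrable_cong_AE_imp)
  show "(%x. h x powr p) \<in> borel_measurable lebesgue" by (intro measurable_completion) simp
  show "AE x in lebesgue. indicator {0..1} x *\<^sub>R f x powr p = h x powr p"
   using fh by eventually_elim (auto simp: indicator_def split: if_splits)
 qed
 hence hp: "integrable lborel (%x. h x powr p)" by (subst (asm) integrable_completion) simp_all
 have "integrable lborel h"
 proof (rule Bochner_Integration.integrable_bound)
  show "integrable lborel (%x. indicator {0..1::real} x + h x powr p)" using hp by (intro Bochner_Integration.integrable_add) (simp_all add: integrable_real_indicator)
  show "AE x in lborel. norm (h x) <= norm (indicator {0..1::real} x + h x powr p)" using fh'
  proof eventually_elim
   case (elim x)
   show ?case
   proof (cases "x \<in> {0..1}")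
    case True
    have "h x <= 1 + h x powr p"
    proof (cases "h x <= 1")
     case False
     hence "h x powr 1 <= h x powr p" using p by (intro powr_mono) auto
     thus ?thesis using False by simp
    qed (simp add: add_increasing2)
    thus ?thesis using h0[of x] True by simp
   qed (use elim in simp)
  qed
 qed simp
 moreover have "D (\<gamma> s) (\<gamma> t) <= (LINT x:{s<..t}|lborel. h x)" if st: "0 <= s & s <= t & t <= 1" for s t
 proof -
  have "(LINT x|lebesgue_on {s..t}. f x) = (LINT x|lebesgue_on {s..t}. h x)"
  proof (rule integral_cong_AE)
   have sub: "{s..t} \<subseteq> {0..1}" using st by auto
   show "f \<in> borel_measurable (lebesgue_on {s..t})" by (rule measurable_restrict_mono[OF fm sub])
   show "h \<in> borel_measurable (lebesgue_on {s..t})" by (rule measurable_restrict_space1[OF measurable_completion]) simp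
   show "AE x in lebesgue_on {s..t}. f x = h x" by (subst AE_restrict_space_iff) (use fh sub in \<open>auto elim!: eventually_mono\<close>)
  qed
  thus ?thesis using D[OF st] LINT_lebesgue_on_Icc[OF hm] by simp
 qed
 ultimately show ?thesis using h0 hp by blast
qed

lemma dyadic_in_unit: "i <= 2 ^ N ==> real i / 2 ^ N \<in> {0..1}"
proof -
 assume "i <= 2 ^ N"
 hence "real i <= 2 ^ N" by (metis of_nat_le_iff of_nat_numeral of_nat_power)
 thus ?thesis by (simp add: divide_le_eq)
qed

text \<open>Each dyadic interval splits into its two halves. The function \<open>c\<close> is
  abstract because the lemma serves the Wasserstein distance along \<open>\<mu>\<close> as well as
  the Finsler distance along a path.\<close>

lemma dyadic_pen_sum_le_Suc:
 fixes c :: "real => real => real"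
 assumes "!!r s t l m. r \<in> {0..1} ==> s \<in> {0..1} ==> t \<in> {0..1} ==> 0 < l ==> 0 < m ==>
  pen p (c r t) (l + m) <= pen p (c r s) l + pen p (c s t) m"
 shows "(\<Sum>i<2 ^ N. pen p (c (real i / 2 ^ N) (real (Suc i) / 2 ^ N)) (1 / 2 ^ N))
  <= (\<Sum>i<2 ^ Suc N. pen p (c (real i / 2 ^ Suc N) (real (Suc i) / 2 ^ Suc N)) (1 / 2 ^ Suc N))"
proof -
 let ?e = "%j. pen p (c (real j / 2 ^ Suc N) (real (Suc j) / 2 ^ Suc N)) (1 / 2 ^ Suc N)"
 have "(\<Sum>i<2 ^ N. pen p (c (real i / 2 ^ N) (real (Suc i) / 2 ^ N)) (1 / 2 ^ N)) <= (\<Sum>i<2 ^ N. ?e (2 * i) + ?e (Suc (2 * i)))"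
 proof (rule sum_mono)
  fix i :: nat assume i: "i \<in> {..<2 ^ N}"
  have u: "real j / 2 ^ Suc N \<in> {0..1}" if "j <= 2 * i + 2" for j using i that by (intro dyadic_in_unit) auto
  note assms[OF u[of "2 * i"] u[of "Suc (2 * i)"] u[of "Suc (Suc (2 * i))"], of "1 / 2 ^ Suc N" "1 / 2 ^ Suc N"]
  moreover have "real (2 * i) / 2 ^ Suc N = real i / 2 ^ N" "real (Suc (Suc (2 * i))) / 2 ^ Suc N = real (Suc i) / 2 ^ N"
    "1 / 2 ^ Suc N + 1 / 2 ^ Suc N = (1 / 2 ^ N :: real)" by (simp_all add: field_simps)
  ultimately show "pen p (c (real i / 2 ^ N) (real (Suc i) / 2 ^ N)) (1 / 2 ^ N) <= ?e (2 * i) + ?e (Suc (2 * i))"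
   by (simp del: of_nat_Suc power_Suc of_nat_mult)
 qed
 also have "... = (\<Sum>j<2 ^ Suc N. ?e j)" using sum_dyadic_split[of ?e "2 ^ N"] by (simp only: power_Suc)
 finally show ?thesis .
qed

lemma sum_Ioc_dyadic:
 fixes h :: "real => real"
 assumes "integrable lborel h"
 shows "(\<Sum>i<k. LINT x:{real i / 2 ^ N<..real (Suc i) / 2 ^ N}|lborel. h x) = (LINT x:{0<..real k / 2 ^ N}|lborel. h x)"
proof (induction k)
 case (Suc k)
 have "real k / 2 ^ N <= real (Suc k) / 2 ^ N" by (simp add: divide_right_mono)
 thus ?case using Suc set_integral_Ioc_split[OF assms, of 0 "real k / 2 ^ N" "real (Suc k) / 2 ^ N"] by (simp del: of_nat_Suc)
qed (simp add: set_lebesgue_integral_def)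

locale wasserstein_curve = theta_finsler \<A> F star \<Theta> p
 for \<A> :: "('a::{t2_space, second_countable_topology}, 'n::finite) chart set" and F star \<Theta> p +
 fixes \<mu> :: "real => 'a measure"
 assumes FAC: "\<mu> \<in> FAC p PM WD"
begin

lemma \<mu>_PM: "t \<in> {0..1} ==> \<mu> t \<in> PM" using FAC unfolding FAC_def by blast

definition energy :: "nat => real" where
 "energy N = (\<Sum>i<2 ^ N. pen p (WD (\<mu> (real i / 2 ^ N)) (\<mu> (real (Suc i) / 2 ^ N))) (1 / 2 ^ N))"

lemma energy_le_Suc: "energy N <= energy (Suc N)" unfolding energy_def by (rule dyadic_pen_sum_le_Suc) (intro wasserstein_pen_add_le \<mu>_PM)

text \<open>Jensen's inequality on every dyadic interval bounds the energy by the integral of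
  \<open>h powr p\<close>, uniformly in the level.\<close>

lemma ex_energy_bound: "\<exists>B. \<forall>N. energy N <= B"
proof -
 obtain h where h: "!!x. 0 <= h x" "integrable lborel h" "integrable lborel (%x. h x powr p)"
  and W: "!!s t. 0 <= s & s <= t & t <= 1 ==> WD (\<mu> s) (\<mu> t) <= (LINT x:{s<..t}|lborel. h x)"
  using FAC_density[OF FAC p] by blast
 have "energy N <= (LINT x|lborel. h x powr p)" for N
 proof -
  have "energy N <= (\<Sum>i<2 ^ N. LINT x:{real i / 2 ^ N<..real (Suc i) / 2 ^ N}|lborel. h x powr p)" unfolding energy_def
  proof (rule sum_mono)
   fix i :: nat assume "i \<in> {..<2 ^ N}"
   hence u: "real i / 2 ^ N \<in> {0..1}" "real (Suc i) / 2 ^ N \<in> {0..1}" by (auto intro!: dyadic_in_unit simp del: of_nat_Suc)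
   have st: "real i / 2 ^ N < real (Suc i) / 2 ^ N" by (simp add: divide_strict_right_mono)
   have "pen p (WD (\<mu> (real i / 2 ^ N)) (\<mu> (real (Suc i) / 2 ^ N))) (1 / 2 ^ N)
     <= pen p (LINT x:{real i / 2 ^ N<..real (Suc i) / 2 ^ N}|lborel. h x) (1 / 2 ^ N)"
    using u st p by (intro pen_mono W wasserstein_nonneg \<mu>_PM) (auto simp del: of_nat_Suc)
   also have "... <= (LINT x:{real i / 2 ^ N<..real (Suc i) / 2 ^ N}|lborel. h x powr p)"
   proof -
    have "1 / 2 ^ N = real (Suc i) / 2 ^ N - real i / 2 ^ N" by (simp add: diff_divide_distrib[symmetric])
    thus ?thesis using pen_integral_le[OF p st h(1) set_integrable_Ioc[OF h(2)] set_integrable_Ioc[OF h(3)]] by (simp only:)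
   qed
   finally show "pen p (WD (\<mu> (real i / 2 ^ N)) (\<mu> (real (Suc i) / 2 ^ N))) (1 / 2 ^ N)
     <= (LINT x:{real i / 2 ^ N<..real (Suc i) / 2 ^ N}|lborel. h x powr p)" .
  qed
  also have "... = (LINT x:{0<..real (2 ^ N) / 2 ^ N}|lborel. h x powr p)" by (rule sum_Ioc_dyadic[OF h(3)])
  also have "... <= (LINT x|lborel. h x powr p)" by (rule set_integral_Ioc_le[OF h(3)]) simp
  finally show ?thesis .
 qed
 thus ?thesis by blast
qed

definition total :: real where
 "total = (SUP N. energy N)"

lemma bdd_above_energy: "bdd_above (range energy)" using ex_energy_bound by (auto simp: bdd_above_def)

lemma energy_le_total: "energy N <= total" unfolding total_def by (rule cSUP_upper[OF _ bdd_above_energy]) simp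

lemma energy_tendsto: "energy \<longlonglongrightarrow> total"
 unfolding total_def by (intro LIMSEQ_incseq_SUP bdd_above_energy incseq_SucI energy_le_Suc)

text \<open>Cells of level \<open>2 N\<close> are recorded because the errors of the \<open>2\<^sup>N\<close> steps add up.\<close>

definition code :: "nat => 'a => nat" where
 "code N x = to_nat (map (%m. cell m x) [0..<Suc (2 * N)])"

definition level :: "nat => nat => nat" where
 "level m c = (from_nat c :: nat list) ! m"

lemma level_code: "m <= 2 * N ==> level m (code N x) = cell m x" unfolding level_def code_def by (simp del: upt_Suc)

lemma code_measurable: "code N \<in> borel \<rightarrow>\<^sub>M count_space UNIV"
proof -
 have "(%x. map (%m. cell m x) xs) \<in> borel \<rightarrow>\<^sub>M count_space UNIV" for xs
 proof (induction xs)
  case (Cons m xs)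
  from measurable_count_space_combine[OF cell_measurable this, of Cons m] show ?case by simp
 qed simp
 from measurable_compose[OF this, of to_nat "count_space UNIV"] show ?thesis unfolding code_def[abs_def] by (simp del: upt_Suc)
qed

text \<open>Only the discrete laws of pairs of codes are joined to a chain; consecutive ones match,
  because both have the law of the code under \<open>\<mu>\<close> at the common time. The costs
  remain attached to the couplings \<open>\<pi> i\<close> of points.\<close>

lemma ex_chain:
 "\<exists>(Q :: (nat => nat) pmf) \<pi>. \<forall>i<2 ^ N. \<pi> i \<in> couplings (\<mu> (real i / 2 ^ N)) (\<mu> (real (Suc i) / 2 ^ N)) &
  transport_cost p d (\<pi> i) <= ennreal (WD (\<mu> (real i / 2 ^ N)) (\<mu> (real (Suc i) / 2 ^ N)) powr p + \<kappa>) &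
  (\<forall>h. (\<integral>\<^sup>+\<omega>. h (\<omega> i) (\<omega> (Suc i)) \<partial>measure_pmf Q) = (\<integral>\<^sup>+z. h (code N (fst z)) (code N (snd z)) \<partial>\<pi> i))"
 if \<kappa>: "0 < \<kappa>"
proof -
 let ?m = "%i. \<mu> (real i / 2 ^ N)"
 have PM: "?m i \<in> PM" if "i <= 2 ^ N" for i using that by (intro \<mu>_PM dyadic_in_unit)
 have "\<forall>i\<in>{..<2 ^ N}. \<exists>\<pi>. \<pi> \<in> couplings (?m i) (?m (Suc i)) & transport_cost p d \<pi> <= ennreal (WD (?m i) (?m (Suc i)) powr p + \<kappa>)"
 proof
  fix i :: nat assume "i \<in> {..<2 ^ N}"
  thus "\<exists>\<pi>. \<pi> \<in> couplings (?m i) (?m (Suc i)) & transport_cost p d \<pi> <= ennreal (WD (?m i) (?m (Suc i)) powr p + \<kappa>)"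
   using ex_near_optimal_coupling[OF PM PM \<kappa>, of i "Suc i"] by (simp del: of_nat_Suc) blast
 qed
 from bchoice[OF this] obtain \<pi> where
  \<pi>: "!!i. i < 2 ^ N ==> \<pi> i \<in> couplings (?m i) (?m (Suc i)) & transport_cost p d (\<pi> i) <= ennreal (WD (?m i) (?m (Suc i)) powr p + \<kappa>)"
  by blast
 have "\<forall>i\<in>{..<2 ^ N}. \<exists>q :: (nat \<times> nat) pmf. \<forall>h. (\<integral>\<^sup>+y. h y \<partial>measure_pmf q) = (\<integral>\<^sup>+z. h (code N (fst z), code N (snd z)) \<partial>\<pi> i)"
 proof
  fix i :: nat assume "i \<in> {..<2 ^ N}"
  hence c: "\<pi> i \<in> couplings (?m i) (?m (Suc i))" using \<pi> by blast
  have f: "fst \<in> \<pi> i \<rightarrow>\<^sub>M borel" "snd \<in> \<pi> i \<rightarrow>\<^sub>M borel"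
   unfolding measurable_cong_sets[OF couplings_D(2)[OF c] refl] by (rule fst_snd_borel)+
  show "\<exists>q :: (nat \<times> nat) pmf. \<forall>h. (\<integral>\<^sup>+y. h y \<partial>measure_pmf q) = (\<integral>\<^sup>+z. h (code N (fst z), code N (snd z)) \<partial>\<pi> i)"
   by (rule ex_pmf_of_countable_valued[OF couplings_D(1)[OF c] measurable_count_space_combine[OF
      measurable_compose[OF f(1) code_measurable] measurable_compose[OF f(2) code_measurable]]])
 qed
 from bchoice[OF this] obtain q :: "nat => (nat \<times> nat) pmf" where
  q: "!!i h. i < 2 ^ N ==> (\<integral>\<^sup>+y. h y \<partial>measure_pmf (q i)) = (\<integral>\<^sup>+z. h (code N (fst z), code N (snd z)) \<partial>\<pi> i)"
  by blast
 have q_snd: "(\<integral>\<^sup>+z. h (code N (snd z)) \<partial>\<pi> i) = (\<integral>\<^sup>+x. h (code N x) \<partial>?m (Suc i))"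
  and q_fst: "(\<integral>\<^sup>+z. h (code N (fst z)) \<partial>\<pi> i) = (\<integral>\<^sup>+x. h (code N x) \<partial>?m i)" if "i < 2 ^ N" for i and h :: "nat => ennreal"
 proof -
  have c: "\<pi> i \<in> couplings (?m i) (?m (Suc i))" using \<pi>[OF that] by blast
  have f: "fst \<in> \<pi> i \<rightarrow>\<^sub>M borel" "snd \<in> \<pi> i \<rightarrow>\<^sub>M borel"
   unfolding measurable_cong_sets[OF couplings_D(2)[OF c] refl] by (rule fst_snd_borel)+
  have h: "(%x. h (code N x)) \<in> borel_measurable borel" by (rule measurable_compose[OF code_measurable]) simp
  show "(\<integral>\<^sup>+z. h (code N (snd z)) \<partial>\<pi> i) = (\<integral>\<^sup>+x. h (code N x) \<partial>?m (Suc i))"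
   by (rule nn_integral_marginal[OF couplings_D(5)[OF c] f(2) h])
  show "(\<integral>\<^sup>+z. h (code N (fst z)) \<partial>\<pi> i) = (\<integral>\<^sup>+x. h (code N x) \<partial>?m i)"
   by (rule nn_integral_marginal[OF couplings_D(4)[OF c] f(1) h])
 qed
 have "map_pmf snd (q i) = map_pmf fst (q (Suc i))" if "Suc i < 2 ^ N" for i
  using that by (intro pmf_eqI_nn_integral) (simp add: q q_snd q_fst del: of_nat_Suc)
 from ex_markov_chain_pmf[of "2 ^ N" q, OF this] obtain Q :: "(nat => nat) pmf" where
  Q: "!!i. i < 2 ^ N ==> map_pmf (%\<omega>. (\<omega> i, \<omega> (Suc i))) Q = q i" by blast
 have "(\<integral>\<^sup>+\<omega>. h (\<omega> i) (\<omega> (Suc i)) \<partial>measure_pmf Q) = (\<integral>\<^sup>+z. h (code N (fst z)) (code N (snd z)) \<partial>\<pi> i)"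
  if "i < 2 ^ N" for i and h :: "nat => nat => ennreal"
  using q[OF that, of "%y. h (fst y) (snd y)"] unfolding Q[OF that, symmetric] by simp
 thus ?thesis using \<pi> by blast
qed

end

section \<open>Discretised energies and the limit process\<close>

context wasserstein_curve
begin

lemma dist_le_sum: "a <= b ==> d (Y a) (Y b) <= (\<Sum>j\<in>{a..<b}. d (Y j) (Y (Suc j)))"
proof (induction b)
 case (Suc b)
 show ?case
 proof (cases "a = Suc b")
  case False
  hence "d (Y a) (Y b) <= (\<Sum>j\<in>{a..<b}. d (Y j) (Y (Suc j)))" "a <= b" using Suc by auto
  thus ?thesis using dist_triangle_ineq[of "Y a" "Y (Suc b)" "Y b"] by simp
 qed (simp add: dist_self)
qed (simp add: dist_self)

abbreviation "centre m c \<equiv> dense_seq (level m c)"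

text \<open>A code in the range comes from a single point, which is close to the centres of all its
  levels.\<close>

lemma centre_dist: "c \<in> range (code N) ==> m <= 2 * N ==> k <= 2 * N ==> d (centre m c) (centre k c) <= 1 / 2 ^ m + 1 / 2 ^ k"
proof -
 assume c: "c \<in> range (code N)" and mk: "m <= 2 * N" "k <= 2 * N"
 then obtain x where x: "c = code N x" by blast
 have "d (centre m c) (centre k c) <= d (dense_seq (cell m x)) x + d x (dense_seq (cell k x))"
  using mk unfolding x by (simp add: level_code dist_triangle_ineq)
 thus ?thesis
  using dist_cell[of m x] dist_cell[of k x] dist_nonneg[of x "dense_seq (cell m x)"] dist_nonneg[of "dense_seq (cell k x)" x] by linarith
qed

text \<open>With the errors of the two centres subtracted, this is a lower bound for the distance of
  any two points having these codes.\<close>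

definition slack_dist :: "nat => nat => nat => real" where
 "slack_dist N c c' = max 0 (d (centre (2 * N) c) (centre (2 * N) c') - 2 / 2 ^ (2 * N))"

lemma slack_dist_code: "slack_dist N (code N x) (code N y) <= d x y"
proof -
 let ?x = "dense_seq (cell (2 * N) x)" and ?y = "dense_seq (cell (2 * N) y)"
 have "d ?x ?y <= d ?x x + d x ?y" "d x ?y <= d x y + d y ?y" by (rule dist_triangle_ineq)+
 hence "d ?x ?y - 2 / 2 ^ (2 * N) <= d x y"
  using dist_cell[of "2 * N" x] dist_cell[of "2 * N" y] dist_nonneg[of x ?x] dist_nonneg[of ?y y] by linarith
 thus ?thesis unfolding slack_dist_def using dist_nonneg[of x y] by (simp add: level_code)
qed

text \<open>The fine steps inside a coarse one are summed. Their slacks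
  \<open>2 / 2 ^ (2 * N)\<close>, at most \<open>2 ^ N\<close> in number, total at most
  \<open>2 / 2 ^ m\<close>; passing from level \<open>2 * N\<close> to level \<open>m\<close> costs
  at most \<open>2 / 2 ^ m\<close> at each end. All this fits into \<open>8 / 2 ^ m\<close>.\<close>

lemma coarse_pen_le:
 assumes \<omega>: "!!i. i <= 2 ^ N ==> \<omega> i \<in> range (code N)" and MN: "M <= N" "m <= N"
 shows "(\<Sum>i<2 ^ M. pen p (max 0 (d (centre m (\<omega> (i * 2 ^ (N - M)))) (centre m (\<omega> (Suc i * 2 ^ (N - M)))) - 8 / 2 ^ m)) (1 / 2 ^ M))
  <= (\<Sum>k<2 ^ N. pen p (slack_dist N (\<omega> k) (\<omega> (Suc k))) (1 / 2 ^ N))"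
proof -
 let ?n = "2 ^ (N - M) :: nat"
 have nM: "2 ^ M * ?n = 2 ^ N" using MN by (simp add: power_add[symmetric])
 have "pen p (max 0 (d (centre m (\<omega> (i * ?n))) (centre m (\<omega> (Suc i * ?n))) - 8 / 2 ^ m)) (1 / 2 ^ M)
   <= (\<Sum>k\<in>{i * ?n..<i * ?n + ?n}. pen p (slack_dist N (\<omega> k) (\<omega> (Suc k))) (1 / 2 ^ N))" if i: "i < 2 ^ M" for i
 proof -
  let ?a = "i * ?n" and ?b = "i * ?n + ?n"
  have "Suc i * ?n <= 2 ^ M * ?n" using i by (intro mult_right_mono) auto
  hence b: "?b <= 2 ^ N" using nM by (simp add: add.commute)
  have a: "?a <= 2 ^ N" using b by simp
  have K: "m <= 2 * N" using MN by simp
  have small: "1 / 2 ^ (2 * N) <= (1 / 2 ^ m :: real)" using MN by (intro divide_left_mono power_increasing) auto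
  have "real ?n * (2 / 2 ^ (2 * N)) <= 2 ^ N * (2 / 2 ^ (2 * N))" by (intro mult_right_mono) (simp_all add: power_increasing)
  also have "... = 2 / 2 ^ N" by (simp add: mult_2 power_add)
  also have "... <= 2 / 2 ^ m" using MN by (intro divide_left_mono power_increasing) auto
  finally have n_small: "real ?n * (2 / 2 ^ (2 * N)) <= 2 / 2 ^ m" .
  have "d (centre (2 * N) (\<omega> ?a)) (centre (2 * N) (\<omega> ?b)) <= (\<Sum>k\<in>{?a..<?b}. d (centre (2 * N) (\<omega> k)) (centre (2 * N) (\<omega> (Suc k))))"
   by (rule dist_le_sum) simp
  also have "... <= (\<Sum>k\<in>{?a..<?b}. slack_dist N (\<omega> k) (\<omega> (Suc k)) + 2 / 2 ^ (2 * N))"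
   by (rule sum_mono) (simp add: slack_dist_def)
  also have "... = (\<Sum>k\<in>{?a..<?b}. slack_dist N (\<omega> k) (\<omega> (Suc k))) + real ?n * (2 / 2 ^ (2 * N))"
   by (simp add: sum.distrib)
  finally have 1: "d (centre (2 * N) (\<omega> ?a)) (centre (2 * N) (\<omega> ?b)) <= (\<Sum>k\<in>{?a..<?b}. slack_dist N (\<omega> k) (\<omega> (Suc k))) + 2 / 2 ^ m"
   using n_small by linarith
  have "d (centre m (\<omega> ?a)) (centre m (\<omega> ?b)) <= d (centre m (\<omega> ?a)) (centre (2 * N) (\<omega> ?a)) + d (centre (2 * N) (\<omega> ?a)) (centre m (\<omega> ?b))"
   "d (centre (2 * N) (\<omega> ?a)) (centre m (\<omega> ?b)) <= d (centre (2 * N) (\<omega> ?a)) (centre (2 * N) (\<omega> ?b)) + d (centre (2 * N) (\<omega> ?b)) (centre m (\<omega> ?b))"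
   by (rule dist_triangle_ineq)+
  hence "max 0 (d (centre m (\<omega> ?a)) (centre m (\<omega> ?b)) - 8 / 2 ^ m) <= (\<Sum>k\<in>{?a..<?b}. slack_dist N (\<omega> k) (\<omega> (Suc k)))"
  proof (intro max.boundedI)
   have "8 / 2 ^ m = 8 * (1 / 2 ^ m :: real)" "2 / 2 ^ m = 2 * (1 / 2 ^ m :: real)" "0 <= (1 / 2 ^ m :: real)" by simp_all
   thus "d (centre m (\<omega> ?a)) (centre m (\<omega> ?b)) - 8 / 2 ^ m <= (\<Sum>k\<in>{?a..<?b}. slack_dist N (\<omega> k) (\<omega> (Suc k)))"
    if "d (centre m (\<omega> ?a)) (centre m (\<omega> ?b)) <= d (centre m (\<omega> ?a)) (centre (2 * N) (\<omega> ?a)) + d (centre (2 * N) (\<omega> ?a)) (centre m (\<omega> ?b))"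
     "d (centre (2 * N) (\<omega> ?a)) (centre m (\<omega> ?b)) <= d (centre (2 * N) (\<omega> ?a)) (centre (2 * N) (\<omega> ?b)) + d (centre (2 * N) (\<omega> ?b)) (centre m (\<omega> ?b))"
    using 1 small centre_dist[OF \<omega>[OF a] K order_refl] centre_dist[OF \<omega>[OF b] order_refl K] that by linarith
   show "0 <= (\<Sum>k\<in>{?a..<?b}. slack_dist N (\<omega> k) (\<omega> (Suc k)))" by (intro sum_nonneg) (simp add: slack_dist_def)
  qed
  hence "pen p (max 0 (d (centre m (\<omega> ?a)) (centre m (\<omega> ?b)) - 8 / 2 ^ m)) (1 / 2 ^ M)
    <= pen p (\<Sum>k\<in>{?a..<?b}. slack_dist N (\<omega> k) (\<omega> (Suc k))) (1 / 2 ^ M)" using p by (intro pen_mono) auto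
  also have "... <= (\<Sum>k\<in>{?a..<?b}. pen p (slack_dist N (\<omega> k) (\<omega> (Suc k))) (1 / 2 ^ N))"
  proof -
   have "(2::real) ^ N = 2 ^ M * 2 ^ (N - M)" using MN by (simp add: power_add[symmetric])
   hence len: "(\<Sum>k\<in>{?a..<?b}. 1 / 2 ^ N :: real) = 1 / 2 ^ M" by simp
   show ?thesis unfolding len[symmetric] using p by (intro pen_sum_le) (auto simp: slack_dist_def)
  qed
  finally show ?thesis by (simp add: add.commute)
 qed
 hence "(\<Sum>i<2 ^ M. pen p (max 0 (d (centre m (\<omega> (i * ?n))) (centre m (\<omega> (Suc i * ?n))) - 8 / 2 ^ m)) (1 / 2 ^ M))
   <= (\<Sum>i<2 ^ M. \<Sum>k\<in>{i * ?n..<i * ?n + ?n}. pen p (slack_dist N (\<omega> k) (\<omega> (Suc k))) (1 / 2 ^ N))"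
  by (intro sum_mono) auto
 also have "... = (\<Sum>k<2 ^ N. pen p (slack_dist N (\<omega> k) (\<omega> (Suc k))) (1 / 2 ^ N))" unfolding sum.nat_group nM ..
 finally show ?thesis .
qed

lemma ex_approximating_chain:
 "\<exists>Q :: (nat => nat) pmf.
  (\<forall>i h. i <= 2 ^ N --> (\<integral>\<^sup>+\<omega>. h (\<omega> i) \<partial>measure_pmf Q) = (\<integral>\<^sup>+x. h (code N x) \<partial>\<mu> (real i / 2 ^ N))) &
  (\<forall>M m. M <= N --> m <= N -->
   (\<integral>\<^sup>+\<omega>. ennreal (\<Sum>i<2 ^ M. pen p (max 0 (d (centre m (\<omega> (i * 2 ^ (N - M)))) (centre m (\<omega> (Suc i * 2 ^ (N - M)))) - 8 / 2 ^ m)) (1 / 2 ^ M)) \<partial>measure_pmf Q)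
    <= ennreal (energy N + 1 / 2 ^ N))"
proof -
 let ?e = "1 / 2 ^ N :: real"
 \<comment> \<open>Chosen so that \<open>\<kappa> / ?e powr (p - 1)\<close> is
   \<open>?e * ?e\<close>: the errors of the \<open>2 ^ N\<close> steps then add up to
   \<open>1 / 2 ^ N\<close>.\<close>
 define \<kappa> where "\<kappa> = ?e * ?e powr p"
 have "0 < \<kappa>" by (simp add: \<kappa>_def)
 from ex_chain[OF this, of N] obtain Q \<pi> where
  \<pi>: "!!i. i < 2 ^ N ==> \<pi> i \<in> couplings (\<mu> (real i / 2 ^ N)) (\<mu> (real (Suc i) / 2 ^ N))"
  "!!i. i < 2 ^ N ==> transport_cost p d (\<pi> i) <= ennreal (WD (\<mu> (real i / 2 ^ N)) (\<mu> (real (Suc i) / 2 ^ N)) powr p + \<kappa>)"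
  and Q: "!!i h. i < 2 ^ N ==> (\<integral>\<^sup>+\<omega>. h (\<omega> i) (\<omega> (Suc i)) \<partial>measure_pmf Q) = (\<integral>\<^sup>+z. h (code N (fst z)) (code N (snd z)) \<partial>\<pi> i)"
  by blast
 have marginal: "(\<integral>\<^sup>+\<omega>. h (\<omega> i) \<partial>measure_pmf Q) = (\<integral>\<^sup>+x. h (code N x) \<partial>\<mu> (real i / 2 ^ N))" if "i <= 2 ^ N" for i and h :: "nat => ennreal"
 proof -
  have h: "(%x. h (code N x)) \<in> borel_measurable borel" by (rule measurable_compose[OF code_measurable]) simp
  show ?thesis
  proof (cases "i < 2 ^ N")
   case True
   have "fst \<in> \<pi> i \<rightarrow>\<^sub>M borel"
    unfolding measurable_cong_sets[OF couplings_D(2)[OF \<pi>(1)[OF True]] refl] by (rule fst_snd_borel)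
   thus ?thesis using Q[OF True, of "%a b. h a"] nn_integral_marginal[OF couplings_D(4)[OF \<pi>(1)[OF True]] _ h] by simp
  next
   case False
   \<comment> \<open>The final time has no outgoing transition; its law is read off the second
     component of the last one.\<close>
   hence "i ~= 0" by (intro notI) simp
   with \<open>i <= 2 ^ N\<close> have "\<exists>k. i = Suc k & k < 2 ^ N" by (cases i) auto
   then obtain k where k: "i = Suc k" "k < 2 ^ N" by blast
   have "snd \<in> \<pi> k \<rightarrow>\<^sub>M borel"
    unfolding measurable_cong_sets[OF couplings_D(2)[OF \<pi>(1)[OF k(2)]] refl] by (rule fst_snd_borel)
   thus ?thesis using Q[OF k(2), of "%a b. h b"] nn_integral_marginal[OF couplings_D(5)[OF \<pi>(1)[OF k(2)]] _ h] k(1) by simp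
  qed
 qed
 \<comment> \<open>The marginal law charges only genuine codes, for which the centres of different
   levels are close to each other.\<close>
 have "AE \<omega> in measure_pmf Q. \<omega> i \<in> range (code N)" if "i <= 2 ^ N" for i
 proof -
  have "(\<integral>\<^sup>+\<omega>. indicator (- range (code N)) (\<omega> i) \<partial>measure_pmf Q) = 0" unfolding marginal[OF that] by simp
  hence "AE \<omega> in measure_pmf Q. indicator (- range (code N)) (\<omega> i) = (0 :: ennreal)" by (simp add: nn_integral_0_iff_AE)
  thus ?thesis
  proof (rule eventually_mono)
   fix \<omega> :: "nat => nat" assume "indicator (- range (code N)) (\<omega> i) = (0 :: ennreal)"
   thus "\<omega> i \<in> range (code N)" by (rule contrapos_pp) simp
  qed
 qed
 hence "AE \<omega> in measure_pmf Q. \<forall>i\<in>{..2 ^ N}. \<omega> i \<in> range (code N)"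
  by (intro AE_finite_allI finite_atMost) (simp only: atMost_iff)
 hence good: "AE \<omega> in measure_pmf Q. \<forall>i. i <= 2 ^ N --> \<omega> i \<in> range (code N)" by (rule eventually_mono) (simp only: Ball_def atMost_iff)
 let ?p = "%\<omega> k. pen p (slack_dist N (\<omega> k) (\<omega> (Suc k))) ?e"
 let ?W = "%k. WD (\<mu> (real k / 2 ^ N)) (\<mu> (real (Suc k) / 2 ^ N))"
 have E: "(\<integral>\<^sup>+\<omega>. ennreal (\<Sum>k<2 ^ N. ?p \<omega> k) \<partial>measure_pmf Q) <= ennreal (energy N + ?e)"
 proof -
  have "(\<integral>\<^sup>+\<omega>. ennreal (\<Sum>k<2 ^ N. ?p \<omega> k) \<partial>measure_pmf Q) = (\<Sum>k<2 ^ N. \<integral>\<^sup>+\<omega>. ennreal (?p \<omega> k) \<partial>measure_pmf Q)"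
   by (subst sum_ennreal[symmetric]) (simp_all add: pen_nonneg nn_integral_sum del: sum_ennreal)
  also have "... <= (\<Sum>k<2 ^ N. ennreal (pen p (?W k) ?e + \<kappa> / ?e powr (p - 1)))"
  proof (rule sum_mono)
   fix k :: nat assume "k \<in> {..<2 ^ N}"
   hence k: "k < 2 ^ N" by simp
   have "(\<integral>\<^sup>+\<omega>. ennreal (?p \<omega> k) \<partial>measure_pmf Q) = (\<integral>\<^sup>+z. ennreal (pen p (slack_dist N (code N (fst z)) (code N (snd z))) ?e) \<partial>\<pi> k)"
    by (rule Q[OF k])
   also have "... <= (\<integral>\<^sup>+z. ennreal (1 / ?e powr (p - 1)) * ennreal (d (fst z) (snd z) powr p) \<partial>\<pi> k)"
   proof (rule nn_integral_mono)
    fix z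
    have "pen p (slack_dist N (code N (fst z)) (code N (snd z))) ?e <= pen p (d (fst z) (snd z)) ?e"
     using p slack_dist_code by (intro pen_mono) (auto simp: slack_dist_def)
    thus "ennreal (pen p (slack_dist N (code N (fst z)) (code N (snd z))) ?e) <= ennreal (1 / ?e powr (p - 1)) * ennreal (d (fst z) (snd z) powr p)"
     by (simp add: ennreal_mult[symmetric] pen_def ennreal_leI)
   qed
   also have "... = ennreal (1 / ?e powr (p - 1)) * transport_cost p d (\<pi> k)"
    unfolding transport_cost_def by (rule nn_integral_cmult[OF cost_integrand_measurable[OF couplings_D(2)[OF \<pi>(1)[OF k]]]])
   also have "... <= ennreal (1 / ?e powr (p - 1)) * ennreal (?W k powr p + \<kappa>)" by (intro mult_left_mono \<pi>(2)[OF k]) simp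
   also have "... = ennreal (pen p (?W k) ?e + \<kappa> / ?e powr (p - 1))"
    using \<open>0 < \<kappa>\<close> by (subst ennreal_mult[symmetric]) (simp_all add: pen_def add_divide_distrib del: ennreal_plus of_nat_Suc)
   finally show "(\<integral>\<^sup>+\<omega>. ennreal (?p \<omega> k) \<partial>measure_pmf Q) <= ennreal (pen p (?W k) ?e + \<kappa> / ?e powr (p - 1))" .
  qed
  also have "... = ennreal (\<Sum>k<2 ^ N. pen p (?W k) ?e + \<kappa> / ?e powr (p - 1))"
   using \<open>0 < \<kappa>\<close> by (intro sum_ennreal add_nonneg_nonneg pen_nonneg) auto
  also have "(\<Sum>k<2 ^ N. pen p (?W k) ?e + \<kappa> / ?e powr (p - 1)) = energy N + 2 ^ N * (\<kappa> / ?e powr (p - 1))"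
   by (simp add: sum.distrib energy_def)
  also have "\<kappa> / ?e powr (p - 1) = ?e * ?e" unfolding \<kappa>_def by (simp add: powr_diff)
  finally show ?thesis by simp
 qed
 have "(\<integral>\<^sup>+\<omega>. ennreal (\<Sum>i<2 ^ M. pen p (max 0 (d (centre m (\<omega> (i * 2 ^ (N - M)))) (centre m (\<omega> (Suc i * 2 ^ (N - M)))) - 8 / 2 ^ m)) (1 / 2 ^ M)) \<partial>measure_pmf Q)
    <= ennreal (energy N + 1 / 2 ^ N)" if "M <= N" "m <= N" for M m
 proof (rule order_trans[OF nn_integral_mono_AE E])
  show "AE \<omega> in measure_pmf Q. ennreal (\<Sum>i<2 ^ M. pen p (max 0 (d (centre m (\<omega> (i * 2 ^ (N - M)))) (centre m (\<omega> (Suc i * 2 ^ (N - M)))) - 8 / 2 ^ m)) (1 / 2 ^ M))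
   <= ennreal (\<Sum>k<2 ^ N. ?p \<omega> k)" using good
  proof eventually_elim
   case (elim \<omega>)
   show ?case by (rule ennreal_leI, rule coarse_pen_le[OF _ that]) (use elim in blast)
  qed
 qed
 thus ?thesis using marginal by blast
qed

definition dyadics :: "real set" where
 "dyadics = {real i / 2 ^ M |i M. i <= 2 ^ M}"

lemma dyadicsI: "i <= 2 ^ M ==> real i / 2 ^ M \<in> dyadics" unfolding dyadics_def by blast

lemma countable_dyadics: "countable dyadics"
proof -
 have "dyadics \<subseteq> (%(i, M). real i / 2 ^ M) ` (UNIV :: (nat \<times> nat) set)" unfolding dyadics_def by auto
 thus ?thesis by (rule countable_subset) simp
qed

lemma dyadics_unit: "t \<in> dyadics ==> t \<in> {0..1}" unfolding dyadics_def using dyadic_in_unit by blast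

definition ix :: "nat => real => nat" where
 "ix N t = nat \<lfloor>t * 2 ^ N\<rfloor>"

lemma ix_dyadic: "M <= N ==> ix N (real i / 2 ^ M) = i * 2 ^ (N - M)"
proof -
 assume "M <= N"
 hence "(2::real) ^ N = 2 ^ M * 2 ^ (N - M)" by (simp add: power_add[symmetric])
 hence "real i / 2 ^ M * 2 ^ N = real (i * 2 ^ (N - M))" by simp
 thus ?thesis unfolding ix_def by (simp only: floor_of_nat nat_int)
qed

lemma eventually_ix:
 assumes "t \<in> dyadics"
 shows "\<forall>\<^sub>F N in sequentially. ix N t <= 2 ^ N & real (ix N t) / 2 ^ N = t"
proof -
 obtain i M where t: "t = real i / 2 ^ M" "i <= 2 ^ M" using assms unfolding dyadics_def by blast
 have "ix N t <= 2 ^ N & real (ix N t) / 2 ^ N = t" if "M <= N" for N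
 proof -
  have 2: "(2::nat) ^ N = 2 ^ M * 2 ^ (N - M)" using that by (simp add: power_add[symmetric])
  hence "(2::real) ^ N = 2 ^ M * 2 ^ (N - M)" using that by (simp add: power_add[symmetric])
  thus ?thesis unfolding t(1) ix_dyadic[OF that] using t(2) 2 by simp
 qed
 thus ?thesis unfolding eventually_sequentially by blast
qed

lemma liminf_le_const: "\<forall>\<^sub>F N in sequentially. f N <= (c :: ennreal) ==> liminf f <= c"
 using Liminf_mono[of f "%_. c" sequentially] by (simp add: Liminf_const)

text \<open>\<open>Z t m\<close> is the limiting cell number of level \<open>m\<close> at the dyadic
  time \<open>t\<close>, and \<open>r\<close> is the subsequence of chains. The condition on
  \<open>\<psi>\<close> says that it depends only on the finitely many coordinates in
  \<open>A\<close>; for such functions the limit is compared by a lower limit.\<close>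

definition limit_process :: "(nat => nat) => (nat => (nat => nat) pmf) => (real => nat => real => nat) => bool" where
 "limit_process r Q Z \<longleftrightarrow> strict_mono r &
  (\<forall>N i h. i <= 2 ^ N --> (\<integral>\<^sup>+\<omega>. h (\<omega> i) \<partial>measure_pmf (Q N)) = (\<integral>\<^sup>+x. h (code N x) \<partial>\<mu> (real i / 2 ^ N))) &
  (\<forall>N M m. M <= N --> m <= N -->
   (\<integral>\<^sup>+\<omega>. ennreal (\<Sum>i<2 ^ M. pen p (max 0 (d (centre m (\<omega> (i * 2 ^ (N - M)))) (centre m (\<omega> (Suc i * 2 ^ (N - M)))) - 8 / 2 ^ m)) (1 / 2 ^ M)) \<partial>measure_pmf (Q N))
    <= ennreal (energy N + 1 / 2 ^ N)) &
  (\<forall>t m. Z t m \<in> borel \<rightarrow>\<^sub>M count_space UNIV) &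
  (\<forall>A \<psi>. finite A --> A \<subseteq> dyadics \<times> UNIV --> (\<forall>z z'. (\<forall>a\<in>A. z (fst a) (snd a) = z' (fst a) (snd a)) --> \<psi> z = \<psi> z') -->
   (\<integral>\<^sup>+u. \<psi> (%t m. Z t m u) \<partial>unit_measure) <= liminf (%N. \<integral>\<^sup>+\<omega>. (\<psi> (%t m. level m (\<omega> (ix (r N) t))) :: ennreal) \<partial>measure_pmf (Q (r N))))"

text \<open>All pairs of a dyadic time and a level are enumerated as one sequence of coordinates.
  Once the grid contains the time and \<open>m <= N\<close>, the law of the coordinate is that of
  \<open>cell m\<close> under \<open>\<mu>\<close> and no longer depends on \<open>N\<close>, as the
  compactness theorem demands.\<close>

lemma ex_limit_process: "\<exists>r Q Z. limit_process r Q Z"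
proof -
 have "\<exists>Q. \<forall>N. (\<forall>i h. i <= 2 ^ N --> (\<integral>\<^sup>+\<omega>. h (\<omega> i) \<partial>measure_pmf (Q N)) = (\<integral>\<^sup>+x. h (code N x) \<partial>\<mu> (real i / 2 ^ N))) &
  (\<forall>M m. M <= N --> m <= N -->
   (\<integral>\<^sup>+\<omega>. ennreal (\<Sum>i<2 ^ M. pen p (max 0 (d (centre m (\<omega> (i * 2 ^ (N - M)))) (centre m (\<omega> (Suc i * 2 ^ (N - M)))) - 8 / 2 ^ m)) (1 / 2 ^ M)) \<partial>measure_pmf (Q N))
    <= ennreal (energy N + 1 / 2 ^ N))" by (rule choice) (rule allI, rule ex_approximating_chain)
 then obtain Q :: "nat => (nat => nat) pmf" where Q:
  "!!N i h. i <= 2 ^ N ==> (\<integral>\<^sup>+\<omega>. h (\<omega> i) \<partial>measure_pmf (Q N)) = (\<integral>\<^sup>+x. h (code N x) \<partial>\<mu> (real i / 2 ^ N))"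
  and E: "!!N M m. M <= N ==> m <= N ==>
   (\<integral>\<^sup>+\<omega>. ennreal (\<Sum>i<2 ^ M. pen p (max 0 (d (centre m (\<omega> (i * 2 ^ (N - M)))) (centre m (\<omega> (Suc i * 2 ^ (N - M)))) - 8 / 2 ^ m)) (1 / 2 ^ M)) \<partial>measure_pmf (Q N))
    <= ennreal (energy N + 1 / 2 ^ N)" by blast
 define time where "time k = from_nat_into dyadics (fst (prod_decode k))" for k
 define coord where "coord N \<omega> k = level (snd (prod_decode k)) (\<omega> (ix N (time k)))" for N and \<omega> :: "nat => nat" and k
 have "dyadics ~= {}" using dyadicsI[of 0 0] by auto
 hence time: "time k \<in> dyadics" for k unfolding time_def by (rule from_nat_into)
 have const: "\<exists>\<rho>. \<forall>\<^sub>F N in sequentially. map_pmf (%\<omega>. \<omega> k) (map_pmf (coord N) (Q N)) = \<rho>" for k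
 proof -
  let ?m = "snd (prod_decode k)"
  have PM: "\<mu> (time k) \<in> PM" using time dyadics_unit \<mu>_PM by blast
  have "cell ?m \<in> \<mu> (time k) \<rightarrow>\<^sub>M count_space UNIV"
   unfolding measurable_cong_sets[OF wasserstein_space_D(2)[OF PM] refl] by (rule cell_measurable)
  from ex_pmf_of_countable_valued[OF wasserstein_space_D(1)[OF PM] this]
  obtain \<rho> where \<rho>: "!!h. (\<integral>\<^sup>+y. h y \<partial>measure_pmf \<rho>) = (\<integral>\<^sup>+x. h (cell ?m x) \<partial>\<mu> (time k))" by blast
  have "\<forall>\<^sub>F N in sequentially. ix N (time k) <= 2 ^ N & real (ix N (time k)) / 2 ^ N = time k & ?m <= N"
   using eventually_ix[OF time, of k] eventually_ge_at_top[of ?m] by eventually_elim simp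
  hence "\<forall>\<^sub>F N in sequentially. map_pmf (%\<omega>. \<omega> k) (map_pmf (coord N) (Q N)) = \<rho>"
  proof eventually_elim
   case (elim N)
   show ?case
   proof (rule pmf_eqI_nn_integral)
    fix h :: "nat => ennreal"
    have "(\<integral>\<^sup>+y. h y \<partial>measure_pmf (map_pmf (%\<omega>. \<omega> k) (map_pmf (coord N) (Q N)))) = (\<integral>\<^sup>+\<omega>. h (level ?m (\<omega> (ix N (time k)))) \<partial>measure_pmf (Q N))"
     by (simp add: coord_def)
    also have "... = (\<integral>\<^sup>+x. h (level ?m (code N x)) \<partial>\<mu> (time k))"
     using Q[of "ix N (time k)" N "%c. h (level ?m c)"] elim by simp
    also have "... = (\<integral>\<^sup>+y. h y \<partial>measure_pmf \<rho>)" using elim by (simp add: level_code \<rho>)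
    finally show "(\<integral>\<^sup>+y. h y \<partial>measure_pmf (map_pmf (%\<omega>. \<omega> k) (map_pmf (coord N) (Q N)))) = (\<integral>\<^sup>+y. h y \<partial>measure_pmf \<rho>)" .
   qed
  qed
  thus ?thesis ..
 qed
 from discrete_processes_subsequence_limit[of "%N. map_pmf (coord N) (Q N)", OF const]
 obtain r X where r: "strict_mono (r :: nat => nat)" and X: "!!k. X k \<in> borel \<rightarrow>\<^sub>M count_space UNIV"
  and lim: "!!n (\<psi> :: nat list => ennreal). (\<integral>\<^sup>+u. \<psi> (map (%k. X k u) [0..<n]) \<partial>unit_measure)
    <= liminf (%N. \<integral>\<^sup>+\<omega>. \<psi> (map \<omega> [0..<n]) \<partial>measure_pmf (map_pmf (coord (r N)) (Q (r N))))"
  by blast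
 define enc where "enc t m = prod_encode (to_nat_on dyadics t, m)" for t m
 have enc: "coord N \<omega> (enc t m) = level m (\<omega> (ix N t))" if "t \<in> dyadics" for N \<omega> t m
  using that by (simp add: coord_def enc_def time_def from_nat_into_to_nat_on[OF countable_dyadics])
 define Z where "Z t m = X (enc t m)" for t m
 have "(\<integral>\<^sup>+u. \<psi> (%t m. Z t m u) \<partial>unit_measure) <= liminf (%N. \<integral>\<^sup>+\<omega>. \<psi> (%t m. level m (\<omega> (ix (r N) t))) \<partial>measure_pmf (Q (r N)))"
  if A: "finite A" "A \<subseteq> dyadics \<times> UNIV" and dep: "!!z z'. (\<forall>a\<in>A. z (fst a) (snd a) = z' (fst a) (snd a)) ==> \<psi> z = \<psi> z'"
  for A and \<psi> :: "(real => nat => nat) => ennreal"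
 proof -
  obtain n where n: "!!a. a \<in> A ==> enc (fst a) (snd a) < n"
   using finite_nat_set_iff_bounded[of "(%a. enc (fst a) (snd a)) ` A"] A(1) by auto
  define \<psi>' where "\<psi>' l = \<psi> (%t m. l ! enc t m)" for l
  have 1: "\<psi>' (map (%k. X k u) [0..<n]) = \<psi> (%t m. Z t m u)" for u unfolding \<psi>'_def Z_def using n by (intro dep) simp
  have 2: "\<psi>' (map (coord N \<omega>) [0..<n]) = \<psi> (%t m. level m (\<omega> (ix N t)))" for N \<omega> unfolding \<psi>'_def
  proof (intro dep ballI)
   fix a assume a: "a \<in> A"
   hence "fst a \<in> dyadics" using A(2) by auto
   thus "map (coord N \<omega>) [0..<n] ! enc (fst a) (snd a) = level (snd a) (\<omega> (ix N (fst a)))" using n[OF a] by (simp add: enc)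
  qed
  show ?thesis using lim[of \<psi>' n] by (simp add: 1 2)
 qed
 moreover have "Z t m \<in> borel \<rightarrow>\<^sub>M count_space UNIV" for t m unfolding Z_def by (rule X)
 ultimately show ?thesis unfolding limit_process_def by (intro exI[of _ r] exI[of _ Q] exI[of _ Z] conjI allI impI r Q E) blast+
qed

end

context wasserstein_curve
begin

text \<open>Compatibility of two consecutive levels involves two coordinates only, so it passes to
  the limit process; it suffices for the convergence of the centres.\<close>

definition linked :: "nat => nat => nat => bool" where
 "linked m j k \<longleftrightarrow> (\<exists>x. j = cell m x & k = cell (Suc m) x)"

text \<open>Consecutive centres are at forward distance at most \<open>2 / 2 ^ m\<close>, a summable
  bound, so they form a forward Cauchy sequence.\<close>

lemma linked_cells_converge:
 assumes c: "!!m. linked m (c m) (c (Suc m))"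
 shows "\<exists>y. (%m. dense_seq (c m)) \<longlonglongrightarrow> y"
proof -
 have step: "d (dense_seq (c m)) (dense_seq (c (Suc m))) <= 2 / 2 ^ m" for m
 proof -
  obtain x where x: "c m = cell m x" "c (Suc m) = cell (Suc m) x" using c[of m] unfolding linked_def by blast
  have "d (dense_seq (c m)) (dense_seq (c (Suc m))) <= d (dense_seq (c m)) x + d x (dense_seq (c (Suc m)))" by (rule dist_triangle_ineq)
  moreover have "1 / 2 ^ Suc m <= (1 / 2 ^ m :: real)" by (simp add: divide_simps)
  ultimately have "d (dense_seq (c m)) (dense_seq (c (Suc m))) <= 1 / 2 ^ m + 1 / 2 ^ m"
   using dist_cell[of m x] dist_cell[of "Suc m" x] dist_nonneg[of x "dense_seq (c m)"] dist_nonneg[of "dense_seq (c (Suc m))" x]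
   unfolding x by linarith
  thus ?thesis by simp
 qed
 have sum: "m <= n ==> (\<Sum>j\<in>{m..<n}. 2 / 2 ^ j :: real) = 4 / 2 ^ m - 4 / 2 ^ n" for m n
 proof (induction n rule: dec_induct)
  case (step n)
  have "4 / 2 ^ Suc n = (2 / 2 ^ n :: real)" "4 / 2 ^ n = 2 * (2 / 2 ^ n :: real)" by simp_all
  thus ?case using step by (simp del: power_Suc)
 qed simp
 have "forward_Cauchy d (%m. dense_seq (c m))" unfolding forward_Cauchy_def
 proof (intro allI impI)
  fix \<epsilon> :: real assume "0 < \<epsilon>"
  then obtain N where N: "(1 / 2) ^ N < \<epsilon> / 4" using real_arch_pow_inv[of "\<epsilon> / 4" "1 / 2"] by auto
  have "d (dense_seq (c m)) (dense_seq (c n)) < \<epsilon>" if mn: "n \<ge> m & m > N" for m n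
  proof -
   have "d (dense_seq (c m)) (dense_seq (c n)) <= (\<Sum>j\<in>{m..<n}. d (dense_seq (c j)) (dense_seq (c (Suc j))))"
    using mn by (intro dist_le_sum[where Y = "%m. dense_seq (c m)"]) simp
   also have "... <= (\<Sum>j\<in>{m..<n}. 2 / 2 ^ j)" by (intro sum_mono step)
   also have "... <= 4 / 2 ^ m" using mn by (simp add: sum)
   also have "... <= 4 / 2 ^ N" using mn by (intro divide_left_mono power_increasing) auto
   also have "... < \<epsilon>" using N by (simp add: power_one_over)
   finally show ?thesis .
  qed
  thus "\<exists>N. \<forall>m n. n \<ge> m & m > N --> d (dense_seq (c m)) (dense_seq (c n)) < \<epsilon>" by blast
 qed
 thus ?thesis using complete unfolding forward_complete_def by blast
qed

lemma dense_seq_measurable: "X \<in> M \<rightarrow>\<^sub>M count_space UNIV ==> (%u. dense_seq (X u)) \<in> M \<rightarrow>\<^sub>M borel"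
 by (rule measurable_compose[of X M "count_space UNIV" dense_seq borel]) simp_all

text \<open>\<open>Y t\<close> is the limit of the centres. Integrals over two consecutive levels of
  \<open>Z\<close> are at most those under \<open>\<mu> t\<close>; applied to the event of unlinked
  cells this gives convergence almost surely, applied to test functions it identifies the law of
  \<open>Y t\<close>.\<close>

theorem ex_dyadic_process:
 "\<exists>Y :: real => real => 'a. (\<forall>t. Y t \<in> borel \<rightarrow>\<^sub>M borel) & (\<forall>t\<in>dyadics. distr unit_measure borel (Y t) = \<mu> t) &
  (\<forall>M. (\<integral>\<^sup>+u. ennreal (\<Sum>i<2 ^ M. pen p (d (Y (real i / 2 ^ M) u) (Y (real (Suc i) / 2 ^ M) u)) (1 / 2 ^ M)) \<partial>unit_measure) <= ennreal total)"
proof -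
 obtain r Q Z where L: "limit_process r Q Z" using ex_limit_process by blast
 note L = L[unfolded limit_process_def]
 note r = L[THEN conjunct1] and Q = L[THEN conjunct2, THEN conjunct1, rule_format]
  and E = L[THEN conjunct2, THEN conjunct2, THEN conjunct1, rule_format]
  and Z = L[THEN conjunct2, THEN conjunct2, THEN conjunct2, THEN conjunct1, rule_format]
  and lim = L[THEN conjunct2, THEN conjunct2, THEN conjunct2, THEN conjunct2, THEN spec, THEN spec, THEN mp, THEN mp, THEN mp]
 define good where "good t u \<longleftrightarrow> (\<forall>m. linked m (Z t m u) (Z t (Suc m) u))" for t u
 \<comment> \<open>At dyadic times the dummy \<open>star\<close> is taken only on a null
   set.\<close>
 define y where "y t m u = (if good t u then dense_seq (Z t m u) else star)" for t m u
 define Y where "Y t u = lim (%m. y t m u)" for t u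
 have y_lim: "(%m. y t m u) \<longlonglongrightarrow> Y t u" for t u
 proof -
  have "convergent (%m. y t m u)"
  proof (cases "good t u")
   case True
   thus ?thesis using linked_cells_converge[of "%m. Z t m u"] unfolding convergent_def by (simp add: y_def good_def)
  qed (simp add: y_def convergent_const)
  thus ?thesis unfolding Y_def by (simp add: convergent_LIMSEQ_iff)
 qed
 have good_meas: "{u \<in> space borel. good t u} \<in> sets borel" for t
 proof -
  have "(%u. linked m (Z t m u) (Z t (Suc m) u)) \<in> borel \<rightarrow>\<^sub>M count_space UNIV" for m
   by (rule measurable_count_space_combine[OF Z Z])
  thus ?thesis unfolding good_def by measurable
 qed
 have y_meas: "y t m \<in> borel \<rightarrow>\<^sub>M borel" for t m
  unfolding y_def by (rule measurable_If[OF dense_seq_measurable[OF Z] _ good_meas]) simp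
 have Y_meas: "Y t \<in> borel \<rightarrow>\<^sub>M borel" for t by (rule measurable_limit[OF y_meas y_lim])
 have ev: "\<forall>\<^sub>F N in sequentially. ix (r N) t <= 2 ^ r N & real (ix (r N) t) / 2 ^ r N = t & m <= r N" if "t \<in> dyadics" for t m
 proof (rule eventually_compose_filterlim[OF _ filterlim_subseq[OF r]])
  show "\<forall>\<^sub>F N in sequentially. ix N t <= 2 ^ N & real (ix N t) / 2 ^ N = t & m <= N"
   using eventually_ix[OF that] eventually_ge_at_top[of m] by eventually_elim simp
 qed
 have marginal_le: "(\<integral>\<^sup>+u. h (Z t m u) (Z t (Suc m) u) \<partial>unit_measure) <= (\<integral>\<^sup>+x. h (cell m x) (cell (Suc m) x) \<partial>\<mu> t)"
  if t: "t \<in> dyadics" for t m and h :: "nat => nat => ennreal"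
 proof -
  have "(\<integral>\<^sup>+u. h (Z t m u) (Z t (Suc m) u) \<partial>unit_measure)
    <= liminf (%N. \<integral>\<^sup>+\<omega>. h (level m (\<omega> (ix (r N) t))) (level (Suc m) (\<omega> (ix (r N) t))) \<partial>measure_pmf (Q (r N)))"
   by (rule lim[of "{(t, m), (t, Suc m)}" "%z. h (z t m) (z t (Suc m))"]) (use t in auto)
  also have "... <= (\<integral>\<^sup>+x. h (cell m x) (cell (Suc m) x) \<partial>\<mu> t)"
  proof (rule liminf_le_const)
   show "\<forall>\<^sub>F N in sequentially. (\<integral>\<^sup>+\<omega>. h (level m (\<omega> (ix (r N) t))) (level (Suc m) (\<omega> (ix (r N) t))) \<partial>measure_pmf (Q (r N)))
     <= (\<integral>\<^sup>+x. h (cell m x) (cell (Suc m) x) \<partial>\<mu> t)" using ev[OF t, of "Suc m"]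
   proof eventually_elim
    case (elim N)
    thus ?case using Q[of "ix (r N) t" "r N" "%c. h (level m c) (level (Suc m) c)"] by (simp add: level_code)
   qed
  qed
  finally show ?thesis .
 qed
 have good_AE: "AE u in unit_measure. good t u" if t: "t \<in> dyadics" for t unfolding good_def AE_all_countable
 proof
  fix m
  let ?h = "%j k. if linked m j k then 0 else 1 :: ennreal"
  have [measurable]: "(%u. ?h (Z t m u) (Z t (Suc m) u)) \<in> borel_measurable borel"
   by (rule measurable_compose[OF measurable_count_space_combine[OF Z Z, of "linked m"], of "%b. if b then 0 else 1"]) simp
  have "(\<integral>\<^sup>+u. ?h (Z t m u) (Z t (Suc m) u) \<partial>unit_measure) <= (\<integral>\<^sup>+x. ?h (cell m x) (cell (Suc m) x) \<partial>\<mu> t)"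
   by (rule marginal_le[OF t])
  also have "... = (\<integral>\<^sup>+x. 0 \<partial>\<mu> t)" by (rule nn_integral_cong) (auto simp: linked_def)
  finally have "AE u in unit_measure. ?h (Z t m u) (Z t (Suc m) u) = 0" by (subst (asm) nn_integral_const) (simp add: nn_integral_0_iff_AE)
  thus "AE u in unit_measure. linked m (Z t m u) (Z t (Suc m) u)" by (rule eventually_mono) (simp split: if_splits)
 qed
 interpret U: prob_space unit_measure by (rule prob_space_unit_measure)
 have law: "distr unit_measure borel (Y t) = \<mu> t" if t: "t \<in> dyadics" for t
 proof -
  have PM: "\<mu> t \<in> PM" using t dyadics_unit \<mu>_PM by blast
  note M = wasserstein_space_D[OF PM]
  interpret M: prob_space "\<mu> t" by (rule M)
  have YU: "Y t \<in> unit_measure \<rightarrow>\<^sub>M borel" using Y_meas[of t] by simp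
  show ?thesis
  proof (rule measure_eq_if_bump_le[OF U.prob_space_distr[OF YU] _ M(1,2)])
   fix C :: "'a set" and n assume C: "C ~= {}"
   let ?I = "\<integral>\<^sup>+x. ennreal (bump C n x) \<partial>\<mu> t"
   have bm: "(%x. ennreal (bump C n x)) \<in> borel_measurable borel" using bump_measurable[OF C] by measurable
   have step: "(\<integral>\<^sup>+u. ennreal (bump C n (y t m u)) \<partial>unit_measure) <= ?I + ennreal (real n / 2 ^ m)" for m
   proof -
    have "(\<integral>\<^sup>+u. ennreal (bump C n (y t m u)) \<partial>unit_measure) = (\<integral>\<^sup>+u. ennreal (bump C n (dense_seq (Z t m u))) \<partial>unit_measure)"
     using good_AE[OF t] by (intro nn_integral_cong_AE) (auto simp: y_def elim!: eventually_mono)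
    also have "... <= (\<integral>\<^sup>+x. ennreal (bump C n (dense_seq (cell m x))) \<partial>\<mu> t)"
     by (rule marginal_le[OF t, where h = "%j k. ennreal (bump C n (dense_seq j))"])
    also have "... <= (\<integral>\<^sup>+x. ennreal (bump C n x) + ennreal (real n / 2 ^ m) \<partial>\<mu> t)"
    proof (rule nn_integral_mono)
     fix x
     have "bump C n (dense_seq (cell m x)) <= bump C n x + real n * d x (dense_seq (cell m x))" by (rule bump_Lipschitz[OF C])
     also have "d x (dense_seq (cell m x)) <= 1 / 2 ^ m" using dist_cell[of m x] dist_nonneg[of "dense_seq (cell m x)" x] by simp
     finally have "bump C n (dense_seq (cell m x)) <= bump C n x + real n / 2 ^ m" by (simp add: mult_left_mono)
     thus "ennreal (bump C n (dense_seq (cell m x))) <= ennreal (bump C n x) + ennreal (real n / 2 ^ m)"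
      using bump_bounds[OF C, of n x] by (simp add: ennreal_plus[symmetric] ennreal_leI del: ennreal_plus)
    qed
    also have "... = ?I + ennreal (real n / 2 ^ m)"
     using bm M(2) by (subst nn_integral_add) (simp_all add: measurable_cong_sets[OF M(2) refl] M.emeasure_space_1)
    finally show ?thesis .
   qed
   have "(\<integral>\<^sup>+x. ennreal (bump C n x) \<partial>distr unit_measure borel (Y t)) = (\<integral>\<^sup>+u. ennreal (bump C n (Y t u)) \<partial>unit_measure)"
    by (rule nn_integral_distr[OF YU]) (use bm in simp)
   also have "... = (\<integral>\<^sup>+u. liminf (%m. ennreal (bump C n (y t m u))) \<partial>unit_measure)"
    by (intro nn_integral_cong lim_imp_Liminf[symmetric] tendsto_ennrealI bump_tendsto[OF C y_lim]) simp
   also have "... <= liminf (%m. \<integral>\<^sup>+u. ennreal (bump C n (y t m u)) \<partial>unit_measure)"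
    by (rule nn_integral_liminf) (use measurable_compose[OF y_meas bm] in simp)
   also have "... <= liminf (%m. ?I + ennreal (real n / 2 ^ m))" by (intro Liminf_mono always_eventually allI step)
   also have "... = ?I"
   proof (rule lim_imp_Liminf)
    have "(%m. real n * (1 / 2) ^ m) \<longlonglongrightarrow> real n * 0" by (intro tendsto_intros LIMSEQ_realpow_zero) auto
    hence "(%m. ?I + ennreal (real n / 2 ^ m)) \<longlonglongrightarrow> ?I + ennreal 0"
     by (intro tendsto_add tendsto_const tendsto_ennrealI) (simp add: power_one_over)
    thus "(%m. ?I + ennreal (real n / 2 ^ m)) \<longlonglongrightarrow> ?I" by simp
   qed simp
   finally show "(\<integral>\<^sup>+x. ennreal (bump C n x) \<partial>distr unit_measure borel (Y t)) <= ?I" .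
  qed simp
 qed
 \<comment> \<open>Two limits in succession: along the chains at a fixed level \<open>m\<close>,
   with the slack \<open>8 / 2 ^ m\<close>, and then for \<open>m\<close> to infinity, where the
   slack disappears.\<close>
 have "(\<integral>\<^sup>+u. ennreal (\<Sum>i<2 ^ M. pen p (d (Y (real i / 2 ^ M) u) (Y (real (Suc i) / 2 ^ M) u)) (1 / 2 ^ M)) \<partial>unit_measure) <= ennreal total" for M
 proof -
  let ?t = "%i. real i / 2 ^ M"
  define \<psi> where "\<psi> m z = ennreal (\<Sum>i<2 ^ M. pen p (max 0 (d (dense_seq (z (?t i) m)) (dense_seq (z (?t (Suc i)) m)) - 8 / 2 ^ m)) (1 / 2 ^ M))"
   for m :: nat and z :: "real => nat => nat"
  have step: "(\<integral>\<^sup>+u. \<psi> m (%t m. Z t m u) \<partial>unit_measure) <= ennreal total" for m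
  proof -
   have "(\<integral>\<^sup>+u. \<psi> m (%t m. Z t m u) \<partial>unit_measure) <= liminf (%N. \<integral>\<^sup>+\<omega>. \<psi> m (%t m. level m (\<omega> (ix (r N) t))) \<partial>measure_pmf (Q (r N)))"
   proof (rule lim[of "(%i. (?t i, m)) ` {..2 ^ M}"])
    show "(%i. (?t i, m)) ` {..2 ^ M} \<subseteq> dyadics \<times> UNIV" using dyadicsI by auto
    show "\<forall>z z'. (\<forall>a\<in>(%i. (?t i, m)) ` {..2 ^ M}. z (fst a) (snd a) = z' (fst a) (snd a)) --> \<psi> m z = \<psi> m z'"
    proof (intro allI impI)
     fix z z' :: "real => nat => nat"
     assume "\<forall>a\<in>(%i. (?t i, m)) ` {..2 ^ M}. z (fst a) (snd a) = z' (fst a) (snd a)"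
     hence "z (?t i) m = z' (?t i) m" if "i <= 2 ^ M" for i using that by auto
     thus "\<psi> m z = \<psi> m z'" unfolding \<psi>_def by (simp del: of_nat_Suc)
    qed
   qed simp
   also have "... <= liminf (%N. ennreal (total + 1 / 2 ^ r N))"
   proof (rule Liminf_mono)
    have "\<forall>\<^sub>F N in sequentially. max M m <= r N"
     by (rule eventually_compose_filterlim[OF eventually_ge_at_top filterlim_subseq[OF r]])
    thus "\<forall>\<^sub>F N in sequentially. (\<integral>\<^sup>+\<omega>. \<psi> m (%t m. level m (\<omega> (ix (r N) t))) \<partial>measure_pmf (Q (r N))) <= ennreal (total + 1 / 2 ^ r N)"
    proof eventually_elim
     case (elim N)
     hence MN: "M <= r N" "m <= r N" by simp_all
     have "(\<integral>\<^sup>+\<omega>. \<psi> m (%t m. level m (\<omega> (ix (r N) t))) \<partial>measure_pmf (Q (r N))) <= ennreal (energy (r N) + 1 / 2 ^ r N)"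
      using E[OF MN] unfolding \<psi>_def by (simp only: ix_dyadic[OF MN(1)])
     also have "... <= ennreal (total + 1 / 2 ^ r N)" using energy_le_total[of "r N"] by (intro ennreal_leI) simp
     finally show ?case .
    qed
   qed
   also have "... = ennreal total"
   proof (rule lim_imp_Liminf)
    have "((%k. (1 / 2 :: real) ^ k) \<circ> r) \<longlonglongrightarrow> 0" by (rule LIMSEQ_subseq_LIMSEQ[OF LIMSEQ_realpow_zero r]) auto
    hence "(%N. total + 1 / 2 ^ r N) \<longlonglongrightarrow> total + 0" by (intro tendsto_intros) (simp add: comp_def power_one_over)
    thus "(%N. ennreal (total + 1 / 2 ^ r N)) \<longlonglongrightarrow> ennreal total" by (intro tendsto_ennrealI) simp
   qed simp
   finally show ?thesis .
  qed
  have \<psi>_meas: "(%u. \<psi> m (%t m. Z t m u)) \<in> borel_measurable unit_measure" for m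
  proof -
   have "(%u. d (dense_seq (Z s m u)) (dense_seq (Z t m u))) \<in> borel_measurable borel" for s t
    by (intro borel_measurable_dist dense_seq_measurable Z)
   thus ?thesis unfolding \<psi>_def pen_def by measurable
  qed
  have "AE u in unit_measure. \<forall>i\<in>{..2 ^ M}. good (?t i) u"
   by (intro AE_finite_allI finite_atMost) (rule good_AE[OF dyadicsI], simp only: atMost_iff)
  hence "AE u in unit_measure. (%m. \<psi> m (%t m. Z t m u)) \<longlonglongrightarrow> ennreal (\<Sum>i<2 ^ M. pen p (d (Y (?t i) u) (Y (?t (Suc i)) u)) (1 / 2 ^ M))"
  proof eventually_elim
   case (elim u)
   have conv: "(%m. dense_seq (Z (?t i) m u)) \<longlonglongrightarrow> Y (?t i) u" if "i <= 2 ^ M" for i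
    using y_lim[of "?t i" u] elim that unfolding y_def by simp
   have "(%m. \<Sum>i<2 ^ M. pen p (max 0 (d (dense_seq (Z (?t i) m u)) (dense_seq (Z (?t (Suc i)) m u)) - 8 / 2 ^ m)) (1 / 2 ^ M))
     \<longlonglongrightarrow> (\<Sum>i<2 ^ M. pen p (max 0 (d (Y (?t i) u) (Y (?t (Suc i)) u) - 8 * 0)) (1 / 2 ^ M))"
   proof (rule tendsto_sum)
    fix i :: nat assume i: "i \<in> {..<2 ^ M}"
    have z: "(%m. 8 / 2 ^ m :: real) \<longlonglongrightarrow> 8 * 0"
     using tendsto_mult[OF tendsto_const[of "8 :: real"] LIMSEQ_realpow_zero[of "1 / 2 :: real"]] by (simp add: power_one_over)
    have "(%m. max 0 (d (dense_seq (Z (?t i) m u)) (dense_seq (Z (?t (Suc i)) m u)) - 8 / 2 ^ m)) \<longlonglongrightarrow> max 0 (d (Y (?t i) u) (Y (?t (Suc i)) u) - 8 * 0)"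
     using i by (intro tendsto_max tendsto_const tendsto_diff tendsto_dist_Finsler conv z) auto
    thus "(%m. pen p (max 0 (d (dense_seq (Z (?t i) m u)) (dense_seq (Z (?t (Suc i)) m u)) - 8 / 2 ^ m)) (1 / 2 ^ M))
      \<longlonglongrightarrow> pen p (max 0 (d (Y (?t i) u) (Y (?t (Suc i)) u) - 8 * 0)) (1 / 2 ^ M)"
     unfolding pen_def using p by (intro tendsto_divide tendsto_powr2 tendsto_const) auto
   qed
   thus ?case unfolding \<psi>_def by (intro tendsto_ennrealI) (simp add: dist_nonneg max_absorb2 del: of_nat_Suc)
  qed
  hence "AE u in unit_measure. ennreal (\<Sum>i<2 ^ M. pen p (d (Y (?t i) u) (Y (?t (Suc i)) u)) (1 / 2 ^ M)) = liminf (%m. \<psi> m (%t m. Z t m u))"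
  proof eventually_elim
   case (elim u)
   from lim_imp_Liminf[OF _ elim] show ?case by simp
  qed
  hence "(\<integral>\<^sup>+u. ennreal (\<Sum>i<2 ^ M. pen p (d (Y (?t i) u) (Y (?t (Suc i)) u)) (1 / 2 ^ M)) \<partial>unit_measure)
    = (\<integral>\<^sup>+u. liminf (%m. \<psi> m (%t m. Z t m u)) \<partial>unit_measure)" by (rule nn_integral_cong_AE)
  also have "... <= liminf (%m. \<integral>\<^sup>+u. \<psi> m (%t m. Z t m u) \<partial>unit_measure)" by (rule nn_integral_liminf[OF \<psi>_meas])
  also have "... <= ennreal total" by (intro liminf_le_const always_eventually allI step)
  finally show ?thesis .
 qed
 thus ?thesis using Y_meas law by blast
qed

end

section \<open>The space of curves\<close>

lemma nn_integral_SUP_bound: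
 assumes [measurable]: "!!N. e N \<in> borel_measurable M"
  and mono: "!!N x. e N x <= (e (Suc N) x :: real)" and C: "!!N. (\<integral>\<^sup>+x. ennreal (e N x) \<partial>M) <= ennreal C"
 shows "(\<integral>\<^sup>+x. (SUP N. ennreal (e N x)) \<partial>M) <= ennreal C" "AE x in M. \<exists>B. \<forall>N. e N x <= B"
proof -
 have "(\<integral>\<^sup>+x. (SUP N. ennreal (e N x)) \<partial>M) = (SUP N. \<integral>\<^sup>+x. ennreal (e N x) \<partial>M)"
  by (rule nn_integral_monotone_convergence_SUP) (auto intro!: incseq_SucI le_funI ennreal_leI mono)
 also have "... <= ennreal C" by (rule SUP_least) (rule C)
 finally show le: "(\<integral>\<^sup>+x. (SUP N. ennreal (e N x)) \<partial>M) <= ennreal C" .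
 have "AE x in M. (SUP N. ennreal (e N x)) ~= \<infinity>" by (rule nn_integral_PInf_AE) (use le in \<open>auto simp: top_unique\<close>)
 thus "AE x in M. \<exists>B. \<forall>N. e N x <= B"
 proof (rule eventually_mono)
  fix x assume "(SUP N. ennreal (e N x)) ~= \<infinity>"
  then obtain B where B: "0 <= B" "(SUP N. ennreal (e N x)) = ennreal B" by (cases "SUP N. ennreal (e N x)") auto
  have "ennreal (e N x) <= ennreal B" for N unfolding B(2)[symmetric] by (rule SUP_upper) simp
  thus "\<exists>B. \<forall>N. e N x <= B" using B(1) by (auto simp: ennreal_le_iff)
 qed
qed

lemma openin_compact_open_subset:
 "{S. openin compact_open_topology S} \<subseteq> Pow (curve_space :: (real => 'c::topological_space) set)"
proof (intro subsetI PowI, elim CollectE)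
 fix S :: "(real => 'c) set" and \<gamma> assume "openin compact_open_topology S" "\<gamma> \<in> S"
 hence "\<gamma> \<in> topspace compact_open_topology" using openin_subset subsetD by metis
 then obtain T where "T \<in> {{\<gamma> \<in> curve_space. \<gamma> ` K \<subseteq> U} | K U. compact K & K \<subseteq> {0..1} & open U}" "\<gamma> \<in> T"
  unfolding compact_open_topology_def topology_generated_by_topspace by (elim UnionE)
 thus "\<gamma> \<in> curve_space" by (elim CollectE exE conjE) simp
qed

lemma evaluation_measurable: "t \<in> {0..1} ==> (%\<gamma>. \<gamma> t) \<in> curve_borel \<rightarrow>\<^sub>M (borel :: 'c::topological_space measure)"
proof (rule borel_measurableI)
 fix U :: "'c set" assume t: "t \<in> {0..1}" and U: "open U"
 have "(%\<gamma>. \<gamma> t) -` U \<inter> space curve_borel = {\<gamma> \<in> curve_space. \<gamma> ` {t} \<subseteq> U}"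
  unfolding curve_borel_def by (auto simp: space_measure_of_conv)
 moreover have "openin compact_open_topology {\<gamma> \<in> curve_space. \<gamma> ` {t} \<subseteq> U}"
  unfolding compact_open_topology_def by (rule topology_generated_by_Basis, intro CollectI exI[of _ "{t}"] exI[of _ U]) (use t U in simp)
 ultimately show "(%\<gamma>. \<gamma> t) -` U \<inter> space curve_borel \<in> sets curve_borel"
  unfolding curve_borel_def sets_measure_of[OF openin_compact_open_subset] by (simp add: sigma_sets.Basic)
qed

text \<open>The compact-open topology has a countable basis, indexed by finite sets of constraints
 \<open>((a, b), V)\<close> with rational \<open>a, b\<close> and \<open>V\<close> in a countable basis of the target.\<close>

definition curve_box :: "((real \<times> real) \<times> 'c::topological_space set) set => (real => 'c) set" where
 "curve_box W = {\<gamma> \<in> curve_space. \<forall>w\<in>W. \<gamma> ` ({fst (fst w)..snd (fst w)} \<inter> {0..1}) \<subseteq> snd w}"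

text \<open>The essential case is a subbasic set. By continuity every \<open>t\<close> in
  \<open>K\<close> has a rational interval mapped into a basis set inside \<open>U\<close>, and
  compactness of \<open>K\<close> selects finitely many of these constraints.\<close>

lemma curve_box_basis:
 fixes S :: "(real => 'c::topological_space) set"
 assumes B: "topological_basis B" and S: "openin compact_open_topology S" and \<gamma>: "\<gamma> \<in> S"
 shows "\<exists>W. finite W & W \<subseteq> (\<rat> \<times> \<rat>) \<times> B & \<gamma> \<in> curve_box W & curve_box W \<subseteq> S"
proof -
 have "generate_topology_on {{\<gamma> \<in> curve_space. \<gamma> ` K \<subseteq> U} | K U. compact K & K \<subseteq> {0..1} & open U} S"
  using S unfolding compact_open_topology_def openin_topology_generated_by_iff .
 thus ?thesis using \<gamma>
 proof induction
  case (Int S T)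
  then obtain W W' where "finite W" "W \<subseteq> (\<rat> \<times> \<rat>) \<times> B" "\<gamma> \<in> curve_box W" "curve_box W \<subseteq> S"
   "finite W'" "W' \<subseteq> (\<rat> \<times> \<rat>) \<times> B" "\<gamma> \<in> curve_box W'" "curve_box W' \<subseteq> T" by auto
  moreover have "curve_box (W \<union> W') = curve_box W \<inter> curve_box W'" unfolding curve_box_def by blast
  ultimately show ?case by (intro exI[of _ "W \<union> W'"]) blast
 next
  case (UN \<K>)
  then obtain S where "S \<in> \<K>" "\<gamma> \<in> S" by blast
  with UN.IH[of S] show ?case by blast
 next
  case (Basis S)
  then obtain K U where S: "S = {\<gamma> \<in> curve_space. \<gamma> ` K \<subseteq> U}" and K: "compact K" "K \<subseteq> {0..1}" and U: "open U" by blast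
  have \<gamma>: "\<gamma> \<in> curve_space" "\<gamma> ` K \<subseteq> U" using Basis.prems S by simp_all
  define ok where "ok t w \<longleftrightarrow> w \<in> (\<rat> \<times> \<rat>) \<times> B & t \<in> {fst (fst w)<..<snd (fst w)} & \<gamma> ` ({fst (fst w)..snd (fst w)} \<inter> {0..1}) \<subseteq> snd w & snd w \<subseteq> U" for t w
  have "\<forall>t\<in>K. \<exists>w. ok t w"
  proof
   fix t assume t: "t \<in> K"
   then obtain V where V: "V \<in> B" "\<gamma> t \<in> V" "V \<subseteq> U" using topological_basisE[OF B U, of "\<gamma> t"] \<gamma>(2) by blast
   have "continuous_on {0..1} \<gamma>" using \<gamma>(1) by (simp add: curve_space_def)
   then obtain A where A: "open A" "t \<in> A" "\<forall>s\<in>{0..1}. s \<in> A --> \<gamma> s \<in> V"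
    using continuous_on_topological[THEN iffD1, rule_format, of "{0..1}" \<gamma> t V] subsetD[OF K(2) t] topological_basis_open[OF B V(1)] V(2) by metis
   obtain e where e: "0 < e" "ball t e \<subseteq> A" using A(1,2) openE by blast
   obtain a where a: "a \<in> \<rat>" "t - e < a" "a < t" using Rats_dense_in_real[of "t - e" t] e(1) by auto
   obtain b where b: "b \<in> \<rat>" "t < b" "b < t + e" using Rats_dense_in_real[of t "t + e"] e(1) by auto
   have "s \<in> A" if "s \<in> {a..b}" for s by (rule subsetD[OF e(2)]) (use that a b in \<open>auto simp: dist_real_def\<close>)
   hence "\<gamma> ` ({a..b} \<inter> {0..1}) \<subseteq> V" using A(3) by blast
   thus "\<exists>w. ok t w" unfolding ok_def using a b V by (intro exI[of _ "((a, b), V)"]) simp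
  qed
  from bchoice[OF this] obtain w where "\<forall>t\<in>K. ok t (w t)" ..
  hence w: "w t \<in> (\<rat> \<times> \<rat>) \<times> B" "t \<in> {fst (fst (w t))<..<snd (fst (w t))}"
   "\<gamma> ` ({fst (fst (w t))..snd (fst (w t))} \<inter> {0..1}) \<subseteq> snd (w t)" "snd (w t) \<subseteq> U" if "t \<in> K" for t
   using that unfolding ok_def by simp_all
  have "K \<subseteq> (\<Union>t\<in>K. {fst (fst (w t))<..<snd (fst (w t))})" using w(2) by (intro subsetI UN_I)
  from compactE_image[OF K(1) open_greaterThanLessThan this]
  obtain T where T: "T \<subseteq> K" "finite T" "K \<subseteq> (\<Union>t\<in>T. {fst (fst (w t))<..<snd (fst (w t))})" .
  have "curve_box (w ` T) \<subseteq> S"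
  proof
   fix \<gamma>' assume g: "\<gamma>' \<in> curve_box (w ` T)"
   have "\<gamma>' s \<in> U" if s: "s \<in> K" for s
   proof -
    obtain t where t: "t \<in> T" "s \<in> {fst (fst (w t))<..<snd (fst (w t))}" using T(3) s by blast
    hence "s \<in> {fst (fst (w t))..snd (fst (w t))} \<inter> {0..1}" using subsetD[OF K(2) s] by simp
    hence "\<gamma>' s \<in> snd (w t)" using g t(1) unfolding curve_box_def by blast
    thus ?thesis using w(4)[of t] t(1) T(1) by blast
   qed
   thus "\<gamma>' \<in> S" using g unfolding S curve_box_def by blast
  qed
  moreover have "\<gamma> \<in> curve_box (w ` T)" unfolding curve_box_def using \<gamma>(1) w(3) T(1) by blast
  moreover have "w ` T \<subseteq> (\<rat> \<times> \<rat>) \<times> B" using w(1) T(1) by blast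
  ultimately show ?case using T(2) by blast
 qed simp
qed

context finsler
begin

text \<open>On \<open>K\<close> the distance to the complement of \<open>U\<close> attains its
  minimum, so the inclusion amounts to a lower bound \<open>1 / Suc n\<close>, and by continuity
  this can be tested on a countable dense subset of \<open>K\<close>.\<close>

lemma compact_constraint_measurable:
 assumes \<Gamma>: "!!u. u \<in> space M ==> \<Gamma> u \<in> curve_space" "!!t. t \<in> {0..1} ==> (%u. \<Gamma> u t) \<in> M \<rightarrow>\<^sub>M (borel :: 'a measure)"
  and K: "compact K" "K \<subseteq> {0..1}" and U: "open U"
 shows "{u \<in> space M. \<Gamma> u ` K \<subseteq> U} \<in> sets M"
proof (cases "- U = {} \<or> K = {}")
 case False
 hence ne: "- U ~= {}" and Kn: "K ~= {}" by simp_all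
 obtain D where D: "countable D" "D \<subseteq> K" "K \<subseteq> closure D" using separable[of K] by blast
 let ?f = "%u t. dist_to (- U) (\<Gamma> u t)"
 have "\<Gamma> u ` K \<subseteq> U \<longleftrightarrow> (\<exists>n. \<forall>t\<in>D. 1 / real (Suc n) <= ?f u t)" if u: "u \<in> space M" for u
 proof -
  have cont: "continuous_on K (?f u)" by (rule continuous_on_compose2[OF dist_to_continuous[OF ne], of K "\<Gamma> u"])
    (use \<Gamma>(1)[OF u] K(2) continuous_on_subset in \<open>auto simp: curve_space_def\<close>)
  have pos: "\<Gamma> u t \<in> U \<longleftrightarrow> 0 < ?f u t" for t
   using dist_to_eq_0_iff[OF ne, of "\<Gamma> u t"] U dist_to_nonneg[OF ne, of "\<Gamma> u t"] by (auto simp: closed_def less_le)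
  show ?thesis
  proof
   assume sub: "\<Gamma> u ` K \<subseteq> U"
   obtain t where t: "t \<in> K" "\<forall>s\<in>K. ?f u t <= ?f u s" using continuous_attains_inf[OF K(1) Kn cont] by blast
   have "0 < ?f u t" using t(1) sub pos by blast
   then obtain n where "1 / real (Suc n) < ?f u t" using nat_approx_posE by metis
   hence "\<forall>s\<in>D. 1 / real (Suc n) <= ?f u s" using t(2) D(2) by force
   thus "\<exists>n. \<forall>t\<in>D. 1 / real (Suc n) <= ?f u t" ..
  next
   assume "\<exists>n. \<forall>t\<in>D. 1 / real (Suc n) <= ?f u t"
   then obtain n where n: "\<forall>t\<in>D. 1 / real (Suc n) <= ?f u t" ..
   have "closed {t \<in> K. 1 / real (Suc n) <= ?f u t}"
    by (intro continuous_on_closed_Collect_le continuous_on_const cont compact_imp_closed K)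
   hence "closure D \<subseteq> {t \<in> K. 1 / real (Suc n) <= ?f u t}" using n D(2) by (intro closure_minimal) auto
   hence "0 < ?f u t" if "t \<in> K" for t using D(3) that less_le_trans[of 0 "1 / real (Suc n)" "?f u t"] by auto
   thus "\<Gamma> u ` K \<subseteq> U" using pos by blast
  qed
 qed
 hence "{u \<in> space M. \<Gamma> u ` K \<subseteq> U} = {u \<in> space M. \<exists>n. \<forall>t\<in>D. 1 / real (Suc n) <= ?f u t}" by blast
 also have "... \<in> sets M"
 proof -
  have "(%u. ?f u t) \<in> borel_measurable M" if "t \<in> D" for t
   using that D(2) K(2) by (intro measurable_compose[OF \<Gamma>(2) dist_to_measurable[OF ne]]) auto
  thus ?thesis by (intro sets.sets_Collect_countable_Ex sets.sets_Collect_countable_All'[OF _ D(1)] borel_measurable_le borel_measurable_const)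
 qed
 finally show ?thesis .
next
 case True
 hence "U = UNIV \<or> K = {}" by auto
 thus ?thesis by auto
qed

text \<open>Measurability of the evaluations is enough because every open set of curves is a
  countable union of boxes.\<close>

lemma curve_borel_measurableI:
 assumes \<Gamma>: "!!u. u \<in> space M ==> \<Gamma> u \<in> curve_space" "!!t. t \<in> {0..1} ==> (%u. \<Gamma> u t) \<in> M \<rightarrow>\<^sub>M (borel :: 'a measure)"
 shows "\<Gamma> \<in> M \<rightarrow>\<^sub>M curve_borel" unfolding curve_borel_def
proof (rule measurable_measure_of)
 obtain B :: "'a set set" where B: "countable B" "topological_basis B" using ex_countable_basis by blast
 let ?W = "{W. finite W & W \<subseteq> (\<rat> \<times> \<rat>) \<times> B}"
 have "countable ((\<rat> \<times> \<rat>) \<times> B)" by (intro countable_SIGMA countable_rat B(1))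
 hence cW: "countable ?W" by (rule countable_Collect_finite_subset)
 show "{S. openin compact_open_topology S} \<subseteq> Pow (curve_space :: (real => 'a) set)" by (rule openin_compact_open_subset)
 show "\<Gamma> \<in> space M \<rightarrow> curve_space" using \<Gamma>(1) by blast
 fix S :: "(real => 'a) set" assume "S \<in> {S. openin compact_open_topology S}"
 hence S: "openin compact_open_topology S" by simp
 have "\<Gamma> -` S \<inter> space M = (\<Union>W\<in>{W\<in>?W. curve_box W \<subseteq> S}. {u \<in> space M. \<Gamma> u \<in> curve_box W})"
 proof (intro subset_antisym subsetI)
  fix u assume "u \<in> \<Gamma> -` S \<inter> space M"
  hence u: "\<Gamma> u \<in> S" "u \<in> space M" by simp_all
  from curve_box_basis[OF B(2) S u(1)] obtain W where "finite W" "W \<subseteq> (\<rat> \<times> \<rat>) \<times> B" "\<Gamma> u \<in> curve_box W" "curve_box W \<subseteq> S"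
   by (elim exE conjE)
  thus "u \<in> (\<Union>W\<in>{W\<in>?W. curve_box W \<subseteq> S}. {u \<in> space M. \<Gamma> u \<in> curve_box W})"
   using u(2) by (intro UN_I[of W]) simp_all
 qed auto
 also have "... \<in> sets M"
 proof (rule sets.countable_UN')
  show "countable {W\<in>?W. curve_box W \<subseteq> S}" by (rule countable_subset[OF _ cW]) blast
  show "(%W. {u \<in> space M. \<Gamma> u \<in> curve_box W}) ` {W\<in>?W. curve_box W \<subseteq> S} \<subseteq> sets M"
  proof (rule image_subsetI)
   fix W assume "W \<in> {W\<in>?W. curve_box W \<subseteq> S}"
   hence W: "finite W" "W \<subseteq> (\<rat> \<times> \<rat>) \<times> B" by simp_all
   have "{u \<in> space M. \<Gamma> u \<in> curve_box W} = {u \<in> space M. \<forall>w\<in>W. \<Gamma> u ` ({fst (fst w)..snd (fst w)} \<inter> {0..1}) \<subseteq> snd w}"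
    using \<Gamma>(1) unfolding curve_box_def by blast
   also have "... \<in> sets M"
   proof (rule sets.sets_Collect_countable_All'[OF _ countable_finite[OF W(1)]])
    fix w assume "w \<in> W"
    hence "open (snd w)" using W(2) topological_basis_open[OF B(2)] by auto
    thus "{u \<in> space M. \<Gamma> u ` ({fst (fst w)..snd (fst w)} \<inter> {0..1}) \<subseteq> snd w} \<in> sets M"
     by (intro compact_constraint_measurable \<Gamma> compact_Int) auto
   qed
   finally show "{u \<in> space M. \<Gamma> u \<in> curve_box W} \<in> sets M" .
  qed
 qed
 finally show "\<Gamma> -` S \<inter> space M \<in> sets M" .
qed

end

section \<open>The path measure and its marginals\<close>

context wasserstein_curve
begin

definition dyadic_energy :: "(real => 'a) => nat => real" where
 "dyadic_energy \<gamma> M = (\<Sum>i<2 ^ M. pen p (d (\<gamma> (real i / 2 ^ M)) (\<gamma> (real (Suc i) / 2 ^ M))) (1 / 2 ^ M))"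

lemma dyadic_energy_le_Suc: "dyadic_energy \<gamma> M <= dyadic_energy \<gamma> (Suc M)" unfolding dyadic_energy_def
proof (rule dyadic_pen_sum_le_Suc)
 fix r s t l m :: real assume "0 < l" "0 < m"
 hence "pen p (d (\<gamma> r) (\<gamma> s) + d (\<gamma> s) (\<gamma> t)) (l + m) <= pen p (d (\<gamma> r) (\<gamma> s)) l + pen p (d (\<gamma> s) (\<gamma> t)) m"
  using p by (intro pen_add_le dist_nonneg) auto
 moreover have "pen p (d (\<gamma> r) (\<gamma> t)) (l + m) <= pen p (d (\<gamma> r) (\<gamma> s) + d (\<gamma> s) (\<gamma> t)) (l + m)"
  using p by (intro pen_mono dist_nonneg dist_triangle_ineq) auto
 ultimately show "pen p (d (\<gamma> r) (\<gamma> t)) (l + m) <= pen p (d (\<gamma> r) (\<gamma> s)) l + pen p (d (\<gamma> s) (\<gamma> t)) m" by simp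
qed

lemma dyadic_energy_measurable:
 assumes "!!t. t \<in> dyadics ==> (%x. X x t) \<in> M \<rightarrow>\<^sub>M borel"
 shows "(%x. dyadic_energy (X x) N) \<in> borel_measurable M" unfolding dyadic_energy_def
proof (rule borel_measurable_sum)
 fix i :: nat assume "i \<in> {..<2 ^ N}"
 hence "(%x. d (X x (real i / 2 ^ N)) (X x (real (Suc i) / 2 ^ N))) \<in> borel_measurable M"
  by (intro borel_measurable_dist assms dyadicsI) auto
 thus "(%x. pen p (d (X x (real i / 2 ^ N)) (X x (real (Suc i) / 2 ^ N))) (1 / 2 ^ N)) \<in> borel_measurable M"
  unfolding pen_def by measurable
qed

lemma dyadic_floor_mem: "t \<in> {0..1} ==> dyadic_floor m t \<in> dyadics"
proof -
 assume t: "t \<in> {0..1}"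
 hence "dyadic_floor m t <= 1" using dyadic_floor_bounds(1)[of t m] by simp
 hence "real (nat \<lfloor>t * 2 ^ m\<rfloor>) / 2 ^ m <= 1" unfolding dyadic_floor_def .
 hence "real (nat \<lfloor>t * 2 ^ m\<rfloor>) <= real (2 ^ m)" by (simp only: divide_le_eq_1_pos zero_less_power zero_less_numeral of_nat_power of_nat_numeral)
 thus ?thesis unfolding dyadic_floor_def by (intro dyadicsI) (simp only: of_nat_le_iff)
qed

text \<open>Dyadic paths of bounded energy extend to continuous curves; all other paths are replaced
  by the constant curve at \<open>star\<close>. Evaluations of the resulting curve are limits of
  \<open>Y\<close> at dyadic floors, hence measurable.\<close>

lemma ex_path_measure:
 "\<exists>\<eta>\<in>curve_prob. (\<forall>t\<in>dyadics. distr \<eta> borel (%\<gamma>. \<gamma> t) = \<mu> t) &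
  (\<forall>M. (\<integral>\<^sup>+\<gamma>. ennreal (dyadic_energy \<gamma> M) \<partial>\<eta>) <= ennreal total)"
proof -
 obtain Y :: "real => real => 'a" where Y: "!!t. Y t \<in> borel \<rightarrow>\<^sub>M borel" "!!t. t \<in> dyadics ==> distr unit_measure borel (Y t) = \<mu> t"
  and E: "!!M. (\<integral>\<^sup>+u. ennreal (dyadic_energy (%t. Y t u) M) \<partial>unit_measure) <= ennreal total"
  using ex_dyadic_process unfolding dyadic_energy_def by blast
 interpret U: prob_space unit_measure by (rule prob_space_unit_measure)
 have YU: "Y t \<in> unit_measure \<rightarrow>\<^sub>M borel" for t using Y(1)[of t] by simp
 have em: "(%u. dyadic_energy (%t. Y t u) M) \<in> borel_measurable unit_measure" for M by (rule dyadic_energy_measurable) (rule YU)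
 \<comment> \<open>A natural number as bound makes this a countable condition.\<close>
 define good where "good u \<longleftrightarrow> (\<exists>B::nat. \<forall>M. dyadic_energy (%t. Y t u) M <= real B)" for u
 have "AE u in unit_measure. \<exists>B. \<forall>M. dyadic_energy (%t. Y t u) M <= B"
  by (rule nn_integral_SUP_bound(2)[of "%M u. dyadic_energy (%t. Y t u) M", OF em dyadic_energy_le_Suc E])
 hence good_AE: "AE u in unit_measure. good u"
 proof (rule eventually_mono)
  fix u assume "\<exists>B. \<forall>M. dyadic_energy (%t. Y t u) M <= B"
  then obtain B where "!!M. dyadic_energy (%t. Y t u) M <= B" by blast
  from order_trans[OF this real_nat_ceiling_ge] show "good u" unfolding good_def by blast
 qed
 have good_meas: "{u \<in> space unit_measure. good u} \<in> sets unit_measure"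
  unfolding good_def by (intro sets.sets_Collect_countable_Ex sets.sets_Collect_countable_All borel_measurable_le em) simp
 have "\<exists>\<gamma>. \<gamma> \<in> curve_space & (\<forall>t\<in>{0..1}. (%m. if good u then Y (dyadic_floor m t) u else star) \<longlonglongrightarrow> \<gamma> t) &
   (good u --> (\<forall>t\<in>dyadics. \<gamma> t = Y t u))" for u
 proof (cases "good u")
  case True
  then obtain B where "!!M. dyadic_energy (%t. Y t u) M <= B" unfolding good_def by blast
  hence "\<exists>g \<gamma>. controlled g \<gamma> & (\<forall>t\<in>{0..1}. (%m. Y (dyadic_floor m t) u) \<longlonglongrightarrow> \<gamma> t)
    & (\<forall>M i. i <= 2 ^ M --> \<gamma> (real i / 2 ^ M) = Y (real i / 2 ^ M) u)"
   unfolding dyadic_energy_def by (rule dyadic_extension)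
  then obtain g \<gamma> where \<gamma>: "controlled g \<gamma>" "\<forall>t\<in>{0..1}. (%m. Y (dyadic_floor m t) u) \<longlonglongrightarrow> \<gamma> t"
    "\<forall>M i. i <= 2 ^ M --> \<gamma> (real i / 2 ^ M) = Y (real i / 2 ^ M) u" by (elim exE conjE)
  have "continuous_on {0..1} (restrict \<gamma> {0..1})" using controlled_continuous[OF \<gamma>(1)] by (rule continuous_on_eq) simp
  hence "restrict \<gamma> {0..1} \<in> curve_space" unfolding curve_space_def by simp
  moreover have "restrict \<gamma> {0..1} t = Y t u" if "t \<in> dyadics" for t
   using dyadics_unit[OF that] that \<gamma>(3) unfolding dyadics_def by auto
  ultimately show ?thesis using True \<gamma>(2) by (intro exI[of _ "restrict \<gamma> {0..1}"]) simp
 next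
  case False
  have "(\<lambda>t\<in>{0..1}. star) \<in> curve_space" unfolding curve_space_def by (auto intro: continuous_on_eq[OF continuous_on_const])
  thus ?thesis using False by (intro exI[of _ "\<lambda>t\<in>{0..1}. star"]) simp
 qed
 then obtain \<Gamma> where \<Gamma>: "!!u. \<Gamma> u \<in> curve_space"
  "!!u t. t \<in> {0..1} ==> (%m. if good u then Y (dyadic_floor m t) u else star) \<longlonglongrightarrow> \<Gamma> u t"
  "!!u t. good u ==> t \<in> dyadics ==> \<Gamma> u t = Y t u" by metis
 have "(%u. \<Gamma> u t) \<in> unit_measure \<rightarrow>\<^sub>M borel" if "t \<in> {0..1}" for t
 proof (rule measurable_limit[OF _ \<Gamma>(2)[OF that]])
  show "(%u. if good u then Y (dyadic_floor m t) u else star) \<in> unit_measure \<rightarrow>\<^sub>M borel" for m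
   by (rule measurable_If[OF YU _ good_meas]) simp
 qed
 hence \<Gamma>m: "\<Gamma> \<in> unit_measure \<rightarrow>\<^sub>M curve_borel" by (intro curve_borel_measurableI \<Gamma>(1))
 let ?\<eta> = "distr unit_measure curve_borel \<Gamma>"
 have "?\<eta> \<in> curve_prob" unfolding curve_prob_def using U.prob_space_distr[OF \<Gamma>m] by simp
 moreover have "distr ?\<eta> borel (%\<gamma>. \<gamma> t) = \<mu> t" if t: "t \<in> dyadics" for t
 proof -
  have ev: "(%\<gamma>. \<gamma> t) \<in> curve_borel \<rightarrow>\<^sub>M (borel :: 'a measure)" by (rule evaluation_measurable[OF dyadics_unit[OF t]])
  have "distr ?\<eta> borel (%\<gamma>. \<gamma> t) = distr unit_measure borel (%u. \<Gamma> u t)"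
   by (subst distr_distr[OF ev \<Gamma>m]) (simp add: comp_def)
  also have "... = distr unit_measure borel (Y t)"
  proof (rule distr_cong_AE[OF refl refl])
   show "AE u in unit_measure. \<Gamma> u t = Y t u" using good_AE by (rule eventually_mono) (rule \<Gamma>(3)[OF _ t])
  qed (use measurable_compose[OF \<Gamma>m ev] Y(1) in simp_all)
  finally show ?thesis using Y(2)[OF t] by simp
 qed
 moreover have "(\<integral>\<^sup>+\<gamma>. ennreal (dyadic_energy \<gamma> M) \<partial>?\<eta>) <= ennreal total" for M
 proof -
  have "(\<integral>\<^sup>+\<gamma>. ennreal (dyadic_energy \<gamma> M) \<partial>?\<eta>) = (\<integral>\<^sup>+u. ennreal (dyadic_energy (\<Gamma> u) M) \<partial>unit_measure)"
   by (rule nn_integral_distr[OF \<Gamma>m])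
    (simp only: measurable_distr_eq1, intro measurable_compose[OF _ measurable_ennreal] dyadic_energy_measurable evaluation_measurable dyadics_unit)
  also have "... = (\<integral>\<^sup>+u. ennreal (dyadic_energy (%t. Y t u) M) \<partial>unit_measure)"
  proof (rule nn_integral_cong_AE, rule eventually_mono[OF good_AE])
   fix u assume "good u"
   hence "\<Gamma> u (real i / 2 ^ M) = Y (real i / 2 ^ M) u" if "i <= 2 ^ M" for i using \<Gamma>(3) dyadicsI[OF that] by blast
   thus "ennreal (dyadic_energy (\<Gamma> u) M) = ennreal (dyadic_energy (%t. Y t u) M)"
    unfolding dyadic_energy_def by (simp del: of_nat_Suc)
  qed
  also have "... <= ennreal total" by (rule E)
  finally show ?thesis .
 qed
 ultimately show ?thesis by blast
qed

text \<open>By continuity the curve coincides with the extension of its own dyadic values, which is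
  controlled.\<close>

lemma finite_energy_controlled:
 assumes \<gamma>: "\<gamma> \<in> curve_space" and E: "!!M. dyadic_energy \<gamma> M <= E"
 shows "\<exists>g. controlled g \<gamma>"
proof -
 from dyadic_extension[OF E[unfolded dyadic_energy_def]] obtain g \<gamma>' where
  g: "controlled g \<gamma>'" "\<forall>t\<in>{0..1}. (%m. \<gamma> (dyadic_floor m t)) \<longlonglongrightarrow> \<gamma>' t" by (elim exE conjE)
 have "\<gamma>' t = \<gamma> t" if t: "t \<in> {0..1}" for t
 proof (rule LIMSEQ_unique)
  show "(%m. \<gamma> (dyadic_floor m t)) \<longlonglongrightarrow> \<gamma>' t" using g(2) t by blast
  show "(%m. \<gamma> (dyadic_floor m t)) \<longlonglongrightarrow> \<gamma> t"
  proof (rule continuous_on_tendsto_compose[OF _ dyadic_floor_tendsto t])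
   show "continuous_on {0..1} \<gamma>" using \<gamma> by (simp add: curve_space_def)
   show "\<forall>\<^sub>F m in sequentially. dyadic_floor m t \<in> {0..1}" using dyadic_floor_mem[OF t] dyadics_unit by simp
  qed (use t in simp)
 qed
 hence "controlled g \<gamma>" using g(1) unfolding controlled_def by simp
 thus ?thesis by blast
qed

text \<open>Jensen's inequality for the density of \<open>\<mu>\<close>. It makes
  \<open>WD (\<mu> s) (\<mu> t)\<close> tend to 0 as \<open>s\<close> increases to
  \<open>t\<close>.\<close>

lemma ex_Hoelder_bound: "\<exists>B\<ge>0. \<forall>s t. 0 <= s & s < t & t <= 1 --> WD (\<mu> s) (\<mu> t) powr p <= B * (t - s) powr (p - 1)"
proof -
 obtain h where h: "!!x. 0 <= h x" "integrable lborel h" "integrable lborel (%x. h x powr p)"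
  and W: "!!s t. 0 <= s & s <= t & t <= 1 ==> WD (\<mu> s) (\<mu> t) <= (LINT x:{s<..t}|lborel. h x)"
  using FAC_density[OF FAC p] by blast
 let ?B = "LINT x|lborel. h x powr p"
 have "WD (\<mu> s) (\<mu> t) powr p <= ?B * (t - s) powr (p - 1)" if st: "0 <= s & s < t & t <= 1" for s t
 proof -
  have "pen p (WD (\<mu> s) (\<mu> t)) (t - s) <= pen p (LINT x:{s<..t}|lborel. h x) (t - s)"
   using st p by (intro pen_mono W wasserstein_nonneg \<mu>_PM) auto
  also have "... <= (LINT x:{s<..t}|lborel. h x powr p)" using st by (intro pen_integral_le[OF p _ h(1)] set_integrable_Ioc h) auto
  also have "... <= ?B" by (rule set_integral_Ioc_le[OF h(3)]) simp
  finally show ?thesis using st unfolding pen_def by (subst (asm) pos_divide_le_eq) auto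
 qed
 moreover have "0 <= ?B" by (rule Bochner_Integration.integral_nonneg) simp
 ultimately show ?thesis by blast
qed

text \<open>A near optimal coupling compares the two integrals through the Lipschitz bound and
  \<open>d <= \<epsilon> + d powr p / \<epsilon> powr (p - 1)\<close>. The second
  \<open>\<epsilon>\<close> is the defect \<open>\<epsilon> * \<epsilon> powr (p - 1)\<close> of the
  coupling after division.\<close>

lemma bump_integral_le:
 assumes \<rho>: "\<rho> \<in> PM" and \<nu>: "\<nu> \<in> PM" and C: "C ~= {}" and \<epsilon>: "0 < \<epsilon>"
 shows "(\<integral>\<^sup>+x. ennreal (bump C n x) \<partial>\<nu>) <= (\<integral>\<^sup>+x. ennreal (bump C n x) \<partial>\<rho>) + ennreal (real n * (2 * \<epsilon> + WD \<rho> \<nu> powr p / \<epsilon> powr (p - 1)))"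
proof -
 let ?E = "\<epsilon> powr (p - 1)"
 have E0: "0 < ?E" using \<epsilon> by simp
 obtain \<pi> where \<pi>: "\<pi> \<in> couplings \<rho> \<nu>" "transport_cost p d \<pi> <= ennreal (WD \<rho> \<nu> powr p + \<epsilon> * ?E)"
  using ex_near_optimal_coupling[OF \<rho> \<nu>, of "\<epsilon> * ?E"] \<epsilon> by auto
 note P = couplings_D[OF \<pi>(1)]
 interpret P: prob_space \<pi> by (rule P)
 have f: "fst \<in> \<pi> \<rightarrow>\<^sub>M borel" "snd \<in> \<pi> \<rightarrow>\<^sub>M borel"
  unfolding measurable_cong_sets[OF P(2) refl] by (rule fst_snd_borel)+
 have bm: "(%x. ennreal (bump C n x)) \<in> borel_measurable borel" using bump_measurable[OF C] by measurable
 have cm: "(%z. ennreal (d (fst z) (snd z) powr p)) \<in> borel_measurable \<pi>" by (rule cost_integrand_measurable[OF P(2)])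
 have "(\<integral>\<^sup>+x. ennreal (bump C n x) \<partial>\<nu>) = (\<integral>\<^sup>+z. ennreal (bump C n (snd z)) \<partial>\<pi>)"
  by (rule nn_integral_marginal[OF P(5) f(2) bm, symmetric])
 also have "... <= (\<integral>\<^sup>+z. ennreal (bump C n (fst z)) + (ennreal (real n * \<epsilon>) + ennreal (real n / ?E) * ennreal (d (fst z) (snd z) powr p)) \<partial>\<pi>)"
 proof (rule nn_integral_mono)
  fix z :: "'a \<times> 'a"
  let ?d = "d (fst z) (snd z)"
  have "?d <= \<epsilon> + ?d powr p / ?E"
  proof (cases "?d <= \<epsilon>")
   case False
   hence "?E <= ?d powr (p - 1)" using \<epsilon> p by (intro powr_mono2) auto
   hence "?d * ?E <= ?d * ?d powr (p - 1)" using dist_nonneg by (rule mult_left_mono)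
   also have "... = ?d powr p" using False \<epsilon> by (simp add: powr_mult_base)
   finally have "?d <= ?d powr p / ?E" using E0 by (simp add: pos_le_divide_eq)
   thus ?thesis using \<epsilon> by simp
  qed (simp add: add_increasing2)
  hence "real n * ?d <= real n * (\<epsilon> + ?d powr p / ?E)" by (rule mult_left_mono) simp
  hence "bump C n (snd z) <= bump C n (fst z) + (real n * \<epsilon> + real n / ?E * ?d powr p)"
   using bump_Lipschitz[OF C, of n "snd z" "fst z"] by (simp add: distrib_left)
  thus "ennreal (bump C n (snd z)) <= ennreal (bump C n (fst z)) + (ennreal (real n * \<epsilon>) + ennreal (real n / ?E) * ennreal (?d powr p))"
   using bump_bounds(1)[OF C, of n "fst z"] \<epsilon> by (simp add: ennreal_mult[symmetric] ennreal_plus[symmetric] ennreal_leI del: ennreal_plus)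
 qed
 also have "... = (\<integral>\<^sup>+x. ennreal (bump C n x) \<partial>\<rho>) + (ennreal (real n * \<epsilon>) + ennreal (real n / ?E) * transport_cost p d \<pi>)"
  using measurable_compose[OF f(1) bm] cm
  by (simp add: nn_integral_add nn_integral_cmult nn_integral_marginal[OF P(4) f(1) bm] P.emeasure_space_1 transport_cost_def)
 also have "... <= (\<integral>\<^sup>+x. ennreal (bump C n x) \<partial>\<rho>) + (ennreal (real n * \<epsilon>) + ennreal (real n / ?E) * ennreal (WD \<rho> \<nu> powr p + \<epsilon> * ?E))"
  by (intro add_mono order_refl mult_left_mono \<pi>(2)) simp
 also have "ennreal (real n * \<epsilon>) + ennreal (real n / ?E) * ennreal (WD \<rho> \<nu> powr p + \<epsilon> * ?E) = ennreal (real n * (2 * \<epsilon> + WD \<rho> \<nu> powr p / ?E))"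
  using \<epsilon> E0 by (subst ennreal_mult[symmetric], simp, simp, subst ennreal_plus[symmetric]) (simp_all add: field_simps)
 finally show ?thesis .
qed

text \<open>A non-dyadic time is approached by dyadic floors: under \<open>\<eta>\<close> by
  continuity of the curves, under \<open>\<mu>\<close> by the Hoelder bound. The approach is from
  the left, where \<open>WD (\<mu> s) (\<mu> t)\<close> is controlled.\<close>

lemma path_measure_marginal:
 assumes \<eta>: "\<eta> \<in> curve_prob" and dy: "!!t. t \<in> dyadics ==> distr \<eta> borel (%\<gamma>. \<gamma> t) = \<mu> t" and t: "t \<in> {0..1}"
 shows "distr \<eta> borel (%\<gamma>. \<gamma> t) = \<mu> t"
proof (cases "t \<in> dyadics")
 case False
 interpret P: prob_space \<eta> using \<eta> by (simp add: curve_prob_def)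
 have s\<eta>: "sets \<eta> = sets curve_borel" using \<eta> by (simp add: curve_prob_def)
 have sp: "space \<eta> = curve_space" using sets_eq_imp_space_eq[OF s\<eta>] by (simp add: curve_borel_def space_measure_of_conv)
 have ev: "(%\<gamma>. \<gamma> s) \<in> \<eta> \<rightarrow>\<^sub>M borel" if "s \<in> {0..1}" for s
  unfolding measurable_cong_sets[OF s\<eta> refl] by (rule evaluation_measurable[OF that])
 let ?s = "%m. dyadic_floor m t"
 have s: "?s m \<in> dyadics" "?s m \<in> {0..1}" for m using dyadic_floor_mem[OF t] dyadics_unit by blast+
 have st: "?s m < t" for m using dyadic_floor_bounds(1)[of t m] t s(1)[of m] False by (cases "?s m = t") auto
 have slim: "?s \<longlonglongrightarrow> t" using t by (intro dyadic_floor_tendsto) simp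
 obtain B where B: "0 <= B" "!!s t. 0 <= s & s < t & t <= 1 ==> WD (\<mu> s) (\<mu> t) powr p <= B * (t - s) powr (p - 1)"
  using ex_Hoelder_bound by blast
 note M = wasserstein_space_D[OF \<mu>_PM[OF t]]
 have "\<mu> t = distr \<eta> borel (%\<gamma>. \<gamma> t)"
 proof (rule measure_eq_if_bump_le[OF M(1,2) P.prob_space_distr[OF ev[OF t]]])
  fix C :: "'a set" and n assume C: "C ~= {}"
  let ?I = "%\<nu>. \<integral>\<^sup>+x. ennreal (bump C n x) \<partial>\<nu>"
  have bm: "(%x. ennreal (bump C n x)) \<in> borel_measurable borel" using bump_measurable[OF C] by measurable
  have I_eq: "?I (distr \<eta> borel (%\<gamma>. \<gamma> s)) = (\<integral>\<^sup>+\<gamma>. ennreal (bump C n (\<gamma> s)) \<partial>\<eta>)" if "s \<in> {0..1}" for s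
   by (rule nn_integral_distr[OF ev[OF that]]) (use bm in simp)
  have "(%m. \<integral>\<^sup>+\<gamma>. ennreal (bump C n (\<gamma> (?s m))) \<partial>\<eta>) \<longlonglongrightarrow> (\<integral>\<^sup>+\<gamma>. ennreal (bump C n (\<gamma> t)) \<partial>\<eta>)"
  proof (rule nn_integral_dominated_convergence[where w = "%_. 1"])
   show "AE \<gamma> in \<eta>. (%m. ennreal (bump C n (\<gamma> (?s m)))) \<longlonglongrightarrow> ennreal (bump C n (\<gamma> t))"
   proof (rule AE_I2, rule tendsto_ennrealI, rule bump_tendsto[OF C])
    fix \<gamma> assume "\<gamma> \<in> space \<eta>"
    hence "continuous_on {0..1} \<gamma>" using sp by (simp add: curve_space_def)
    from continuous_on_tendsto_compose[OF this slim t] show "(%m. \<gamma> (?s m)) \<longlonglongrightarrow> \<gamma> t" using s(2) by simp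
   qed
   show "AE \<gamma> in \<eta>. ennreal (bump C n (\<gamma> (?s m))) <= 1" for m using bump_bounds(2)[OF C] by (intro AE_I2) simp
  qed (use measurable_compose[OF ev bm] s t P.emeasure_space_1 in simp_all)
  hence lim: "(%m. ?I (\<mu> (?s m))) \<longlonglongrightarrow> ?I (distr \<eta> borel (%\<gamma>. \<gamma> t))"
   using I_eq[OF s(2)] I_eq[OF t] dy[OF s(1)] by simp
  have "?I (\<mu> t) <= ?I (distr \<eta> borel (%\<gamma>. \<gamma> t)) + ennreal (real n * (2 * \<epsilon>))" if \<epsilon>: "0 < \<epsilon>" for \<epsilon>
  proof (rule LIMSEQ_le_const)
   have "(%m. ?I (\<mu> (?s m)) + ennreal (real n * (2 * \<epsilon> + B * (t - ?s m) powr (p - 1) / \<epsilon> powr (p - 1))))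
     \<longlonglongrightarrow> ?I (distr \<eta> borel (%\<gamma>. \<gamma> t)) + ennreal (real n * (2 * \<epsilon> + B * (t - t) powr (p - 1) / \<epsilon> powr (p - 1)))"
   proof (intro tendsto_add lim tendsto_ennrealI tendsto_mult tendsto_divide tendsto_const)
    show "(%m. (t - ?s m) powr (p - 1)) \<longlonglongrightarrow> (t - t) powr (p - 1)"
     using p st by (intro tendsto_powr2 tendsto_diff tendsto_const slim) (auto intro!: always_eventually less_imp_le)
   qed (use \<epsilon> in simp)
   thus "(%m. ?I (\<mu> (?s m)) + ennreal (real n * (2 * \<epsilon> + B * (t - ?s m) powr (p - 1) / \<epsilon> powr (p - 1))))
     \<longlonglongrightarrow> ?I (distr \<eta> borel (%\<gamma>. \<gamma> t)) + ennreal (real n * (2 * \<epsilon>))" by simp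
   have "?I (\<mu> t) <= ?I (\<mu> (?s m)) + ennreal (real n * (2 * \<epsilon> + B * (t - ?s m) powr (p - 1) / \<epsilon> powr (p - 1)))" for m
   proof -
    have "WD (\<mu> (?s m)) (\<mu> t) powr p <= B * (t - ?s m) powr (p - 1)" using B(2) st[of m] s(2)[of m] t by simp
    hence "ennreal (real n * (2 * \<epsilon> + WD (\<mu> (?s m)) (\<mu> t) powr p / \<epsilon> powr (p - 1)))
      <= ennreal (real n * (2 * \<epsilon> + B * (t - ?s m) powr (p - 1) / \<epsilon> powr (p - 1)))"
     using \<epsilon> by (intro ennreal_leI mult_left_mono add_left_mono divide_right_mono) auto
    from add_left_mono[OF this] show ?thesis by (rule order_trans[OF bump_integral_le[OF \<mu>_PM[OF s(2)] \<mu>_PM[OF t] C \<epsilon>]])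
   qed
   thus "\<exists>N. \<forall>m\<ge>N. ?I (\<mu> t) <= ?I (\<mu> (?s m)) + ennreal (real n * (2 * \<epsilon> + B * (t - ?s m) powr (p - 1) / \<epsilon> powr (p - 1)))" by blast
  qed
  note this[of "1 / real (Suc m)" for m]
  moreover have "(%m. ?I (distr \<eta> borel (%\<gamma>. \<gamma> t)) + ennreal (real n * (2 * (1 / real (Suc m))))) \<longlonglongrightarrow> ?I (distr \<eta> borel (%\<gamma>. \<gamma> t)) + ennreal (real n * (2 * 0))"
   by (intro tendsto_add tendsto_ennrealI tendsto_mult tendsto_const LIMSEQ_Suc[OF lim_1_over_n])
  ultimately show "?I (\<mu> t) <= ?I (distr \<eta> borel (%\<gamma>. \<gamma> t))"
   by (intro LIMSEQ_le_const[where a = "?I (\<mu> t)"]) (simp, force)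
 qed simp
 thus ?thesis ..
qed (rule dy)

end

section \<open>Speed and metric derivative\<close>

text \<open>The hypothesis is the Cauchy criterion for difference quotients, multiplied out by
  \<open>h * h'\<close> so that it makes sense for all increments and is preserved under limits in
  them.\<close>

lemma Cauchy_quotient_differentiable:
 fixes f :: "real => 'b::euclidean_space"
 assumes C: "!!k::nat. \<exists>r>0. \<forall>h h'. \<bar>h\<bar> < r --> \<bar>h'\<bar> < r -->
  norm (h' *\<^sub>R (f (t + h) - f t) - h *\<^sub>R (f (t + h') - f t)) <= \<bar>h * h'\<bar> / real (Suc k)"
 shows "f differentiable (at t)"
proof -
 define q where "q h = (1 / h) *\<^sub>R (f (t + h) - f t)" for h
 have "\<exists>r>0. \<forall>h h'. h ~= 0 --> h' ~= 0 --> \<bar>h\<bar> < r --> \<bar>h'\<bar> < r --> norm (q h - q h') <= e" if e: "0 < e" for e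
 proof -
  obtain k where k: "1 / real (Suc k) < e" using nat_approx_posE[OF e] by metis
  obtain r where r: "0 < r" "!!h h'. \<bar>h\<bar> < r ==> \<bar>h'\<bar> < r ==>
   norm (h' *\<^sub>R (f (t + h) - f t) - h *\<^sub>R (f (t + h') - f t)) <= \<bar>h * h'\<bar> / real (Suc k)" using C[of k] by blast
  have "norm (q h - q h') <= e" if h: "h ~= 0" "h' ~= 0" "\<bar>h\<bar> < r" "\<bar>h'\<bar> < r" for h h'
  proof -
   have "q h - q h' = (1 / (h * h')) *\<^sub>R (h' *\<^sub>R (f (t + h) - f t) - h *\<^sub>R (f (t + h') - f t))"
    using h(1,2) by (simp add: q_def scaleR_right_diff_distrib)
   hence "norm (q h - q h') = norm (h' *\<^sub>R (f (t + h) - f t) - h *\<^sub>R (f (t + h') - f t)) / \<bar>h * h'\<bar>"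
    by (simp add: abs_mult)
   also have "... <= 1 / real (Suc k)" using r(2)[OF h(3,4)] h(1,2) by (simp add: pos_divide_le_eq)
   finally show ?thesis using k by simp
  qed
  thus ?thesis using r(1) by blast
 qed
 note q = this
 have n0: "(%n. 1 / real (Suc n)) \<longlonglongrightarrow> 0" by (rule LIMSEQ_Suc[OF lim_1_over_n])
 have small: "\<forall>\<^sub>F n in sequentially. \<bar>1 / real (Suc n)\<bar> < r" if "0 < r" for r using order_tendstoD(2)[OF n0 that] by simp
 have "Cauchy (%n. q (1 / real (Suc n)))"
 proof (rule metric_CauchyI)
  fix e :: real assume "0 < e"
  then obtain r where r: "0 < r" "!!h h'. h ~= 0 ==> h' ~= 0 ==> \<bar>h\<bar> < r ==> \<bar>h'\<bar> < r ==> norm (q h - q h') <= e / 2"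
   using q[of "e / 2"] by auto
  obtain N where N: "!!n. N <= n ==> \<bar>1 / real (Suc n)\<bar> < r" using small[OF r(1)] unfolding eventually_sequentially by blast
  have "dist (q (1 / real (Suc m))) (q (1 / real (Suc n))) < e" if "N <= m" "N <= n" for m n
   using r(2)[OF _ _ N[OF that(1)] N[OF that(2)]] \<open>0 < e\<close> by (simp add: dist_norm)
  thus "\<exists>N. \<forall>m\<ge>N. \<forall>n\<ge>N. dist (q (1 / real (Suc m))) (q (1 / real (Suc n))) < e" by blast
 qed
 then obtain L where L: "(%n. q (1 / real (Suc n))) \<longlonglongrightarrow> L" using Cauchy_convergent_iff convergent_def by blast
 have "(f has_derivative (%h. h *\<^sub>R L)) (at t)" unfolding has_derivative_at_alt
 proof (intro conjI allI impI bounded_linear_scaleR_left)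
  fix e :: real assume "0 < e"
  then obtain r where r: "0 < r" "!!h h'. h ~= 0 ==> h' ~= 0 ==> \<bar>h\<bar> < r ==> \<bar>h'\<bar> < r ==> norm (q h - q h') <= e"
   using q[of e] by auto
  have "norm (f y - f t - (y - t) *\<^sub>R L) <= e * norm (y - t)" if y: "norm (y - t) < r" for y
  proof (cases "y = t")
   case False
   have "norm (q (y - t) - L) <= e"
   proof (rule tendsto_upperbound[OF tendsto_norm[OF tendsto_diff[OF tendsto_const L]]])
    show "\<forall>\<^sub>F n in sequentially. norm (q (y - t) - q (1 / real (Suc n))) <= e"
     using small[OF r(1)] by (rule eventually_mono) (use r(2) y False in simp)
   qed simp
   moreover have "f y - f t - (y - t) *\<^sub>R L = (y - t) *\<^sub>R (q (y - t) - L)" using False by (simp add: q_def scaleR_right_diff_distrib)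
   ultimately show ?thesis by (simp add: mult.commute[of e] mult_left_mono)
  qed simp
  thus "\<exists>r>0. \<forall>y. norm (y - t) < r --> norm (f y - f t - (y - t) *\<^sub>R L) <= e * norm (y - t)" using r(1) by blast
 qed
 thus ?thesis unfolding differentiable_def by blast
qed

context theta_finsler
begin

text \<open>Extension by 0 gives coordinates that are Borel measurable on the whole
  manifold.\<close>

definition chart0 :: "('a, 'n) chart => 'a => real ^ 'n" where
 "chart0 c x = (if x \<in> fst c then snd c x else 0)"

lemma chart0_measurable: "c \<in> \<A> ==> chart0 c \<in> borel_measurable borel"
 unfolding chart0_def using borel_measurable_continuous_on_if[of "fst c" "snd c" "%_. 0"] open_chart continuous_chart by simp

text \<open>The differentiability of a continuous curve at \<open>t\<close>, expressed through countably many measurable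
 conditions, so that Fubini's theorem applies to it.\<close>

definition rational_differentiable_at :: "('a, 'n) chart => (real => 'a) => real => bool" where
 "rational_differentiable_at c \<gamma> t \<longleftrightarrow> \<gamma> (clamp01 t) \<in> fst c &
  (\<forall>k::nat. \<exists>j::nat. \<forall>h\<in>\<rat> \<inter> {h. \<bar>h\<bar> < 1 / real (Suc j)}. \<forall>h'\<in>\<rat> \<inter> {h. \<bar>h\<bar> < 1 / real (Suc j)}.
   norm (h' *\<^sub>R (chart0 c (\<gamma> (clamp01 (t + h))) - chart0 c (\<gamma> (clamp01 t)))
     - h *\<^sub>R (chart0 c (\<gamma> (clamp01 (t + h'))) - chart0 c (\<gamma> (clamp01 t)))) <= \<bar>h * h'\<bar> / real (Suc k))"

lemma curve_near:
 assumes \<gamma>: "continuous_on {0..1} \<gamma>" and t: "0 < t" "t < 1" and c: "c \<in> \<A>" "\<gamma> t \<in> fst c"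
 shows "\<exists>r>0. \<forall>h. \<bar>h\<bar> < r --> 0 < t + h & t + h < 1 & clamp01 (t + h) = t + h & \<gamma> (t + h) \<in> fst c & isCont (snd c \<circ> \<gamma>) (t + h)"
proof -
 have iC: "isCont \<gamma> s" if "0 < s" "s < 1" for s using continuous_on_interior[OF \<gamma>, of s] that by simp
 have "\<forall>\<^sub>F s in nhds t. \<gamma> s \<in> fst c"
  using topological_tendstoD[OF isContD[OF iC[OF t]] open_chart[OF c(1)] c(2)] c(2) by (simp add: eventually_nhds_conv_at)
 then obtain e where e: "0 < e" "!!s. dist s t < e ==> \<gamma> s \<in> fst c" unfolding eventually_nhds_metric by blast
 show ?thesis
 proof (intro exI[of _ "min e (min t (1 - t))"] conjI allI impI)
  fix h assume h: "\<bar>h\<bar> < min e (min t (1 - t))"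
  show s: "0 < t + h" "t + h < 1" using h by auto
  thus "clamp01 (t + h) = t + h" by (simp add: clamp01_def)
  show "\<gamma> (t + h) \<in> fst c" using h by (intro e(2)) (simp add: dist_real_def)
  hence "isCont (snd c) (\<gamma> (t + h))" using continuous_chart[OF c(1)] open_chart[OF c(1)] by (simp add: continuous_on_eq_continuous_at)
  thus "isCont (snd c \<circ> \<gamma>) (t + h)" using iC[OF s] by (intro continuous_at_compose)
 qed (use e(1) t in simp)
qed

text \<open>Near \<open>t\<close> the curve is continuous in the chart, so the inequality extends
  from rational to real increments, and the Cauchy criterion applies.\<close>

lemma rational_differentiable_at_imp:
 assumes \<gamma>: "continuous_on {0..1} \<gamma>" and t: "0 < t" "t < 1" and c: "c \<in> \<A>" and R: "rational_differentiable_at c \<gamma> t"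
 shows "curve_differentiable_at \<A> \<gamma> t"
proof -
 have ct: "clamp01 t = t" using t by (simp add: clamp01_def)
 have ct': "\<gamma> t \<in> fst c" using R unfolding rational_differentiable_at_def ct by simp
 obtain r0 where r0: "0 < r0" "!!h. \<bar>h\<bar> < r0 ==> clamp01 (t + h) = t + h & \<gamma> (t + h) \<in> fst c & isCont (snd c \<circ> \<gamma>) (t + h)"
  using curve_near[OF \<gamma> t c ct'] by blast
 let ?f = "snd c \<circ> \<gamma>"
 have c0: "chart0 c (\<gamma> (clamp01 (t + h))) = ?f (t + h)" if "\<bar>h\<bar> < r0" for h using r0(2)[OF that] by (simp add: chart0_def)
 have c00: "chart0 c (\<gamma> (clamp01 t)) = ?f t" using ct' by (simp add: chart0_def ct)
 have "?f differentiable (at t)"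
 proof (rule Cauchy_quotient_differentiable)
  fix k :: nat
  obtain j where j: "!!h h'. h \<in> \<rat> ==> h' \<in> \<rat> ==> \<bar>h\<bar> < 1 / real (Suc j) ==> \<bar>h'\<bar> < 1 / real (Suc j) ==>
   norm (h' *\<^sub>R (chart0 c (\<gamma> (clamp01 (t + h))) - chart0 c (\<gamma> (clamp01 t)))
     - h *\<^sub>R (chart0 c (\<gamma> (clamp01 (t + h'))) - chart0 c (\<gamma> (clamp01 t)))) <= \<bar>h * h'\<bar> / real (Suc k)"
   using R unfolding rational_differentiable_at_def by blast
  let ?r = "min r0 (1 / real (Suc j))"
  let ?P = "%h h'. norm (h' *\<^sub>R (?f (t + h) - ?f t) - h *\<^sub>R (?f (t + h') - ?f t))"
  have "?P h h' <= \<bar>h * h'\<bar> / real (Suc k)" if h: "\<bar>h\<bar> < ?r" "\<bar>h'\<bar> < ?r" for h h'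
  proof -
   obtain x where x: "!!n. x n \<in> \<rat>" "x \<longlonglongrightarrow> h" using Rats_closure_real closure_sequential[of h \<rat>] by auto
   obtain y where y: "!!n. y n \<in> \<rat>" "y \<longlonglongrightarrow> h'" using Rats_closure_real closure_sequential[of h' \<rat>] by auto
   have f: "(%n. ?f (t + z n)) \<longlonglongrightarrow> ?f (t + l)" if "z \<longlonglongrightarrow> l" "\<bar>l\<bar> < ?r" for z l
    using that r0(2)[of l] by (intro isCont_tendsto_compose[of "t + l" ?f] tendsto_add tendsto_const) auto
   show ?thesis
   proof (rule tendsto_le[OF sequentially_bot])
    show "(%n. \<bar>x n * y n\<bar> / real (Suc k)) \<longlonglongrightarrow> \<bar>h * h'\<bar> / real (Suc k)"
     by (intro tendsto_divide tendsto_rabs tendsto_mult tendsto_const x y) simp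
    show "(%n. ?P (x n) (y n)) \<longlonglongrightarrow> ?P h h'"
     by (intro tendsto_norm tendsto_diff tendsto_scaleR tendsto_const f x y h)
    have "\<forall>\<^sub>F n in sequentially. \<bar>x n\<bar> < ?r" "\<forall>\<^sub>F n in sequentially. \<bar>y n\<bar> < ?r"
     using order_tendstoD(2)[OF tendsto_rabs[OF x(2)] h(1)] order_tendstoD(2)[OF tendsto_rabs[OF y(2)] h(2)] .
    thus "\<forall>\<^sub>F n in sequentially. ?P (x n) (y n) <= \<bar>x n * y n\<bar> / real (Suc k)"
    proof eventually_elim
     case (elim n)
     thus ?case using j[OF x(1) y(1), of n n] c0[of "x n"] c0[of "y n"] unfolding c00 by simp
    qed
   qed
  qed
  thus "\<exists>r>0. \<forall>h h'. \<bar>h\<bar> < r --> \<bar>h'\<bar> < r --> ?P h h' <= \<bar>h * h'\<bar> / real (Suc k)"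
   using r0(1) by (intro exI[of _ ?r]) auto
 qed
 moreover have "isCont \<gamma> t" using continuous_on_interior[OF \<gamma>, of t] t by simp
 ultimately show ?thesis using curve_differentiable_at_iff[of c \<gamma> t] c ct' by blast
qed

text \<open>The linear parts of the two increments cancel; what remains are two errors of relative
  size \<open>1 / (2 * Suc k)\<close>.\<close>

lemma rational_differentiable_at_if:
 assumes \<gamma>: "continuous_on {0..1} \<gamma>" and t: "0 < t" "t < 1" and c: "c \<in> \<A>" "\<gamma> t \<in> fst c" and D: "curve_differentiable_at \<A> \<gamma> t"
 shows "rational_differentiable_at c \<gamma> t"
proof -
 have ct: "clamp01 t = t" using t by (simp add: clamp01_def)
 obtain r0 where r0: "0 < r0" "!!h. \<bar>h\<bar> < r0 ==> clamp01 (t + h) = t + h & \<gamma> (t + h) \<in> fst c"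
  using curve_near[OF \<gamma> t c] by blast
 let ?f = "snd c \<circ> \<gamma>"
 have c0: "chart0 c (\<gamma> (clamp01 (t + h))) = ?f (t + h)" if "\<bar>h\<bar> < r0" for h using r0(2)[OF that] by (simp add: chart0_def)
 have c00: "chart0 c (\<gamma> (clamp01 t)) = ?f t" using c by (simp add: chart0_def ct)
 have "?f differentiable (at t)" using D curve_differentiable_at_iff[of c \<gamma> t] c by blast
 then obtain D where D: "(?f has_derivative D) (at t)" unfolding differentiable_def by blast
 hence lin: "linear D" by (rule has_derivative_linear)
 have "\<exists>j::nat. \<forall>h\<in>\<rat> \<inter> {h. \<bar>h\<bar> < 1 / real (Suc j)}. \<forall>h'\<in>\<rat> \<inter> {h. \<bar>h\<bar> < 1 / real (Suc j)}.
   norm (h' *\<^sub>R (chart0 c (\<gamma> (clamp01 (t + h))) - chart0 c (\<gamma> (clamp01 t)))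
     - h *\<^sub>R (chart0 c (\<gamma> (clamp01 (t + h'))) - chart0 c (\<gamma> (clamp01 t)))) <= \<bar>h * h'\<bar> / real (Suc k)" for k
 proof -
  let ?e = "1 / (2 * real (Suc k))"
  have "0 < ?e" by simp
  then obtain r where r: "0 < r" "!!y. norm (y - t) < r ==> norm (?f y - ?f t - D (y - t)) <= ?e * norm (y - t)"
   using D unfolding has_derivative_at_alt by blast
  obtain j where j: "1 / real (Suc j) < min r r0" using nat_approx_posE[of "min r r0"] r(1) r0(1) by auto
  have "norm (h' *\<^sub>R (?f (t + h) - ?f t) - h *\<^sub>R (?f (t + h') - ?f t)) <= \<bar>h * h'\<bar> / real (Suc k)"
   if h: "\<bar>h\<bar> < r" "\<bar>h'\<bar> < r" for h h'
  proof -
   have "D h = h *\<^sub>R D 1" "D h' = h' *\<^sub>R D 1" using linear_scale[OF lin, of h 1] linear_scale[OF lin, of h' 1] by simp_all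
   hence "h' *\<^sub>R (?f (t + h) - ?f t) - h *\<^sub>R (?f (t + h') - ?f t) = h' *\<^sub>R (?f (t + h) - ?f t - D h) - h *\<^sub>R (?f (t + h') - ?f t - D h')"
    by (simp add: scaleR_right_diff_distrib mult.commute)
   also have "norm ... <= \<bar>h'\<bar> * norm (?f (t + h) - ?f t - D h) + \<bar>h\<bar> * norm (?f (t + h') - ?f t - D h')"
    by (rule order_trans[OF norm_triangle_ineq4]) simp
   also have "... <= \<bar>h'\<bar> * (?e * \<bar>h\<bar>) + \<bar>h\<bar> * (?e * \<bar>h'\<bar>)"
    using r(2)[of "t + h"] r(2)[of "t + h'"] h by (intro add_mono mult_left_mono) simp_all
   also have "... = \<bar>h * h'\<bar> / real (Suc k)" by (simp add: abs_mult field_simps del: of_nat_Suc)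
   finally show ?thesis .
  qed
  thus ?thesis using j by (intro exI[of _ j] ballI) (simp add: c0 c00)
 qed
 thus ?thesis unfolding rational_differentiable_at_def ct using c(2) by blast
qed

lemma ex_countable_charts: "\<exists>\<C>. countable \<C> & \<C> \<subseteq> \<A> & (\<forall>x. \<exists>c\<in>\<C>. x \<in> fst c)"
proof -
 have "!!S. S \<in> fst ` \<A> ==> open S" using open_chart by blast
 from Lindelof[OF this] obtain W where W: "W \<subseteq> fst ` \<A>" "countable W" "\<Union>W = \<Union>(fst ` \<A>)" by blast
 then obtain \<C> where C: "\<C> \<subseteq> \<A>" "countable \<C>" "W = fst ` \<C>" using countable_subset_image[of W fst \<A>] by blast
 have "\<exists>c\<in>\<C>. x \<in> fst c" for x using ex_chart[of x] W(3) unfolding C(3) by blast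
 thus ?thesis using C by blast
qed

end

section \<open>Speed of the paths and metric derivative of the curve of measures\<close>

context wasserstein_curve
begin

context
 fixes \<eta> :: "(real => 'a) measure"
 assumes \<eta>: "\<eta> \<in> curve_prob"
  and marginal: "!!t. t \<in> {0..1} ==> distr \<eta> borel (%\<gamma>. \<gamma> t) = \<mu> t"
  and energy_bound: "!!M. (\<integral>\<^sup>+\<gamma>. ennreal (dyadic_energy \<gamma> M) \<partial>\<eta>) <= ennreal total"
begin

lemma sets_\<eta>: "sets \<eta> = sets curve_borel" and prob_\<eta>: "prob_space \<eta>" using \<eta> by (simp_all add: curve_prob_def)

lemma space_\<eta>: "space \<eta> = curve_space" using sets_eq_imp_space_eq[OF sets_\<eta>] by (simp add: curve_borel_def space_measure_of_conv)

lemma space_continuous: "\<gamma> \<in> space \<eta> ==> continuous_on {0..1} \<gamma>" by (simp add: space_\<eta> curve_space_def)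

lemma eval_\<eta>: "t \<in> {0..1} ==> (%\<gamma>. \<gamma> t) \<in> \<eta> \<rightarrow>\<^sub>M borel"
 unfolding measurable_cong_sets[OF sets_\<eta> refl] by (rule evaluation_measurable)

lemma clamp01_mem: "clamp01 t \<in> {0..1}" by (simp add: clamp01_def)

text \<open>Paths are continuous, so the evaluation at a measurable time is the limit of evaluations
  at its dyadic floors, which take countably many values.\<close>

lemma joint_evaluation_measurable:
 fixes S :: "(real => 'a) \<times> real => real"
 assumes S: "S \<in> borel_measurable (\<eta> \<Otimes>\<^sub>M lborel)"
 shows "(%z. fst z (clamp01 (S z))) \<in> \<eta> \<Otimes>\<^sub>M lborel \<rightarrow>\<^sub>M borel"
proof (rule measurable_limit)
 show "(%z. fst z (clamp01 (real (nat \<lfloor>clamp01 (S z) * 2 ^ m\<rfloor>) / 2 ^ m))) \<in> \<eta> \<Otimes>\<^sub>M lborel \<rightarrow>\<^sub>M borel" for m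
 proof (rule measurable_compose_countable[where f = "%j z. fst z (clamp01 (real j / 2 ^ m))"])
  show "(%z. fst z (clamp01 (real j / 2 ^ m))) \<in> \<eta> \<Otimes>\<^sub>M lborel \<rightarrow>\<^sub>M borel" for j
   by (rule measurable_compose[OF measurable_fst eval_\<eta>[OF clamp01_mem]])
  show "(%z. nat \<lfloor>clamp01 (S z) * 2 ^ m\<rfloor>) \<in> \<eta> \<Otimes>\<^sub>M lborel \<rightarrow>\<^sub>M count_space UNIV"
   using S by measurable
 qed
 fix z :: "(real => 'a) \<times> real" assume "z \<in> space (\<eta> \<Otimes>\<^sub>M lborel)"
 hence c: "continuous_on {0..1} (fst z)" by (intro space_continuous) (simp add: space_pair_measure mem_Times_iff)
 have s: "clamp01 (dyadic_floor m (clamp01 (S z))) = dyadic_floor m (clamp01 (S z))" for m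
  using dyadics_unit[OF dyadic_floor_mem[OF clamp01_mem[of "S z"]], of m] by (simp add: clamp01_def)
 have "(%m. dyadic_floor m (clamp01 (S z))) \<longlonglongrightarrow> clamp01 (S z)"
  using clamp01_mem[of "S z"] by (intro dyadic_floor_tendsto) simp
 from continuous_on_tendsto_compose[OF c this clamp01_mem]
 have "(%m. fst z (dyadic_floor m (clamp01 (S z)))) \<longlonglongrightarrow> fst z (clamp01 (S z))"
  using dyadics_unit[OF dyadic_floor_mem[OF clamp01_mem]] by simp
 thus "(%m. fst z (clamp01 (real (nat \<lfloor>clamp01 (S z) * 2 ^ m\<rfloor>) / 2 ^ m))) \<longlonglongrightarrow> fst z (clamp01 (S z))"
  unfolding dyadic_floor_def[symmetric] s .
qed

lemma mspeed_joint_measurable: "(%z. mspeed (fst z) (snd z)) \<in> borel_measurable (\<eta> \<Otimes>\<^sub>M lborel)"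
proof (rule mspeed_measurable)
 show s: "snd \<in> borel_measurable (\<eta> \<Otimes>\<^sub>M lborel)" using measurable_snd[of \<eta> lborel] by simp
 show "(%z. fst z (clamp01 (snd z + 1 / real (Suc k)))) \<in> \<eta> \<Otimes>\<^sub>M lborel \<rightarrow>\<^sub>M borel" for k
  by (rule joint_evaluation_measurable[OF borel_measurable_add[OF s borel_measurable_const]])
 show "(%z. fst z (clamp01 (snd z))) \<in> \<eta> \<Otimes>\<^sub>M lborel \<rightarrow>\<^sub>M borel" by (rule joint_evaluation_measurable[OF s])
qed

lemma AE_finite_energy: "AE \<gamma> in \<eta>. \<exists>B. \<forall>M. dyadic_energy \<gamma> M <= B"
 and SUP_energy: "(\<integral>\<^sup>+\<gamma>. (SUP M. ennreal (dyadic_energy \<gamma> M)) \<partial>\<eta>) <= ennreal total"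
proof -
 have em: "(%\<gamma>. dyadic_energy \<gamma> M) \<in> borel_measurable \<eta>" for M
  by (rule dyadic_energy_measurable) (rule eval_\<eta>[OF dyadics_unit])
 note * = nn_integral_SUP_bound[of "%M \<gamma>. dyadic_energy \<gamma> M", OF em dyadic_energy_le_Suc energy_bound]
 show "AE \<gamma> in \<eta>. \<exists>B. \<forall>M. dyadic_energy \<gamma> M <= B" "(\<integral>\<^sup>+\<gamma>. (SUP M. ennreal (dyadic_energy \<gamma> M)) \<partial>\<eta>) <= ennreal total"
  by (rule *(2), rule *(1))
qed

text \<open>The bound by the supremum of the dyadic energies is recorded beside finiteness because
  the mean of this supremum is at most \<open>total\<close>.\<close>

lemma AE_controlled: "AE \<gamma> in \<eta>. (\<exists>g. controlled g \<gamma>) &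
 (\<integral>\<^sup>+t. ennreal (mspeed \<gamma> t powr p) \<partial>lborel) <= (SUP M. ennreal (dyadic_energy \<gamma> M)) &
 (\<integral>\<^sup>+t. ennreal (mspeed \<gamma> t powr p) \<partial>lborel) < \<infinity>" using AE_finite_energy AE_space
proof eventually_elim
 case (elim \<gamma>)
 then obtain B where B: "!!M. dyadic_energy \<gamma> M <= B" by blast
 then obtain g where g: "controlled g \<gamma>" using finite_energy_controlled[of \<gamma> B] elim(2) space_\<eta> by blast
 have "(SUP M. ennreal (dyadic_energy \<gamma> M)) <= ennreal B" by (intro SUP_least ennreal_leI B)
 then obtain b where b: "0 <= b" "(SUP M. ennreal (dyadic_energy \<gamma> M)) = ennreal b"
  by (cases "SUP M. ennreal (dyadic_energy \<gamma> M)") (auto simp: top_unique)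
 have "ennreal (dyadic_energy \<gamma> M) <= ennreal b" for M unfolding b(2)[symmetric] by (rule SUP_upper) simp
 hence "dyadic_energy \<gamma> M <= b" for M using b(1) by (simp add: ennreal_le_iff)
 hence "(\<integral>\<^sup>+t. ennreal (mspeed \<gamma> t powr p) \<partial>lborel) <= ennreal b"
  unfolding dyadic_energy_def by (rule energy_mspeed_le[OF g])
 thus ?case using g b(2) by (auto simp: le_less_trans)
qed

lemma AE_AC: "AE \<gamma> in \<eta>. \<gamma> \<in> AC p UNIV d" using AE_controlled by eventually_elim (use controlled_AC in blast)

text \<open>Fubini's theorem exchanges the two quantifiers for the jointly measurable predicate
  \<open>P\<close>, built from \<open>rational_differentiable_at\<close> in countably many charts;
  for continuous paths it is equivalent to differentiability at the times between 0 and 1.\<close>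

lemma AE_AE_differentiable: "AE t in lborel. AE \<gamma> in \<eta>. 0 < t & t < 1 --> curve_differentiable_at \<A> \<gamma> t"
proof -
 interpret P: prob_space \<eta> by (rule prob_\<eta>)
 interpret PS: pair_sigma_finite \<eta> lborel ..
 obtain \<C> where C: "countable \<C>" "\<C> \<subseteq> \<A>" "!!x. \<exists>c\<in>\<C>. x \<in> fst c" using ex_countable_charts by blast
 define P where "P \<gamma> t \<longleftrightarrow> t <= 0 \<or> 1 <= t \<or> (\<exists>c\<in>\<C>. rational_differentiable_at c \<gamma> t)" for \<gamma> t
 have "{z \<in> space (\<eta> \<Otimes>\<^sub>M lborel). P (fst z) (snd z)} \<in> sets (\<eta> \<Otimes>\<^sub>M lborel)" unfolding P_def
 proof (intro sets.sets_Collect_disj sets.sets_Collect_countable_Ex'[OF _ C(1)])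
  fix c assume "c \<in> \<C>"
  hence c: "c \<in> \<A>" using C(2) by blast
  have e: "(%z. fst z (clamp01 (snd z + h))) \<in> \<eta> \<Otimes>\<^sub>M lborel \<rightarrow>\<^sub>M borel" for h
   by (intro joint_evaluation_measurable) measurable
  have e0: "(%z. fst z (clamp01 (snd z))) \<in> \<eta> \<Otimes>\<^sub>M lborel \<rightarrow>\<^sub>M borel" using e[of 0] by simp
  note [measurable] = measurable_compose[OF e chart0_measurable[OF c]] measurable_compose[OF e0 chart0_measurable[OF c]]
  show "{z \<in> space (\<eta> \<Otimes>\<^sub>M lborel). rational_differentiable_at c (fst z) (snd z)} \<in> sets (\<eta> \<Otimes>\<^sub>M lborel)"
   unfolding rational_differentiable_at_def
  proof (intro sets.sets_Collect_conj sets.sets_Collect_countable_All sets.sets_Collect_countable_Ex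
    sets.sets_Collect_countable_All'[OF _ countable_Int1[OF countable_rat]] borel_measurable_le borel_measurable_const)
   have "(%z. fst z (clamp01 (snd z))) -` fst c \<inter> space (\<eta> \<Otimes>\<^sub>M lborel) \<in> sets (\<eta> \<Otimes>\<^sub>M lborel)"
    by (rule measurable_sets[OF e0]) (use open_chart[OF c] in simp)
   thus "{z \<in> space (\<eta> \<Otimes>\<^sub>M lborel). fst z (clamp01 (snd z)) \<in> fst c} \<in> sets (\<eta> \<Otimes>\<^sub>M lborel)"
    by (simp add: vimage_def Int_def conj_commute)
  qed measurable
 qed measurable
 from PS.AE_commute[OF this] have "(AE \<gamma> in \<eta>. AE t in lborel. P \<gamma> t) = (AE t in lborel. AE \<gamma> in \<eta>. P \<gamma> t)" .
 moreover have "AE \<gamma> in \<eta>. AE t in lborel. P \<gamma> t" using AE_controlled AE_space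
 proof eventually_elim
  case (elim \<gamma>)
  then obtain g where "controlled g \<gamma>" by blast
  from controlled_AE_differentiable[OF this] show ?case
  proof (rule eventually_mono)
   fix t assume D: "0 < t & t < 1 --> curve_differentiable_at \<A> \<gamma> t"
   obtain c where "c \<in> \<C>" "\<gamma> t \<in> fst c" using C(3) by blast
   thus "P \<gamma> t" unfolding P_def using rational_differentiable_at_if[OF space_continuous[OF elim(2)], of t c] D C(2) by fastforce
  qed
 qed
 ultimately have "AE t in lborel. AE \<gamma> in \<eta>. P \<gamma> t" by simp
 thus ?thesis
 proof eventually_elim
  case (elim t)
  thus ?case using AE_space
  proof eventually_elim
   case (elim \<gamma>)
   show ?case
   proof
    assume t: "0 < t & t < 1"
    then obtain c where "c \<in> \<C>" "rational_differentiable_at c \<gamma> t" using elim(1) unfolding P_def by auto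
    thus "curve_differentiable_at \<A> \<gamma> t"
     using rational_differentiable_at_imp[OF space_continuous[OF elim(2)], of t c] t C(2) by blast
   qed
  qed
 qed
qed

text \<open>Extended valued, because finiteness is obtained only for almost every time.\<close>

definition mean_speed :: "real => ennreal" where
 "mean_speed t = (\<integral>\<^sup>+\<gamma>. ennreal (mspeed \<gamma> t powr p) \<partial>\<eta>)"

lemma mean_speed_measurable: "mean_speed \<in> borel_measurable borel"
 and integral_mean_speed: "I \<in> sets borel ==> (\<integral>\<^sup>+t. indicator I t * mean_speed t \<partial>lborel) =
  (\<integral>\<^sup>+\<gamma>. \<integral>\<^sup>+t. indicator I t * ennreal (mspeed \<gamma> t powr p) \<partial>lborel \<partial>\<eta>)"
proof -
 interpret P: prob_space \<eta> by (rule prob_\<eta>)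
 interpret PS: pair_sigma_finite \<eta> lborel ..
 have [measurable]: "(%z. mspeed (fst z) (snd z)) \<in> borel_measurable (\<eta> \<Otimes>\<^sub>M lborel)" by (rule mspeed_joint_measurable)
 have m: "(%z. ennreal (mspeed (fst z) (snd z) powr p)) \<in> borel_measurable (\<eta> \<Otimes>\<^sub>M lborel)" by measurable
 have "(%(t, \<gamma>). ennreal (mspeed \<gamma> t powr p)) \<in> borel_measurable (lborel \<Otimes>\<^sub>M \<eta>)"
  using measurable_compose[OF measurable_pair_swap' m] by (simp add: case_prod_beta')
 from P.borel_measurable_nn_integral[OF this]
 show "mean_speed \<in> borel_measurable borel" unfolding mean_speed_def[abs_def] by simp
 assume I: "I \<in> sets borel"
 have "(\<integral>\<^sup>+t. indicator I t * mean_speed t \<partial>lborel) = (\<integral>\<^sup>+t. \<integral>\<^sup>+\<gamma>. indicator I t * ennreal (mspeed \<gamma> t powr p) \<partial>\<eta> \<partial>lborel)"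
 proof (rule nn_integral_cong)
  fix t
  have "(%\<gamma>. ennreal (mspeed \<gamma> t powr p)) \<in> borel_measurable \<eta>"
   using measurable_compose[OF measurable_Pair2'[of t lborel \<eta>] m] by simp
  thus "indicator I t * mean_speed t = (\<integral>\<^sup>+\<gamma>. indicator I t * ennreal (mspeed \<gamma> t powr p) \<partial>\<eta>)"
   unfolding mean_speed_def by (simp add: nn_integral_cmult)
 qed
 also have "... = (\<integral>\<^sup>+\<gamma>. \<integral>\<^sup>+t. indicator I t * ennreal (mspeed \<gamma> t powr p) \<partial>lborel \<partial>\<eta>)"
 proof (rule PS.Fubini')
  have "(%z. indicator I (snd z) :: ennreal) \<in> borel_measurable (\<eta> \<Otimes>\<^sub>M lborel)"
   by (rule measurable_compose[OF measurable_snd]) (use I in simp)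
  thus "(%(\<gamma>, t). indicator I t * ennreal (mspeed \<gamma> t powr p)) \<in> borel_measurable (\<eta> \<Otimes>\<^sub>M lborel)"
   using m by (simp add: case_prod_beta')
 qed
 finally show "(\<integral>\<^sup>+t. indicator I t * mean_speed t \<partial>lborel) = (\<integral>\<^sup>+\<gamma>. \<integral>\<^sup>+t. indicator I t * ennreal (mspeed \<gamma> t powr p) \<partial>lborel \<partial>\<eta>)" .
qed

lemma integral_mean_speed_le: "(\<integral>\<^sup>+t. mean_speed t \<partial>lborel) <= ennreal total"
proof -
 have "(\<integral>\<^sup>+t. mean_speed t \<partial>lborel) = (\<integral>\<^sup>+\<gamma>. \<integral>\<^sup>+t. ennreal (mspeed \<gamma> t powr p) \<partial>lborel \<partial>\<eta>)"
  using integral_mean_speed[of UNIV] by simp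
 also have "... <= (\<integral>\<^sup>+\<gamma>. (SUP M. ennreal (dyadic_energy \<gamma> M)) \<partial>\<eta>)"
  by (rule nn_integral_mono_AE) (use AE_controlled in eventually_elim, simp)
 also have "... <= ennreal total" by (rule SUP_energy)
 finally show ?thesis .
qed

text \<open>The joint law of the evaluations at \<open>s\<close> and \<open>t\<close> is a coupling
  of the two marginals; Jensen's inequality along each path bounds its cost.\<close>

lemma wasserstein_le_mean_speed:
 assumes st: "0 <= s" "s < t" "t <= 1"
 shows "ennreal (pen p (WD (\<mu> s) (\<mu> t)) (t - s)) <= (\<integral>\<^sup>+x. indicator {s<..t} x * mean_speed x \<partial>lborel)"
proof -
 interpret P: prob_space \<eta> by (rule prob_\<eta>)
 have u: "s \<in> {0..1}" "t \<in> {0..1}" using st by auto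
 let ?f = "%\<gamma>. (\<gamma> s, \<gamma> t)"
 have f: "?f \<in> \<eta> \<rightarrow>\<^sub>M borel" unfolding borel_prod[symmetric] by (intro measurable_Pair eval_\<eta> u)
 have "distr \<eta> borel ?f \<in> couplings (\<mu> s) (\<mu> t)" unfolding couplings_def borel_prob_def
 proof (intro CollectI conjI)
  show "distr (distr \<eta> borel ?f) borel fst = \<mu> s" by (subst distr_distr[OF fst_snd_borel(1) f]) (simp add: comp_def marginal[OF u(1)])
  show "distr (distr \<eta> borel ?f) borel snd = \<mu> t" by (subst distr_distr[OF fst_snd_borel(2) f]) (simp add: comp_def marginal[OF u(2)])
 qed (simp_all add: P.prob_space_distr[OF f])
 from wasserstein_le[OF \<mu>_PM[OF u(1)] \<mu>_PM[OF u(2)] this]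
 have W: "ennreal (WD (\<mu> s) (\<mu> t) powr p) <= (\<integral>\<^sup>+\<gamma>. ennreal (d (\<gamma> s) (\<gamma> t) powr p) \<partial>\<eta>)"
  unfolding transport_cost_def by (subst (asm) nn_integral_distr[OF f]) (simp_all add: cost_integrand_measurable)
 let ?L = "(t - s) powr (p - 1)"
 have L: "0 < ?L" using st by simp
 have "(%\<gamma>. d (\<gamma> s) (\<gamma> t)) \<in> borel_measurable \<eta>" by (intro borel_measurable_dist eval_\<eta> u)
 hence dm: "(%\<gamma>. ennreal (d (\<gamma> s) (\<gamma> t) powr p)) \<in> borel_measurable \<eta>" by measurable
 have "ennreal (pen p (WD (\<mu> s) (\<mu> t)) (t - s)) = ennreal (1 / ?L) * ennreal (WD (\<mu> s) (\<mu> t) powr p)"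
  by (simp add: pen_def ennreal_mult[symmetric])
 also have "... <= ennreal (1 / ?L) * (\<integral>\<^sup>+\<gamma>. ennreal (d (\<gamma> s) (\<gamma> t) powr p) \<partial>\<eta>)"
  by (rule mult_left_mono[OF W]) simp
 also have "... = (\<integral>\<^sup>+\<gamma>. ennreal (pen p (d (\<gamma> s) (\<gamma> t)) (t - s)) \<partial>\<eta>)"
  by (subst nn_integral_cmult[OF dm, symmetric]) (simp add: pen_def ennreal_mult[symmetric])
 also have "... <= (\<integral>\<^sup>+\<gamma>. \<integral>\<^sup>+x. indicator {s<..t} x * ennreal (mspeed \<gamma> x powr p) \<partial>lborel \<partial>\<eta>)"
 proof (rule nn_integral_mono_AE)
  show "AE \<gamma> in \<eta>. ennreal (pen p (d (\<gamma> s) (\<gamma> t)) (t - s)) <= (\<integral>\<^sup>+x. indicator {s<..t} x * ennreal (mspeed \<gamma> x powr p) \<partial>lborel)"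
   using AE_controlled
  proof eventually_elim
   case (elim \<gamma>)
   then obtain g where g: "controlled g \<gamma>" by blast
   have [measurable]: "mspeed \<gamma> \<in> borel_measurable borel" by (rule controlled_mspeed_measurable[OF g])
   have ip: "integrable lborel (%x. mspeed \<gamma> x powr p)" using elim by (intro integrableI_nonneg) auto
   have "pen p (d (\<gamma> s) (\<gamma> t)) (t - s) <= pen p (LINT x:{s<..t}|lborel. mspeed \<gamma> x) (t - s)"
    using st p by (intro pen_mono dist_nonneg dist_le_integral_mspeed[OF g]) auto
   also have "... <= (LINT x:{s<..t}|lborel. mspeed \<gamma> x powr p)"
    by (rule pen_integral_le[OF p st(2) mspeed_nonneg set_integrable_Ioc[OF controlled_mspeed_integrable[OF g]] set_integrable_Ioc[OF ip]])
   finally have "ennreal (pen p (d (\<gamma> s) (\<gamma> t)) (t - s)) <= ennreal (LINT x:{s<..t}|lborel. mspeed \<gamma> x powr p)" by (rule ennreal_leI)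
   also have "... = (\<integral>\<^sup>+x. ennreal (indicator {s<..t} x *\<^sub>R mspeed \<gamma> x powr p) \<partial>lborel)"
    unfolding set_lebesgue_integral_def using set_integrable_Ioc[OF ip] unfolding set_integrable_def
    by (intro nn_integral_eq_integral[symmetric]) auto
   also have "... = (\<integral>\<^sup>+x. indicator {s<..t} x * ennreal (mspeed \<gamma> x powr p) \<partial>lborel)"
    by (intro nn_integral_cong) (simp split: split_indicator)
   finally show ?case .
  qed
 qed
 also have "... = (\<integral>\<^sup>+x. indicator {s<..t} x * mean_speed x \<partial>lborel)" by (rule integral_mean_speed[symmetric]) simp
 finally show ?thesis .
qed

text \<open>Where the indefinite integral of \<open>g\<close> has derivative \<open>g t\<close> and
  \<open>\<delta>\<close> has density 0, the \<open>p\<close>-th powers of the quotients of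
  \<open>WD\<close> converge to \<open>g t\<close>. The limit that defines the metric derivative
  therefore exists and equals \<open>g t powr (1 / p)\<close>.\<close>

lemma AE_forward_metric_deriv:
 "AE t in lborel. 0 < t & t < 1 --> ennreal (forward_metric_deriv WD \<mu> t powr p) = mean_speed t"
proof -
 define g where "g t = enn2real (mean_speed t)" for t
 note [measurable] = mean_speed_measurable
 have gm [measurable]: "g \<in> borel_measurable borel" unfolding g_def by measurable
 have g0: "0 <= g t" for t by (simp add: g_def)
 have "AE t in lborel. mean_speed t ~= \<infinity>"
  by (rule nn_integral_PInf_AE) (use integral_mean_speed_le in \<open>auto simp: top_unique\<close>)
 hence fin: "AE t in lborel. mean_speed t = ennreal (g t)" by (rule eventually_mono) (simp add: g_def less_top)
 have int_g: "(\<integral>\<^sup>+t. ennreal (g t) \<partial>lborel) = (\<integral>\<^sup>+t. mean_speed t \<partial>lborel)"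
  by (rule nn_integral_cong_AE) (use fin in eventually_elim, simp)
 have g: "integrable lborel g" by (rule integrableI_nonneg) (use g0 int_g integral_mean_speed_le in \<open>auto intro: le_less_trans\<close>)
 have "ennreal (LINT t|lborel. g t) <= ennreal total" using nn_integral_eq_integral[OF g] g0 int_g integral_mean_speed_le by simp
 moreover have "0 <= total" using energy_le_total[of 0] pen_nonneg[of p "WD (\<mu> 0) (\<mu> 1)" 1] by (simp add: energy_def)
 ultimately have total: "(LINT t|lborel. g t) <= total" by (simp only: ennreal_le_iff)
 have I: "ennreal (LINT x:{s<..t}|lborel. g x) = (\<integral>\<^sup>+x. indicator {s<..t} x * mean_speed x \<partial>lborel)" for s t
 proof -
  have "ennreal (LINT x:{s<..t}|lborel. g x) = (\<integral>\<^sup>+x. ennreal (indicator {s<..t} x *\<^sub>R g x) \<partial>lborel)"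
   unfolding set_lebesgue_integral_def using g0 integrable_mult_indicator[of "{s<..t}" lborel g] g
   by (intro nn_integral_eq_integral[symmetric]) auto
  also have "... = (\<integral>\<^sup>+x. indicator {s<..t} x * mean_speed x \<partial>lborel)"
  proof (rule nn_integral_cong_AE)
   show "AE x in lborel. ennreal (indicator {s<..t} x *\<^sub>R g x) = indicator {s<..t} x * mean_speed x"
    using fin by eventually_elim (simp split: split_indicator)
  qed
  finally show ?thesis .
 qed
 define \<delta> where "\<delta> s t = (LINT x:{s<..t}|lborel. g x) - pen p (WD (\<mu> s) (\<mu> t)) (t - s)" for s t
 have \<delta>0: "\<delta> t t = 0" for t by (simp add: \<delta>_def set_lebesgue_integral_def pen_def)
 have nonneg: "0 <= \<delta> s t" if "0 <= s" "s <= t" "t <= 1" for s t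
 proof (cases "s = t")
  case False
  hence "ennreal (pen p (WD (\<mu> s) (\<mu> t)) (t - s)) <= ennreal (LINT x:{s<..t}|lborel. g x)"
   unfolding I using that by (intro wasserstein_le_mean_speed) auto
  thus ?thesis using set_integral_Ioc_nonneg[of g s t] g0 by (simp add: \<delta>_def ennreal_le_iff)
 qed (simp add: \<delta>0)
 have super: "\<delta> r s + \<delta> s t <= \<delta> r t" if "0 <= r" "r <= s" "s <= t" "t <= 1" for r s t
 proof (cases "r = s \<or> s = t")
  case False
  hence "pen p (WD (\<mu> r) (\<mu> t)) ((s - r) + (t - s)) <= pen p (WD (\<mu> r) (\<mu> s)) (s - r) + pen p (WD (\<mu> s) (\<mu> t)) (t - s)"
   using that by (intro wasserstein_pen_add_le \<mu>_PM) auto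
  thus ?thesis using set_integral_Ioc_split[OF g that(2,3)] by (simp add: \<delta>_def)
 qed (auto simp: \<delta>0)
 \<comment> \<open>The integrals of \<open>g\<close> over the dyadic intervals add up to at most
   \<open>total\<close>, and the subtracted energies to \<open>energy N\<close>, which tends to
   \<open>total\<close>.\<close>
 have dyadic: "\<exists>N. (\<Sum>i<2 ^ N. \<delta> (real i / 2 ^ N) (real (Suc i) / 2 ^ N)) < e" if "0 < e" for e
 proof -
  have "\<forall>\<^sub>F N in sequentially. total - e < energy N" using order_tendstoD(1)[OF energy_tendsto] that by simp
  then obtain N where N: "total - e < energy N" using eventually_happens'[OF sequentially_bot] by blast
  have len: "real (Suc i) / 2 ^ N - real i / 2 ^ N = 1 / 2 ^ N" for i by (simp add: diff_divide_distrib[symmetric])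
  have "(\<Sum>i<2 ^ N. \<delta> (real i / 2 ^ N) (real (Suc i) / 2 ^ N)) = (LINT x:{0<..real (2 ^ N) / 2 ^ N}|lborel. g x) - energy N"
   unfolding \<delta>_def len sum_subtractf sum_Ioc_dyadic[OF g] energy_def ..
  also have "... <= total - energy N" using set_integral_Ioc_le[OF g g0] total by (intro diff_right_mono) (rule order_trans)
  finally show ?thesis using N by (intro exI[of _ N]) simp
 qed
 have "AE t in lborel. 0 < t & t < 1 --> ((%x. LINT y:{0<..x}|lborel. g y) has_real_derivative g t) (at t)"
 proof (rule AE_has_real_derivative_integral[OF g])
  show "(LINT y:{0<..t}|lborel. g y) - (LINT y:{0<..s}|lborel. g y) = (LINT x:{s<..t}|lborel. g x)" if "0 <= s" "s <= t" for s t
   using set_integral_Ioc_split[OF g that] by simp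
 qed
 moreover have "AE t in lborel. 0 < t & t < 1 --> (\<forall>c>0. \<exists>r>0. \<forall>s u.
   0 <= s & s <= t & t <= u & u <= 1 & s < u & u - s < r --> \<delta> s u <= c * (u - s))"
  by (rule AE_density_zero_superadditive) (fact nonneg super dyadic)+
 ultimately show ?thesis using fin
 proof eventually_elim
  case (elim t)
  show ?case
  proof
   assume t: "0 < t & t < 1"
   let ?w = "%x. LINT y:{0<..x}|lborel. g y"
   let ?D = "%s. \<delta> (min s t) (max s t) / \<bar>t - s\<bar>"
   let ?q = "%s. WD (\<mu> (min s t)) (\<mu> (max s t)) / \<bar>t - s\<bar>"
   have near: "\<forall>\<^sub>F s in at t. s ~= t & 0 < s & s < 1"
    using eventually_at_in_open[of "{0<..<1}" t] t by (auto elim: eventually_mono)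
   have w: "((%s. (?w s - ?w t) / (s - t)) \<longlongrightarrow> g t) (at t)" using elim(1) t unfolding has_field_derivative_iff by blast
   have D: "(?D \<longlongrightarrow> 0) (at t)"
   proof (rule tendstoI)
    fix e :: real assume e: "0 < e"
    then obtain r where r: "0 < r" "!!s u. 0 <= s & s <= t & t <= u & u <= 1 & s < u & u - s < r ==> \<delta> s u <= e / 2 * (u - s)"
     using elim(2) t half_gt_zero[OF e] by blast
    have "\<forall>\<^sub>F s in at t. dist s t < r" using r(1) by (auto simp: eventually_at intro!: exI[of _ r])
    with near show "\<forall>\<^sub>F s in at t. dist (?D s) 0 < e"
    proof eventually_elim
     case (elim s)
     have "\<delta> (min s t) (max s t) <= e / 2 * (max s t - min s t)"
      using elim t by (intro r(2)) (auto simp: dist_real_def min_def max_def)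
     moreover have "max s t - min s t = \<bar>t - s\<bar>" by auto
     ultimately have "?D s <= e / 2" using elim by (simp add: pos_divide_le_eq)
     moreover have "0 <= ?D s" using elim t by (intro divide_nonneg_nonneg nonneg) auto
     ultimately show ?case using e by (simp only: dist_real_def diff_0_right abs_of_nonneg)
    qed
   qed
   have "((%s. (?w s - ?w t) / (s - t) - ?D s) \<longlongrightarrow> g t - 0) (at t)" by (rule tendsto_diff[OF w D])
   \<comment> \<open>On either side of \<open>t\<close>, the mean of \<open>g\<close> over the
     interval minus the relative defect is \<open>pen\<close> divided by the length, that is, the
     \<open>p\<close>-th power of the quotient.\<close>
   moreover have "\<forall>\<^sub>F s in at t. (?w s - ?w t) / (s - t) - ?D s = ?q s powr p" using near
   proof eventually_elim
    case (elim s)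
    have len: "max s t - min s t = \<bar>t - s\<bar>" "0 < \<bar>t - s\<bar>" using elim by auto
    have I: "(LINT x:{min s t<..max s t}|lborel. g x) = (?w s - ?w t) / (s - t) * \<bar>t - s\<bar>"
     using set_integral_Ioc_split[OF g, of 0 "min s t" "max s t"] elim t by (auto simp: min_def max_def field_simps)
    have "pen p (WD (\<mu> (min s t)) (\<mu> (max s t))) \<bar>t - s\<bar> = \<bar>t - s\<bar> * ?q s powr p"
     using elim t by (intro pen_alt wasserstein_nonneg \<mu>_PM) auto
    thus ?case using len(2) unfolding \<delta>_def len(1) I by (simp add: diff_divide_distrib)
   qed
   ultimately have "((%s. ?q s powr p) \<longlongrightarrow> g t) (at t)" by (simp add: tendsto_cong)
   hence "((%s. (?q s powr p) powr (1 / p)) \<longlongrightarrow> g t powr (1 / p)) (at t)"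
    using p by (intro tendsto_powr2 tendsto_const) auto
   moreover have "\<forall>\<^sub>F s in at t. (?q s powr p) powr (1 / p) = ?q s" using near
   proof eventually_elim
    case (elim s)
    have "0 <= ?q s" using elim t by (intro divide_nonneg_nonneg wasserstein_nonneg \<mu>_PM) auto
    thus ?case using p by (auto simp: powr_powr)
   qed
   ultimately have "(?q \<longlongrightarrow> g t powr (1 / p)) (at t)" by (simp add: tendsto_cong)
   hence "forward_metric_deriv WD \<mu> t = g t powr (1 / p)" unfolding forward_metric_deriv_def by (intro tendsto_Lim) simp
   thus "ennreal (forward_metric_deriv WD \<mu> t powr p) = mean_speed t" using p g0 elim(3) by (simp add: powr_powr)
  qed
 qed
qed

text \<open>At almost every time almost every path is differentiable, and there
  \<open>mspeed\<close> is the speed.\<close>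

lemma AE_forward_metric_deriv_speed:
 "AE t in lborel. 0 < t & t < 1 -->
  ennreal (forward_metric_deriv WD \<mu> t powr p) = (\<integral>\<^sup>+\<gamma>. ennreal (speed \<A> F \<gamma> t powr p) \<partial>\<eta>)"
 using AE_forward_metric_deriv AE_AE_differentiable
proof eventually_elim
 case (elim t)
 show ?case
 proof
  assume t: "0 < t & t < 1"
  have "mean_speed t = (\<integral>\<^sup>+\<gamma>. ennreal (speed \<A> F \<gamma> t powr p) \<partial>\<eta>)" unfolding mean_speed_def
  proof (rule nn_integral_cong_AE)
   show "AE \<gamma> in \<eta>. ennreal (mspeed \<gamma> t powr p) = ennreal (speed \<A> F \<gamma> t powr p)"
    using elim(2) by (rule eventually_mono) (use t mspeed_eq_speed in simp)
  qed
  thus "ennreal (forward_metric_deriv WD \<mu> t powr p) = (\<integral>\<^sup>+\<gamma>. ennreal (speed \<A> F \<gamma> t powr p) \<partial>\<eta>)"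
   using elim(1) t by simp
 qed
qed

end

end

theorem theorem4p12:
  fixes \<A> :: "('a::{t2_space, second_countable_topology}, 'n::finite) chart set"
    and star :: 'a
    and F :: "'a \<times> ('a, 'n) tvec \<Rightarrow> real"
    and \<Theta> :: "real \<Rightarrow> real"
    and p :: real
    and \<mu> :: "real \<Rightarrow> 'a measure"
  defines "d \<equiv> finsler_dist \<A> F"
  assumes "theta_finsler_manifold \<A> star F \<Theta>"
    and "forward_complete d"
    and "1 < p"
    and "\<exists>q. 1 < q \<and> q \<le> p \<and> theta_power_concave d star \<Theta> p q"
    and "\<mu> \<in> FAC p (wasserstein_space p d star) (wasserstein_dist p d)"
  shows "\<exists>\<eta>\<in>curve_prob.
           (AE \<gamma> in \<eta>. \<gamma> \<in> AC p UNIV d) \<and>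
           (\<forall>t\<in>{0..1}. \<mu> t = distr \<eta> borel (\<lambda>\<gamma>. \<gamma> t)) \<and>
           (AE t in lborel. 0 < t \<and> t < 1 \<longrightarrow>
              ennreal (forward_metric_deriv (wasserstein_dist p d) \<mu> t powr p)
                = (\<integral>\<^sup>+ \<gamma>. ennreal (speed \<A> F \<gamma> t powr p) \<partial>\<eta>))"
proof -
 have "finsler_manifold \<A> F" using assms(2) unfolding theta_finsler_manifold_def by (elim conjE)
 then interpret wasserstein_curve \<A> F star \<Theta> p \<mu> by unfold_locales (use assms in \<open>simp_all only: d_def\<close>)
 obtain \<eta> where \<eta>: "\<eta> \<in> curve_prob" "!!t. t \<in> dyadics ==> distr \<eta> borel (%\<gamma>. \<gamma> t) = \<mu> t"
  "!!M. (\<integral>\<^sup>+\<gamma>. ennreal (dyadic_energy \<gamma> M) \<partial>\<eta>) <= ennreal total" using ex_path_measure by blast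
 have marginal: "distr \<eta> borel (%\<gamma>. \<gamma> t) = \<mu> t" if "t \<in> {0..1}" for t
  by (rule path_measure_marginal[OF \<eta>(1) _ that]) (rule \<eta>(2))
 show ?thesis unfolding d_def
 proof (intro bexI[OF _ \<eta>(1)] conjI ballI)
  show "AE \<gamma> in \<eta>. \<gamma> \<in> AC p UNIV (finsler_dist \<A> F)" by (rule AE_AC[OF \<eta>(1) _ \<eta>(3)]) (rule marginal)
  show "\<mu> t = distr \<eta> borel (%\<gamma>. \<gamma> t)" if "t \<in> {0..1}" for t using marginal[OF that] by simp
  show "AE t in lborel. 0 < t & t < 1 -->
    ennreal (forward_metric_deriv (wasserstein_dist p (finsler_dist \<A> F)) \<mu> t powr p) = (\<integral>\<^sup>+ \<gamma>. ennreal (speed \<A> F \<gamma> t powr p) \<partial>\<eta>)"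
   by (rule AE_forward_metric_deriv_speed[OF \<eta>(1) _ \<eta>(3)]) (rule marginal)
 qed
qed

end
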